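(* Let $\mathbf A:\mathbb R\times\mathbb R^d\times\mathbb R^d\to\mathbb C^{d\times d}$ be measurable, bounded by $\Lambda$ and elliptic with constant $\lambda$ (in the Gårding sense (E) of the context), let $\mathcal A=-\nabla_v\cdot(\mathbf A\nabla_v\,\cdot)$, and let $\Gamma(t,s)$, $-\infty<s\le t<\infty$, be the fundamental solution operators of $(\partial_t+v\cdot\nabla_x)+\mathcal A$. For all closed sets $E,F\subset\mathbb R^{2d}$, all $s<t$ and all $\psi\in\mathrm L^2_{x,v}$ supported in $F$, $$\|\Gamma(t,s)\psi\|_{\mathrm L^2_{x,v}(E)}\le\exp\Big(-\frac{\alpha\,\rho_{t-s}(E,F)^2}{t-s}\Big)\|\psi\|_{\mathrm L^2_{x,v}(F)},\qquad \alpha=\frac{3\lambda}{104\Lambda^2},$$ where for $\tau\neq0$, $\rho_\tau(E,F)\ge0$ is defined by $$\rho_\tau(E,F)^2=\inf_{(x,v)\in E,\ (y,w)\in F}\Big(\frac{|x-y-\tau w|^2}{\tau^2}+|v-w|^2\Big).$$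
   Context: **Setting.** $d\ge1$; functions are complex-valued; $\mathrm L^2_{x,v}=\mathrm L^2(\mathbb R^{2d})$. $\mathbf A=\mathbf A(t,x,v)$ is a measurable $d\times d$ matrix-valued function with $|\mathbf A(t,x,v)\xi\cdot\overline\eta|\le\Lambda|\xi||\eta|$ for almost every $(t,x,v)$ and all $\xi,\eta\in\mathbb C^d$, and for some $\lambda>0$, (E) $\mathrm{Re}\int_{\mathbb R^d}\mathbf A(t,x,v)\nabla_vf\cdot\overline{\nabla_vf}\,dv\ge\lambda\|\nabla_vf\|_{\mathrm L^2_v}^2$ uniformly in $(t,x)$, for all $f\in\dot{\mathrm W}^{1,2}_v=\{f\in\mathcal D'(\mathbb R^d):\nabla f\in\mathrm L^2(\mathbb R^d)\}$. No symmetry, realness or smoothness of $\mathbf A$ is assumed. $\mathcal Af=-\nabla_v\cdot(\mathbf A\nabla_vf)$. **Fundamental solution operators.** For $s\in\mathbb R$ and $\psi\in\mathrm L^2_{x,v}$ there is (known) a unique weak solution $f$ on $[s,\infty)$ of $(\partial_t+v\cdot\nabla_x)f+\mathcal Af=0$, $f(s)=\psi$, i.e. $f\in\mathrm L^2_{\mathrm{loc}}([s,\infty);\mathrm L^2_{x,v})$ with $\nabla_vf\in\mathrm L^2((s,\infty)\times\mathbb R^{2d})$ and $$-\iiint f(\partial_t+v\cdot\nabla_x)\overline h\,dt\,dx\,dv+\iiint\mathbf A\nabla_vf\cdot\overline{\nabla_vh}\,dt\,dx\,dv=\iint\psi\,\overline h(s,x,v)\,dx\,dv\quad\text{for all }h\in\mathcal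 D([s,\infty)\times\mathbb R^{2d}).$$ It is continuous in $t\in[s,\infty)$ with values in $\mathrm L^2_{x,v}$. For $t\ge s$, $\Gamma(t,s)\psi:=f(t)$; this is a contraction of $\mathrm L^2_{x,v}$. $\mathrm L^2_{x,v}(E)$ denotes $\mathrm L^2(E)$ for $E\subset\mathbb R^{2d}$. *)

theory Defs
  imports "HOL-Analysis.Analysis"
begin

text \<open>
  Points of \<open>\<real>\<^sup>d\<close> have type \<open>real ^ 'd\<close> (so \<open>d \<ge> 1\<close>); points of phase space and of space-time are
  \<open>(x, v)\<close> and \<open>(t, x, v)\<close>, where \<open>(t, x, v) = (t, (x, v))\<close>.  Measurable means Lebesgue measurable,
  and elements of \<open>L\<^sup>2\<close> are represented by functions, equality of classes being equality a.e.
\<close>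

type_synonym 'd phase = "(real ^ 'd) \<times> (real ^ 'd)"


section \<open>Square integrable functions\<close>

definition L2 :: "'a measure \<Rightarrow> ('a \<Rightarrow> 'b::real_normed_vector) set" where
  "L2 M = {f \<in> borel_measurable M. integrable M (\<lambda>x. (norm (f x))\<^sup>2)}"

definition L2norm :: "'a measure \<Rightarrow> ('a \<Rightarrow> 'b::real_normed_vector) \<Rightarrow> real" where
  "L2norm M f = sqrt (\<integral>x. (norm (f x))\<^sup>2 \<partial>M)"

text \<open>Continuity on \<open>[s, \<infinity>)\<close> with values in \<open>L\<^sup>2\<close>.\<close>

definition L2_continuous_from :: "real \<Rightarrow> (real \<Rightarrow> 'a::euclidean_space \<Rightarrow> complex) \<Rightarrow> bool" where
  "L2_continuous_from s f \<longleftrightarrow>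
     (\<forall>t\<ge>s. f t \<in> L2 lebesgue) \<and>
     (\<forall>t0\<ge>s. ((\<lambda>t. L2norm lebesgue (\<lambda>z. f t z - f t0 z)) \<longlongrightarrow> 0) (at t0 within {s..}))"


section \<open>Test functions and distributions\<close>

definition dir_deriv :: "'a::euclidean_space \<Rightarrow> ('a \<Rightarrow> complex) \<Rightarrow> 'a \<Rightarrow> complex" where
  "dir_deriv b h = (\<lambda>p. frechet_derivative h (at p) b)"

definition iter_deriv :: "'a::euclidean_space list \<Rightarrow> ('a \<Rightarrow> complex) \<Rightarrow> 'a \<Rightarrow> complex" where
  "iter_deriv bs h = foldr dir_deriv bs h"

text \<open>\<open>C\<^sup>\<infinity>\<close>: all iterated partial derivatives exist and are again (totally) differentiable.\<close>

definition smooth :: "('a::euclidean_space \<Rightarrow> complex) \<Rightarrow> bool" where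
  "smooth h \<longleftrightarrow> (\<forall>bs. set bs \<subseteq> Basis \<longrightarrow> (\<forall>p. iter_deriv bs h differentiable at p))"

definition supp :: "('a::euclidean_space \<Rightarrow> complex) \<Rightarrow> 'a set" where
  "supp h = closure {p. h p \<noteq> 0}"

text \<open>\<open>\<D>(S)\<close> for open \<open>S\<close>.\<close>

definition test_functions :: "'a::euclidean_space set \<Rightarrow> ('a \<Rightarrow> complex) set" where
  "test_functions S = {h. smooth h \<and> compact (supp h) \<and> supp h \<subseteq> S}"

text \<open>
  \<open>\<D>'(\<real>\<^sup>n)\<close>: linear forms on \<open>\<D>(\<real>\<^sup>n)\<close> bounded, on each compact \<open>K\<close>, by a multiple of some
  \<open>C\<^sup>N\<close> norm.  Values of \<open>T\<close> outside \<open>\<D>(\<real>\<^sup>n)\<close> are irrelevant.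
\<close>

definition distribution :: "(('a::euclidean_space \<Rightarrow> complex) \<Rightarrow> complex) \<Rightarrow> bool" where
  "distribution T \<longleftrightarrow>
     (\<forall>\<phi>\<in>test_functions UNIV. \<forall>\<psi>\<in>test_functions UNIV. T (\<lambda>p. \<phi> p + \<psi> p) = T \<phi> + T \<psi>) \<and>
     (\<forall>c. \<forall>\<phi>\<in>test_functions UNIV. T (\<lambda>p. c * \<phi> p) = c * T \<phi>) \<and>
     (\<forall>K. compact K \<longrightarrow> (\<exists>C N. \<forall>\<phi>\<in>test_functions UNIV. \<forall>B. supp \<phi> \<subseteq> K \<longrightarrow>
        (\<forall>bs p. set bs \<subseteq> Basis \<longrightarrow> length bs \<le> N \<longrightarrow> norm (iter_deriv bs \<phi> p) \<le> B) \<longrightarrow>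
        norm (T \<phi>) \<le> C * B))"

text \<open>\<open>T\<close> is a distribution with gradient in \<open>L\<^sup>2\<close> (homogeneous \<open>W\<^sup>1\<^sup>,\<^sup>2\<close>), and \<open>\<nabla>T = G\<close>.\<close>

definition W12_dot_grad ::
  "(((real ^ 'd) \<Rightarrow> complex) \<Rightarrow> complex) \<Rightarrow> (real ^ 'd \<Rightarrow> complex ^ 'd) \<Rightarrow> bool" where
  "W12_dot_grad T G \<longleftrightarrow> distribution T \<and> G \<in> L2 lebesgue \<and>
     (\<forall>\<phi>\<in>test_functions UNIV. \<forall>i.
        T (dir_deriv (axis i 1) \<phi>) = - (\<integral>v. G v $ i * \<phi> v \<partial>lebesgue))"


section \<open>The coefficients\<close>

text \<open>\<open>\<xi> \<cdot> \<eta>\<^sup>-\<close> (conjugate on the second factor).\<close>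

definition herm :: "complex ^ 'd \<Rightarrow> complex ^ 'd \<Rightarrow> complex" where
  "herm \<xi> \<eta> = (\<Sum>i\<in>UNIV. \<xi> $ i * cnj (\<eta> $ i))"

definition bounded_coeff :: "real \<Rightarrow> (real \<times> 'd::finite phase \<Rightarrow> complex ^ 'd ^ 'd) \<Rightarrow> bool" where
  "bounded_coeff \<Lambda> A \<longleftrightarrow>
     (AE p in lebesgue. \<forall>\<xi> \<eta>. norm (herm (A p *v \<xi>) \<eta>) \<le> \<Lambda> * norm \<xi> * norm \<eta>)"

text \<open>
  \<open>A\<close> is only determined up to null sets, so uniformly in \<open>(t, x)\<close> means: for a.e. \<open>(t, x)\<close>, with the
  same ellipticity constant.
\<close>

definition garding_elliptic :: "real \<Rightarrow> (real \<times> 'd::finite phase \<Rightarrow> complex ^ 'd ^ 'd) \<Rightarrow> bool" where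
  "garding_elliptic lam A \<longleftrightarrow>
     (AE tx in lebesgue. \<forall>T G. W12_dot_grad T G \<longrightarrow>
        Re (\<integral>v. herm (A (fst tx, snd tx, v) *v G v) (G v) \<partial>lebesgue) \<ge> lam * (L2norm lebesgue G)\<^sup>2)"


section \<open>Weak solutions and fundamental solution operators\<close>

definition grad_v :: "(real \<times> 'd::finite phase \<Rightarrow> complex) \<Rightarrow> real \<times> 'd::finite phase \<Rightarrow> complex ^ 'd" where
  "grad_v h = (\<lambda>p. \<chi> i. dir_deriv (0, 0, axis i 1) h p)"

text \<open>\<open>(\<partial>\<^sub>t + v \<cdot> \<nabla>\<^sub>x) h\<close>\<close>

definition transport :: "(real \<times> 'd::finite phase \<Rightarrow> complex) \<Rightarrow> real \<times> 'd::finite phase \<Rightarrow> complex" where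
  "transport h = (\<lambda>(t, x, v). dir_deriv (1, v, 0) h (t, x, v))"

text \<open>\<open>G\<close> is the distributional \<open>\<nabla>\<^sub>v f\<close> on \<open>(s, \<infinity>) \<times> \<real>\<^sup>2\<^sup>d\<close>, and it belongs to \<open>L\<^sup>2\<close> there.\<close>

definition weak_grad_v ::
  "real \<Rightarrow> (real \<Rightarrow> 'd::finite phase \<Rightarrow> complex) \<Rightarrow> (real \<times> 'd::finite phase \<Rightarrow> complex ^ 'd) \<Rightarrow> bool" where
  "weak_grad_v s f G \<longleftrightarrow> G \<in> L2 (lebesgue_on ({s<..} \<times> UNIV)) \<and>
     (\<forall>\<phi>\<in>test_functions ({s<..} \<times> UNIV). \<forall>i.
        (\<integral>p. f (fst p) (snd p) * dir_deriv (0, 0, axis i 1) \<phi> p \<partial>lebesgue_on ({s<..} \<times> UNIV)) =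
        - (\<integral>p. G p $ i * \<phi> p \<partial>lebesgue_on ({s<..} \<times> UNIV)))"

text \<open>
  Weak solution on \<open>[s, \<infinity>)\<close> with initial value \<open>\<psi>\<close>.  The test functions in \<open>\<D>([s, \<infinity>) \<times> \<real>\<^sup>2\<^sup>d)\<close> are
  the restrictions of elements of \<open>\<D>(\<real> \<times> \<real>\<^sup>2\<^sup>d)\<close>; they need not vanish at \<open>t = s\<close>.
\<close>

definition weak_solution ::
  "(real \<times> 'd::finite phase \<Rightarrow> complex ^ 'd ^ 'd) \<Rightarrow> real \<Rightarrow> ('d::finite phase \<Rightarrow> complex)
     \<Rightarrow> (real \<Rightarrow> 'd::finite phase \<Rightarrow> complex) \<Rightarrow> bool" where
  "weak_solution A s \<psi> f \<longleftrightarrow>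
     (\<forall>T>s. (\<lambda>p. f (fst p) (snd p)) \<in> L2 (lebesgue_on ({s..T} \<times> UNIV))) \<and>
     (\<exists>G. weak_grad_v s f G \<and>
        (\<forall>h\<in>test_functions UNIV.
           - (\<integral>p. f (fst p) (snd p) * transport (\<lambda>q. cnj (h q)) p \<partial>lebesgue_on ({s..} \<times> UNIV))
           + (\<integral>p. herm (A p *v G p) (grad_v h p) \<partial>lebesgue_on ({s..} \<times> UNIV))
           = (\<integral>z. \<psi> z * cnj (h (s, z)) \<partial>lebesgue)))"

text \<open>
  \<open>\<Gamma> t s \<psi>\<close> is the value at time \<open>t\<close> of the weak solution starting from \<open>\<psi>\<close> at time \<open>s\<close>, in its
  version that is continuous in time.  The jointly measurable representative \<open>f\<close> is
  existentially quantified since \<open>\<Gamma> t s \<psi>\<close> is only determined a.e. for each single \<open>t\<close>.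
\<close>

definition fundamental_solution_operators ::
  "(real \<times> 'd::finite phase \<Rightarrow> complex ^ 'd ^ 'd)
     \<Rightarrow> (real \<Rightarrow> real \<Rightarrow> ('d::finite phase \<Rightarrow> complex) \<Rightarrow> 'd::finite phase \<Rightarrow> complex) \<Rightarrow> bool" where
  "fundamental_solution_operators A \<Gamma> \<longleftrightarrow>
     (\<forall>s. \<forall>\<psi>\<in>L2 lebesgue. \<exists>f. weak_solution A s \<psi> f \<and> L2_continuous_from s f \<and>
        (\<forall>t\<ge>s. AE z in lebesgue. \<Gamma> t s \<psi> z = f t z))"


section \<open>The kinetic distance between sets\<close>

text \<open>
  If \<open>E\<close> or \<open>F\<close> is empty the infimum should be \<open>\<infinity>\<close>; the real \<open>Inf\<close> of the empty set is an
  unspecified number instead.  This does not matter for off-diagonal bounds, where an empty \<open>E\<close>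
  makes the left-hand side zero and an empty \<open>F\<close> forces zero data.
\<close>

definition kin_dist :: "real \<Rightarrow> 'd::finite phase set \<Rightarrow> 'd::finite phase set \<Rightarrow> real" where
  "kin_dist \<tau> E F =
     sqrt (INF ((x, v), (y, w))\<in>E \<times> F. (norm (x - y - \<tau> *\<^sub>R w))\<^sup>2 / \<tau>\<^sup>2 + (norm (v - w))\<^sup>2)"

end

theory Submission
  imports Defs
begin

text \<open>
  The bound is proved by Davies' method of exponential weights. Let \<open>f\<close> be a solution and \<open>\<phi>\<close> a bounded
  weight that is constant along free transport. The transport term then does not see \<open>\<phi>\<close>, and the
  energy \<open>\<integral> exp (2 \<phi>) \<bar>f\<bar>\<^sup>2\<close> changes in time only through the elliptic term. Writing that term with
  \<open>P = \<nabla>\<^sub>v (exp \<phi> f)\<close>, the coercivity of \<open>A\<close> on \<open>P\<close> absorbs the products of \<open>P\<close> with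
  \<open>exp \<phi> f \<nabla>\<^sub>v \<phi>\<close>, so the energy grows at most at the rate
  \<open>2 (\<Lambda>\<^sup>2 / \<lambda> + \<Lambda>) \<parallel>\<nabla>\<^sub>v \<phi>\<parallel>\<^sup>2\<close> (lemma \<open>weighted_energy_bound\<close>). If \<open>\<phi>\<close> vanishes on the set \<open>F\<close>, transported
  to time \<open>t\<close>, and equals \<open>\<kappa> \<rho>\<close> on \<open>E\<close>, comparing the energies at times \<open>s\<close> and \<open>t\<close> gives
  \<open>\<integral>\<^sub>E \<bar>f(t)\<bar>\<^sup>2 \<le> exp (8 q \<kappa>\<^sup>2 (t - s) - 2 \<kappa> \<rho>) \<integral> \<bar>\<psi>\<bar>\<^sup>2\<close> with \<open>q = \<Lambda>\<^sup>2 / \<lambda>\<close>, because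
  \<open>\<parallel>\<nabla>\<^sub>v \<phi>\<parallel>\<^sup>2 \<le> 2 \<kappa>\<^sup>2\<close> and \<open>\<Lambda> \<le> q\<close> (lemma \<open>garding_constant_le_bound\<close>). The best \<open>\<kappa>\<close> yields the constant
  \<open>1 / (16 q)\<close> in the theorem, which exceeds \<open>3 / (104 q)\<close>; the margin pays for making \<open>\<phi>\<close> smooth.

  The weight comes from the kinetic distance (lemma \<open>kinetic_weight_exists\<close>). After division of the position by
  \<open>\<tau> = t - s\<close>, the number \<open>\<rho>\<close> is the Euclidean distance from \<open>E\<close> to the transported \<open>F\<close>, and \<open>\<phi>\<close> is
  \<open>\<kappa>\<close> times the truncated distance function, as a function of the point that free transport reaches at time
  \<open>t\<close>. At time \<open>r\<close> a unit velocity displacement moves that point by \<open>((t - r) / \<tau>, 1)\<close> in these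
  coordinates, hence the velocity gradient of \<open>\<phi>\<close> is at most \<open>\<kappa> \<surd>2\<close>.

  The argument has to be justified for a weak solution, which need not be differentiable in time and is
  not a test function for its own equation. All functions are therefore written in the frame that moves with free transport.
  There the transport derivative becomes \<open>\<partial>\<^sub>r\<close>, and \<open>\<nabla>\<^sub>v\<close> becomes a derivative in directions that depend on \<open>r\<close>
  alone. Convolution in the remaining variables (averaging over Galilean translations, in the original
  variables) commutes with both, without any commutator terms. Since mollifiers composed with the flow are test
  functions, the mollified solution satisfies an evolution equation in integrated form (lemma
  \<open>evolution_identity\<close>) and has the mollified gradient (lemma \<open>gradient_identity\<close>). It is smooth in space, so the
  energy identity and the integration by parts are classical, and Garding's inequality applies on the
  velocity line over almost every \<open>(t, x)\<close>. Only the product with \<open>A\<close> does not commute with the mollification, and this error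
  vanishes in \<open>L\<^sup>2\<close> in the limit. The time continuity of \<open>f\<close> identifies the energy at each single time, and
  Gronwall's inequality concludes.
\<close>

section \<open>Square integrable functions\<close>

lemma L2_I: "f \<in> borel_measurable M \<Longrightarrow> integrable M (\<lambda>x. (norm (f x))\<^sup>2) \<Longrightarrow> f \<in> L2 M"
  by (simp add: L2_def)

lemma L2_measurable[measurable_dest]: "f \<in> L2 M \<Longrightarrow> f \<in> borel_measurable M"
  by (simp add: L2_def)

lemma L2_borel: "f \<in> L2 lborel \<Longrightarrow> f \<in> borel_measurable borel"
  by (simp add: L2_def)

lemma L2_integrable: "f \<in> L2 M \<Longrightarrow> integrable M (\<lambda>x. (norm (f x))\<^sup>2)"
  by (simp add: L2_def)

lemma L2norm_square: "(L2norm M f)\<^sup>2 = (\<integral>x. (norm (f x))\<^sup>2 \<partial>M)"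
  by (simp add: L2norm_def)

lemma L2_bound_AE:
  assumes "u \<in> L2 M" "v \<in> borel_measurable M" "AE x in M. norm (v x) \<le> C * norm (u x)"
  shows "v \<in> L2 M"
proof (rule L2_I[OF assms(2)])
  have "AE x in M. (norm (v x))\<^sup>2 \<le> C\<^sup>2 * (norm (u x))\<^sup>2"
    using assms(3)
  proof eventually_elim
    case (elim x) then show ?case using power_mono[OF elim, of 2] by (simp add: power_mult_distrib)
  qed
  then show "integrable M (\<lambda>x. (norm (v x))\<^sup>2)"
    using assms by (intro Bochner_Integration.integrable_bound[OF integrable_mult_right[OF L2_integrable[OF assms(1)], of "C\<^sup>2"]]) auto
qed

lemma L2_bound:
  assumes "u \<in> L2 M" "v \<in> borel_measurable M" "\<And>x. norm (v x) \<le> C * norm (u x)"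
  shows "v \<in> L2 M"
  by (rule L2_bound_AE[OF assms(1,2) AE_I2[OF assms(3)]])

lemma square_add_le: "((a::real) + b)\<^sup>2 \<le> 2 * a\<^sup>2 + 2 * b\<^sup>2"
  using sum_squares_bound[of a b] by (simp add: power2_sum)

lemma L2_add:
  fixes u v :: "'a \<Rightarrow> 'b::{real_normed_vector, second_countable_topology}"
  assumes "u \<in> L2 M" "v \<in> L2 M"
  shows "(\<lambda>x. u x + v x) \<in> L2 M"
proof (rule L2_I)
  have [measurable]: "u \<in> borel_measurable M" "v \<in> borel_measurable M" using assms by auto
  show "(\<lambda>x. u x + v x) \<in> borel_measurable M" by measurable
  have "(norm (u x + v x))\<^sup>2 \<le> 2 * (norm (u x))\<^sup>2 + 2 * (norm (v x))\<^sup>2" for x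
    by (rule order_trans[OF power_mono[OF norm_triangle_ineq norm_ge_zero] square_add_le])
  then show "integrable M (\<lambda>x. (norm (u x + v x))\<^sup>2)"
    by (intro Bochner_Integration.integrable_bound[OF Bochner_Integration.integrable_add[OF
       integrable_mult_right[OF L2_integrable[OF assms(1)], of 2] integrable_mult_right[OF L2_integrable[OF assms(2)], of 2]]]) auto
qed

lemma L2_minus:
  fixes u v :: "'a \<Rightarrow> 'b::{real_normed_vector, second_countable_topology}"
  assumes "u \<in> L2 M" "v \<in> L2 M"
  shows "(\<lambda>x. u x - v x) \<in> L2 M"
proof -
  have "(\<lambda>x. - v x) \<in> L2 M"
    using assms(2) by (rule L2_bound[where C=1]) (use assms in auto)
  from L2_add[OF assms(1) this] show ?thesis by simp
qed

lemma L2_norm_mult_integrable: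
  assumes "u \<in> L2 M" "v \<in> L2 M"
  shows "integrable M (\<lambda>x. norm (u x) * norm (v x))"
proof -
  have [measurable]: "u \<in> borel_measurable M" "v \<in> borel_measurable M" using assms by auto
  have "norm (u x) * norm (v x) \<le> (norm (u x))\<^sup>2 + (norm (v x))\<^sup>2" for x
    using sum_squares_bound[of "norm (u x)" "norm (v x)"] mult_nonneg_nonneg[OF norm_ge_zero[of "u x"] norm_ge_zero[of "v x"]]
    by linarith
  then show ?thesis
    by (intro Bochner_Integration.integrable_bound[OF Bochner_Integration.integrable_add[OF
       L2_integrable[OF assms(1)] L2_integrable[OF assms(2)]]]) auto
qed

lemma L2_Cauchy_Schwarz:
  assumes "u \<in> L2 M" "v \<in> L2 M"
  shows "(\<integral>x. norm (u x) * norm (v x) \<partial>M)\<^sup>2 \<le> (\<integral>x. (norm (u x))\<^sup>2 \<partial>M) * (\<integral>x. (norm (v x))\<^sup>2 \<partial>M)"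
proof -
  define a b d where "a = (\<integral>x. (norm (u x))\<^sup>2 \<partial>M)" and "b = (\<integral>x. norm (u x) * norm (v x) \<partial>M)"
    and "d = (\<integral>x. (norm (v x))\<^sup>2 \<partial>M)"
  note I = L2_norm_mult_integrable[OF assms] L2_integrable[OF assms(1)] L2_integrable[OF assms(2)]
  have q: "0 \<le> c\<^sup>2 * a - 2 * c * b + d" for c
  proof -
    have "0 \<le> (\<integral>x. (c * norm (u x) - norm (v x))\<^sup>2 \<partial>M)" by simp
    also have "\<dots> = (\<integral>x. c\<^sup>2 * (norm (u x))\<^sup>2 - 2 * c * (norm (u x) * norm (v x)) + (norm (v x))\<^sup>2 \<partial>M)"
      by (rule Bochner_Integration.integral_cong) (auto simp: power2_eq_square algebra_simps)
    also have "\<dots> = c\<^sup>2 * a - 2 * c * b + d"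
      using I by (simp add: a_def b_def d_def)
    finally show ?thesis .
  qed
  have a0: "a \<ge> 0" and d0: "d \<ge> 0" by (simp_all add: a_def d_def)
  show ?thesis
  proof (cases "a = 0")
    case True
    then have "b = 0"
      using q[of "(d + 1) / b"] d0 by (cases "b = 0") auto
    then show ?thesis using True by (simp add: a_def[symmetric] b_def[symmetric])
  next
    case False
    with a0 have "a > 0" by simp
    have "0 \<le> a * ((b / a)\<^sup>2 * a - 2 * (b / a) * b + d)"
      using q[of "b / a"] \<open>a > 0\<close> by (intro mult_nonneg_nonneg) auto
    also have "\<dots> = a * d - b\<^sup>2" using \<open>a > 0\<close> by (simp add: field_simps power2_eq_square)
    finally show ?thesis by (simp add: a_def b_def d_def)
  qed
qed

lemma L2_Cauchy_Schwarz_L2norm: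
  assumes "u \<in> L2 M" "v \<in> L2 M"
  shows "(\<integral>x. norm (u x) * norm (v x) \<partial>M) \<le> L2norm M u * L2norm M v"
  using real_sqrt_le_mono[OF L2_Cauchy_Schwarz[OF assms]]
  by (simp add: L2norm_def real_sqrt_mult)

text \<open>
  Cauchy--Schwarz for the functions \<open>\<surd>\<bar>\<kappa>\<bar>\<close> and \<open>\<surd>\<bar>\<kappa>\<bar> \<bar>p\<bar>\<close>.
\<close>

lemma weighted_Cauchy_Schwarz:
  fixes p :: "'a \<Rightarrow> 'b::{banach, second_countable_topology}"
  assumes k: "integrable M \<kappa>" and p[measurable]: "p \<in> borel_measurable M"
    and I: "integrable M (\<lambda>x. \<bar>\<kappa> x\<bar> * (norm (p x))\<^sup>2)"
  shows "integrable M (\<lambda>x. \<kappa> x *\<^sub>R p x)"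
    and "(norm (\<integral>x. \<kappa> x *\<^sub>R p x \<partial>M))\<^sup>2 \<le> (\<integral>x. \<bar>\<kappa> x\<bar> \<partial>M) * (\<integral>x. \<bar>\<kappa> x\<bar> * (norm (p x))\<^sup>2 \<partial>M)"
proof -
  have [measurable]: "\<kappa> \<in> borel_measurable M" using k by auto
  have 1: "(\<lambda>x. sqrt \<bar>\<kappa> x\<bar>) \<in> L2 M" using k by (auto intro!: L2_I)
  have 2: "(\<lambda>x. sqrt \<bar>\<kappa> x\<bar> * norm (p x)) \<in> L2 M"
    using I by (auto intro!: L2_I simp: power_mult_distrib)
  have e: "norm (sqrt \<bar>\<kappa> x\<bar>) * norm (sqrt \<bar>\<kappa> x\<bar> * norm (p x)) = norm (\<kappa> x *\<^sub>R p x)" for x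
    by (simp add: abs_mult flip: mult.assoc)
  have 3: "integrable M (\<lambda>x. norm (\<kappa> x *\<^sub>R p x))"
    using L2_norm_mult_integrable[OF 1 2] unfolding e .
  then show i: "integrable M (\<lambda>x. \<kappa> x *\<^sub>R p x)"
    by (subst (asm) integrable_norm_iff) auto
  have "norm (\<integral>x. \<kappa> x *\<^sub>R p x \<partial>M) \<le> (\<integral>x. norm (\<kappa> x *\<^sub>R p x) \<partial>M)" by (rule integral_norm_bound)
  then have "(norm (\<integral>x. \<kappa> x *\<^sub>R p x \<partial>M))\<^sup>2 \<le> (\<integral>x. norm (\<kappa> x *\<^sub>R p x) \<partial>M)\<^sup>2" by (rule power_mono) simp
  also have "\<dots> \<le> (\<integral>x. \<bar>\<kappa> x\<bar> \<partial>M) * (\<integral>x. \<bar>\<kappa> x\<bar> * (norm (p x))\<^sup>2 \<partial>M)"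
    using L2_Cauchy_Schwarz[OF 1 2] unfolding e by (simp add: power_mult_distrib)
  finally show "(norm (\<integral>x. \<kappa> x *\<^sub>R p x \<partial>M))\<^sup>2 \<le> (\<integral>x. \<bar>\<kappa> x\<bar> \<partial>M) * (\<integral>x. \<bar>\<kappa> x\<bar> * (norm (p x))\<^sup>2 \<partial>M)" .
qed

lemma tendsto_sqrt_zero: "(f \<longlongrightarrow> (0::real)) F \<Longrightarrow> ((\<lambda>x. sqrt (f x)) \<longlongrightarrow> 0) F"
  using tendsto_real_sqrt[of f 0 F] by simp

lemma L2_limit_product_zero:
  fixes p :: "'a \<Rightarrow> 'c::{real_normed_vector, second_countable_topology}"
  assumes e: "\<And>n::nat. e n \<in> L2 M" "(\<lambda>n. \<integral>x. (norm (e n x))\<^sup>2 \<partial>M) \<longlonglongrightarrow> 0"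
    and p: "\<And>n. p' n \<in> L2 M" "p \<in> L2 M" "(\<lambda>n. \<integral>x. (norm (p' n x - p x))\<^sup>2 \<partial>M) \<longlonglongrightarrow> 0"
  shows "(\<lambda>n. \<integral>x. norm (e n x) * norm (p' n x) \<partial>M) \<longlonglongrightarrow> 0"
proof (rule tendsto_sandwich[where f="\<lambda>_. 0" and h="\<lambda>n. L2norm M (e n) * L2norm M (\<lambda>x. p' n x - p x) + L2norm M (e n) * L2norm M p"])
  note d = L2_minus[OF p(1) p(2)]
  have "(\<integral>x. norm (e n x) * norm (p' n x) \<partial>M) \<le> L2norm M (e n) * L2norm M (\<lambda>x. p' n x - p x) + L2norm M (e n) * L2norm M p" for n
  proof -
    note I = L2_norm_mult_integrable[OF e(1)[of n] d[of n]] L2_norm_mult_integrable[OF e(1)[of n] p(2)]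
    have "norm (p' n x) \<le> norm (p' n x - p x) + norm (p x)" for x by norm
    then have "(\<integral>x. norm (e n x) * norm (p' n x) \<partial>M) \<le> (\<integral>x. norm (e n x) * norm (p' n x - p x) + norm (e n x) * norm (p x) \<partial>M)"
      using I L2_norm_mult_integrable[OF e(1)[of n] p(1)[of n]]
      by (intro integral_mono Bochner_Integration.integrable_add)
         (auto simp flip: distrib_left intro!: mult_left_mono)
    also have "\<dots> = (\<integral>x. norm (e n x) * norm (p' n x - p x) \<partial>M) + (\<integral>x. norm (e n x) * norm (p x) \<partial>M)"
      using I by simp
    finally show ?thesis using L2_Cauchy_Schwarz_L2norm[OF e(1)[of n] d[of n]] L2_Cauchy_Schwarz_L2norm[OF e(1)[of n] p(2)] by linarith
  qed
  then show "\<forall>\<^sub>F n in sequentially. (\<integral>x. norm (e n x) * norm (p' n x) \<partial>M) \<le> L2norm M (e n) * L2norm M (\<lambda>x. p' n x - p x) + L2norm M (e n) * L2norm M p"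
    by simp
  have "(\<lambda>n. L2norm M (e n) * L2norm M (\<lambda>x. p' n x - p x) + L2norm M (e n) * L2norm M p) \<longlonglongrightarrow> 0 * 0 + 0 * L2norm M p"
    using tendsto_sqrt_zero[OF e(2)] tendsto_sqrt_zero[OF p(3)]
    unfolding L2norm_def by (intro tendsto_intros)
  then show "(\<lambda>n. L2norm M (e n) * L2norm M (\<lambda>x. p' n x - p x) + L2norm M (e n) * L2norm M p) \<longlonglongrightarrow> 0" by simp
qed auto

lemma L2_limit_weighted_square:
  fixes p :: "'a \<Rightarrow> 'c::{real_normed_vector, second_countable_topology}"
  assumes p: "\<And>n::nat. p' n \<in> L2 M" "p \<in> L2 M" "(\<lambda>n. \<integral>x. (norm (p' n x - p x))\<^sup>2 \<partial>M) \<longlonglongrightarrow> 0"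
    and w[measurable]: "w \<in> borel_measurable M" and C: "\<And>x. \<bar>w x\<bar> \<le> C"
  shows "(\<lambda>n. \<integral>x. w x * (norm (p' n x))\<^sup>2 \<partial>M) \<longlonglongrightarrow> (\<integral>x. w x * (norm (p x))\<^sup>2 \<partial>M)"
proof -
  note d = L2_minus[OF p(1) p(2)]
  have C0: "0 \<le> C" using C order_trans abs_ge_zero by blast
  have ms[measurable]: "p' n \<in> borel_measurable M" "p \<in> borel_measurable M" for n using p by auto
  have I: "integrable M (\<lambda>x. w x * (norm (q x))\<^sup>2)" if "q \<in> L2 M" for q :: "'a \<Rightarrow> 'c"
    using C that by (intro Bochner_Integration.integrable_bound[OF integrable_mult_right[OF L2_integrable[OF that], of C]])
      (auto simp: abs_mult C0 intro!: mult_right_mono)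
  have 1: "(\<lambda>n. \<integral>x. norm (p' n x - p x) * norm (p' n x - p x) \<partial>M) \<longlonglongrightarrow> 0"
    using p(3) by (simp add: power2_eq_square)
  have 2: "(\<lambda>n. \<integral>x. norm (p' n x - p x) * norm (p x) \<partial>M) \<longlonglongrightarrow> 0"
    by (rule L2_limit_product_zero[where p="p"]) (use p d in auto)
  have "(\<lambda>n. C * ((\<integral>x. norm (p' n x - p x) * norm (p' n x - p x) \<partial>M) + 2 * (\<integral>x. norm (p' n x - p x) * norm (p x) \<partial>M))) \<longlonglongrightarrow> C * (0 + 2 * 0)"
    by (intro tendsto_intros 1 2)
  then have 3: "(\<lambda>n. C * ((\<integral>x. norm (p' n x - p x) * norm (p' n x - p x) \<partial>M) + 2 * (\<integral>x. norm (p' n x - p x) * norm (p x) \<partial>M))) \<longlonglongrightarrow> 0"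
    by simp
  have "(\<lambda>n. (\<integral>x. w x * (norm (p' n x))\<^sup>2 \<partial>M) - (\<integral>x. w x * (norm (p x))\<^sup>2 \<partial>M)) \<longlonglongrightarrow> 0"
  proof (rule Lim_null_comparison[OF _ 3], rule always_eventually, rule allI)
    fix n
    note J = L2_norm_mult_integrable[OF d[of n] d[of n]] L2_norm_mult_integrable[OF d[of n] p(2)]
    have pt0: "\<bar>(norm a)\<^sup>2 - (norm b)\<^sup>2\<bar> = \<bar>norm a - norm b\<bar> * (norm a + norm b)" for a b :: 'c
    proof -
      have "(norm a)\<^sup>2 - (norm b)\<^sup>2 = (norm a - norm b) * (norm a + norm b)" by (simp add: power2_eq_square algebra_simps)
      then show ?thesis by (simp add: abs_mult)
    qed
    have pt: "\<bar>w x * (norm (p' n x))\<^sup>2 - w x * (norm (p x))\<^sup>2\<bar> \<le> C * (norm (p' n x - p x) * norm (p' n x - p x) + 2 * (norm (p' n x - p x) * norm (p x)))" for x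
    proof -
      have "\<bar>(norm (p' n x))\<^sup>2 - (norm (p x))\<^sup>2\<bar> = \<bar>norm (p' n x) - norm (p x)\<bar> * (norm (p' n x) + norm (p x))"
        by (rule pt0)
      also have "\<dots> \<le> norm (p' n x - p x) * (norm (p' n x - p x) + 2 * norm (p x))"
        by (intro mult_mono norm_triangle_ineq3) (use norm_triangle_sub[of "p' n x" "p x"] in auto)
      finally have "\<bar>(norm (p' n x))\<^sup>2 - (norm (p x))\<^sup>2\<bar> \<le> norm (p' n x - p x) * (norm (p' n x - p x) + 2 * norm (p x))" .
      then have "\<bar>w x\<bar> * \<bar>(norm (p' n x))\<^sup>2 - (norm (p x))\<^sup>2\<bar> \<le> C * (norm (p' n x - p x) * (norm (p' n x - p x) + 2 * norm (p x)))"
        using C[of x] C0 by (intro mult_mono) auto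
      then show ?thesis by (simp add: abs_mult[symmetric] algebra_simps)
    qed
    have "norm ((\<integral>x. w x * (norm (p' n x))\<^sup>2 \<partial>M) - (\<integral>x. w x * (norm (p x))\<^sup>2 \<partial>M)) = norm (\<integral>x. w x * (norm (p' n x))\<^sup>2 - w x * (norm (p x))\<^sup>2 \<partial>M)"
      using I p by simp
    also have "\<dots> \<le> (\<integral>x. norm (w x * (norm (p' n x))\<^sup>2 - w x * (norm (p x))\<^sup>2) \<partial>M)" by (rule integral_norm_bound)
    also have "\<dots> \<le> (\<integral>x. C * (norm (p' n x - p x) * norm (p' n x - p x) + 2 * (norm (p' n x - p x) * norm (p x))) \<partial>M)"
      using I p pt J by (intro integral_mono) auto
    also have "\<dots> = C * ((\<integral>x. norm (p' n x - p x) * norm (p' n x - p x) \<partial>M) + 2 * (\<integral>x. norm (p' n x - p x) * norm (p x) \<partial>M))"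
      using J by simp
    finally show "norm ((\<integral>x. w x * (norm (p' n x))\<^sup>2 \<partial>M) - (\<integral>x. w x * (norm (p x))\<^sup>2 \<partial>M)) \<le> \<dots>" .
  qed
  then show ?thesis by (rule LIM_zero_cancel)
qed

section \<open>Integrals over product spaces\<close>

lemma AE_integrable_section:
  fixes f :: "'a::euclidean_space \<times> 'b::euclidean_space \<Rightarrow> 'c::{banach, second_countable_topology}"
  assumes "integrable lborel f"
  shows "AE x in lborel. integrable lborel (\<lambda>y. f (x, y))"
  using lborel_pair.AE_integrable_fst'[of f] assms by (simp add: lborel_prod)

lemma integrable_section_integral:
  fixes f :: "'a::euclidean_space \<times> 'b::euclidean_space \<Rightarrow> 'c::{banach, second_countable_topology}"
  assumes "integrable lborel f"
  shows "integrable lborel (\<lambda>x. \<integral>y. f (x, y) \<partial>lborel)"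
  using lborel_pair.integrable_fst'[of f] assms by (simp add: lborel_prod)

lemma integral_lborel_prod:
  fixes f :: "'a::euclidean_space \<times> 'b::euclidean_space \<Rightarrow> 'c::{banach, second_countable_topology}"
  assumes "integrable lborel f"
  shows "(\<integral>x. (\<integral>y. f (x, y) \<partial>lborel) \<partial>lborel) = (\<integral>p. f p \<partial>lborel)"
  using lborel_pair.integral_fst'[of f] assms by (simp add: lborel_prod)

lemma integrable_lborel_swap:
  fixes f :: "'a::euclidean_space \<times> 'b::euclidean_space \<Rightarrow> 'c::{banach, second_countable_topology}"
  assumes "integrable lborel f"
  shows "integrable lborel (\<lambda>(y, x). f (x, y))"
  using lborel_pair.integrable_product_swap[of f] assms by (simp add: lborel_prod)

lemma integral_lborel_swap:
  fixes f :: "'a::euclidean_space \<times> 'b::euclidean_space \<Rightarrow> 'c::{banach, second_countable_topology}"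
  assumes "integrable lborel f"
  shows "(\<integral>x. (\<integral>y. f (x, y) \<partial>lborel) \<partial>lborel) = (\<integral>y. (\<integral>x. f (x, y) \<partial>lborel) \<partial>lborel)"
  using lborel_pair.integral_product_swap[of f] integral_lborel_prod[OF assms]
    integral_lborel_prod[OF integrable_lborel_swap[OF assms]] assms by (simp add: lborel_prod)

lemma integrable_lborel_prodI:
  fixes f :: "'a::euclidean_space \<times> 'b::euclidean_space \<Rightarrow> 'c::{banach, second_countable_topology}"
  assumes "f \<in> borel_measurable borel"
    and "integrable lborel (\<lambda>x. \<integral>y. norm (f (x, y)) \<partial>lborel)"
    and "AE x in lborel. integrable lborel (\<lambda>y. f (x, y))"
  shows "integrable lborel f"
  using lborel_pair.Fubini_integrable[of f] assms by (simp add: lborel_prod)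

lemma AE_lborel_sections:
  assumes "AE p in (lborel :: ('a::euclidean_space \<times> 'b::euclidean_space) measure). P p"
  shows "AE x in lborel. AE y in lborel. P (x, y)"
  using assms unfolding lborel_prod[symmetric] by (rule lborel_pair.AE_pair)

lemma AE_lborel_swap:
  assumes "AE p in (lborel :: ('a::euclidean_space \<times> 'b::euclidean_space) measure). P p"
  shows "AE p in lborel. P (snd p, fst p)"
proof -
  have e: "distr (lborel \<Otimes>\<^sub>M lborel) (lborel \<Otimes>\<^sub>M lborel) (\<lambda>(x, y). (y, x)) = (lborel \<Otimes>\<^sub>M lborel :: ('a \<times> 'b) measure)"
    by (rule lborel_pair.distr_pair_swap[symmetric])
  have "AE p in (lborel \<Otimes>\<^sub>M lborel :: ('a \<times> 'b) measure). P p"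
    using assms unfolding lborel_prod .
  then have "AE p in distr (lborel \<Otimes>\<^sub>M lborel :: ('b \<times> 'a) measure) (lborel \<Otimes>\<^sub>M lborel) (\<lambda>(x, y). (y, x)). P p"
    by (subst e)
  from AE_distrD[OF _ this] show ?thesis unfolding lborel_prod[symmetric] by (simp add: case_prod_beta)
qed

lemma AE_lborel_prodI:
  fixes P :: "'a::euclidean_space \<times> 'b::euclidean_space \<Rightarrow> bool"
  assumes "Measurable.pred borel P" "AE x in lborel. AE y in lborel. P (x, y)"
  shows "AE p in lborel. P p"
proof -
  have "{p \<in> space (lborel \<Otimes>\<^sub>M lborel). P p} \<in> sets (lborel \<Otimes>\<^sub>M lborel)"
    using assms(1) unfolding lborel_prod by (simp add: pred_def)
  from lborel_pair.AE_pair_measure[OF this assms(2)] show ?thesis unfolding lborel_prod .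
qed

section \<open>Translations\<close>

lemma integrable_lborel_translate_iff:
  fixes f :: "'a::euclidean_space \<Rightarrow> 'b::{banach, second_countable_topology}"
  shows "integrable lborel (\<lambda>x. f (x + h)) \<longleftrightarrow> integrable lborel f"
proof -
  have *: "integrable lborel (\<lambda>x. f (x + h))" if "integrable lborel f" for f :: "'a \<Rightarrow> 'b" and h
    using integrable_distr_eq[of "(+) h" lborel borel f] that by (simp add: lborel_distr_plus add.commute)
  from *[of f h] *[of "\<lambda>x. f (x + h)" "-h"] show ?thesis by auto
qed

lemma integral_lborel_translate:
  fixes f :: "'a::euclidean_space \<Rightarrow> 'b::{banach, second_countable_topology}"
  shows "(\<integral>x. f (x + h) \<partial>lborel) = (\<integral>x. f x \<partial>lborel)"
proof (cases "integrable lborel f")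
  case True
  then show ?thesis
    using integral_distr[of "(+) h" lborel borel f] by (simp add: lborel_distr_plus add.commute borel_measurable_integrable)
qed (simp add: not_integrable_integral_eq integrable_lborel_translate_iff)

lemma lborel_distr_uminus_euclidean: "distr lborel borel uminus = (lborel :: 'a::euclidean_space measure)"
  by (subst (2) lborel_affine[of "-1" 0]) (auto simp: density_1)

lemma integrable_lborel_reflect_iff:
  fixes f :: "'a::euclidean_space \<Rightarrow> 'b::{banach, second_countable_topology}"
  shows "integrable lborel (\<lambda>x. f (h - x)) \<longleftrightarrow> integrable lborel f"
proof -
  have *: "integrable lborel (\<lambda>x. f (- x))" if "integrable lborel f" for f :: "'a \<Rightarrow> 'b"
    using integrable_distr_eq[of "uminus" lborel borel f] that by (simp add: lborel_distr_uminus_euclidean)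
  have "integrable lborel (\<lambda>x. f (h - x)) \<longleftrightarrow> integrable lborel (\<lambda>x. f (- x))"
    using integrable_lborel_translate_iff[of "\<lambda>x. f (- x)" "- h"] by simp
  also have "\<dots> \<longleftrightarrow> integrable lborel f" using *[of f] *[of "\<lambda>x. f (- x)"] by auto
  finally show ?thesis .
qed

lemma integral_lborel_reflect:
  fixes f :: "'a::euclidean_space \<Rightarrow> 'b::{banach, second_countable_topology}"
  shows "(\<integral>x. f (h - x) \<partial>lborel) = (\<integral>x. f x \<partial>lborel)"
proof (cases "integrable lborel f")
  case True
  have "(\<integral>x. f (h - x) \<partial>lborel) = (\<integral>x. f (- x) \<partial>lborel)"
    using integral_lborel_translate[of "\<lambda>x. f (- x)" "- h"] by simp
  also have "\<dots> = (\<integral>x. f x \<partial>lborel)"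
    using integral_distr[of "uminus" lborel borel f] True by (simp add: lborel_distr_uminus_euclidean borel_measurable_integrable)
  finally show ?thesis .
qed (simp add: not_integrable_integral_eq integrable_lborel_reflect_iff)

text \<open>
  Translation is an isometry of \<open>L\<^sup>1\<close>, so the property passes to limits in \<open>L\<^sup>1\<close>. By outer regularity,
  indicators of open sets therefore suffice; these converge pointwise on the open set, and since translation
  preserves the measure this already controls the symmetric difference.
\<close>

lemma translation_continuous_L1:
  fixes u :: "'a::euclidean_space \<Rightarrow> 'b::{banach, second_countable_topology}"
  assumes "integrable lborel u" "h \<longlonglongrightarrow> 0"
  shows "(\<lambda>n. \<integral>x. norm (u (x + h n) - u x) \<partial>lborel) \<longlonglongrightarrow> 0"
proof -
  define D where "D u v = (\<integral>x. norm (u x - v x :: 'b) \<partial>lborel)" for u v :: "'a \<Rightarrow> 'b"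
  have tri: "D u w \<le> D u v + D v w"
    if "integrable lborel u" "integrable lborel v" "integrable lborel w" for u v w
  proof -
    have "D u w \<le> (\<integral>x. norm (u x - v x) + norm (v x - w x) \<partial>lborel)"
      unfolding D_def using that by (intro integral_mono) (auto intro: norm_triangle_le simp: order_trans[OF _ norm_triangle_ineq])
    also have "\<dots> = D u v + D v w" using that by (simp add: D_def)
    finally show ?thesis .
  qed
  have Dt: "D (\<lambda>x. u (x + k)) (\<lambda>x. v (x + k)) = D u v" for u v k
    unfolding D_def using integral_lborel_translate[of "\<lambda>x. norm (u x - v x)" k] by simp
  \<comment> \<open>The property is closed under approximation in \<open>L\<^sup>1\<close>.\<close>
  have approx: "(\<lambda>n. D (\<lambda>x. u (x + h n)) u) \<longlonglongrightarrow> 0"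
    if u: "integrable lborel u"
      and a: "\<And>e. e > 0 \<Longrightarrow> \<exists>v. integrable lborel v \<and> D u v < e \<and> (\<lambda>n. D (\<lambda>x. v (x + h n)) v) \<longlonglongrightarrow> 0" for u
  proof (rule LIMSEQ_I)
    fix e :: real assume "e > 0"
    then obtain v where v: "integrable lborel v" "D u v < e / 3" "(\<lambda>n. D (\<lambda>x. v (x + h n)) v) \<longlonglongrightarrow> 0"
      using a[of "e / 3"] by auto
    obtain N where N: "\<And>n. n \<ge> N \<Longrightarrow> norm (D (\<lambda>x. v (x + h n)) v - 0) < e / 3"
      using LIMSEQ_D[OF v(3), of "e / 3"] \<open>e > 0\<close> by auto
    have "norm (D (\<lambda>x. u (x + h n)) u - 0) < e" if "n \<ge> N" for n
    proof -
      have It: "integrable lborel (\<lambda>x. u (x + h n))" "integrable lborel (\<lambda>x. v (x + h n))"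
        using u v by (simp_all add: integrable_lborel_translate_iff)
      have "D (\<lambda>x. u (x + h n)) u \<le> D (\<lambda>x. u (x + h n)) (\<lambda>x. v (x + h n)) + (D (\<lambda>x. v (x + h n)) v + D v u)"
        using tri[OF It(1) It(2) u] tri[OF It(2) v(1) u] by linarith
      also have "\<dots> = D u v + D (\<lambda>x. v (x + h n)) v + D u v"
        by (simp add: Dt) (simp add: D_def norm_minus_commute)
      also have "\<dots> < e" using v(2) N[OF that] by simp
      finally show ?thesis by (simp add: D_def)
    qed
    then show "\<exists>N. \<forall>n\<ge>N. norm (D (\<lambda>x. u (x + h n)) u - 0) < e" by blast
  qed
  \<comment> \<open>For an open set, \<open>\<bar>1\<^sub>U(x + h) - 1\<^sub>U(x)\<bar>\<close> has integral \<open>2 \<bar>U\<bar> - 2 \<bar>U \<inter> (U - h)\<bar>\<close>.\<close>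
  have opn: "(\<lambda>n. D (\<lambda>x. indicator U (x + h n) *\<^sub>R c) (\<lambda>x. indicator U x *\<^sub>R c)) \<longlonglongrightarrow> 0"
    if U: "open U" "emeasure lborel U < \<infinity>" for U c
  proof -
    have [measurable]: "U \<in> sets borel" using U by auto
    have i: "integrable lborel (indicator U :: 'a \<Rightarrow> real)" using U by (intro integrable_real_indicator) auto
    have it: "integrable lborel (\<lambda>x. indicator U (x + h n) :: real)" for n
      using i integrable_lborel_translate_iff[of "indicator U :: 'a \<Rightarrow> real"] by simp
    have ip: "integrable lborel (\<lambda>x. indicator U x * indicator U (x + h n) :: real)" for n
      by (rule Bochner_Integration.integrable_bound[OF i]) (auto simp: indicator_def)
    have e: "D (\<lambda>x. indicator U (x + h n) *\<^sub>R c) (\<lambda>x. indicator U x *\<^sub>R c)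
        = norm c * (2 * measure lborel U - 2 * (\<integral>x. indicator U x * indicator U (x + h n) \<partial>lborel))" for n
    proof -
      have "D (\<lambda>x. indicator U (x + h n) *\<^sub>R c) (\<lambda>x. indicator U x *\<^sub>R c) =
        (\<integral>x. norm c * (indicator U (x + h n) + indicator U x - 2 * (indicator U x * indicator U (x + h n))) \<partial>lborel)"
        unfolding D_def by (rule Bochner_Integration.integral_cong) (auto simp: indicator_def)
      also have "\<dots> = norm c * ((\<integral>x. indicator U (x + h n) \<partial>lborel) + measure lborel U - 2 * (\<integral>x. indicator U x * indicator U (x + h n) \<partial>lborel))"
        using i it[of n] ip[of n] by simp
      also have "(\<integral>x. indicator U (x + h n) \<partial>lborel) = measure lborel U"
        using integral_lborel_translate[of "indicator U :: 'a \<Rightarrow> real" "h n"] by simp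
      finally show ?thesis by simp
    qed
    have "(\<lambda>n. \<integral>x. indicator U x * indicator U (x + h n) \<partial>lborel) \<longlonglongrightarrow> (\<integral>x. indicator U x * (1::real) \<partial>lborel)"
    proof (rule integral_dominated_convergence[where w="indicator U"])
      show "AE x in lborel. (\<lambda>n. indicator U x * indicator U (x + h n)) \<longlonglongrightarrow> indicator U x * (1::real)"
      proof (rule AE_I2)
        fix x
        show "(\<lambda>n. indicator U x * indicator U (x + h n)) \<longlonglongrightarrow> indicator U x * (1::real)"
        proof (cases "x \<in> U")
          case True
          have "(\<lambda>n. x + h n) \<longlonglongrightarrow> x + 0" by (intro tendsto_intros assms)
          then have "\<forall>\<^sub>F n in sequentially. x + h n \<in> U"
            using U(1) True by (auto dest: topological_tendstoD)
          then have "\<forall>\<^sub>F n in sequentially. indicator U x * indicator U (x + h n) = indicator U x * (1::real)"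
            by eventually_elim (simp add: indicator_def)
          then show ?thesis by (rule tendsto_eventually)
        qed simp
      qed
    qed (use i in \<open>auto simp: indicator_def\<close>)
    then have "(\<lambda>n. norm c * (2 * measure lborel U - 2 * (\<integral>x. indicator U x * indicator U (x + h n) \<partial>lborel))) \<longlonglongrightarrow> norm c * (2 * measure lborel U - 2 * measure lborel U)"
      by (intro tendsto_intros) simp
    then show ?thesis unfolding e by simp
  qed
  have "(\<lambda>n. D (\<lambda>x. u (x + h n)) u) \<longlonglongrightarrow> 0"
    using assms(1)
  proof (induct rule: integrable_induct)
    case (base A c)
    then have [measurable]: "A \<in> sets borel" by simp
    have iA: "integrable lborel (\<lambda>x. indicator A x *\<^sub>R c)" using base by simp
    show ?case
    proof (rule approx[OF iA])
      fix e :: real assume "e > 0"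
      define e' where "e' = e / (norm c + 1)"
      have "e' > 0" using \<open>e > 0\<close> by (auto simp: e'_def intro!: divide_pos_pos add_nonneg_pos)
      then obtain U where U: "open U" "A \<subseteq> U" "emeasure lborel (U - A) < e'"
        using outer_regular_lborel[of A e'] by auto
      have [measurable]: "U \<in> sets borel" using U by auto
      have "emeasure lborel U = emeasure lborel A + emeasure lborel (U - A)"
        using U(2) by (subst plus_emeasure) (auto intro!: arg_cong[where f="emeasure lborel"])
      also have "\<dots> < \<infinity>" using U(3) base(2) by (auto simp: less_top[symmetric] ennreal_add_eq_top)
      finally have fin: "emeasure lborel U < \<infinity>" .
      have "D (\<lambda>x. indicator A x *\<^sub>R c) (\<lambda>x. indicator U x *\<^sub>R c) = (\<integral>x. norm c * indicator (U - A) x \<partial>lborel)"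
        unfolding D_def by (rule Bochner_Integration.integral_cong) (use U(2) in \<open>auto simp: indicator_def\<close>)
      also have "\<dots> = norm c * measure lborel (U - A)" by simp
      also have "\<dots> \<le> norm c * e'"
        using U(3) by (intro mult_left_mono) (auto simp: measure_def enn2real_leI less_imp_le \<open>e' > 0\<close>)
      also have "\<dots> < e" using \<open>e > 0\<close> by (simp add: e'_def divide_simps) (smt (verit) norm_ge_zero)
      finally show "\<exists>v. integrable lborel v \<and> D (\<lambda>x. indicator A x *\<^sub>R c) v < e \<and> (\<lambda>n. D (\<lambda>x. v (x + h n)) v) \<longlonglongrightarrow> 0"
        using opn[OF U(1) fin, of c] fin by (intro exI[of _ "\<lambda>x. indicator U x *\<^sub>R c"]) auto
    qed
  next
    case (add f g)
    show ?case
    proof (rule tendsto_sandwich[OF _ _ tendsto_const])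
      show "\<forall>\<^sub>F n in sequentially. 0 \<le> D (\<lambda>x. f (x + h n) + g (x + h n)) (\<lambda>x. f x + g x)" by (simp add: D_def)
      show "(\<lambda>n. D (\<lambda>x. f (x + h n)) f + D (\<lambda>x. g (x + h n)) g) \<longlonglongrightarrow> 0"
        using tendsto_add[OF add(2) add(4)] by simp
      show "\<forall>\<^sub>F n in sequentially. D (\<lambda>x. f (x + h n) + g (x + h n)) (\<lambda>x. f x + g x) \<le> D (\<lambda>x. f (x + h n)) f + D (\<lambda>x. g (x + h n)) g"
      proof (intro always_eventually allI)
        fix n
        have It: "integrable lborel (\<lambda>x. f (x + h n))" "integrable lborel (\<lambda>x. g (x + h n))"
          using add by (simp_all add: integrable_lborel_translate_iff)
        have "D (\<lambda>x. f (x + h n) + g (x + h n)) (\<lambda>x. f x + g x) \<le> (\<integral>x. norm (f (x + h n) - f x) + norm (g (x + h n) - g x) \<partial>lborel)"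
          unfolding D_def using It add
          by (intro integral_mono) (auto simp: add_diff_add intro: norm_triangle_ineq)
        also have "\<dots> = D (\<lambda>x. f (x + h n)) f + D (\<lambda>x. g (x + h n)) g" using It add by (simp add: D_def)
        finally show "D (\<lambda>x. f (x + h n) + g (x + h n)) (\<lambda>x. f x + g x) \<le> \<dots>" .
      qed
    qed
  next
    case (lim f s)
    show ?case
    proof (rule approx[OF lim(5)])
      fix e :: real assume "e > 0"
      have "(\<lambda>i. \<integral>x. norm (f x - s i x) \<partial>lborel) \<longlonglongrightarrow> (\<integral>x. (0::real) \<partial>(lborel :: 'a measure))"
      proof (rule integral_dominated_convergence[where w="\<lambda>x. 3 * norm (f x)"])
        show "AE x in lborel. (\<lambda>i. norm (f x - s i x)) \<longlonglongrightarrow> 0"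
          using lim(3) by (intro AE_I2) (auto intro!: tendsto_norm_zero LIM_zero simp: norm_minus_commute[of "f _"])
        show "AE x in lborel. norm (norm (f x - s i x)) \<le> 3 * norm (f x)" for i
        proof (rule AE_I2)
          fix x :: 'a
          show "norm (norm (f x - s i x)) \<le> 3 * norm (f x)"
            using lim(4)[of x i] norm_triangle_ineq4[of "f x" "s i x"] by simp
        qed
      qed (use lim in auto)
      then have "(\<lambda>i. D f (s i)) \<longlonglongrightarrow> 0" by (simp add: D_def)
      from order_tendstoD(2)[OF this \<open>e > 0\<close>] obtain i where "D f (s i) < e" by (auto simp: eventually_sequentially)
      then show "\<exists>v. integrable lborel v \<and> D f v < e \<and> (\<lambda>n. D (\<lambda>x. v (x + h n)) v) \<longlonglongrightarrow> 0"
        using lim(1,2) by blast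
    qed
  qed
  then show ?thesis by (simp add: D_def)
qed

text \<open>
  The map \<open>a \<mapsto> \<bar>a\<bar> a\<close> is strongly monotone: its difference quotient in the direction \<open>a - b\<close> is at least
  \<open>(\<bar>a\<bar> + \<bar>b\<bar>) / 2\<close>.
\<close>

lemma norm_scale_diff_lower:
  fixes a b :: "'a::real_inner"
  shows "(norm (a - b))\<^sup>2 \<le> 2 * norm (norm a *\<^sub>R a - norm b *\<^sub>R b)"
proof -
  define m where "m = norm a + norm b"
  have m0: "m \<ge> 0" by (simp add: m_def)
  have ab: "(norm (a - b))\<^sup>2 = (norm a)\<^sup>2 + (norm b)\<^sup>2 - 2 * (a \<bullet> b)"
    by (simp add: power2_norm_eq_inner inner_diff inner_commute)
  have "m * (norm (a - b))\<^sup>2 \<le> m * (2 * ((norm a)\<^sup>2 - norm a * norm b + (norm b)\<^sup>2 - a \<bullet> b))"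
    using sum_squares_bound[of "norm a" "norm b"] by (intro mult_left_mono m0) (simp add: ab)
  also have "\<dots> = 2 * ((norm a *\<^sub>R a - norm b *\<^sub>R b) \<bullet> (a - b))"
    by (simp add: m_def inner_diff inner_commute[of b a] dot_square_norm power2_eq_square algebra_simps)
  also have "\<dots> \<le> 2 * (norm (norm a *\<^sub>R a - norm b *\<^sub>R b) * norm (a - b))"
    by (intro mult_left_mono norm_cauchy_schwarz) auto
  finally have 1: "norm (a - b) * (m * norm (a - b)) \<le> norm (a - b) * (2 * norm (norm a *\<^sub>R a - norm b *\<^sub>R b))"
    by (simp add: power2_eq_square mult_ac)
  show ?thesis
  proof (cases "a = b")
    case False
    with 1 have 2: "m * norm (a - b) \<le> 2 * norm (norm a *\<^sub>R a - norm b *\<^sub>R b)" by simp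
    have "(norm (a - b))\<^sup>2 \<le> m * norm (a - b)"
      unfolding power2_eq_square m_def by (intro mult_right_mono norm_triangle_ineq4) auto
    with 2 show ?thesis by linarith
  qed simp
qed

text \<open>
  The function \<open>\<bar>u\<bar> u\<close> is integrable, and by \<open>norm_scale_diff_lower\<close> its \<open>L\<^sup>1\<close> modulus of continuity bounds the square
  of the \<open>L\<^sup>2\<close> modulus of continuity of \<open>u\<close>.
\<close>

lemma translation_continuous_L2:
  fixes u :: "'a::euclidean_space \<Rightarrow> 'b::euclidean_space"
  assumes u: "u \<in> L2 lborel" and h: "h \<longlonglongrightarrow> 0"
  shows "(\<lambda>n. \<integral>x. (norm (u (x + h n) - u x))\<^sup>2 \<partial>lborel) \<longlonglongrightarrow> 0"
proof -
  define g where "g x = norm (u x) *\<^sub>R u x" for x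
  have [measurable]: "u \<in> borel_measurable borel" using L2_borel[OF u] .
  have g: "integrable lborel g"
  proof -
    have "g \<in> borel_measurable lborel" unfolding g_def by measurable
    moreover have "integrable lborel (\<lambda>x. norm (g x))"
      using L2_integrable[OF u] by (simp add: g_def power2_eq_square)
    ultimately show ?thesis by (subst (asm) integrable_norm_iff) auto
  qed
  have "(\<lambda>n. 2 * (\<integral>x. norm (g (x + h n) - g x) \<partial>lborel)) \<longlonglongrightarrow> 2 * 0"
    by (intro tendsto_intros translation_continuous_L1 g h)
  then have l: "(\<lambda>n. 2 * (\<integral>x. norm (g (x + h n) - g x) \<partial>lborel)) \<longlonglongrightarrow> 0" by simp
  show ?thesis
  proof (rule tendsto_sandwich[OF _ _ tendsto_const l]; intro always_eventually allI)
    fix n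
    have ig: "integrable lborel (\<lambda>x. 2 * norm (g (x + h n) - g x))"
      using g by (simp add: integrable_lborel_translate_iff)
    have b: "(norm (u (x + h n) - u x))\<^sup>2 \<le> 2 * norm (g (x + h n) - g x)" for x
      unfolding g_def by (rule norm_scale_diff_lower)
    have "integrable lborel (\<lambda>x. (norm (u (x + h n) - u x))\<^sup>2)"
      by (rule Bochner_Integration.integrable_bound[OF ig]) (use b in \<open>auto intro: order_trans[OF b abs_ge_self]\<close>)
    then have "(\<integral>x. (norm (u (x + h n) - u x))\<^sup>2 \<partial>lborel) \<le> (\<integral>x. 2 * norm (g (x + h n) - g x) \<partial>lborel)"
      using ig b by (intro integral_mono) auto
    then show "(\<integral>x. (norm (u (x + h n) - u x))\<^sup>2 \<partial>lborel) \<le> 2 * (\<integral>x. norm (g (x + h n) - g x) \<partial>lborel)" by simp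
  qed auto
qed

lemma L2_translate:
  fixes u :: "'a::euclidean_space \<Rightarrow> 'b::{real_normed_vector,second_countable_topology}"
  assumes "u \<in> L2 lborel" shows "(\<lambda>x. u (x + h)) \<in> L2 lborel"
proof (rule L2_I)
  have [measurable]: "u \<in> borel_measurable borel" using L2_borel[OF assms] .
  show "(\<lambda>x. u (x + h)) \<in> borel_measurable lborel" by measurable
  show "integrable lborel (\<lambda>x. (norm (u (x + h)))\<^sup>2)"
    using L2_integrable[OF assms] integrable_lborel_translate_iff[of "\<lambda>x. (norm (u x))\<^sup>2"] by simp
qed

section \<open>Mollification along a subspace\<close>

text \<open>
  The map \<open>\<iota>\<close> embeds the variables that are averaged: the identity for a full convolution, \<open>y \<mapsto> (0, y)\<close> for a
  convolution in space at fixed time. One definition serves both, and the \<open>L\<^sup>2\<close> estimates hold for both.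
\<close>

definition moll :: "('z::euclidean_space \<Rightarrow> 'a) \<Rightarrow> ('z \<Rightarrow> real) \<Rightarrow> ('a::euclidean_space \<Rightarrow> 'b) \<Rightarrow> 'a \<Rightarrow> 'b::euclidean_space" where
  "moll \<iota> k u x = (\<integral>y. k y *\<^sub>R u (x - \<iota> y) \<partial>lborel)"

lemma moll_measurable[measurable]:
  assumes [measurable]: "\<iota> \<in> borel_measurable borel" "k \<in> borel_measurable borel" "u \<in> borel_measurable borel"
  shows "moll \<iota> k u \<in> borel_measurable borel"
proof -
  have "(\<lambda>x. \<integral>y. (\<lambda>(x, y). k y *\<^sub>R u (x - \<iota> y)) (x, y) \<partial>lborel) \<in> borel_measurable borel"
    by (intro lborel.borel_measurable_lebesgue_integral) measurable
  then show ?thesis by (simp add: moll_def[abs_def])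
qed

text \<open>
  Young's inequality is the case \<open>c = 0\<close>, and the error estimate for an approximate identity is the case
  \<open>c = 1\<close>. Both follow from Cauchy--Schwarz in \<open>y\<close> with respect to \<open>\<bar>k\<bar>\<close> and an exchange of the integrals.
\<close>

lemma moll_L2_estimate:
  fixes u :: "'a::euclidean_space \<Rightarrow> 'b::euclidean_space"
  assumes \<iota>[measurable]: "\<iota> \<in> borel_measurable borel" and k: "integrable lborel k" and u: "u \<in> L2 lborel"
    and B: "\<And>y. k y \<noteq> 0 \<Longrightarrow> (\<integral>x. (norm (u (x - \<iota> y) - c *\<^sub>R u x))\<^sup>2 \<partial>lborel) \<le> B"
  shows "(\<lambda>x. \<integral>y. k y *\<^sub>R (u (x - \<iota> y) - c *\<^sub>R u x) \<partial>lborel) \<in> L2 lborel"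
    and "(\<integral>x. (norm (\<integral>y. k y *\<^sub>R (u (x - \<iota> y) - c *\<^sub>R u x) \<partial>lborel))\<^sup>2 \<partial>lborel) \<le> (\<integral>y. \<bar>k y\<bar> \<partial>lborel)\<^sup>2 * B"
    and "AE x in lborel. integrable lborel (\<lambda>y. k y *\<^sub>R (u (x - \<iota> y) - c *\<^sub>R u x))"
proof -
  have [measurable]: "k \<in> borel_measurable borel" "u \<in> borel_measurable borel" using k L2_borel[OF u] by auto
  let ?p = "\<lambda>x y. u (x - \<iota> y) - c *\<^sub>R u x"
  have pL2: "(\<lambda>x. ?p x y) \<in> L2 lborel" for y
    using L2_minus[OF L2_translate[OF u, of "- \<iota> y"] L2_bound[OF u, of "\<lambda>x. c *\<^sub>R u x" "\<bar>c\<bar>"]] by simp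
  let ?Q = "\<lambda>(y, x). \<bar>k y\<bar> * (norm (?p x y))\<^sup>2"
  have m: "?Q \<in> borel_measurable borel" unfolding borel_prod[symmetric] by measurable
  have m2: "(\<lambda>y. \<integral>x. (\<lambda>(y, x). \<bar>k y\<bar> * (norm (?p x y))\<^sup>2) (y, x) \<partial>lborel) \<in> borel_measurable borel"
    by (intro lborel.borel_measurable_lebesgue_integral) measurable
  have le: "\<bar>k y\<bar> * (\<integral>x. (norm (?p x y))\<^sup>2 \<partial>lborel) \<le> \<bar>k y\<bar> * B" for y
    using B[of y] by (cases "k y = 0") (auto intro!: mult_left_mono)
  have ik: "integrable lborel (\<lambda>y. \<bar>k y\<bar> * B)" using k by auto
  have I2: "integrable lborel (\<lambda>y. \<bar>k y\<bar> * (\<integral>x. (norm (?p x y))\<^sup>2 \<partial>lborel))"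
    by (rule Bochner_Integration.integrable_bound[OF ik])
       (use m2 in \<open>auto intro!: AE_I2 order_trans[OF _ order_trans[OF le abs_ge_self]] simp del: mult_le_cancel_left\<close>)
  have I: "integrable lborel ?Q"
  proof (rule integrable_lborel_prodI[OF m])
    show "integrable lborel (\<lambda>y. \<integral>x. norm (?Q (y, x)) \<partial>lborel)" using I2 by (simp add: abs_mult)
    show "AE y in lborel. integrable lborel (\<lambda>x. ?Q (y, x))"
      using L2_integrable[OF pL2] by auto
  qed
  have Is: "integrable lborel (\<lambda>(x, y). \<bar>k y\<bar> * (norm (?p x y))\<^sup>2)"
    using integrable_lborel_swap[OF I] by simp
  note AI = AE_integrable_section[OF Is]
  have AE1: "AE x in lborel. integrable lborel (\<lambda>y. k y *\<^sub>R ?p x y) \<and> (norm (\<integral>y. k y *\<^sub>R ?p x y \<partial>lborel))\<^sup>2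
     \<le> (\<integral>y. \<bar>k y\<bar> \<partial>lborel) * (\<integral>y. \<bar>k y\<bar> * (norm (?p x y))\<^sup>2 \<partial>lborel)"
    using AI
  proof eventually_elim
    case (elim x)
    have "(\<lambda>y. ?p x y) \<in> borel_measurable lborel" by measurable
    from weighted_Cauchy_Schwarz[OF k this] elim show ?case by auto
  qed
  then show "AE x in lborel. integrable lborel (\<lambda>y. k y *\<^sub>R ?p x y)" by auto
  have mm: "(\<lambda>x. \<integral>y. (\<lambda>(x, y). k y *\<^sub>R ?p x y) (x, y) \<partial>lborel) \<in> borel_measurable borel"
    by (intro lborel.borel_measurable_lebesgue_integral) measurable
  note IS = integrable_section_integral[OF Is]
  have J: "integrable lborel (\<lambda>x. (norm (\<integral>y. k y *\<^sub>R ?p x y \<partial>lborel))\<^sup>2)"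
    by (rule Bochner_Integration.integrable_bound[OF integrable_mult_right[OF IS, of "\<integral>y. \<bar>k y\<bar> \<partial>lborel"]])
      (use mm AE1 in \<open>auto simp: elim!: AE_mp intro!: AE_I2 order_trans[OF _ abs_ge_self]\<close>)
  then show "(\<lambda>x. \<integral>y. k y *\<^sub>R ?p x y \<partial>lborel) \<in> L2 lborel"
    using mm by (intro L2_I) auto
  have "(\<integral>x. (norm (\<integral>y. k y *\<^sub>R ?p x y \<partial>lborel))\<^sup>2 \<partial>lborel) \<le> (\<integral>x. (\<integral>y. \<bar>k y\<bar> \<partial>lborel) * (\<integral>y. \<bar>k y\<bar> * (norm (?p x y))\<^sup>2 \<partial>lborel) \<partial>lborel)"
    using J IS AE1 by (intro integral_mono_AE) auto
  also have "\<dots> = (\<integral>y. \<bar>k y\<bar> \<partial>lborel) * (\<integral>y. \<bar>k y\<bar> * (\<integral>x. (norm (?p x y))\<^sup>2 \<partial>lborel) \<partial>lborel)"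
    using integral_lborel_swap[OF Is] by simp
  also have "\<dots> \<le> (\<integral>y. \<bar>k y\<bar> \<partial>lborel) * (\<integral>y. \<bar>k y\<bar> * B \<partial>lborel)"
    by (rule mult_left_mono, rule integral_mono[OF I2 ik]) (use le in auto)
  finally show "(\<integral>x. (norm (\<integral>y. k y *\<^sub>R ?p x y \<partial>lborel))\<^sup>2 \<partial>lborel) \<le> (\<integral>y. \<bar>k y\<bar> \<partial>lborel)\<^sup>2 * B"
    by (simp add: power2_eq_square mult.assoc)
qed

lemma moll_L2:
  fixes u :: "'a::euclidean_space \<Rightarrow> 'b::euclidean_space"
  assumes \<iota>: "\<iota> \<in> borel_measurable borel" and k: "integrable lborel k" and u: "u \<in> L2 lborel"
  shows "moll \<iota> k u \<in> L2 lborel" 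
proof -
  have "(\<integral>x. (norm (u (x - \<iota> y)))\<^sup>2 \<partial>lborel) = (\<integral>x. (norm (u x))\<^sup>2 \<partial>lborel)" for y
    using integral_lborel_translate[of "\<lambda>x. (norm (u x))\<^sup>2" "- \<iota> y"] by simp
  then show ?thesis
    using moll_L2_estimate(1)[OF \<iota> k u, where c=0 and B="\<integral>x. (norm (u x))\<^sup>2 \<partial>lborel"] by (simp add: moll_def[abs_def])
qed

lemma moll_tendsto_L2:
  fixes u :: "'a::euclidean_space \<Rightarrow> 'b::euclidean_space"
  assumes \<iota>: "bounded_linear \<iota>" and u: "u \<in> L2 lborel"
    and k: "\<And>n::nat. integrable lborel (k n)" "\<And>n y. 0 \<le> k n y" "\<And>n. (\<integral>y. k n y \<partial>lborel) = 1"
    and supp: "\<And>n y. norm y \<ge> \<epsilon> n \<Longrightarrow> k n y = 0" and \<epsilon>: "\<epsilon> \<longlonglongrightarrow> 0"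
  shows "(\<lambda>n. \<integral>x. (norm (moll \<iota> (k n) u x - u x))\<^sup>2 \<partial>lborel) \<longlonglongrightarrow> 0"
proof (rule LIMSEQ_I)
  interpret \<iota>: bounded_linear \<iota> by fact
  have m: "\<iota> \<in> borel_measurable borel" by (intro borel_measurable_continuous_onI linear_continuous_on \<iota>)
  fix e :: real assume "e > 0"
  define \<omega> where "\<omega> h = (\<integral>x. (norm (u (x + h) - u x))\<^sup>2 \<partial>lborel)" for h
  have "(\<omega> \<longlongrightarrow> \<omega> 0) (at 0)"
    using translation_continuous_L2[OF u]
    unfolding tendsto_at_iff_sequentially by (auto simp: \<omega>_def comp_def)
  from order_tendstoD(2)[OF this, of "e / 2"] have "\<forall>\<^sub>F h in at 0. \<omega> h < e / 2" using \<open>e > 0\<close> by (simp add: \<omega>_def)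
  then obtain d where d: "d > 0" "\<And>h. h \<noteq> 0 \<Longrightarrow> norm h < d \<Longrightarrow> \<omega> h < e / 2"
    by (auto simp: eventually_at dist_norm)
  have d': "norm h < d \<Longrightarrow> \<omega> h < e / 2" for h
    using d(2)[of h] \<open>e > 0\<close> by (cases "h = 0") (auto simp: \<omega>_def)
  obtain K where K: "K > 0" "\<And>y. norm (\<iota> y) \<le> norm y * K" using \<iota>.pos_bounded by auto
  obtain N where N: "\<And>n. n \<ge> N \<Longrightarrow> norm (\<epsilon> n) < d / K"
    using LIMSEQ_D[OF \<epsilon>, of "d / K"] d(1) K(1) by auto
  have "norm ((\<integral>x. (norm (moll \<iota> (k n) u x - u x))\<^sup>2 \<partial>lborel) - 0) < e" if "n \<ge> N" for n
  proof -
    have B: "(\<integral>x. (norm (u (x - \<iota> y) - 1 *\<^sub>R u x))\<^sup>2 \<partial>lborel) \<le> e / 2" if "k n y \<noteq> 0" for y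
    proof -
      have "norm y < \<epsilon> n" using supp[of n y] that by (meson not_le)
      then have "norm y < d / K" using N[OF \<open>n \<ge> N\<close>] by simp
      then have "norm y * K < d" using K(1) by (simp add: pos_less_divide_eq)
      then have "norm (- \<iota> y) < d" using K(2)[of y] by simp
      from d'[OF this] show ?thesis by (simp add: \<omega>_def)
    qed
    have ab: "(\<integral>y. \<bar>k n y\<bar> \<partial>lborel) = 1" using k(2,3)[of n] by simp
    have E: "(\<lambda>x. \<integral>y. k n y *\<^sub>R (u (x - \<iota> y) - 1 *\<^sub>R u x) \<partial>lborel) \<in> L2 lborel"
      "(\<integral>x. (norm (\<integral>y. k n y *\<^sub>R (u (x - \<iota> y) - 1 *\<^sub>R u x) \<partial>lborel))\<^sup>2 \<partial>lborel) \<le> (\<integral>y. \<bar>k n y\<bar> \<partial>lborel)\<^sup>2 * (e / 2)"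
      "AE x in lborel. integrable lborel (\<lambda>y. k n y *\<^sub>R (u (x - \<iota> y) - 1 *\<^sub>R u x))"
      by (rule moll_L2_estimate[OF m k(1)[of n] u B], assumption)+
    have eq: "AE x in lborel. (\<integral>y. k n y *\<^sub>R (u (x - \<iota> y) - 1 *\<^sub>R u x) \<partial>lborel) = moll \<iota> (k n) u x - u x"
      using E(3)
    proof eventually_elim
      case (elim x)
      have 1: "integrable lborel (\<lambda>y. k n y *\<^sub>R u x)" using k(1)[of n] by simp
      have "integrable lborel (\<lambda>y. k n y *\<^sub>R u (x - \<iota> y))"
        using Bochner_Integration.integrable_add[OF elim 1] by (simp add: scaleR_diff_right)
      moreover have "(\<integral>y. k n y *\<^sub>R u x \<partial>lborel) = u x"
        using k(1)[of n] k(3)[of n] by (subst integral_scaleR_left) auto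
      ultimately show ?case using 1 by (simp add: scaleR_diff_right moll_def)
    qed
    have [measurable]: "u \<in> borel_measurable borel" "k n \<in> borel_measurable borel" using L2_borel[OF u] k(1)[of n] by auto
    have mm: "moll \<iota> (k n) u \<in> borel_measurable borel" using m by measurable
    have "(\<integral>x. (norm (moll \<iota> (k n) u x - u x))\<^sup>2 \<partial>lborel) = (\<integral>x. (norm (\<integral>y. k n y *\<^sub>R (u (x - \<iota> y) - 1 *\<^sub>R u x) \<partial>lborel))\<^sup>2 \<partial>lborel)"
      using eq mm L2_measurable[OF E(1)] by (intro integral_cong_AE) auto
    also have "\<dots> \<le> e / 2" using E(2) by (simp add: ab)
    finally show ?thesis using \<open>e > 0\<close> by simp
  qed
  then show "\<exists>N. \<forall>n\<ge>N. norm ((\<integral>x. (norm (moll \<iota> (k n) u x - u x))\<^sup>2 \<partial>lborel) - 0) < e" by blast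
qed

section \<open>Convolution with compactly supported kernels\<close>

definition locally_integrable :: "('a::euclidean_space \<Rightarrow> 'b::euclidean_space) \<Rightarrow> bool" where
  "locally_integrable u \<longleftrightarrow> u \<in> borel_measurable borel \<and> (\<forall>R. integrable lborel (\<lambda>y. indicator (cball 0 R) y *\<^sub>R u y))"

text \<open>
  Continuity and compact support suffice for pairing with locally integrable functions; derivatives are always
  given explicitly through \<open>line_deriv\<close>.
\<close>

definition kernel :: "('a::euclidean_space \<Rightarrow> real) \<Rightarrow> bool" where
  "kernel k \<longleftrightarrow> continuous_on UNIV k \<and> (\<exists>R. \<forall>z. norm z \<ge> R \<longrightarrow> k z = 0)"

definition conv :: "('a::euclidean_space \<Rightarrow> real) \<Rightarrow> ('a \<Rightarrow> 'b::euclidean_space) \<Rightarrow> 'a \<Rightarrow> 'b" where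
  "conv k u z = (\<integral>y. k (z - y) *\<^sub>R u y \<partial>lborel)"

text \<open>
  Differentiability along one direction only. In the moving frame the velocity derivatives are
  derivatives along oblique directions, and no others are available for the functions considered.
\<close>

definition line_deriv :: "'a::real_vector \<Rightarrow> ('a \<Rightarrow> 'b::real_normed_vector) \<Rightarrow> ('a \<Rightarrow> 'b) \<Rightarrow> bool" where
  "line_deriv b f f' \<longleftrightarrow> (\<forall>z. ((\<lambda>\<sigma>. f (z + \<sigma> *\<^sub>R b)) has_vector_derivative f' z) (at 0))"

lemma integrable_cball_indicator:
  "integrable lborel (\<lambda>y. indicator (cball (0::'a::euclidean_space) R) y :: real)"
  using emeasure_lborel_cball_finite[of "0::'a" R] by (intro integrable_real_indicator) (auto simp: less_top)

lemma L2_locally_integrable: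
  fixes u :: "'a::euclidean_space \<Rightarrow> 'b::euclidean_space"
  assumes "u \<in> L2 lborel" shows "locally_integrable u"
  unfolding locally_integrable_def
proof (intro conjI allI)
  show [measurable]: "u \<in> borel_measurable borel" using assms by (rule L2_borel)
  fix R
  have le: "a \<le> 1 + a\<^sup>2" for a :: real
    using zero_le_power2[of "a - 1 / 2"] by (simp add: power2_eq_square algebra_simps)
  show "integrable lborel (\<lambda>y. indicator (cball 0 R) y *\<^sub>R u y)"
    by (rule Bochner_Integration.integrable_bound[OF Bochner_Integration.integrable_add[OF integrable_cball_indicator[of R] L2_integrable[OF assms]]])
       (auto simp: indicator_def intro!: AE_I2 le)
qed

lemma continuous_compact_support_integrable:
  fixes f :: "'a::euclidean_space \<Rightarrow> 'b::euclidean_space"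
  assumes "continuous_on UNIV f" "\<And>z. norm z \<ge> R \<Longrightarrow> f z = 0"
  shows "integrable lborel f"
proof -
  have "integrable lborel (\<lambda>x. indicator (cball 0 R) x *\<^sub>R f x)"
    by (intro borel_integrable_compact[OF compact_cball] continuous_on_subset[OF assms(1)]) auto
  moreover have "(\<lambda>x. indicator (cball 0 R) x *\<^sub>R f x) = f"
    using assms(2) by (auto simp: indicator_def fun_eq_iff not_le intro: less_imp_le)
  ultimately show ?thesis by simp
qed

lemma continuous_locally_integrable:
  fixes u :: "'a::euclidean_space \<Rightarrow> 'b::euclidean_space"
  assumes "continuous_on UNIV u" shows "locally_integrable u"
  unfolding locally_integrable_def
  using assms by (auto intro!: borel_integrable_compact borel_measurable_continuous_onI continuous_on_subset[OF assms])

lemma kernel_measurable[measurable_dest]: "kernel k \<Longrightarrow> k \<in> borel_measurable borel"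
  by (auto simp: kernel_def intro: borel_measurable_continuous_onI)

lemma kernel_continuous: "kernel k \<Longrightarrow> continuous_on UNIV k"
  by (simp add: kernel_def)

lemma kernel_bounds:
  assumes "kernel k"
  obtains R B where "\<And>z. norm z \<ge> R \<Longrightarrow> k z = 0" "\<And>z. \<bar>k z\<bar> \<le> B" "B \<ge> 0" "R \<ge> 0"
proof -
  obtain R where R: "\<And>z. norm z \<ge> R \<Longrightarrow> k z = 0" using assms by (auto simp: kernel_def)
  have "compact (k ` cball 0 R)"
    by (intro compact_continuous_image continuous_on_subset[OF kernel_continuous[OF assms]]) auto
  then have "bounded (k ` cball 0 R)" by (rule compact_imp_bounded)
  then obtain B where "\<forall>x\<in>cball 0 R. \<bar>k x\<bar> \<le> B" by (auto simp: bounded_iff)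
  then have B: "\<And>z. norm z \<le> R \<Longrightarrow> \<bar>k z\<bar> \<le> B" by simp
  have "\<bar>k z\<bar> \<le> max B 0" for z using R[of z] B[of z] by (cases "norm z \<le> R") auto
  then show ?thesis using R by (intro that[of "max R 0" "max B 0"]) auto
qed

lemma kernel_integrable: "kernel k \<Longrightarrow> integrable lborel k"
  by (metis continuous_compact_support_integrable kernel_def)

lemma conv_integrand_bound:
  assumes "\<And>z. norm z \<ge> R \<Longrightarrow> k z = 0" "\<And>z. \<bar>k z\<bar> \<le> B" "norm z \<le> C"
  shows "norm (k (z - y) *\<^sub>R u y) \<le> B * norm (indicator (cball 0 (R + C)) y *\<^sub>R u y)"
proof (cases "norm y \<le> R + C")
  case True
  then show ?thesis using assms(2)[of "z - y"] by (auto intro!: mult_right_mono)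
next
  case False
  then have "norm (z - y) \<ge> R" using norm_triangle_ineq2[of y z] assms(3) by (simp add: norm_minus_commute)
  then show ?thesis using assms(1) False by (simp add: indicator_def)
qed

lemma conv_integrable:
  fixes u :: "'a::euclidean_space \<Rightarrow> 'b::euclidean_space"
  assumes k: "kernel k" and u: "locally_integrable u"
  shows "integrable lborel (\<lambda>y. k (z - y) *\<^sub>R u y)"
proof -
  obtain R B where RB: "\<And>z. norm z \<ge> R \<Longrightarrow> k z = 0" "\<And>z. \<bar>k z\<bar> \<le> B" "B \<ge> 0" "R \<ge> 0"
    by (rule kernel_bounds[OF k], rule that)
  have [measurable]: "k \<in> borel_measurable borel" "u \<in> borel_measurable borel"
    using k u by (auto simp: locally_integrable_def)
  have i: "integrable lborel (\<lambda>y. B * norm (indicator (cball 0 (R + norm z)) y *\<^sub>R u y))"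
    using u by (intro integrable_mult_right integrable_norm) (auto simp: locally_integrable_def)
  show ?thesis
    by (rule Bochner_Integration.integrable_bound[OF i])
       (auto intro!: AE_I2 order_trans[OF conv_integrand_bound[of R k B z "norm z", OF RB(1,2)] abs_ge_self] simp del: norm_scaleR)
qed

lemma conv_eq_moll:
  "conv k u z = moll (\<lambda>y. y) k u z"
  using integral_lborel_reflect[of "\<lambda>y. k (z - y) *\<^sub>R u y" z]
  by (simp add: conv_def moll_def)

lemma conv_section_eq_moll:
  fixes U :: "'p::euclidean_space \<times> 'a::euclidean_space \<Rightarrow> 'b::euclidean_space"
  shows "conv k (\<lambda>y. U (r, y)) z = moll (\<lambda>y. (0, y)) k U (r, z)"
  using integral_lborel_reflect[of "\<lambda>y. k (z - y) *\<^sub>R U (r, y)" z]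
  by (simp add: conv_def moll_def)

text \<open>
  Uniform bounds on the kernels and their supports give a dominating function on a fixed ball. Continuity and
  differentiability of convolutions are both instances.
\<close>

lemma conv_tendsto:
  fixes u :: "'a::euclidean_space \<Rightarrow> 'b::euclidean_space" and z :: "nat \<Rightarrow> 'a"
  assumes u: "locally_integrable u" and m: "\<And>n. k n \<in> borel_measurable borel"
    and R: "\<And>n z. norm z \<ge> R \<Longrightarrow> k n z = 0" and B: "\<And>n z. \<bar>k n z\<bar> \<le> B"
    and z: "bounded (range z)" and lim: "\<And>y. (\<lambda>n. k n (z n - y)) \<longlonglongrightarrow> l (z0 - y)"
    and ml: "l \<in> borel_measurable borel"
  shows "(\<lambda>n. conv (k n) u (z n)) \<longlonglongrightarrow> conv l u z0"
proof -
  obtain C where C: "\<And>n. norm (z n) \<le> C" using z by (auto simp: bounded_iff)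
  have [measurable]: "u \<in> borel_measurable borel" "k n \<in> borel_measurable borel" "l \<in> borel_measurable borel" for n
    using u m ml by (auto simp: locally_integrable_def)
  have i: "integrable lborel (\<lambda>y. B * norm (indicator (cball 0 (R + C)) y *\<^sub>R u y))"
    using u by (intro integrable_mult_right integrable_norm) (auto simp: locally_integrable_def)
  show ?thesis unfolding conv_def
  proof (rule integral_dominated_convergence[OF _ _ i])
    show "AE y in lborel. (\<lambda>n. k n (z n - y) *\<^sub>R u y) \<longlonglongrightarrow> l (z0 - y) *\<^sub>R u y"
      by (intro AE_I2 tendsto_intros lim)
    show "AE y in lborel. norm (k n (z n - y) *\<^sub>R u y) \<le> B * norm (indicator (cball 0 (R + C)) y *\<^sub>R u y)" for n
      by (intro AE_I2 conv_integrand_bound[of R "k n" B "z n" C]) (use R B C in auto)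
  qed measurable
qed

lemma conv_continuous:
  fixes u :: "'a::euclidean_space \<Rightarrow> 'b::euclidean_space"
  assumes k: "kernel k" and u: "locally_integrable u"
  shows "continuous_on UNIV (conv k u)"
  unfolding continuous_on_sequentially
proof (intro ballI allI impI, elim conjE)
  fix z :: "nat \<Rightarrow> 'a" and a assume z: "z \<longlonglongrightarrow> a"
  obtain R B where RB: "\<And>z. norm z \<ge> R \<Longrightarrow> k z = 0" "\<And>z. \<bar>k z\<bar> \<le> B" "B \<ge> 0" "R \<ge> 0"
    by (rule kernel_bounds[OF k], rule that)
  have "isCont k x" for x using kernel_continuous[OF k] by (simp add: continuous_on_eq_continuous_at)
  then have "(\<lambda>n. k (z n - y)) \<longlonglongrightarrow> k (a - y)" for y
    by (rule isCont_tendsto_compose) (intro tendsto_intros z)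
  then show "(conv k u \<circ> z) \<longlonglongrightarrow> conv k u a"
    unfolding comp_def using kernel_measurable[OF k] RB
    by (intro conv_tendsto[OF u, where k="\<lambda>_. k" and R=R and B=B] convergent_imp_bounded[OF z]) (simp_all add: RB)
qed

lemma line_deriv_shift:
  assumes "line_deriv b f f'"
  shows "((\<lambda>\<sigma>. f (z + \<sigma> *\<^sub>R b)) has_vector_derivative f' (z + s *\<^sub>R b)) (at s)"
proof -
  have "((\<lambda>\<sigma>. f ((z + s *\<^sub>R b) + \<sigma> *\<^sub>R b)) has_vector_derivative f' (z + s *\<^sub>R b)) (at (s - s))"
    using assms by (simp add: line_deriv_def)
  then have "((\<lambda>\<sigma>. f ((z + s *\<^sub>R b) + (\<sigma> - s) *\<^sub>R b)) has_vector_derivative f' (z + s *\<^sub>R b)) (at s)"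
    using vector_diff_chain_at[of "\<lambda>\<sigma>. \<sigma> - s" 1 s "\<lambda>\<sigma>. f ((z + s *\<^sub>R b) + \<sigma> *\<^sub>R b)" "f' (z + s *\<^sub>R b)"]
    by (simp add: comp_def has_vector_derivative_diff_const)
  then show ?thesis by (simp add: algebra_simps)
qed

lemma line_deriv_difference_bound:
  fixes f :: "'a::real_vector \<Rightarrow> real"
  assumes "line_deriv b f f'" "\<And>z. \<bar>f' z\<bar> \<le> B"
  shows "\<bar>f (z + \<sigma> *\<^sub>R b) - f z\<bar> \<le> B * \<bar>\<sigma>\<bar>"
  using field_differentiable_bound[of UNIV "\<lambda>\<sigma>. f (z + \<sigma> *\<^sub>R b)" "\<lambda>\<sigma>. f' (z + \<sigma> *\<^sub>R b)" B \<sigma> 0]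
    line_deriv_shift[OF assms(1)] assms(2)
  by (simp add: has_real_derivative_iff_has_vector_derivative)

text \<open>
  The difference quotients of the kernel are bounded, by the mean value theorem, and have a common
  compact support.
\<close>

lemma conv_line_deriv:
  fixes u :: "'a::euclidean_space \<Rightarrow> 'b::euclidean_space"
  assumes k: "kernel k" "kernel k'" "line_deriv b k k'" and u: "locally_integrable u"
  shows "line_deriv b (conv k u) (conv k' u)"
  unfolding line_deriv_def
proof
  fix z
  obtain R B0 where RB: "\<And>z. norm z \<ge> R \<Longrightarrow> k z = 0" "\<And>z. \<bar>k z\<bar> \<le> B0" "B0 \<ge> 0" "R \<ge> 0"
    by (rule kernel_bounds[OF k(1)], rule that)
  obtain R' B where RB': "\<And>z. norm z \<ge> R' \<Longrightarrow> k' z = 0" "\<And>z. \<bar>k' z\<bar> \<le> B" "B \<ge> 0" "R' \<ge> 0"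
    by (rule kernel_bounds[OF k(2)], rule that)
  have [measurable]: "k \<in> borel_measurable borel" "k' \<in> borel_measurable borel" using k by auto
  have D: "((\<lambda>\<sigma>. (conv k u (z + \<sigma> *\<^sub>R b) - conv k u z) /\<^sub>R \<sigma>) \<longlongrightarrow> conv k' u z) (at 0)"
    unfolding tendsto_at_iff_sequentially
  proof (intro allI impI)
    fix X :: "nat \<Rightarrow> real" assume X0: "\<forall>i. X i \<in> UNIV - {0}" and X: "X \<longlonglongrightarrow> 0"
    obtain K where K: "\<And>n. \<bar>X n\<bar> \<le> K" using convergent_imp_bounded[OF X] by (auto simp: bounded_iff)
    define q where "q n x = (k (x + X n *\<^sub>R b) - k x) / X n" for n x
    have qb: "\<bar>q n x\<bar> \<le> B" for n x
      using line_deriv_difference_bound[OF k(3) RB'(2), of x "X n"] X0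
      by (auto simp: q_def abs_divide intro!: mult_imp_div_pos_le)
    have qs: "q n x = 0" if "norm x \<ge> R + K * norm b" for n x
    proof -
      have "norm (X n *\<^sub>R b) \<le> K * norm b" using K[of n] by (auto intro: mult_right_mono)
      then have "norm (x + X n *\<^sub>R b) \<ge> R" using norm_diff_ineq[of x "X n *\<^sub>R b"] that by linarith
      moreover have "norm x \<ge> R" using that K[of n] by (smt (verit) mult_nonneg_nonneg norm_ge_zero)
      ultimately show ?thesis by (simp add: q_def RB)
    qed
    have eq: "(conv k u (z + X n *\<^sub>R b) - conv k u z) /\<^sub>R X n = conv (q n) u z" for n
    proof -
      have "conv (q n) u z = (\<integral>y. (k (z + X n *\<^sub>R b - y) *\<^sub>R u y - k (z - y) *\<^sub>R u y) /\<^sub>R X n \<partial>lborel)"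
        unfolding conv_def q_def
        by (intro Bochner_Integration.integral_cong) (auto simp: divide_inverse_commute scaleR_diff_left scaleR_diff_right algebra_simps)
      also have "\<dots> = (conv k u (z + X n *\<^sub>R b) - conv k u z) /\<^sub>R X n"
        using conv_integrable[OF k(1) u] by (simp add: conv_def)
      finally show ?thesis by simp
    qed
    have "(\<lambda>n. q n x) \<longlonglongrightarrow> k' x" for x
    proof -
      have "((\<lambda>\<sigma>. k (x + \<sigma> *\<^sub>R b)) has_real_derivative k' x) (at 0)"
        using k(3) by (simp add: line_deriv_def has_real_derivative_iff_has_vector_derivative)
      then have "((\<lambda>\<sigma>. (k (x + \<sigma> *\<^sub>R b) - k x) / \<sigma>) \<longlongrightarrow> k' x) (at 0)" by (simp add: DERIV_def)
      then show ?thesis using X0 X unfolding tendsto_at_iff_sequentially q_def comp_def by simp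
    qed
    then have "(\<lambda>n. conv (q n) u z) \<longlonglongrightarrow> conv k' u z"
      by (intro conv_tendsto[OF u _ qs qb]) (auto simp: q_def)
    then show "((\<lambda>\<sigma>. (conv k u (z + \<sigma> *\<^sub>R b) - conv k u z) /\<^sub>R \<sigma>) \<circ> X) \<longlonglongrightarrow> conv k' u z"
      by (simp add: comp_def eq)
  qed
  have T0: "((\<lambda>\<sigma>. norm ((conv k u (z + \<sigma> *\<^sub>R b) - conv k u z) /\<^sub>R \<sigma> - conv k' u z)) \<longlongrightarrow> 0) (at 0)"
    using D by (intro tendsto_norm_zero LIM_zero)
  have nq: "norm ((conv k u (z + \<sigma> *\<^sub>R b) - conv k u z) /\<^sub>R \<sigma> - conv k' u z)
      = norm (conv k u (z + \<sigma> *\<^sub>R b) - conv k u z - \<sigma> *\<^sub>R conv k' u z) / \<bar>\<sigma>\<bar>" if "\<sigma> \<noteq> 0" for \<sigma>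
  proof -
    have "conv k u (z + \<sigma> *\<^sub>R b) - conv k u z - \<sigma> *\<^sub>R conv k' u z = \<sigma> *\<^sub>R ((conv k u (z + \<sigma> *\<^sub>R b) - conv k u z) /\<^sub>R \<sigma> - conv k' u z)"
      using that by (simp add: scaleR_diff_right)
    then show ?thesis using that by simp
  qed
  have "((\<lambda>\<sigma>. norm (conv k u (z + \<sigma> *\<^sub>R b) - conv k u z - \<sigma> *\<^sub>R conv k' u z) / \<bar>\<sigma>\<bar>) \<longlongrightarrow> 0) (at 0)"
    by (rule Lim_transform_eventually[OF T0]) (simp add: eventually_at_filter nq)
  then show "((\<lambda>\<sigma>. conv k u (z + \<sigma> *\<^sub>R b)) has_vector_derivative conv k' u z) (at 0)"
    unfolding has_vector_derivative_def has_derivative_iff_norm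
    by (auto simp: bounded_linear_scaleR_left)
qed

lemma line_deriv_mult:
  fixes f g :: "'a::real_vector \<Rightarrow> 'b::real_normed_algebra"
  assumes "line_deriv b f f'" "line_deriv b g g'"
  shows "line_deriv b (\<lambda>z. f z * g z) (\<lambda>z. f z * g' z + f' z * g z)"
  unfolding line_deriv_def
proof
  fix z
  show "((\<lambda>\<sigma>. f (z + \<sigma> *\<^sub>R b) * g (z + \<sigma> *\<^sub>R b)) has_vector_derivative f z * g' z + f' z * g z) (at 0)"
    using has_vector_derivative_mult[of "\<lambda>\<sigma>. f (z + \<sigma> *\<^sub>R b)" "f' z" 0 UNIV "\<lambda>\<sigma>. g (z + \<sigma> *\<^sub>R b)" "g' z"] assms
    by (simp add: line_deriv_def)
qed

lemma line_deriv_bounded_linear: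
  assumes "bounded_linear T" "line_deriv b f f'"
  shows "line_deriv b (\<lambda>z. T (f z)) (\<lambda>z. T (f' z))"
  using assms bounded_linear.has_vector_derivative[OF assms(1)] by (auto simp: line_deriv_def)

text \<open>
  The integral of \<open>f'\<close> over all translates by \<open>\<sigma> b\<close>, \<open>0 \<le> \<sigma> \<le> 1\<close>, is the integral of \<open>f (z + b) - f z\<close>.
\<close>

lemma integral_line_deriv_eq_0:
  fixes f f' :: "'a::euclidean_space \<Rightarrow> 'b::euclidean_space"
  assumes d: "line_deriv b f f'" and c: "continuous_on UNIV f'"
    and i: "integrable lborel f" "integrable lborel f'"
  shows "(\<integral>z. f' z \<partial>lborel) = 0"
proof -
  have [measurable]: "f' \<in> borel_measurable borel" using i(2) by auto
  let ?Q = "\<lambda>(s::real, z). indicator {0..1} s *\<^sub>R f' (z + s *\<^sub>R b)"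
  have m: "?Q \<in> borel_measurable borel" unfolding borel_prod[symmetric] by measurable
  have e: "(\<integral>z. norm (f' (z + s *\<^sub>R b)) \<partial>lborel) = (\<integral>z. norm (f' z) \<partial>lborel)" for s
    using integral_lborel_translate[of "\<lambda>z. norm (f' z)"] by simp
  have i01: "integrable lborel (indicator {0..1::real} :: real \<Rightarrow> real)"
    by (intro integrable_real_indicator) auto
  have I: "integrable lborel ?Q"
  proof (rule integrable_lborel_prodI[OF m])
    show "integrable lborel (\<lambda>s. \<integral>z. norm (?Q (s, z)) \<partial>lborel)"
      using i01 by (simp add: e)
    show "AE s in lborel. integrable lborel (\<lambda>z. ?Q (s, z))"
      using i(2) by (auto simp: integrable_lborel_translate_iff)
  qed
  have "(\<integral>z. f' z \<partial>lborel) = (\<integral>s. indicator {0..1::real} s *\<^sub>R (\<integral>z. f' z \<partial>lborel) \<partial>lborel)"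
    using i01 by (subst integral_scaleR_left) auto
  also have "\<dots> = (\<integral>s. \<integral>z. ?Q (s, z) \<partial>lborel \<partial>lborel)"
    by (simp add: integral_lborel_translate)
  also have "\<dots> = (\<integral>z. \<integral>s. ?Q (s, z) \<partial>lborel \<partial>lborel)"
    by (rule integral_lborel_swap[OF I])
  also have "\<dots> = (\<integral>z. f (z + b) - f z \<partial>lborel)"
  proof (rule Bochner_Integration.integral_cong[OF refl])
    fix z
    have "(\<integral>s. indicator {0..1} s *\<^sub>R f' (z + s *\<^sub>R b) \<partial>lborel) = f (z + 1 *\<^sub>R b) - f (z + 0 *\<^sub>R b)"
      by (intro integral_FTC_Icc has_vector_derivative_at_within[OF line_deriv_shift[OF d]]
           continuous_on_compose2[OF c]) (auto intro!: continuous_intros)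
    then show "(\<integral>s. ?Q (s, z) \<partial>lborel) = f (z + b) - f z" by simp
  qed
  also have "\<dots> = 0" using i(1) by (simp add: integrable_lborel_translate_iff integral_lborel_translate)
  finally show ?thesis .
qed

lemma conv_vec_nth:
  fixes u :: "'a::euclidean_space \<Rightarrow> complex ^ 'n"
  assumes "kernel k" "locally_integrable u"
  shows "conv k u z $ i = conv k (\<lambda>y. u y $ i) z"
  using integral_bounded_linear[OF bounded_linear_vec_nth conv_integrable[OF assms, of z], of i]
  by (simp add: conv_def)

section \<open>A flat function and smooth cut-offs\<close>

text \<open>
  The \<open>n\<close>-th derivative of \<open>exp (- 1 / x)\<close> is \<open>flat_poly n (1 / x) exp (- 1 / x)\<close>.
\<close>

primrec flat_poly :: "nat \<Rightarrow> real poly" where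
  "flat_poly 0 = 1"
| "flat_poly (Suc n) = [:0, 0, 1:] * (flat_poly n - pderiv (flat_poly n))"

text \<open>
  The \<open>n\<close>-th derivative of the function \<open>exp (- 1 / x)\<close>, extended by \<open>0\<close> to \<open>x \<le> 0\<close>. Treating all orders at once
  turns smoothness into the single statement \<open>flat_deriv\<close>.
\<close>

definition flat :: "nat \<Rightarrow> real \<Rightarrow> real" where
  "flat n x = (if x \<le> 0 then 0 else poly (flat_poly n) (1 / x) * exp (- (1 / x)))"

lemma poly_times_exp_minus_tendsto_0: "((\<lambda>y. poly q y * exp (- y)) \<longlongrightarrow> (0::real)) at_top"
proof -
  have "((\<lambda>y. \<Sum>i\<le>degree q. coeff q i * (y ^ i / exp y)) \<longlongrightarrow> (\<Sum>i\<le>degree q. coeff q i * 0)) at_top"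
    by (intro tendsto_intros tendsto_power_div_exp_0)
  then show ?thesis
    by (simp add: poly_altdef sum_distrib_right exp_minus divide_inverse mult.assoc)
qed

lemma flat_deriv: "(flat n has_real_derivative flat (Suc n) x) (at x)"
proof -
  consider "x < 0" | "x = 0" | "x > 0" by linarith
  then show ?thesis
  proof cases
    case 1
    have "((\<lambda>_. 0::real) has_real_derivative 0) (at x)" by simp
    then have "(flat n has_real_derivative 0) (at x)"
      by (rule has_field_derivative_transform_within_open[where S="{..<0}"]) (use 1 in \<open>auto simp: flat_def\<close>)
    then show ?thesis using 1 by (simp add: flat_def)
  next
    case 3
    let ?f = "\<lambda>x. poly (flat_poly n) (1 / x) * exp (- (1 / x))"
    have "(?f has_real_derivative flat (Suc n) x) (at x)"
      using 3 by (auto intro!: derivative_eq_intros DERIV_chain2[OF poly_DERIV] simp: flat_def field_simps power2_eq_square)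
    then show ?thesis
      by (rule has_field_derivative_transform_within_open[where S="{0<..}"]) (use 3 in \<open>auto simp: flat_def\<close>)
  next
    case 2
    have l: "((\<lambda>h. flat n h / h) \<longlongrightarrow> 0) (at_left 0)"
      by (rule Lim_transform_eventually[OF tendsto_const]) (simp add: eventually_at_filter flat_def)
    have "((\<lambda>y. poly ([:0, 1:] * flat_poly n) y * exp (- y)) \<longlongrightarrow> 0) at_top"
      by (rule poly_times_exp_minus_tendsto_0)
    then have "((\<lambda>h. poly ([:0, 1:] * flat_poly n) (inverse h) * exp (- inverse h)) \<longlongrightarrow> 0) (at_right (0::real))"
      by (rule filterlim_compose[OF _ filterlim_inverse_at_top_right])
    then have r: "((\<lambda>h. flat n h / h) \<longlongrightarrow> 0) (at_right 0)"
      by (rule Lim_transform_eventually) (auto simp: eventually_at_filter flat_def field_simps)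
    have "((\<lambda>h. flat n h / h) \<longlongrightarrow> 0) (at 0)" using l r by (rule filterlim_split_at)
    then show ?thesis using 2 by (simp add: DERIV_def flat_def)
  qed
qed

lemma flat_continuous: "continuous_on S (flat n)"
  by (intro continuous_at_imp_continuous_on ballI) (use flat_deriv DERIV_isCont in blast)

lemma flat_measurable[measurable]: "flat n \<in> borel_measurable borel"
  by (intro borel_measurable_continuous_onI flat_continuous)

lemma flat_pos: "x > 0 \<Longrightarrow> flat 0 x > 0" and flat_nonneg: "0 \<le> flat 0 x"
  and flat_eq_0: "x \<le> 0 \<Longrightarrow> flat n x = 0"
  by (simp_all add: flat_def)

text \<open>
  A smooth step, equal to \<open>1\<close> on \<open>x \<le> 0\<close> and to \<open>0\<close> on \<open>x \<ge> 1\<close>.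
\<close>

definition step :: "real \<Rightarrow> real" where
  "step x = flat 0 (1 - x) / (flat 0 (1 - x) + flat 0 x)"

definition step' :: "real \<Rightarrow> real" where
  "step' x = (- flat 1 (1 - x) * (flat 0 (1 - x) + flat 0 x) - flat 0 (1 - x) * (flat 1 x - flat 1 (1 - x)))
      / (flat 0 (1 - x) + flat 0 x)\<^sup>2"

lemma step_denominator_pos: "flat 0 (1 - x) + flat 0 x > 0"
  using flat_pos[of x] flat_pos[of "1 - x"] flat_nonneg[of x] flat_nonneg[of "1 - x"]
  by (cases "x > 0") auto

lemma step_deriv: "(step has_real_derivative step' x) (at x)"
  using step_denominator_pos[of x] unfolding step_def[abs_def] step'_def
  by (auto intro!: derivative_eq_intros DERIV_chain2[OF flat_deriv] simp: power2_eq_square)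

lemma step'_continuous: "continuous_on S step'"
  unfolding step'_def[abs_def]
  by (intro continuous_intros continuous_on_compose2[OF flat_continuous[of UNIV]])
    (use step_denominator_pos in \<open>auto simp: less_imp_neq[THEN not_sym] dest: less_imp_neq\<close>)

lemma step_eq_1: "x \<le> 0 \<Longrightarrow> step x = 1" and step_eq_0: "x \<ge> 1 \<Longrightarrow> step x = 0"
  using step_denominator_pos[of x] by (simp_all add: step_def flat_eq_0)

lemma step'_eq_0: "x \<le> 0 \<or> x \<ge> 1 \<Longrightarrow> step' x = 0"
  by (auto simp: step'_def flat_eq_0)

lemma step_bounds: "0 \<le> step x" "step x \<le> 1"
  using step_denominator_pos[of x] flat_nonneg[of x] flat_nonneg[of "1 - x"] by (simp_all add: step_def)

section \<open>Smooth functions\<close>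

text \<open>
  Differentiability of order \<open>n + 1\<close>. The recursion on the order allows proofs by induction that products and
  compositions are smooth.
\<close>

primrec smooth_upto :: "nat \<Rightarrow> ('a::euclidean_space \<Rightarrow> complex) \<Rightarrow> bool" where
  "smooth_upto 0 h \<longleftrightarrow> (\<forall>p. h differentiable at p)"
| "smooth_upto (Suc n) h \<longleftrightarrow> (\<forall>p. h differentiable at p) \<and> (\<forall>b\<in>Basis. smooth_upto n (dir_deriv b h))"

lemma smooth_upto_differentiable: "smooth_upto n h \<Longrightarrow> h differentiable at p"
  by (cases n) auto

lemma smooth_upto_Suc_D: "smooth_upto (Suc n) h \<Longrightarrow> smooth_upto n h"
  by (induction n arbitrary: h) auto

lemma dir_deriv_eq: "(h has_derivative h') (at p) \<Longrightarrow> dir_deriv b h p = h' b"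
  unfolding dir_deriv_def by (metis frechet_derivative_at)

lemma smooth_upto_has_derivative: "smooth_upto n h \<Longrightarrow> (h has_derivative (\<lambda>b. dir_deriv b h p)) (at p)"
  using smooth_upto_differentiable[of n h p] by (simp add: dir_deriv_def frechet_derivative_works)

lemma smooth_smooth_uptoI:
  assumes "\<And>n. smooth_upto n h" shows "smooth h"
proof -
  have "iter_deriv bs h differentiable at p" if "set bs \<subseteq> Basis" "smooth_upto (length bs) h" for bs p
    using that
  proof (induction bs arbitrary: h rule: rev_induct)
    case Nil then show ?case by (simp add: iter_deriv_def)
  next
    case (snoc b bs)
    then show ?case by (auto simp: iter_deriv_def)
  qed
  then show ?thesis using assms by (auto simp: smooth_def)
qed

lemma smooth_upto_SucI:
  assumes "\<And>p. (h has_derivative D p) (at p)" "\<And>b. b \<in> Basis \<Longrightarrow> smooth_upto n (\<lambda>p. D p b)"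
  shows "smooth_upto (Suc n) h"
proof -
  have "dir_deriv b h = (\<lambda>p. D p b)" for b using dir_deriv_eq[OF assms(1)] by auto
  then show ?thesis using assms by (auto simp: differentiable_def)
qed

lemma smooth_upto_const: "smooth_upto n (\<lambda>_. c)"
  by (induction n arbitrary: c) (auto intro!: smooth_upto_SucI[where D="\<lambda>_ _. 0"] simp del: smooth_upto.simps(2))

lemma smooth_upto_bounded_linear: "bounded_linear T \<Longrightarrow> smooth_upto n T"
  by (cases n) (auto intro!: smooth_upto_SucI[where D="\<lambda>_. T"] smooth_upto_const bounded_linear_imp_has_derivative
      bounded_linear_imp_differentiable simp del: smooth_upto.simps(2))

lemma smooth_upto_add: "smooth_upto n f \<Longrightarrow> smooth_upto n g \<Longrightarrow> smooth_upto n (\<lambda>p. f p + g p)"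
proof (induction n arbitrary: f g)
  case (Suc n)
  show ?case
  proof (rule smooth_upto_SucI)
    show "((\<lambda>p. f p + g p) has_derivative (\<lambda>b. dir_deriv b f p + dir_deriv b g p)) (at p)" for p
      by (intro has_derivative_add smooth_upto_has_derivative[OF Suc.prems(1)] smooth_upto_has_derivative[OF Suc.prems(2)])
    show "smooth_upto n (\<lambda>p. dir_deriv b f p + dir_deriv b g p)" if "b \<in> Basis" for b
      using Suc.prems that by (intro Suc.IH) auto
  qed
qed (auto intro: differentiable_add)

lemma smooth_upto_mult: "smooth_upto n f \<Longrightarrow> smooth_upto n g \<Longrightarrow> smooth_upto n (\<lambda>p. f p * g p)"
proof (induction n arbitrary: f g)
  case (Suc n)
  show ?case
  proof (rule smooth_upto_SucI)
    show "((\<lambda>p. f p * g p) has_derivative (\<lambda>b. f p * dir_deriv b g p + dir_deriv b f p * g p)) (at p)" for p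
      by (intro has_derivative_mult smooth_upto_has_derivative[OF Suc.prems(1)] smooth_upto_has_derivative[OF Suc.prems(2)])
    show "smooth_upto n (\<lambda>p. f p * dir_deriv b g p + dir_deriv b f p * g p)" if "b \<in> Basis" for b
      using that Suc.prems(1)[THEN smooth_upto_Suc_D] Suc.prems(2)[THEN smooth_upto_Suc_D] Suc.prems
      by (intro smooth_upto_add Suc.IH) simp_all
  qed
qed (auto intro: differentiable_mult)

lemma smooth_upto_sum: "finite I \<Longrightarrow> (\<And>i. i \<in> I \<Longrightarrow> smooth_upto n (f i)) \<Longrightarrow> smooth_upto n (\<lambda>p. \<Sum>i\<in>I. f i p)"
  by (induction I rule: finite_induct) (auto intro: smooth_upto_const smooth_upto_add)

text \<open>
  The induction needs a whole sequence \<open>g\<close> of successive derivatives, since each differentiation of \<open>g k (u p)\<close>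
  produces \<open>g (k + 1) (u p)\<close>.
\<close>

lemma smooth_upto_compose:
  fixes u :: "'a::euclidean_space \<Rightarrow> real"
  assumes g: "\<And>k x. (g k has_real_derivative g (Suc k) x) (at x)" and u: "smooth_upto n (\<lambda>p. complex_of_real (u p))"
  shows "smooth_upto n (\<lambda>p. complex_of_real (g k (u p)))"
  using u
proof (induction n arbitrary: k)
  have *: "((\<lambda>p. complex_of_real (g k (u p))) has_derivative (\<lambda>b. complex_of_real (g (Suc k) (u p)) * dir_deriv b (\<lambda>p. complex_of_real (u p)) p)) (at p)"
    if "smooth_upto n (\<lambda>p. complex_of_real (u p))" for n k p
  proof -
    note d = smooth_upto_has_derivative[OF that, of p]
    have du: "(u has_derivative (\<lambda>b. Re (dir_deriv b (\<lambda>p. complex_of_real (u p)) p))) (at p)"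
      using has_derivative_Re[OF d] by simp
    from has_derivative_of_real[OF du] have "((\<lambda>p. complex_of_real (u p)) has_derivative (\<lambda>b. complex_of_real (Re (dir_deriv b (\<lambda>p. complex_of_real (u p)) p)))) (at p)" .
    with d have e: "(\<lambda>b. dir_deriv b (\<lambda>p. complex_of_real (u p)) p) = (\<lambda>b. complex_of_real (Re (dir_deriv b (\<lambda>p. complex_of_real (u p)) p)))"
      by (rule has_derivative_unique)
    have e': "complex_of_real (Re (dir_deriv b (\<lambda>p. complex_of_real (u p)) p)) = dir_deriv b (\<lambda>p. complex_of_real (u p)) p" for b
      using fun_cong[OF e, of b] by (rule sym)
    have "(g k has_derivative (\<lambda>h. g (Suc k) (u p) * h)) (at (u p))"
      using g[of k "u p"] by (simp add: has_field_derivative_def)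
    then have "((\<lambda>p. complex_of_real (g k (u p))) has_derivative (\<lambda>b. complex_of_real (g (Suc k) (u p) * Re (dir_deriv b (\<lambda>p. complex_of_real (u p)) p)))) (at p)"
      by (intro has_derivative_of_real has_derivative_compose[OF du])
    then show ?thesis by (simp add: e')
  qed
  { case 0 then show ?case using *[of 0] by (auto simp: differentiable_def) }
  { case (Suc n)
    show ?case
      by (rule smooth_upto_SucI[OF *[OF Suc.prems]])
        (use Suc.prems Suc.IH[OF Suc.prems[THEN smooth_upto_Suc_D]] in \<open>auto intro!: smooth_upto_mult\<close>) }
qed

lemma smooth_upto_inverse:
  assumes nz: "\<And>p. f p \<noteq> 0"
  shows "smooth_upto n f \<Longrightarrow> smooth_upto n (\<lambda>p. inverse (f p))"
proof (induction n)
  case (Suc n)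
  show ?case
  proof (rule smooth_upto_SucI)
    show "((\<lambda>p. inverse (f p)) has_derivative (\<lambda>b. - (inverse (f p) * dir_deriv b f p * inverse (f p)))) (at p)" for p
      by (rule Deriv.has_derivative_inverse[OF nz smooth_upto_has_derivative[OF Suc.prems]])
    show "smooth_upto n (\<lambda>p. - (inverse (f p) * dir_deriv b f p * inverse (f p)))" if "b \<in> Basis" for b
    proof -
      have "smooth_upto n (\<lambda>p. (-1) * (inverse (f p) * dir_deriv b f p * inverse (f p)))"
        using that Suc.prems Suc.IH[OF Suc.prems[THEN smooth_upto_Suc_D]]
        by (intro smooth_upto_mult smooth_upto_const) simp_all
      then show ?thesis by simp
    qed
  qed
qed (use nz in auto)

lemma smooth_upto_step:
  assumes u: "smooth_upto n (\<lambda>p. complex_of_real (u p))"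
  shows "smooth_upto n (\<lambda>p. complex_of_real (step (u p)))"
proof -
  have u': "smooth_upto n (\<lambda>p. complex_of_real (1 - u p))"
    using smooth_upto_add[OF smooth_upto_const[of n 1] smooth_upto_mult[OF smooth_upto_const[of n "-1"] u]] by simp
  note f = smooth_upto_compose[of flat, OF flat_deriv u', of 0] smooth_upto_compose[of flat, OF flat_deriv u, of 0]
  have "smooth_upto n (\<lambda>p. inverse (complex_of_real (flat 0 (1 - u p)) + complex_of_real (flat 0 (u p))))"
  proof (rule smooth_upto_inverse[OF _ smooth_upto_add[OF f]])
    show "complex_of_real (flat 0 (1 - u p)) + complex_of_real (flat 0 (u p)) \<noteq> 0" for p
      using step_denominator_pos[of "u p"] by (metis of_real_add of_real_eq_0_iff less_irrefl)
  qed
  from smooth_upto_mult[OF f(1) this] show ?thesis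
    by (simp add: step_def divide_inverse)
qed

section \<open>Mollifiers\<close>

definition bump :: "real \<Rightarrow> 'a::euclidean_space \<Rightarrow> real" where
  "bump \<epsilon> z = flat 0 (\<epsilon>\<^sup>2 - (norm z)\<^sup>2)"

definition mollifier :: "real \<Rightarrow> 'a::euclidean_space \<Rightarrow> real" where
  "mollifier \<epsilon> z = bump \<epsilon> z / (\<integral>z. bump \<epsilon> (z::'a) \<partial>lborel)"

definition mollifier_deriv :: "real \<Rightarrow> 'a::euclidean_space \<Rightarrow> 'a \<Rightarrow> real" where
  "mollifier_deriv \<epsilon> b z = flat 1 (\<epsilon>\<^sup>2 - (norm z)\<^sup>2) * (- 2 * (z \<bullet> b)) / (\<integral>z. bump \<epsilon> (z::'a) \<partial>lborel)"

lemma bump_eq_0: "norm z \<ge> \<epsilon> \<Longrightarrow> \<epsilon> \<ge> 0 \<Longrightarrow> bump \<epsilon> z = 0"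
  by (simp add: bump_def flat_eq_0 power_mono)

lemma bump_continuous: "continuous_on UNIV (bump \<epsilon>)"
  unfolding bump_def[abs_def]
  by (intro continuous_intros continuous_on_compose2[OF flat_continuous[of UNIV]]) auto

lemma bump_integral_pos:
  assumes "\<epsilon> > 0" shows "(\<integral>z. bump \<epsilon> (z::'a::euclidean_space) \<partial>lborel) > 0"
proof -
  have i: "integrable lborel (bump \<epsilon> :: 'a \<Rightarrow> real)"
    using assms by (intro continuous_compact_support_integrable[OF bump_continuous bump_eq_0]) auto
  have nn: "(\<integral>z. bump \<epsilon> (z::'a) \<partial>lborel) \<ge> 0" by (simp add: bump_def flat_nonneg)
  have "(\<integral>z. bump \<epsilon> (z::'a) \<partial>lborel) \<noteq> 0"
  proof
    assume "(\<integral>z. bump \<epsilon> (z::'a) \<partial>lborel) = 0"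
    then have "AE z in lborel. bump \<epsilon> (z::'a) = 0"
      by (subst (asm) integral_nonneg_eq_0_iff_AE[OF i]) (auto simp: bump_def flat_nonneg)
    moreover have "bump \<epsilon> z = 0 \<longleftrightarrow> z \<notin> ball 0 \<epsilon>" for z :: 'a
      using flat_pos[of "\<epsilon>\<^sup>2 - (norm z)\<^sup>2"] bump_eq_0[of \<epsilon> z] assms
      by (auto simp: bump_def power_strict_mono)
    ultimately have "AE z in lborel. z \<notin> ball (0::'a) \<epsilon>" by simp
    then have "emeasure lborel (ball (0::'a) \<epsilon>) = 0"
      by (intro AE_iff_measurable[THEN iffD1, rotated 2]) (auto simp: ball_def)
    then have "measure lborel (ball (0::'a) \<epsilon>) = 0" by (simp add: measure_def)
    then show False using content_ball_pos[OF assms, of "0::'a"] by simp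
  qed
  with nn show ?thesis by simp
qed

lemma mollifier_has_derivative:
  "(mollifier \<epsilon> has_derivative (\<lambda>b. mollifier_deriv \<epsilon> b z)) (at z)"
proof -
  have 1: "((\<lambda>z. \<epsilon>\<^sup>2 - (norm z)\<^sup>2) has_derivative (\<lambda>b. - 2 * (z \<bullet> b))) (at z)"
    unfolding power2_norm_eq_inner by (auto intro!: derivative_eq_intros simp: inner_commute)
  have "(flat 0 has_derivative (\<lambda>h. flat 1 (\<epsilon>\<^sup>2 - (norm z)\<^sup>2) * h)) (at (\<epsilon>\<^sup>2 - (norm z)\<^sup>2))"
    using flat_deriv[of 0] by (simp add: has_field_derivative_def)
  from has_derivative_compose[OF 1 this]
  have "(bump \<epsilon> has_derivative (\<lambda>b. flat 1 (\<epsilon>\<^sup>2 - (norm z)\<^sup>2) * (- 2 * (z \<bullet> b)))) (at z)"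
    by (simp add: bump_def[abs_def])
  from has_derivative_mult_right[OF this, of "inverse (\<integral>z. bump \<epsilon> (z::'a) \<partial>lborel)"]
  show ?thesis by (simp add: mollifier_def[abs_def] mollifier_deriv_def divide_inverse mult_ac)
qed

lemma mollifier_line_deriv: "line_deriv b (mollifier \<epsilon>) (mollifier_deriv \<epsilon> b)"
  unfolding line_deriv_def
proof
  fix z
  have "((\<lambda>\<sigma>::real. z + \<sigma> *\<^sub>R b) has_derivative (\<lambda>\<sigma>. \<sigma> *\<^sub>R b)) (at 0)"
    by (auto intro!: derivative_eq_intros)
  from has_derivative_compose[OF this, of "mollifier \<epsilon>" "\<lambda>b. mollifier_deriv \<epsilon> b z"] mollifier_has_derivative[of \<epsilon> z]
  have "((\<lambda>\<sigma>. mollifier \<epsilon> (z + \<sigma> *\<^sub>R b)) has_derivative (\<lambda>\<sigma>. mollifier_deriv \<epsilon> (\<sigma> *\<^sub>R b) z)) (at 0)" by simp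
  then show "((\<lambda>\<sigma>. mollifier \<epsilon> (z + \<sigma> *\<^sub>R b)) has_vector_derivative mollifier_deriv \<epsilon> b z) (at 0)"
    by (simp add: has_vector_derivative_def mollifier_deriv_def mult_ac)
qed

lemma mollifier_kernel: "\<epsilon> > 0 \<Longrightarrow> kernel (mollifier \<epsilon>)"
  unfolding kernel_def mollifier_def[abs_def]
  by (intro conjI continuous_intros bump_continuous exI[of _ \<epsilon>])
    (auto simp: bump_eq_0 less_imp_neq[OF bump_integral_pos, THEN not_sym])

lemma mollifier_deriv_kernel:
  assumes "\<epsilon> > 0" shows "kernel (mollifier_deriv \<epsilon> b)"
  unfolding kernel_def
proof (intro conjI exI[of _ \<epsilon>] allI impI)
  show "continuous_on UNIV (mollifier_deriv \<epsilon> b)"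
    unfolding mollifier_deriv_def[abs_def]
    using bump_integral_pos[OF assms, where 'a='a]
    by (intro continuous_intros continuous_on_compose2[OF flat_continuous[of UNIV]]) auto
  show "mollifier_deriv \<epsilon> b z = 0" if "\<epsilon> \<le> norm z" for z
    using that assms by (simp add: mollifier_deriv_def flat_eq_0 power_mono)
qed

lemma mollifier_nonneg: "0 \<le> mollifier \<epsilon> z"
  by (auto simp: mollifier_def bump_def intro!: divide_nonneg_nonneg Bochner_Integration.integral_nonneg flat_nonneg)

lemma mollifier_integral: "\<epsilon> > 0 \<Longrightarrow> (\<integral>z. mollifier \<epsilon> (z::'a::euclidean_space) \<partial>lborel) = 1"
  using bump_integral_pos[of \<epsilon>, where 'a='a] by (simp add: mollifier_def[abs_def])

lemma mollifier_eq_0: "norm z \<ge> \<epsilon> \<Longrightarrow> \<epsilon> > 0 \<Longrightarrow> mollifier \<epsilon> z = 0"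
  by (simp add: mollifier_def bump_eq_0)

section \<open>Representatives and vanishing of integrable functions\<close>

lemma AE_lebesgue_iff: "(AE x in lebesgue. P x) \<longleftrightarrow> (AE x in lborel. P x)"
  by (rule AE_completion_iff)

lemma borel_measurable_lebesgueI: "u \<in> borel_measurable borel \<Longrightarrow> u \<in> borel_measurable lebesgue"
  by (intro measurable_completion) simp

lemma borel_representative:
  fixes u :: "'a::euclidean_space \<Rightarrow> 'b::euclidean_space"
  assumes u: "u \<in> borel_measurable lebesgue"
  obtains u' where "u' \<in> borel_measurable borel" "AE x in lborel. u x = u' x"
proof -
  have "\<exists>g. g \<in> borel_measurable borel \<and> (AE x in lborel. u x \<bullet> b = g x)" for b
    using completion_ex_borel_measurable_real[of "\<lambda>x. u x \<bullet> b" lborel] u by auto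
  then obtain g where g: "\<And>b. g b \<in> borel_measurable borel" "\<And>b. AE x in lborel. u x \<bullet> b = g b x" by metis
  have "AE x in lborel. \<forall>b\<in>Basis. u x \<bullet> b = g b x"
    by (intro AE_finite_allI g) auto
  then have "AE x in lborel. u x = (\<Sum>b\<in>Basis. g b x *\<^sub>R b)"
  proof eventually_elim
    case (elim x)
    have "u x = (\<Sum>b\<in>Basis. (u x \<bullet> b) *\<^sub>R b)" by (rule euclidean_representation[symmetric])
    with elim show ?case by simp
  qed
  moreover have "(\<lambda>x. \<Sum>b\<in>Basis. g b x *\<^sub>R b) \<in> borel_measurable borel"
    using g(1) by measurable
  ultimately show ?thesis using that by blast
qed

lemma AE_eq_borel_imp_lebesgue_measurable:
  fixes u :: "'a::euclidean_space \<Rightarrow> 'b::topological_space"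
  assumes "AE x in lborel. u x = u' x" "u' \<in> borel_measurable borel"
  shows "u \<in> borel_measurable lebesgue"
proof (rule measurableI)
  fix X :: "'b set" assume "X \<in> sets borel"
  then have "u' -` X \<in> sets lebesgue" using assms(2) by (auto dest: measurable_sets_borel)
  then show "u -` X \<inter> space lebesgue \<in> sets lebesgue"
    by (rule completion.in_sets_AE[rotated]) (use assms(1) in \<open>auto simp: AE_lebesgue_iff elim: AE_mp\<close>)
qed auto

lemma integral_lebesgue_eq_lborel:
  fixes u :: "'a::euclidean_space \<Rightarrow> 'b::{banach, second_countable_topology}"
  assumes "AE x in lborel. u x = u' x" "u' \<in> borel_measurable borel"
  shows "(\<integral>x. u x \<partial>lebesgue) = (\<integral>x. u' x \<partial>lborel)"
proof -
  have "(\<integral>x. u x \<partial>lebesgue) = (\<integral>x. u' x \<partial>lebesgue)"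
    using AE_eq_borel_imp_lebesgue_measurable[OF assms] assms
    by (intro integral_cong_AE) (auto simp: AE_lebesgue_iff intro: borel_measurable_lebesgueI)
  then show ?thesis using assms(2) by (simp add: integral_completion)
qed

lemma integral_lebesgue_on_eq_lborel:
  fixes u :: "'a::euclidean_space \<Rightarrow> 'b::{banach, second_countable_topology}"
  assumes "AE x in lborel. (if x \<in> S then u x else 0) = u' x" "u' \<in> borel_measurable borel" "S \<in> sets borel"
  shows "(\<integral>x. u x \<partial>lebesgue_on S) = (\<integral>x. u' x \<partial>lborel)"
proof -
  have "(\<integral>x. u x \<partial>lebesgue_on S) = (\<integral>x. (if x \<in> S then u x else 0) \<partial>lebesgue)"
    using assms(3) by (subst integral_restrict_space) (auto intro!: Bochner_Integration.integral_cong)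
  also have "\<dots> = (\<integral>x. u' x \<partial>lborel)" by (rule integral_lebesgue_eq_lborel[OF assms(1,2)])
  finally show ?thesis .
qed

lemma L2_lebesgue_representative:
  fixes u :: "'a::euclidean_space \<Rightarrow> 'b::euclidean_space"
  assumes "u \<in> L2 (lebesgue_on S)" "S \<in> sets borel"
  obtains u' where "u' \<in> L2 lborel" "AE x in lborel. (if x \<in> S then u x else 0) = u' x"
proof -
  have "(\<lambda>x. if x \<in> S then u x else 0) \<in> borel_measurable lebesgue"
    using assms by (subst borel_measurable_if) (auto simp: L2_def)
  then obtain u' where u': "u' \<in> borel_measurable borel" "AE x in lborel. (if x \<in> S then u x else 0) = u' x"
    by (rule borel_representative)
  have "integrable lebesgue (\<lambda>x. indicator S x *\<^sub>R (norm (u x))\<^sup>2)"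
    using assms L2_integrable[OF assms(1)] by (subst (asm) integrable_restrict_space) auto
  then have "integrable lebesgue (\<lambda>x. (norm (u' x))\<^sup>2)"
  proof (rule integrable_cong_AE_imp)
    show "(\<lambda>x. (norm (u' x))\<^sup>2) \<in> borel_measurable lebesgue"
      using u'(1) by (intro borel_measurable_lebesgueI) measurable
    show "AE x in lebesgue. indicator S x *\<^sub>R (norm (u x))\<^sup>2 = (norm (u' x))\<^sup>2"
      unfolding AE_lebesgue_iff using u'(2) by eventually_elim (auto simp: indicator_def split: if_splits)
  qed
  then have "integrable lborel (\<lambda>x. (norm (u' x))\<^sup>2)"
    using u'(1) by (subst (asm) integrable_completion) auto
  then show ?thesis using u' by (intro that[of u'] L2_I) auto
qed

text \<open>
  The sets over which the integral of \<open>d\<close> vanishes form a Dynkin system containing the half-lines.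
\<close>

lemma AE_zero_of_initial_integrals:
  fixes d :: "real \<Rightarrow> 'b::euclidean_space"
  assumes d: "integrable lborel d" and z: "\<And>b. (\<integral>r. indicator {..b} r *\<^sub>R d r \<partial>lborel) = 0"
  shows "AE r in lborel. d r = 0"
proof -
  have I: "integrable lborel (\<lambda>r. indicator A r *\<^sub>R d r)" if "A \<in> sets borel" for A
    using d that by (intro integrable_mult_indicator) auto
  have all: "(\<integral>r. d r \<partial>lborel) = 0"
  proof -
    have "(\<lambda>n::nat. \<integral>r. indicator {..real n} r *\<^sub>R d r \<partial>lborel) \<longlonglongrightarrow> (\<integral>r. d r \<partial>lborel)"
    proof (rule integral_dominated_convergence[where w="\<lambda>r. norm (d r)"])
      show "AE r in lborel. (\<lambda>n. indicator {..real n} r *\<^sub>R d r) \<longlonglongrightarrow> d r"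
      proof (rule AE_I2)
        fix r
        obtain N :: nat where "r \<le> real N" using real_arch_simple by blast
        then have "\<forall>\<^sub>F n in sequentially. indicator {..real n} r *\<^sub>R d r = d r"
          by (auto simp: eventually_sequentially indicator_def intro!: exI[of _ N])
        then show "(\<lambda>n. indicator {..real n} r *\<^sub>R d r) \<longlonglongrightarrow> d r" by (rule tendsto_eventually)
      qed
    qed (use d I in \<open>auto simp: indicator_def\<close>)
    then show ?thesis by (simp add: z LIMSEQ_const_iff)
  qed
  have zA: "(\<integral>r. indicator A r *\<^sub>R d r \<partial>lborel) = 0" if "A \<in> sets borel" for A
  proof -
    have A: "A \<in> sigma_sets UNIV (range (atMost :: real \<Rightarrow> _))"
      using that by (simp add: borel_eq_atMost)
    have S: "Int_stable (range (atMost :: real \<Rightarrow> _))" "range (atMost :: real \<Rightarrow> _) \<subseteq> Pow UNIV"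
      by (auto simp: Int_stable_def)
    show ?thesis
      using S A
    proof (induct rule: sigma_sets_induct_disjoint)
      case (basic A) then show ?case using z by auto
    next
      case (compl A)
      have "A \<in> sets borel" using compl by (simp add: borel_eq_atMost)
      have "(\<lambda>r. indicator (UNIV - A) r *\<^sub>R d r) = (\<lambda>r. d r - indicator A r *\<^sub>R d r)"
        by (auto simp: indicator_def)
      then show ?case using compl d I[OF \<open>A \<in> sets borel\<close>] all by simp
    next
      case (union A)
      have [measurable]: "A i \<in> sets borel" for i using union by (auto simp: borel_eq_atMost)
      have "(\<integral>r. indicator (\<Union>i. A i) r *\<^sub>R d r \<partial>lborel) = (\<Sum>i. \<integral>r. indicator (A i) r *\<^sub>R d r \<partial>lborel)"
        using lebesgue_integral_countable_add[of A lborel d] union(1) I[of "\<Union>i. A i"]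
        by (auto simp: set_lebesgue_integral_def set_integrable_def disjoint_family_on_def)
      then show ?case using union by simp
    qed auto
  qed
  have "AE r in lborel. d r \<bullet> b = 0" for b
  proof (rule density_unique_real)
    show "set_lebesgue_integral lborel A (\<lambda>r. d r \<bullet> b) = set_lebesgue_integral lborel A (\<lambda>_. 0)"
      if "A \<in> sets lborel" for A
      using integral_inner_left[of b lborel "\<lambda>r. indicator A r *\<^sub>R d r"] I[of A] zA[of A] that
      by (simp add: set_lebesgue_integral_def)
  qed (use d in auto)
  then have "AE r in lborel. \<forall>b\<in>Basis. d r \<bullet> b = 0" by (intro AE_finite_allI) auto
  then show ?thesis by eventually_elim (auto intro: euclidean_eqI)
qed

section \<open>Free transport\<close>

lemma borel_measurable_fst_snd[measurable]:
  "fst \<in> borel_measurable (borel :: ('a::second_countable_topology \<times> 'b::second_countable_topology) measure)"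
  "snd \<in> borel_measurable (borel :: ('a::second_countable_topology \<times> 'b::second_countable_topology) measure)"
  by (auto intro!: borel_measurable_continuous_onI continuous_intros)

text \<open>
  The free transport flow: the motion with constant velocity during time \<open>a\<close>.
\<close>

definition drift :: "real \<Rightarrow> (real ^ 'd::finite) \<times> (real ^ 'd) \<Rightarrow> (real ^ 'd) \<times> (real ^ 'd)" where
  "drift a z = (fst z + a *\<^sub>R snd z, snd z)"

lemma drift_drift[simp]: "drift a (drift b z) = drift (a + b) z"
  by (simp add: drift_def algebra_simps)

lemma drift_0[simp]: "drift 0 z = z"
  by (simp add: drift_def)

lemma drift_continuous[continuous_intros]:
  "continuous_on S a \<Longrightarrow> continuous_on S u \<Longrightarrow> continuous_on S (\<lambda>x. drift (a x) (u x))"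
  unfolding drift_def by (intro continuous_intros)

lemma drift_measurable[measurable]:
  assumes [measurable]: "a \<in> borel_measurable M" "u \<in> borel_measurable M"
  shows "(\<lambda>x. drift (a x) (u x)) \<in> borel_measurable M"
proof -
  have "(\<lambda>p. drift (fst p) (snd p)) \<in> borel_measurable borel"
    by (intro borel_measurable_continuous_onI continuous_intros)
  then have "(\<lambda>p. drift (fst p) (snd p)) \<in> borel_measurable (borel \<Otimes>\<^sub>M borel)" by (simp add: borel_prod)
  from measurable_compose[OF _ this, of "\<lambda>x. (a x, u x)" M] show ?thesis by simp
qed

text \<open>
  At fixed time and velocity, free transport is a translation in position.
\<close>

lemma drift_time_measure_preserving:
  fixes a :: "'p::euclidean_space \<Rightarrow> real"
  assumes [measurable]: "a \<in> borel_measurable borel"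
  shows "distr lborel borel (\<lambda>p. (fst p, drift (a (fst p)) (snd p))) = (lborel :: ('p \<times> (real^'d::finite) \<times> (real^'d)) measure)"
proof -
  let ?T = "\<lambda>p::'p \<times> (real^'d) \<times> (real^'d). (fst p, drift (a (fst p)) (snd p))"
  have T: "?T \<in> borel_measurable borel"
    by measurable
  have l3: "(\<integral>\<^sup>+p. g p \<partial>(lborel :: ('p \<times> (real^'d) \<times> (real^'d)) measure)) = (\<integral>\<^sup>+r. \<integral>\<^sup>+v. \<integral>\<^sup>+x. g (r, x, v) \<partial>lborel \<partial>lborel \<partial>lborel)"
    if g: "g \<in> borel_measurable borel" for g :: "_ \<Rightarrow> ennreal"
  proof -
    have g1: "g \<in> borel_measurable (lborel \<Otimes>\<^sub>M lborel)" using g by (simp add: lborel_prod)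
    have "(\<integral>\<^sup>+p. g p \<partial>lborel) = (\<integral>\<^sup>+r. \<integral>\<^sup>+z. g (r, z) \<partial>lborel \<partial>lborel)"
      using lborel.nn_integral_fst[OF g1] by (simp add: lborel_prod)
    also have "\<dots> = (\<integral>\<^sup>+r. \<integral>\<^sup>+v. \<integral>\<^sup>+x. g (r, x, v) \<partial>lborel \<partial>lborel \<partial>lborel)"
    proof (rule nn_integral_cong)
      fix r
      have "(\<lambda>z. g (r, z)) \<in> borel_measurable (lborel \<Otimes>\<^sub>M lborel)"
        using measurable_compose[OF _ g, of "\<lambda>z. (r, z)" borel] by (simp add: lborel_prod)
      then show "(\<integral>\<^sup>+z. g (r, z) \<partial>lborel) = (\<integral>\<^sup>+v. \<integral>\<^sup>+x. g (r, x, v) \<partial>lborel \<partial>lborel)"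
        using lborel_pair.nn_integral_snd[of "\<lambda>z. g (r, z)"] by (simp add: lborel_prod)
    qed
    finally show ?thesis .
  qed
  have tr: "(\<integral>\<^sup>+x. g (x + c) \<partial>lborel) = (\<integral>\<^sup>+x. g x \<partial>lborel)" if [measurable]: "g \<in> borel_measurable borel" for g :: "real^'d \<Rightarrow> ennreal" and c
  proof -
    have "(\<integral>\<^sup>+x. g x \<partial>lborel) = (\<integral>\<^sup>+x. g x \<partial>distr lborel borel ((+) c))" by (simp add: lborel_distr_plus)
    also have "\<dots> = (\<integral>\<^sup>+x. g (x + c) \<partial>lborel)" by (subst nn_integral_distr) (auto simp: add.commute)
    finally show ?thesis by simp
  qed
  have eq: "emeasure (distr lborel borel ?T) X = emeasure lborel X" if [measurable]: "X \<in> sets borel" for X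
  proof -
    have "emeasure (distr lborel borel ?T) X = (\<integral>\<^sup>+p. indicator X p \<partial>distr lborel borel ?T)" by simp
    also have "\<dots> = (\<integral>\<^sup>+p. indicator X (?T p) \<partial>lborel)"
      using T by (subst nn_integral_distr) auto
    also have "\<dots> = (\<integral>\<^sup>+r. \<integral>\<^sup>+v. \<integral>\<^sup>+x. indicator X (r, x + a r *\<^sub>R v, v) \<partial>lborel \<partial>lborel \<partial>lborel)"
      using T by (subst l3) (auto simp: drift_def)
    also have "\<dots> = (\<integral>\<^sup>+r. \<integral>\<^sup>+v. \<integral>\<^sup>+x. indicator X (r, x, v) \<partial>lborel \<partial>lborel \<partial>lborel)"
    proof (rule nn_integral_cong, rule nn_integral_cong)
      fix r v
      have "(\<lambda>x. indicator X (r, x, v) :: ennreal) \<in> borel_measurable borel"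
        using measurable_compose[of "\<lambda>x. (r, x, v)" borel borel "indicator X"] by simp
      from tr[OF this] show "(\<integral>\<^sup>+x. indicator X (r, x + a r *\<^sub>R v, v) \<partial>lborel) = (\<integral>\<^sup>+x. indicator X (r, x, v) \<partial>lborel :: ennreal)" by simp
    qed
    also have "\<dots> = emeasure lborel X" by (subst l3[symmetric]) auto
    finally show ?thesis .
  qed
  then show ?thesis by (intro measure_eqI) auto
qed

lemma drift_measure_preserving: "distr lborel borel (drift a) = (lborel :: ((real^'d::finite) \<times> (real^'d)) measure)"
proof (rule measure_eqI)
  fix X assume "X \<in> sets (distr lborel borel (drift a) :: ((real^'d) \<times> (real^'d)) measure)"
  then have [measurable]: "X \<in> sets borel" by simp
  have T: "(\<lambda>p::real \<times> (real^'d) \<times> (real^'d). (fst p, drift a (snd p))) \<in> borel_measurable borel" by measurable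
  have m: "drift a \<in> borel_measurable (borel :: ((real^'d) \<times> (real^'d)) measure)" by measurable
  have mp: "distr lborel borel (\<lambda>p::real \<times> (real^'d) \<times> (real^'d). (fst p, drift a (snd p))) = lborel"
    by (rule drift_time_measure_preserving) simp
  have "emeasure lborel ({0..1::real} \<times> X) = emeasure (distr lborel borel (\<lambda>p. (fst p, drift a (snd p)))) ({0..1::real} \<times> X)"
    unfolding mp ..
  also have "\<dots> = emeasure lborel ((\<lambda>p. (fst p, drift a (snd p))) -` ({0..1::real} \<times> X))"
    using T by (subst emeasure_distr) (auto intro!: borel_Times)
  also have "(\<lambda>p. (fst p, drift a (snd p))) -` ({0..1::real} \<times> X) = {0..1} \<times> (drift a -` X)" by auto
  finally have "emeasure (lborel \<Otimes>\<^sub>M lborel) ({0..1::real} \<times> X) = emeasure (lborel \<Otimes>\<^sub>M lborel) ({0..1::real} \<times> (drift a -` X))"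
    by (simp add: lborel_prod)
  then have "emeasure lborel X = emeasure lborel (drift a -` X)"
    using measurable_sets_borel[OF m, of X] by (subst (asm) (1 2) lborel.emeasure_pair_measure_Times) auto
  then show "emeasure (distr lborel borel (drift a)) X = emeasure lborel X"
    using m by (subst emeasure_distr) auto
qed simp

lemma measure_preserving_integral:
  fixes u :: "'a::euclidean_space \<Rightarrow> 'b::{banach, second_countable_topology}"
  assumes "distr lborel borel T = (lborel :: 'a measure)" "T \<in> borel_measurable borel" "u \<in> borel_measurable borel"
  shows "(\<integral>x. u (T x) \<partial>lborel) = (\<integral>x. u x \<partial>lborel)"
  using integral_distr[of T lborel borel u] assms by simp

lemma measure_preserving_integrable:
  fixes u :: "'a::euclidean_space \<Rightarrow> 'b::{banach, second_countable_topology}"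
  assumes "distr lborel borel T = (lborel :: 'a measure)" "T \<in> borel_measurable borel" "u \<in> borel_measurable borel"
  shows "integrable lborel (\<lambda>x. u (T x)) \<longleftrightarrow> integrable lborel u"
  using integrable_distr_eq[of T lborel borel u] assms by simp

lemma measure_preserving_L2:
  assumes "distr lborel borel T = (lborel :: 'a::euclidean_space measure)" "T \<in> borel_measurable borel" "u \<in> L2 lborel"
  shows "(\<lambda>x. u (T x)) \<in> L2 lborel"
proof (rule L2_I)
  note [measurable] = L2_borel[OF assms(3)] assms(2)
  show "(\<lambda>x. u (T x)) \<in> borel_measurable lborel" by measurable
  have "(\<lambda>x. (norm (u x))\<^sup>2) \<in> borel_measurable borel" by measurable
  from measure_preserving_integrable[OF assms(1,2) this] show "integrable lborel (\<lambda>x. (norm (u (T x)))\<^sup>2)"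
    using L2_integrable[OF assms(3)] by simp
qed

lemma measure_preserving_AE:
  assumes "distr lborel borel T = (lborel :: 'a::euclidean_space measure)" "T \<in> borel_measurable borel" "AE x in lborel. P x"
  shows "AE x in lborel. P (T x)"
proof -
  have "AE x in distr lborel borel T. P x" unfolding assms(1) by (rule assms(3))
  from AE_distrD[OF _ this] show ?thesis using assms(2) by simp
qed

lemma drift_borel[measurable]: "drift a \<in> borel_measurable borel" by measurable

lemmas drift_integral = measure_preserving_integral[OF drift_measure_preserving drift_borel]
lemmas drift_L2 = measure_preserving_L2[OF drift_measure_preserving drift_borel]
lemmas drift_AE = measure_preserving_AE[OF drift_measure_preserving drift_borel]

lemma norm_drift_le: "norm (drift a z) \<le> (1 + \<bar>a\<bar>) * norm z"
proof -
  have "drift a z = z + (a *\<^sub>R snd z, 0)" by (simp add: drift_def prod_eq_iff)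
  also have "norm \<dots> \<le> norm z + \<bar>a\<bar> * norm (snd z)" by (rule order_trans[OF norm_triangle_ineq]) (simp add: norm_Pair)
  also have "\<dots> \<le> norm z + \<bar>a\<bar> * norm z"
    using norm_snd_le[of "snd z" "fst z"] by (intro add_left_mono mult_left_mono) auto
  finally show ?thesis by (simp add: algebra_simps)
qed

section \<open>Test functions transported along the flow\<close>

text \<open>
  A time cut-off that is \<open>1\<close> on \<open>[c, b]\<close> and vanishes outside \<open>(c - 1 / m, b + 1 / n)\<close>.
\<close>

definition cutoff :: "real \<Rightarrow> real \<Rightarrow> real \<Rightarrow> real \<Rightarrow> real \<Rightarrow> real" where
  "cutoff n b m c r = step (n * (r - b)) * step (m * (c - r))"

definition cutoff' :: "real \<Rightarrow> real \<Rightarrow> real \<Rightarrow> real \<Rightarrow> real \<Rightarrow> real" where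
  "cutoff' n b m c r = n * step' (n * (r - b)) * step (m * (c - r)) - m * step (n * (r - b)) * step' (m * (c - r))"

text \<open>
  A mollifier centred at \<open>z\<close>, evaluated at the point that free transport reaches at time \<open>t\<close>. Apart from the time
  cut-off it is constant along transport, so the transport derivative falls only on \<open>\<theta>\<close>. Pairing with it
  evaluates convolutions in the moving frame.
\<close>

definition kinetic_test :: "real \<Rightarrow> (real \<Rightarrow> real) \<Rightarrow> real \<Rightarrow> ((real ^ 'd::finite) \<times> (real ^ 'd)) \<Rightarrow> real \<times> (real ^ 'd) \<times> (real ^ 'd) \<Rightarrow> complex" where
  "kinetic_test t \<theta> \<epsilon> z p = complex_of_real (\<theta> (fst p) * mollifier \<epsilon> (z - drift (t - fst p) (snd p)))"

lemma cutoff_deriv: "(cutoff n b m c has_real_derivative cutoff' n b m c r) (at r)"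
  unfolding cutoff_def[abs_def] cutoff'_def
  by (auto intro!: derivative_eq_intros DERIV_chain2[OF step_deriv])

lemma cutoff_eq_0:
  assumes "n > 0" "m > 0" "r \<ge> b + 1 / n \<or> r \<le> c - 1 / m" shows "cutoff n b m c r = 0"
proof -
  have "n * (r - b) \<ge> 1 \<or> m * (c - r) \<ge> 1" using assms by (auto simp: field_simps)
  then show ?thesis by (auto simp: cutoff_def step_eq_0)
qed

lemma power2_norm_prod_eq_sum:
  fixes w :: "(real ^ 'd::finite) \<times> (real ^ 'd)"
  shows "(norm w)\<^sup>2 = (\<Sum>i\<in>UNIV. (fst w $ i)\<^sup>2) + (\<Sum>i\<in>UNIV. (snd w $ i)\<^sup>2)"
  by (cases w) (simp add: norm_Pair norm_vec_def L2_set_def sum_nonneg)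

text \<open>
  The mollifier is a flat function of the squared norm, and that norm is a polynomial in \<open>t\<close>, \<open>x\<close> and \<open>v\<close>. The
  support is compact because free transport over a bounded time distorts norms by a bounded factor.
\<close>

lemma kinetic_test_in_test_functions:
  fixes z :: "(real ^ 'd::finite) \<times> (real ^ 'd)"
  assumes nm: "n > 0" "m > 0" and \<epsilon>: "\<epsilon> > 0" and S: "{c - 1 / m..b + 1 / n} \<times> UNIV \<subseteq> S"
  shows "kinetic_test t (cutoff n b m c) \<epsilon> z \<in> test_functions S"
proof -
  let ?h = "kinetic_test t (cutoff n b m c) \<epsilon> z"
  have r: "smooth_upto k (\<lambda>p::real \<times> (real ^ 'd) \<times> (real ^ 'd). complex_of_real (fst p))" for k
    by (intro smooth_upto_bounded_linear bounded_linear_compose[OF bounded_linear_of_real bounded_linear_fst])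
  have x: "smooth_upto k (\<lambda>p::real \<times> (real ^ 'd) \<times> (real ^ 'd). complex_of_real (fst (snd p) $ i))" for k i
    by (intro smooth_upto_bounded_linear bounded_linear_compose[OF bounded_linear_of_real]
      bounded_linear_compose[OF bounded_linear_vec_nth] bounded_linear_compose[OF bounded_linear_fst bounded_linear_snd])
  have v: "smooth_upto k (\<lambda>p::real \<times> (real ^ 'd) \<times> (real ^ 'd). complex_of_real (snd (snd p) $ i))" for k i
    by (intro smooth_upto_bounded_linear bounded_linear_compose[OF bounded_linear_of_real]
      bounded_linear_compose[OF bounded_linear_vec_nth] bounded_linear_compose[OF bounded_linear_snd bounded_linear_snd])
  have lin: "smooth_upto k (\<lambda>p. complex_of_real (a + c * u p))" if "smooth_upto k (\<lambda>p. complex_of_real (u p))"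
    for k a c and u :: "real \<times> (real ^ 'd) \<times> (real ^ 'd) \<Rightarrow> real"
    using smooth_upto_add[OF smooth_upto_const[of k "complex_of_real a"] smooth_upto_mult[OF smooth_upto_const[of k "complex_of_real c"] that]]
    by simp
  have th: "smooth_upto k (\<lambda>p::real \<times> (real ^ 'd) \<times> (real ^ 'd). complex_of_real (cutoff n b m c (fst p)) :: complex)" for k
  proof -
    have 1: "smooth_upto k (\<lambda>p::real \<times> (real ^ 'd) \<times> (real ^ 'd). complex_of_real (step (- n * b + n * fst p)))"
      by (intro smooth_upto_step lin r)
    have 2: "smooth_upto k (\<lambda>p::real \<times> (real ^ 'd) \<times> (real ^ 'd). complex_of_real (step (m * c + (- m) * fst p)))"
      by (intro smooth_upto_step lin r)
    from smooth_upto_mult[OF 1 2] show ?thesis by (simp add: cutoff_def algebra_simps)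
  qed
  have sq: "smooth_upto k (\<lambda>p. complex_of_real ((u p)\<^sup>2))" if "smooth_upto k (\<lambda>p. complex_of_real (u p))"
    for k and u :: "real \<times> (real ^ 'd) \<times> (real ^ 'd) \<Rightarrow> real"
    using smooth_upto_mult[OF that that] by (simp add: power2_eq_square)
  have w1: "smooth_upto k (\<lambda>p. complex_of_real (fst (z - drift (t - fst p) (snd p)) $ i))" for k i
  proof -
    have "smooth_upto k (\<lambda>p::real \<times> (real ^ 'd) \<times> (real ^ 'd). complex_of_real (fst z $ i + (-1) * fst (snd p) $ i) + complex_of_real (- t + 1 * fst p) * complex_of_real (snd (snd p) $ i))"
      by (intro smooth_upto_add smooth_upto_mult lin r x v)
    then show ?thesis by (simp add: drift_def algebra_simps)
  qed
  have w2: "smooth_upto k (\<lambda>p. complex_of_real (snd (z - drift (t - fst p) (snd p)) $ i))" for k i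
    using lin[OF v, of k "snd z $ i" "-1"] by (simp add: drift_def)
  have N: "smooth_upto k (\<lambda>p. complex_of_real ((norm (z - drift (t - fst p) (snd p)))\<^sup>2))" for k
    unfolding power2_norm_prod_eq_sum of_real_add of_real_sum
    by (intro smooth_upto_add smooth_upto_sum sq w1 w2) auto
  have M: "smooth_upto k (\<lambda>p. complex_of_real (mollifier \<epsilon> (z - drift (t - fst p) (snd p))))" for k
  proof -
    have "smooth_upto k (\<lambda>p. complex_of_real (flat 0 (\<epsilon>\<^sup>2 + (-1) * (norm (z - drift (t - fst p) (snd p)))\<^sup>2)))"
      by (intro smooth_upto_compose[of flat, OF flat_deriv] lin N)
    from smooth_upto_mult[OF smooth_upto_const[of k "complex_of_real (1 / (\<integral>z. bump \<epsilon> (z::(real ^ 'd) \<times> (real ^ 'd)) \<partial>lborel))"] this]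
    show ?thesis by (simp add: mollifier_def bump_def)
  qed
  have sm: "smooth ?h"
    unfolding kinetic_test_def[abs_def] of_real_mult
    by (intro smooth_smooth_uptoI smooth_upto_mult th M)
  have nz: "c - 1 / m \<le> fst p \<and> fst p \<le> b + 1 / n \<and> norm (z - drift (t - fst p) (snd p)) \<le> \<epsilon>" if "?h p \<noteq> 0" for p
    using that cutoff_eq_0[OF nm, of b "fst p" c] mollifier_eq_0[OF _ \<epsilon>, of "z - drift (t - fst p) (snd p)"]
    by (auto simp: kinetic_test_def) (smt (verit))+
  have sub: "supp ?h \<subseteq> {c - 1 / m..b + 1 / n} \<times> UNIV"
    unfolding supp_def by (rule closure_minimal) (use nz in \<open>auto simp: closed_Times\<close>)
  define R where "R = (1 + (\<bar>t\<bar> + \<bar>c - 1 / m\<bar> + \<bar>b + 1 / n\<bar>)) * (norm z + \<epsilon>)"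
  have bd: "norm p \<le> (\<bar>c - 1 / m\<bar> + \<bar>b + 1 / n\<bar>) + R" if "?h p \<noteq> 0" for p
  proof -
    have *: "snd p = drift (fst p - t) (z - (z - drift (t - fst p) (snd p)))" by simp
    have "norm (snd p) \<le> (1 + \<bar>fst p - t\<bar>) * norm (z - (z - drift (t - fst p) (snd p)))"
      by (subst *) (rule norm_drift_le)
    also have "\<dots> \<le> R" unfolding R_def
      using nz[OF that] norm_triangle_ineq4[of z "z - drift (t - fst p) (snd p)"] by (intro mult_mono) auto
    finally have "norm (snd p) \<le> R" .
    moreover have "\<bar>fst p\<bar> \<le> \<bar>c - 1 / m\<bar> + \<bar>b + 1 / n\<bar>" using nz[OF that] by auto
    ultimately show ?thesis using norm_Pair_le[of "fst p" "snd p"] by simp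
  qed
  have "bounded {p. ?h p \<noteq> 0}" unfolding bounded_iff using bd by blast
  then have "compact (supp ?h)" unfolding supp_def by (simp add: compact_closure)
  then show ?thesis using sm sub S by (auto simp: test_functions_def)
qed

lemma mollifier_deriv_linear:
  "mollifier_deriv \<epsilon> (- b) w = - mollifier_deriv \<epsilon> b w"
  "mollifier_deriv \<epsilon> (b + b') w = mollifier_deriv \<epsilon> b w + mollifier_deriv \<epsilon> b' w"
  "mollifier_deriv \<epsilon> (a *\<^sub>R b) w = a * mollifier_deriv \<epsilon> b w"
  "mollifier_deriv \<epsilon> 0 w = 0"
  by (simp_all add: mollifier_deriv_def inner_add_right distrib_left right_diff_distrib add_divide_distrib diff_divide_distrib)

lemma kinetic_test_has_derivative:
  fixes z :: "(real ^ 'd::finite) \<times> (real ^ 'd)"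
  assumes \<theta>: "(\<theta> has_real_derivative \<theta>' (fst p)) (at (fst p))"
  shows "(kinetic_test t \<theta> \<epsilon> z has_derivative (\<lambda>q. complex_of_real
     (\<theta>' (fst p) * fst q * mollifier \<epsilon> (z - drift (t - fst p) (snd p))
      + \<theta> (fst p) * mollifier_deriv \<epsilon> ((fst q *\<^sub>R snd (snd p), 0) - drift (t - fst p) (snd q)) (z - drift (t - fst p) (snd p))))) (at p)"
proof -
  have 1: "((\<lambda>p. \<theta> (fst p)) has_derivative (\<lambda>q. \<theta>' (fst p) * fst q)) (at p)"
    using has_derivative_compose[of fst fst p UNIV \<theta> "\<lambda>h. \<theta>' (fst p) * h"] \<theta>
    by (simp add: has_field_derivative_def has_derivative_fst)
  have 2: "((\<lambda>p. z - drift (t - fst p) (snd p)) has_derivative (\<lambda>q. (fst q *\<^sub>R snd (snd p), 0) - drift (t - fst p) (snd q))) (at p)"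
    unfolding drift_def
    by (auto intro!: derivative_eq_intros simp: algebra_simps)
  from has_derivative_compose[OF 2 mollifier_has_derivative]
  have 3: "((\<lambda>p. mollifier \<epsilon> (z - drift (t - fst p) (snd p))) has_derivative
     (\<lambda>q. mollifier_deriv \<epsilon> ((fst q *\<^sub>R snd (snd p), 0) - drift (t - fst p) (snd q)) (z - drift (t - fst p) (snd p)))) (at p)" .
  show ?thesis unfolding kinetic_test_def[abs_def]
    by (rule has_derivative_of_real) (rule has_derivative_eq_rhs[OF has_derivative_mult[OF 1 3]], auto simp: algebra_simps)
qed

text \<open>
  The direction in which the transported point moves, when the time \<open>a\<close> remains, under a displacement of the
  \<open>i\<close>-th velocity component: \<open>(a e\<^sub>i, e\<^sub>i)\<close>.
\<close>

definition flow_dir :: "real \<Rightarrow> 'd::finite \<Rightarrow> (real ^ 'd) \<times> (real ^ 'd)" where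
  "flow_dir a i = drift a (0, axis i 1)"

lemma kinetic_test_transport:
  fixes z :: "(real ^ 'd::finite) \<times> (real ^ 'd)"
  assumes "(\<theta> has_real_derivative \<theta>' (fst p)) (at (fst p))"
  shows "transport (kinetic_test t \<theta> \<epsilon> z) p = complex_of_real (\<theta>' (fst p) * mollifier \<epsilon> (z - drift (t - fst p) (snd p)))"
proof -
  have "transport (kinetic_test t \<theta> \<epsilon> z) p = dir_deriv (1, snd (snd p), 0) (kinetic_test t \<theta> \<epsilon> z) p"
    by (simp add: transport_def case_prod_beta)
  also have "\<dots> = complex_of_real (\<theta>' (fst p) * mollifier \<epsilon> (z - drift (t - fst p) (snd p)))"
    by (subst dir_deriv_eq[OF kinetic_test_has_derivative[of \<theta> \<theta>', OF assms]])
      (simp add: drift_def mollifier_deriv_linear zero_prod_def[symmetric])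
  finally show ?thesis .
qed

lemma kinetic_test_grad:
  fixes z :: "(real ^ 'd::finite) \<times> (real ^ 'd)"
  assumes "(\<theta> has_real_derivative \<theta>' (fst p)) (at (fst p))"
  shows "dir_deriv (0, 0, axis i 1) (kinetic_test t \<theta> \<epsilon> z) p
    = complex_of_real (- (\<theta> (fst p) * mollifier_deriv \<epsilon> (flow_dir (t - fst p) i) (z - drift (t - fst p) (snd p))))"
  by (subst dir_deriv_eq[OF kinetic_test_has_derivative[of \<theta> \<theta>', OF assms]])
    (simp add: mollifier_deriv_linear zero_prod_def[symmetric] flow_dir_def)

section \<open>The equation along the flow\<close>

lemma step_measurable[measurable]: "step \<in> borel_measurable borel"
  unfolding step_def[abs_def] by measurable

lemma step'_measurable[measurable]: "step' \<in> borel_measurable borel"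
  unfolding step'_def[abs_def] by measurable

lemma cutoff_measurable[measurable]: "cutoff n b m c \<in> borel_measurable borel"
  unfolding cutoff_def[abs_def] by measurable

lemma mollifier_measurable[measurable]: "mollifier \<epsilon> \<in> borel_measurable borel"
  unfolding mollifier_def[abs_def] bump_def[abs_def] by measurable

lemma mollifier_deriv_measurable[measurable]: "mollifier_deriv \<epsilon> b \<in> borel_measurable borel"
  unfolding mollifier_deriv_def[abs_def] by measurable

text \<open>
  The functions \<open>- n step' (n (r - b))\<close> form an approximate identity concentrated to the right of \<open>b\<close>.
\<close>

lemma scaled_step'_integral:
  assumes "n > 0"
  shows "integrable lborel (\<lambda>r. n * step' (n * (r - b)))"
    and "(\<integral>r. n * step' (n * (r - b)) \<partial>lborel) = -1"
    and "(\<integral>r. \<bar>n * step' (n * (r - b))\<bar> \<partial>lborel) = (\<integral>r. \<bar>step' r\<bar> \<partial>lborel)"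
proof -
  have z: "step' x = 0" if "norm x \<ge> 1" for x using that by (intro step'_eq_0) auto
  have i: "integrable lborel step'" by (rule continuous_compact_support_integrable[OF step'_continuous z])
  have "integrable lborel (\<lambda>r. step' (- (n * b) + n * r))"
    using i assms by (subst lborel_integrable_real_affine_iff) auto
  then show "integrable lborel (\<lambda>r. n * step' (n * (r - b)))" by (simp add: algebra_simps)
  have "(\<integral>r. step' r \<partial>lborel) = (\<integral>r. step' r * indicator {0..1} r \<partial>lborel)"
  proof (rule Bochner_Integration.integral_cong[OF refl])
    show "step' r = step' r * indicator {0..1} r" for r
      using step'_eq_0[of r] by (cases "0 \<le> r \<and> r \<le> 1") (auto simp: indicator_def)
  qed
  also have "\<dots> = step 1 - step 0"
    by (intro integral_FTC_Icc_real step_deriv) (use step'_continuous[of UNIV] in \<open>auto simp: continuous_on_eq_continuous_at\<close>)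
  finally have v: "(\<integral>r. step' r \<partial>lborel) = -1" by (simp add: step_eq_0 step_eq_1)
  show "(\<integral>r. n * step' (n * (r - b)) \<partial>lborel) = -1"
    using lborel_integral_real_affine[of n step' "- (n * b)"] assms v by (simp add: algebra_simps)
  show "(\<integral>r. \<bar>n * step' (n * (r - b))\<bar> \<partial>lborel) = (\<integral>r. \<bar>step' r\<bar> \<partial>lborel)"
    using lborel_integral_real_affine[of n "\<lambda>r. \<bar>step' r\<bar>" "- (n * b)"] assms by (simp add: algebra_simps abs_mult)
qed

lemma flow_dir_decompose: "flow_dir a i = (0, axis i 1) + a *\<^sub>R (axis i 1, 0)"
  by (simp add: flow_dir_def drift_def)

lemma mollifier_deriv_flow_dir:
  "mollifier_deriv \<epsilon> (flow_dir a i) w = mollifier_deriv \<epsilon> (0, axis i 1) w + a * mollifier_deriv \<epsilon> (axis i 1, 0) w"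
  unfolding flow_dir_decompose by (simp only: mollifier_deriv_linear)

text \<open>
  A bounded weight of bounded support is square integrable, so its product with \<open>u\<close> is integrable and can be
  integrated slice by slice.
\<close>

lemma weighted_time_slices:
  fixes u :: "real \<times> 'a::euclidean_space \<Rightarrow> 'b::euclidean_space"
  assumes u: "u \<in> L2 lborel" and K[measurable]: "K \<in> borel_measurable borel"
    and C: "\<And>p. \<bar>K p\<bar> \<le> C" and R: "\<And>p. K p \<noteq> 0 \<Longrightarrow> norm p \<le> R"
  shows "integrable lborel (\<lambda>p. K p *\<^sub>R u p)"
    and "integrable lborel (\<lambda>r. \<integral>y. K (r, y) *\<^sub>R u (r, y) \<partial>lborel)"
    and "(\<integral>p. K p *\<^sub>R u p \<partial>lborel) = (\<integral>r. \<integral>y. K (r, y) *\<^sub>R u (r, y) \<partial>lborel \<partial>lborel)"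
proof -
  have [measurable]: "u \<in> borel_measurable borel" using L2_borel[OF u] .
  have C0: "C \<ge> 0" using C[of 0] by linarith
  have i: "integrable lborel (\<lambda>p. C *\<^sub>R (indicator (cball 0 R) p *\<^sub>R u p))"
    using L2_locally_integrable[OF u] by (intro integrable_scaleR_right) (simp add: locally_integrable_def)
  show I: "integrable lborel (\<lambda>p. K p *\<^sub>R u p)"
  proof (rule Bochner_Integration.integrable_bound[OF i])
    show "AE p in lborel. norm (K p *\<^sub>R u p) \<le> norm (C *\<^sub>R (indicator (cball 0 R) p *\<^sub>R u p))"
    proof (rule AE_I2)
      fix p show "norm (K p *\<^sub>R u p) \<le> norm (C *\<^sub>R (indicator (cball 0 R) p *\<^sub>R u p))"
        using C[of p] R[of p] C0 by (cases "K p = 0") (auto intro!: mult_right_mono)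
    qed
  qed measurable
  show "integrable lborel (\<lambda>r. \<integral>y. K (r, y) *\<^sub>R u (r, y) \<partial>lborel)"
    using integrable_section_integral[OF I] .
  show "(\<integral>p. K p *\<^sub>R u p \<partial>lborel) = (\<integral>r. \<integral>y. K (r, y) *\<^sub>R u (r, y) \<partial>lborel \<partial>lborel)"
    using integral_lborel_prod[OF I] by simp
qed

lemma kernel_weight_bounds:
  fixes k1 k2 :: "'a::euclidean_space \<Rightarrow> real"
  assumes k: "kernel k1" "kernel k2" and \<theta>: "\<And>r. \<bar>\<theta> r\<bar> \<le> 1" "\<And>r. \<theta> r \<noteq> 0 \<Longrightarrow> \<bar>r\<bar> \<le> a"
  shows "\<exists>C R. \<forall>p. \<bar>\<theta> (fst p) * (k1 (z - snd p) + (t - fst p) * k2 (z - snd p))\<bar> \<le> C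
    \<and> (\<theta> (fst p) * (k1 (z - snd p) + (t - fst p) * k2 (z - snd p)) \<noteq> 0 \<longrightarrow> norm p \<le> R)"
proof -
  obtain R1 B1 where 1: "\<And>z. norm z \<ge> R1 \<Longrightarrow> k1 z = 0" "\<And>z. \<bar>k1 z\<bar> \<le> B1" "B1 \<ge> 0" "R1 \<ge> 0"
    by (rule kernel_bounds[OF k(1)], rule that)
  obtain R2 B2 where 2: "\<And>z. norm z \<ge> R2 \<Longrightarrow> k2 z = 0" "\<And>z. \<bar>k2 z\<bar> \<le> B2" "B2 \<ge> 0" "R2 \<ge> 0"
    by (rule kernel_bounds[OF k(2)], rule that)
  show ?thesis
  proof (intro exI allI conjI impI)
    fix p :: "real \<times> 'a"
    define r y where "r = fst p" and "y = snd p"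
    have "\<bar>\<theta> r * (k1 (z - y) + (t - r) * k2 (z - y))\<bar> \<le> 1 * (B1 + (\<bar>t\<bar> + \<bar>a\<bar>) * B2)"
    proof (cases "\<theta> r = 0")
      case False
      then have "\<bar>t - r\<bar> \<le> \<bar>t\<bar> + \<bar>a\<bar>" using \<theta>(2)[of r] by linarith
      then have "\<bar>(t - r) * k2 (z - y)\<bar> \<le> (\<bar>t\<bar> + \<bar>a\<bar>) * B2"
        using 2(2)[of "z - y"] by (auto simp: abs_mult intro!: mult_mono)
      then have "\<bar>k1 (z - y) + (t - r) * k2 (z - y)\<bar> \<le> B1 + (\<bar>t\<bar> + \<bar>a\<bar>) * B2" using 1(2)[of "z - y"] by linarith
      then show ?thesis using \<theta>(1)[of r] unfolding abs_mult by (intro mult_mono) auto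
    qed (use 1 2 in auto)
    then show "\<bar>\<theta> (fst p) * (k1 (z - snd p) + (t - fst p) * k2 (z - snd p))\<bar> \<le> 1 * (B1 + (\<bar>t\<bar> + \<bar>a\<bar>) * B2)"
      by (simp add: r_def y_def)
    assume "\<theta> (fst p) * (k1 (z - snd p) + (t - fst p) * k2 (z - snd p)) \<noteq> 0"
    then have nz: "\<theta> r * (k1 (z - y) + (t - r) * k2 (z - y)) \<noteq> 0" by (simp add: r_def y_def)
    then have "norm (z - y) \<le> max R1 R2" using 1(1)[of "z - y"] 2(1)[of "z - y"] by (cases "norm (z - y) \<le> max R1 R2") auto
    then have "norm y \<le> norm z + max R1 R2" using norm_triangle_ineq4[of z "z - y"] by simp
    moreover have "\<bar>r\<bar> \<le> a" using nz \<theta>(2) by auto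
    ultimately show "norm p \<le> a + (norm z + max R1 R2)"
      using norm_Pair_le[of r y] by (simp add: r_def y_def)
  qed
qed

lemma time_slices_flow_kernel:
  fixes u :: "real \<times> (real ^ 'd::finite) \<times> (real ^ 'd) \<Rightarrow> 'b::euclidean_space"
  assumes u: "u \<in> L2 lborel" and \<epsilon>: "\<epsilon> > 0" and [measurable]: "\<theta> \<in> borel_measurable borel"
    and \<theta>: "\<And>r. \<bar>\<theta> r\<bar> \<le> 1" "\<And>r. \<theta> r \<noteq> 0 \<Longrightarrow> \<bar>r\<bar> \<le> a"
  shows "integrable lborel (\<lambda>p. (\<theta> (fst p) * mollifier_deriv \<epsilon> (flow_dir (t - fst p) i) (z - snd p)) *\<^sub>R u p)"
    and "integrable lborel (\<lambda>r. \<theta> r *\<^sub>R conv (mollifier_deriv \<epsilon> (flow_dir (t - r) i)) (\<lambda>y. u (r, y)) z)"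
    and "(\<integral>p. (\<theta> (fst p) * mollifier_deriv \<epsilon> (flow_dir (t - fst p) i) (z - snd p)) *\<^sub>R u p \<partial>lborel)
      = (\<integral>r. \<theta> r *\<^sub>R conv (mollifier_deriv \<epsilon> (flow_dir (t - r) i)) (\<lambda>y. u (r, y)) z \<partial>lborel)"
proof -
  let ?K = "\<lambda>p::real \<times> (real ^ 'd) \<times> (real ^ 'd). \<theta> (fst p) * mollifier_deriv \<epsilon> (flow_dir (t - fst p) i) (z - snd p)"
  have "\<exists>C R. \<forall>p. \<bar>?K p\<bar> \<le> C \<and> (?K p \<noteq> 0 \<longrightarrow> norm p \<le> R)"
    using kernel_weight_bounds[where \<theta>=\<theta> and z=z and t=t, OF mollifier_deriv_kernel[OF \<epsilon>, of "(0, axis i 1)"] mollifier_deriv_kernel[OF \<epsilon>, of "(axis i 1, 0)"] \<theta>]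
    unfolding mollifier_deriv_flow_dir .
  then obtain C R where CR: "\<forall>p. \<bar>?K p\<bar> \<le> C \<and> (?K p \<noteq> 0 \<longrightarrow> norm p \<le> R)" by blast
  have K: "?K \<in> borel_measurable borel" unfolding mollifier_deriv_flow_dir by measurable
  note W = weighted_time_slices[OF u K, of C R]
  have e: "(\<integral>y. ?K (r, y) *\<^sub>R u (r, y) \<partial>lborel) = \<theta> r *\<^sub>R conv (mollifier_deriv \<epsilon> (flow_dir (t - r) i)) (\<lambda>y. u (r, y)) z" for r
    by (simp add: conv_def flip: scaleR_scaleR)
  show "integrable lborel (\<lambda>p. ?K p *\<^sub>R u p)" using W(1) CR by blast
  show "integrable lborel (\<lambda>r. \<theta> r *\<^sub>R conv (mollifier_deriv \<epsilon> (flow_dir (t - r) i)) (\<lambda>y. u (r, y)) z)"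
    using W(2) CR unfolding e by blast
  show "(\<integral>p. ?K p *\<^sub>R u p \<partial>lborel) = (\<integral>r. \<theta> r *\<^sub>R conv (mollifier_deriv \<epsilon> (flow_dir (t - r) i)) (\<lambda>y. u (r, y)) z \<partial>lborel)"
    using W(3) CR unfolding e by blast
qed

lemma time_slices_kernel:
  fixes u :: "real \<times> (real ^ 'd::finite) \<times> (real ^ 'd) \<Rightarrow> 'b::euclidean_space"
  assumes u: "u \<in> L2 lborel" and \<epsilon>: "\<epsilon> > 0" and [measurable]: "\<theta> \<in> borel_measurable borel"
    and \<theta>: "\<And>r. \<bar>\<theta> r\<bar> \<le> C0" "\<And>r. \<theta> r \<noteq> 0 \<Longrightarrow> \<bar>r\<bar> \<le> a"
  shows "integrable lborel (\<lambda>p. (\<theta> (fst p) * mollifier \<epsilon> (z - snd p)) *\<^sub>R u p)"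
    and "integrable lborel (\<lambda>r. \<theta> r *\<^sub>R conv (mollifier \<epsilon>) (\<lambda>y. u (r, y)) z)"
    and "(\<integral>p. (\<theta> (fst p) * mollifier \<epsilon> (z - snd p)) *\<^sub>R u p \<partial>lborel)
      = (\<integral>r. \<theta> r *\<^sub>R conv (mollifier \<epsilon>) (\<lambda>y. u (r, y)) z \<partial>lborel)"
proof -
  let ?K = "\<lambda>p::real \<times> (real ^ 'd) \<times> (real ^ 'd). \<theta> (fst p) * mollifier \<epsilon> (z - snd p)"
  let ?D = "\<bar>C0\<bar> + 1"
  have zk: "kernel (\<lambda>_. 0 :: real)" by (simp add: kernel_def)
  have b: "\<bar>\<theta> r / ?D\<bar> \<le> 1" "\<theta> r / ?D \<noteq> 0 \<Longrightarrow> \<bar>r\<bar> \<le> a" for r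
    using \<theta>[of r] by (auto simp: abs_divide divide_le_eq)
  have "\<exists>C R. \<forall>p. \<bar>\<theta> (fst p) / ?D * mollifier \<epsilon> (z - snd p)\<bar> \<le> C \<and> (\<theta> (fst p) / ?D * mollifier \<epsilon> (z - snd p) \<noteq> 0 \<longrightarrow> norm p \<le> R)"
    using kernel_weight_bounds[where \<theta>="\<lambda>r. \<theta> r / ?D" and z=z and t=t, OF mollifier_kernel[OF \<epsilon>] zk b] by simp
  then obtain C R where CR0: "\<forall>p. \<bar>\<theta> (fst p) / ?D * mollifier \<epsilon> (z - snd p)\<bar> \<le> C \<and> (\<theta> (fst p) / ?D * mollifier \<epsilon> (z - snd p) \<noteq> 0 \<longrightarrow> norm p \<le> R)"
    by blast
  have D0: "?D > 0" by simp
  have CR: "\<forall>p. \<bar>?K p\<bar> \<le> C * ?D \<and> (?K p \<noteq> 0 \<longrightarrow> norm p \<le> R)"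
  proof
    fix p
    have "\<theta> (fst p) / ?D * mollifier \<epsilon> (z - snd p) = ?K p / ?D" by simp
    then have "\<bar>?K p / ?D\<bar> \<le> C \<and> (?K p / ?D \<noteq> 0 \<longrightarrow> norm p \<le> R)" using CR0 by metis
    then show "\<bar>?K p\<bar> \<le> C * ?D \<and> (?K p \<noteq> 0 \<longrightarrow> norm p \<le> R)"
      using D0 by (auto simp: abs_divide divide_le_eq)
  qed
  have K: "?K \<in> borel_measurable borel" by measurable
  note W = weighted_time_slices[OF u K, of "C * ?D" R]
  have e: "(\<integral>y. ?K (r, y) *\<^sub>R u (r, y) \<partial>lborel) = \<theta> r *\<^sub>R conv (mollifier \<epsilon>) (\<lambda>y. u (r, y)) z" for r
    by (simp add: conv_def flip: scaleR_scaleR)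
  show "integrable lborel (\<lambda>p. ?K p *\<^sub>R u p)" using W(1) CR by blast
  show "integrable lborel (\<lambda>r. \<theta> r *\<^sub>R conv (mollifier \<epsilon>) (\<lambda>y. u (r, y)) z)"
    using W(2) CR unfolding e by blast
  show "(\<integral>p. ?K p *\<^sub>R u p \<partial>lborel) = (\<integral>r. \<theta> r *\<^sub>R conv (mollifier \<epsilon>) (\<lambda>y. u (r, y)) z \<partial>lborel)"
    using W(3) CR unfolding e by blast
qed

text \<open>
  The coordinates \<open>(r, z)\<close> of the moving frame label a particle at time \<open>r\<close> by the phase space point \<open>z\<close> that it
  reaches at time \<open>t\<close>.
\<close>

definition flow :: "real \<Rightarrow> real \<times> (real ^ 'd::finite) \<times> (real ^ 'd) \<Rightarrow> real \<times> (real ^ 'd) \<times> (real ^ 'd)" where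
  "flow t p = (fst p, drift (fst p - t) (snd p))"

lemma flow_borel[measurable]: "flow t \<in> borel_measurable borel"
  unfolding flow_def[abs_def] by measurable

lemma flow_measure_preserving: "distr lborel borel (flow t) = lborel"
  unfolding flow_def[abs_def] by (rule drift_time_measure_preserving) simp

lemmas flow_integral = measure_preserving_integral[OF flow_measure_preserving flow_borel]
lemmas flow_L2 = measure_preserving_L2[OF flow_measure_preserving flow_borel]
lemmas flow_AE = measure_preserving_AE[OF flow_measure_preserving flow_borel]

lemma flow_simps[simp]: "fst (flow t p) = fst p" "drift (t - fst p) (snd (flow t p)) = snd p"
  by (simp_all add: flow_def)

text \<open>
  The moving mollifiers converge pointwise and stay supported in a fixed ball, as \<open>r\<close> varies in a bounded set.
\<close>

lemma drift_pairing_continuous: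
  fixes g :: "(real ^ 'd::finite) \<times> (real ^ 'd) \<Rightarrow> 'b::euclidean_space"
  assumes g: "locally_integrable g" and \<epsilon>: "\<epsilon> > 0"
  shows "continuous_on UNIV (\<lambda>r. \<integral>y. mollifier \<epsilon> (z - drift r y) *\<^sub>R g y \<partial>lborel)"
  unfolding continuous_on_sequentially
proof (intro ballI allI impI, elim conjE)
  fix x :: "nat \<Rightarrow> real" and a assume x: "x \<longlonglongrightarrow> a"
  obtain R B where RB: "\<And>z. norm z \<ge> R \<Longrightarrow> mollifier \<epsilon> (z :: (real ^ 'd) \<times> (real ^ 'd)) = 0"
     "\<And>z. \<bar>mollifier \<epsilon> (z :: (real ^ 'd) \<times> (real ^ 'd))\<bar> \<le> B" "B \<ge> 0" "R \<ge> 0"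
    by (rule kernel_bounds[OF mollifier_kernel[OF \<epsilon>]], rule that)
  obtain K where K: "\<And>n. \<bar>x n\<bar> \<le> K" using convergent_imp_bounded[OF x] by (auto simp: bounded_iff)
  have [measurable]: "g \<in> borel_measurable borel" using g by (simp add: locally_integrable_def)
  define R' where "R' = (1 + K) * (norm z + R)"
  have i: "integrable lborel (\<lambda>y. B * norm (indicator (cball 0 R') y *\<^sub>R g y))"
    using g by (intro integrable_mult_right integrable_norm) (auto simp: locally_integrable_def)
  have "(\<lambda>n. \<integral>y. mollifier \<epsilon> (z - drift (x n) y) *\<^sub>R g y \<partial>lborel) \<longlonglongrightarrow> (\<integral>y. mollifier \<epsilon> (z - drift a y) *\<^sub>R g y \<partial>lborel)"
  proof (rule integral_dominated_convergence[OF _ _ i])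
    show "AE y in lborel. (\<lambda>n. mollifier \<epsilon> (z - drift (x n) y) *\<^sub>R g y) \<longlonglongrightarrow> mollifier \<epsilon> (z - drift a y) *\<^sub>R g y"
    proof (intro AE_I2 tendsto_scaleR tendsto_const)
      fix y :: "(real ^ 'd) \<times> (real ^ 'd)"
      have "isCont (mollifier \<epsilon>) w" for w :: "(real ^ 'd) \<times> (real ^ 'd)"
        using kernel_continuous[OF mollifier_kernel[OF \<epsilon>, where 'a="(real ^ 'd) \<times> (real ^ 'd)"]]
        using continuous_on_eq_continuous_at by blast
      then show "(\<lambda>n. mollifier \<epsilon> (z - drift (x n) y)) \<longlonglongrightarrow> mollifier \<epsilon> (z - drift a y)"
        by (rule isCont_tendsto_compose) (unfold drift_def, intro tendsto_intros x)
    qed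
    show "AE y in lborel. norm (mollifier \<epsilon> (z - drift (x n) y) *\<^sub>R g y) \<le> B * norm (indicator (cball 0 R') y *\<^sub>R g y)" for n
    proof (rule AE_I2)
      fix y
      show "norm (mollifier \<epsilon> (z - drift (x n) y) *\<^sub>R g y) \<le> B * norm (indicator (cball 0 R') y *\<^sub>R g y)"
      proof (cases "norm (z - drift (x n) y) \<ge> R")
        case False
        have "norm y = norm (drift (- x n) (z - (z - drift (x n) y)))" by simp
        also have "\<dots> \<le> (1 + \<bar>- x n\<bar>) * norm (z - (z - drift (x n) y))" by (rule norm_drift_le)
        also have "\<dots> \<le> R'" unfolding R'_def
          using K[of n] False norm_triangle_ineq4[of z "z - drift (x n) y"] by (intro mult_mono) auto
        finally show ?thesis using RB(2)[of "z - drift (x n) y"] by (auto intro!: mult_right_mono)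
      qed (use RB in auto)
    qed
  qed measurable
  then show "((\<lambda>r. \<integral>y. mollifier \<epsilon> (z - drift r y) *\<^sub>R g y \<partial>lborel) \<circ> x) \<longlonglongrightarrow> (\<integral>y. mollifier \<epsilon> (z - drift a y) *\<^sub>R g y \<partial>lborel)"
    by (simp add: comp_def)
qed

text \<open>
  A weak solution together with Borel representatives: \<open>F0\<close> of \<open>f\<close> on a time strip slightly longer than
  \<open>[s, t]\<close>, so that cut-offs have room after time \<open>t\<close>, \<open>G0\<close> of its velocity gradient \<open>G\<close>, and \<open>B\<close> of the coefficients.
\<close>

locale weak_kinetic_solution =
  fixes A B :: "real \<times> (real ^ 'd::finite) \<times> (real ^ 'd) \<Rightarrow> complex ^ 'd ^ 'd"
    and s t :: real and \<psi> \<psi>0 :: "(real ^ 'd) \<times> (real ^ 'd) \<Rightarrow> complex"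
    and f :: "real \<Rightarrow> (real ^ 'd) \<times> (real ^ 'd) \<Rightarrow> complex" and F0 :: "real \<times> (real ^ 'd) \<times> (real ^ 'd) \<Rightarrow> complex"
    and G G0 :: "real \<times> (real ^ 'd) \<times> (real ^ 'd) \<Rightarrow> complex ^ 'd"
  assumes st: "s < t"
    and weak_grad: "weak_grad_v s f G"
    and weak_eq: "\<And>h. h \<in> test_functions UNIV \<Longrightarrow>
           - (\<integral>p. f (fst p) (snd p) * transport (\<lambda>q. cnj (h q)) p \<partial>lebesgue_on ({s..} \<times> UNIV))
           + (\<integral>p. herm (A p *v G p) (grad_v h p) \<partial>lebesgue_on ({s..} \<times> UNIV))
           = (\<integral>z. \<psi> z * cnj (h (s, z)) \<partial>lebesgue)"
    and cont: "L2_continuous_from s f"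
    and F0: "F0 \<in> L2 lborel" "AE p in lborel. (if p \<in> {s..t + 1} \<times> UNIV then f (fst p) (snd p) else 0) = F0 p"
    and G0: "G0 \<in> L2 lborel" "AE p in lborel. (if p \<in> {s<..} \<times> UNIV then G p else 0) = G0 p"
    and B: "B \<in> borel_measurable borel" "AE p in lborel. A p = B p"
    and H0: "(\<lambda>p. B p *v G0 p) \<in> L2 lborel"
    and \<psi>0: "\<psi>0 \<in> L2 lborel" "AE z in lborel. \<psi> z = \<psi>0 z"
begin

text \<open>
  The solution, its velocity gradient, the flux \<open>A \<nabla>\<^sub>v f\<close> and the initial value in the moving frame.
\<close>

definition "FF p = F0 (flow t p)"
definition "GG p = G0 (flow t p)"
definition "HH p = B (flow t p) *v G0 (flow t p)"
definition "\<psi>\<psi> z = \<psi>0 (drift (s - t) z)"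

lemma FF: "FF \<in> L2 lborel" unfolding FF_def[abs_def] by (rule flow_L2[OF F0(1)])
lemma GG: "GG \<in> L2 lborel" unfolding GG_def[abs_def] by (rule flow_L2[OF G0(1)])
lemma HH: "HH \<in> L2 lborel" unfolding HH_def[abs_def] by (rule flow_L2[OF H0])
lemma \<psi>\<psi>: "\<psi>\<psi> \<in> L2 lborel" unfolding \<psi>\<psi>_def[abs_def] by (rule drift_L2[OF \<psi>0(1)])

lemma vec_nth_L2: 
  fixes U :: "'x \<Rightarrow> complex ^ 'd"
  assumes "U \<in> L2 M" shows "(\<lambda>p. U p $ i) \<in> L2 M"
proof (rule L2_bound[OF assms, where C=1])
  show "(\<lambda>p. U p $ i) \<in> borel_measurable M"
    using measurable_compose[OF L2_measurable[OF assms] borel_measurable_continuous_onI[OF linear_continuous_on[OF bounded_linear_vec_nth]]] .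
  show "norm (U x $ i) \<le> 1 * norm (U x)" for x by (simp add: Finite_Cartesian_Product.norm_nth_le)
qed

text \<open>
  The definition of the weak gradient, tested with \<open>kinetic_test\<close> and written in the moving frame.
\<close>

lemma gradient_identity_tested:
  assumes \<epsilon>: "\<epsilon> > 0" and n: "n > 0" "m > 0" and r: "c - 1 / m > s" "b + 1 / n \<le> t + 1"
  shows "(\<integral>r. cutoff n b m c r *\<^sub>R conv (mollifier_deriv \<epsilon> (flow_dir (t - r) i)) (\<lambda>y. FF (r, y)) z \<partial>lborel)
    = (\<integral>r. cutoff n b m c r *\<^sub>R conv (mollifier \<epsilon>) (\<lambda>y. GG (r, y) $ i) z \<partial>lborel)"
proof -
  let ?\<theta> = "cutoff n b m c"
  have \<theta>0: "?\<theta> r = 0" if "r \<notin> {s<..t + 1}" for r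
    using that r by (intro cutoff_eq_0 n) auto
  have \<theta>b: "\<bar>?\<theta> r\<bar> \<le> 1" for r
    using step_bounds by (auto simp: cutoff_def abs_mult intro!: mult_le_one)
  have \<theta>s: "?\<theta> r \<noteq> 0 \<Longrightarrow> \<bar>r\<bar> \<le> \<bar>s\<bar> + \<bar>t + 1\<bar>" for r
    using \<theta>0[of r] by fastforce
  have "kinetic_test t ?\<theta> \<epsilon> z \<in> test_functions ({s<..} \<times> UNIV)"
    using r by (intro kinetic_test_in_test_functions n \<epsilon>) auto
  then have W: "(\<integral>p. f (fst p) (snd p) * dir_deriv (0, 0, axis i 1) (kinetic_test t ?\<theta> \<epsilon> z) p \<partial>lebesgue_on ({s<..} \<times> UNIV)) =
        - (\<integral>p. G p $ i * kinetic_test t ?\<theta> \<epsilon> z p \<partial>lebesgue_on ({s<..} \<times> UNIV))"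
    using weak_grad unfolding weak_grad_v_def by blast
  note [measurable] = L2_borel[OF F0(1)] L2_borel[OF vec_nth_L2[OF G0(1)]] L2_borel[OF FF] L2_borel[OF vec_nth_L2[OF GG]]
  let ?K = "\<lambda>p. ?\<theta> (fst p) * mollifier_deriv \<epsilon> (flow_dir (t - fst p) i) (z - drift (t - fst p) (snd p))"
  let ?k = "\<lambda>p. ?\<theta> (fst p) * mollifier \<epsilon> (z - drift (t - fst p) (snd p))"
  have o: "{s<..} \<times> UNIV \<in> sets (borel :: (real \<times> (real ^ 'd) \<times> (real ^ 'd)) measure)"
    by (intro borel_Times) auto
  have "(\<integral>p. f (fst p) (snd p) * dir_deriv (0, 0, axis i 1) (kinetic_test t ?\<theta> \<epsilon> z) p \<partial>lebesgue_on ({s<..} \<times> UNIV))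
    = (\<integral>p. - (?K p *\<^sub>R F0 p) \<partial>lborel)"
  proof (rule integral_lebesgue_on_eq_lborel[OF _ _ o])
    show "AE p in lborel. (if p \<in> {s<..} \<times> UNIV then f (fst p) (snd p) * dir_deriv (0, 0, axis i 1) (kinetic_test t ?\<theta> \<epsilon> z) p else 0) = - (?K p *\<^sub>R F0 p)"
      using F0(2)
    proof eventually_elim
      case (elim p)
      show ?case
      proof (cases "fst p \<in> {s<..t + 1}")
        case True
        then have "f (fst p) (snd p) = F0 p" using elim by (auto simp: mem_Times_iff)
        then show ?thesis using True
          by (simp add: mem_Times_iff kinetic_test_grad[of ?\<theta> "cutoff' n b m c", OF cutoff_deriv] scaleR_conv_of_real)
      qed (use \<theta>0[of "fst p"] in \<open>simp add: kinetic_test_grad[of ?\<theta> "cutoff' n b m c", OF cutoff_deriv]\<close>)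
    qed
    show "(\<lambda>p. - (?K p *\<^sub>R F0 p)) \<in> borel_measurable borel"
      unfolding mollifier_deriv_flow_dir by measurable
  qed
  also have "\<dots> = (\<integral>p. - ((?\<theta> (fst p) * mollifier_deriv \<epsilon> (flow_dir (t - fst p) i) (z - snd p)) *\<^sub>R FF p) \<partial>lborel)"
    by (subst flow_integral[symmetric, where t=t]) (unfold mollifier_deriv_flow_dir, measurable, simp add: FF_def)
  also have "\<dots> = - (\<integral>r. ?\<theta> r *\<^sub>R conv (mollifier_deriv \<epsilon> (flow_dir (t - r) i)) (\<lambda>y. FF (r, y)) z \<partial>lborel)"
    by (subst Bochner_Integration.integral_minus, rule arg_cong[where f=uminus])
      (rule time_slices_flow_kernel(3)[OF FF \<epsilon> cutoff_measurable \<theta>b \<theta>s])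
  finally have L: "(\<integral>p. f (fst p) (snd p) * dir_deriv (0, 0, axis i 1) (kinetic_test t ?\<theta> \<epsilon> z) p \<partial>lebesgue_on ({s<..} \<times> UNIV))
    = - (\<integral>r. ?\<theta> r *\<^sub>R conv (mollifier_deriv \<epsilon> (flow_dir (t - r) i)) (\<lambda>y. FF (r, y)) z \<partial>lborel)" .
  have "(\<integral>p. G p $ i * kinetic_test t ?\<theta> \<epsilon> z p \<partial>lebesgue_on ({s<..} \<times> UNIV)) = (\<integral>p. ?k p *\<^sub>R (G0 p $ i) \<partial>lborel)"
  proof (rule integral_lebesgue_on_eq_lborel[OF _ _ o])
    show "AE p in lborel. (if p \<in> {s<..} \<times> UNIV then G p $ i * kinetic_test t ?\<theta> \<epsilon> z p else 0) = ?k p *\<^sub>R (G0 p $ i)"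
      using G0(2) by eventually_elim (auto simp: kinetic_test_def scaleR_conv_of_real split: if_splits)
    show "(\<lambda>p. ?k p *\<^sub>R (G0 p $ i)) \<in> borel_measurable borel" by measurable
  qed
  also have "\<dots> = (\<integral>p. (?\<theta> (fst p) * mollifier \<epsilon> (z - snd p)) *\<^sub>R (GG p $ i) \<partial>lborel)"
    by (subst flow_integral[symmetric, where t=t]) (measurable, simp add: GG_def)
  also have "\<dots> = (\<integral>r. ?\<theta> r *\<^sub>R conv (mollifier \<epsilon>) (\<lambda>y. GG (r, y) $ i) z \<partial>lborel)"
    by (rule time_slices_kernel(3)[OF vec_nth_L2[OF GG] \<epsilon> cutoff_measurable \<theta>b \<theta>s])
  finally show ?thesis using L W by simp
qed

text \<open>
  In the moving frame the mollified velocity gradient is the derivative of the mollified solution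
  along \<open>flow_dir\<close>. The tested identity holds for enough time cut-offs to determine both sides at almost every
  time.
\<close>

lemma gradient_identity:
  assumes \<epsilon>: "\<epsilon> > 0"
  shows "AE r in lborel. s < r \<and> r \<le> t \<longrightarrow>
    conv (mollifier_deriv \<epsilon> (flow_dir (t - r) i)) (\<lambda>y. FF (r, y)) z = conv (mollifier \<epsilon>) (\<lambda>y. GG (r, y) $ i) z"
proof -
  define D where "D r = conv (mollifier_deriv \<epsilon> (flow_dir (t - r) i)) (\<lambda>y. FF (r, y)) z - conv (mollifier \<epsilon>) (\<lambda>y. GG (r, y) $ i) z" for r
  have I: "integrable lborel (\<lambda>r. \<theta> r *\<^sub>R D r)"
    if [measurable]: "\<theta> \<in> borel_measurable borel" and b: "\<And>r. \<bar>\<theta> r\<bar> \<le> 1" "\<And>r. \<theta> r \<noteq> 0 \<Longrightarrow> \<bar>r\<bar> \<le> a" for \<theta> a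
    unfolding D_def scaleR_diff_right
    by (intro Bochner_Integration.integrable_diff time_slices_flow_kernel(2)[OF FF \<epsilon> that] time_slices_kernel(2)[OF vec_nth_L2[OF GG] \<epsilon> that])
  have ab: "\<bar>r\<bar> \<le> \<bar>s\<bar> + \<bar>t + 1\<bar>" if "s \<le> r" "r \<le> t + 1" for r using that by linarith
  have IT: "integrable lborel (\<lambda>r. indicator {s<..t + 1} r *\<^sub>R D r)"
    by (rule I[of _ "\<bar>s\<bar> + \<bar>t + 1\<bar>"]) (auto simp: indicator_def intro!: ab split: if_splits)
  have It: "integrable lborel (\<lambda>r. indicator {s<..t} r *\<^sub>R D r)"
    by (rule I[of _ "\<bar>s\<bar> + \<bar>t + 1\<bar>"]) (auto simp: indicator_def intro!: ab split: if_splits)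
  have z: "(\<integral>r. indicator {s<..b} r *\<^sub>R D r \<partial>lborel) = 0" if b: "s < b" "b \<le> t" for b
  proof -
    have N: "0 < 1 / real (Suc n)" "1 / real (Suc n) \<le> 1" "2 / real (Suc n) = 2 * (1 / real (Suc n))" for n by auto
    \<comment> \<open>The ramp from \<open>s + 1 / (n + 1)\<close> to \<open>s + 2 / (n + 1)\<close> keeps the support inside \<open>(s, \<infinity>)\<close>.\<close>
    define \<theta> where "\<theta> n = cutoff (real (Suc n)) b (real (Suc n)) (s + 2 / real (Suc n))" for n
    have \<theta>0: "\<theta> n r = 0" if "r \<notin> {s<..t + 1}" for r n
    proof -
      have "r \<ge> b + 1 / real (Suc n) \<or> r \<le> s + 2 / real (Suc n) - 1 / real (Suc n)"
        using that b N[of n] unfolding greaterThanAtMost_iff by linarith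
      then show ?thesis unfolding \<theta>_def by (intro cutoff_eq_0) auto
    qed
    have \<theta>b: "\<bar>\<theta> n r\<bar> \<le> 1" for n r
      unfolding \<theta>_def using step_bounds by (auto simp: cutoff_def abs_mult intro!: mult_le_one)
    have \<theta>s: "\<theta> n r \<noteq> 0 \<Longrightarrow> \<bar>r\<bar> \<le> \<bar>s\<bar> + \<bar>t + 1\<bar>" for n r
      using \<theta>0[of r n] by (intro ab) fastforce+
    have [measurable]: "\<theta> n \<in> borel_measurable borel" for n unfolding \<theta>_def by measurable
    have 0: "(\<integral>r. \<theta> n r *\<^sub>R D r \<partial>lborel) = 0" for n
    proof -
      have "s + 2 / real (Suc n) - 1 / real (Suc n) > s" "b + 1 / real (Suc n) \<le> t + 1" using b N[of n] by linarith+
      then have "(\<integral>r. \<theta> n r *\<^sub>R conv (mollifier_deriv \<epsilon> (flow_dir (t - r) i)) (\<lambda>y. FF (r, y)) z \<partial>lborel)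
        = (\<integral>r. \<theta> n r *\<^sub>R conv (mollifier \<epsilon>) (\<lambda>y. GG (r, y) $ i) z \<partial>lborel)"
        unfolding \<theta>_def by (intro gradient_identity_tested \<epsilon>) auto
      moreover have "integrable lborel (\<lambda>r. \<theta> n r *\<^sub>R conv (mollifier_deriv \<epsilon> (flow_dir (t - r) i)) (\<lambda>y. FF (r, y)) z)"
        by (rule time_slices_flow_kernel(2)[OF FF \<epsilon> _ \<theta>b \<theta>s]) measurable
      moreover have "integrable lborel (\<lambda>r. \<theta> n r *\<^sub>R conv (mollifier \<epsilon>) (\<lambda>y. GG (r, y) $ i) z)"
        by (rule time_slices_kernel(2)[OF vec_nth_L2[OF GG] \<epsilon> _ \<theta>b \<theta>s]) measurable
      ultimately show ?thesis unfolding D_def scaleR_diff_right by simp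
    qed
    have "(\<lambda>n. \<integral>r. \<theta> n r *\<^sub>R D r \<partial>lborel) \<longlonglongrightarrow> (\<integral>r. indicator {s<..b} r *\<^sub>R D r \<partial>lborel)"
    proof (rule integral_dominated_convergence[where w="\<lambda>r. norm (indicator {s<..t + 1} r *\<^sub>R D r)"])
      show "integrable lborel (\<lambda>r. norm (indicator {s<..t + 1} r *\<^sub>R D r))" by (rule integrable_norm[OF IT])
      show "AE r in lborel. norm (\<theta> n r *\<^sub>R D r) \<le> norm (indicator {s<..t + 1} r *\<^sub>R D r)" for n
        using \<theta>b[of n] \<theta>0[of _ n] by (intro AE_I2) (auto simp: indicator_def intro!: mult_left_le_one_le)
      show "(\<lambda>r. \<theta> n r *\<^sub>R D r) \<in> borel_measurable lborel" for n
        by (rule borel_measurable_integrable, rule I[OF _ \<theta>b \<theta>s]) measurable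
      show "(\<lambda>r. indicator {s<..b} r *\<^sub>R D r) \<in> borel_measurable lborel"
        by (rule borel_measurable_integrable, rule I[of _ "\<bar>s\<bar> + \<bar>t + 1\<bar>"])
          (use b in \<open>auto simp: indicator_def intro!: ab split: if_splits\<close>)
      show "AE r in lborel. (\<lambda>n. \<theta> n r *\<^sub>R D r) \<longlonglongrightarrow> indicator {s<..b} r *\<^sub>R D r"
      proof (intro AE_I2 tendsto_scaleR tendsto_const)
        fix r
        have "\<forall>\<^sub>F n in sequentially. \<theta> n r = indicator {s<..b} r"
        proof (cases "r \<le> s")
          case True
          then show ?thesis using \<theta>0[of r] by (auto simp: indicator_def)
        next
          case False
          define d where "d = min (r - s) (if r \<le> b then 1 else r - b)"
          have "d > 0" using False by (auto simp: d_def)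
          then obtain N where N: "2 / d < real (Suc N)" using reals_Archimedean2 less_trans by (metis lessI of_nat_less_iff)
          have "\<theta> n r = indicator {s<..b} r" if "n \<ge> N" for n
          proof -
            have "2 / d < real (Suc n)" using N that by simp
            then have nd: "2 < real (Suc n) * d" using \<open>d > 0\<close> by (simp add: pos_divide_less_eq)
            have 1: "real (Suc n) * (s + 2 / real (Suc n) - r) \<le> 0"
            proof -
              have "real (Suc n) * d \<le> real (Suc n) * (r - s)" by (intro mult_left_mono) (auto simp: d_def)
              moreover have "real (Suc n) * (s + 2 / real (Suc n) - r) = 2 - real (Suc n) * (r - s)" by (simp add: field_simps)
              ultimately show ?thesis using nd by linarith
            qed
            show ?thesis
            proof (cases "r \<le> b")
              case True
              then have "real (Suc n) * (r - b) \<le> 0" by (intro mult_nonneg_nonpos) auto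
              then show ?thesis using 1 True False unfolding \<theta>_def cutoff_def by (simp add: step_eq_1)
            next
              case nb: False
              then have "real (Suc n) * d \<le> real (Suc n) * (r - b)" by (intro mult_left_mono) (auto simp: d_def)
              then have "real (Suc n) * (r - b) \<ge> 1" using nd by linarith
              then show ?thesis using nb unfolding \<theta>_def cutoff_def by (simp add: step_eq_0)
            qed
          qed
          then show ?thesis unfolding eventually_sequentially by blast
        qed
        then show "(\<lambda>n. \<theta> n r) \<longlonglongrightarrow> indicator {s<..b} r" by (rule tendsto_eventually)
      qed
    qed
    then show ?thesis by (simp add: 0 LIMSEQ_const_iff)
  qed
  have "AE r in lborel. indicator {s<..t} r *\<^sub>R D r = 0"
  proof (rule AE_zero_of_initial_integrals[OF It])
    fix b
    have e: "indicator {..b} r *\<^sub>R indicator {s<..t} r *\<^sub>R D r = indicator {s<..min b t} r *\<^sub>R D r" for r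
      by (auto simp: indicator_def)
    show "(\<integral>r. indicator {..b} r *\<^sub>R indicator {s<..t} r *\<^sub>R D r \<partial>lborel) = 0"
      unfolding e using z[of "min b t"] st by (cases "s < min b t") auto
  qed
  then show ?thesis by eventually_elim (auto simp: D_def indicator_def)
qed

end

lemma kernel_step': "kernel step'"
  unfolding kernel_def
proof (intro conjI step'_continuous exI[of _ 1] allI impI)
  show "step' z = 0" if "1 \<le> norm z" for z using that by (intro step'_eq_0) auto
qed

context weak_kinetic_solution
begin

text \<open>The divergence of the mollified flux in the moving frame.\<close>

definition "source \<epsilon> r z = (\<Sum>i\<in>UNIV. conv (mollifier_deriv \<epsilon> (flow_dir (t - r) i)) (\<lambda>y. HH (r, y) $ i) z)"

lemma source_integrable:
  assumes \<epsilon>: "\<epsilon> > 0" and [measurable]: "\<theta> \<in> borel_measurable borel"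
    and \<theta>: "\<And>r. \<bar>\<theta> r\<bar> \<le> 1" "\<And>r. \<theta> r \<noteq> 0 \<Longrightarrow> \<bar>r\<bar> \<le> a"
  shows "integrable lborel (\<lambda>r. \<theta> r *\<^sub>R source \<epsilon> r z)"
  unfolding source_def scaleR_sum_right
  by (intro Bochner_Integration.integrable_sum time_slices_flow_kernel(2)[OF vec_nth_L2[OF HH] \<epsilon> _ \<theta>]) auto

text \<open>
  The weak equation, tested with \<open>kinetic_test\<close>. The time cut-off is \<open>1\<close> on \<open>[s, t']\<close> and
  falls to \<open>0\<close> during \<open>[t', t' + 1 / n]\<close>, so its derivative on \<open>[s, \<infinity>)\<close> tends to minus the unit mass at \<open>t'\<close>.
\<close>

lemma evolution_tested:
  assumes \<epsilon>: "\<epsilon> > 0" and n: "n \<ge> 1" and t': "s \<le> t'" "t' \<le> t"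
  shows "- (\<integral>r. (n * step' (n * (r - t'))) *\<^sub>R conv (mollifier \<epsilon>) (\<lambda>y. FF (r, y)) z \<partial>lborel)
    - (\<integral>r. (indicator {s<..} r * step (n * (r - t'))) *\<^sub>R source \<epsilon> r z \<partial>lborel)
    = conv (mollifier \<epsilon>) \<psi>\<psi> z"
proof -
  let ?\<theta> = "cutoff n t' 1 s"
  let ?h = "kinetic_test t ?\<theta> \<epsilon> z"
  have n0: "n > 0" using n by simp
  have late: "n * (r - t') \<ge> 1" if "r \<ge> t + 1" for r
    using that t' mult_mono[of 1 n 1 "r - t'"] n by simp
  have h: "?h \<in> test_functions UNIV"
    by (intro kinetic_test_in_test_functions n0 \<epsilon>) auto
  have ch: "(\<lambda>q. cnj (?h q)) = ?h" by (simp add: kinetic_test_def fun_eq_iff)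
  have o: "{s..} \<times> UNIV \<in> sets (borel :: (real \<times> (real ^ 'd) \<times> (real ^ 'd)) measure)"
    by (intro borel_Times) auto
  note [measurable] = L2_borel[OF F0(1)] L2_borel[OF vec_nth_L2[OF H0]] L2_borel[OF FF] L2_borel[OF vec_nth_L2[OF HH]] L2_borel[OF \<psi>0(1)]
  define \<theta>1 where "\<theta>1 r = n * step' (n * (r - t'))" for r
  define \<theta>2 where "\<theta>2 r = indicator {s<..} r * step (n * (r - t'))" for r
  have [measurable]: "\<theta>1 \<in> borel_measurable borel" "\<theta>2 \<in> borel_measurable borel"
    unfolding \<theta>1_def[abs_def] \<theta>2_def[abs_def] by measurable
  obtain R0 C0 where C0: "\<And>r. \<bar>step' r\<bar> \<le> C0" by (rule kernel_bounds[OF kernel_step'], rule that)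
  have \<theta>1b: "\<bar>\<theta>1 r\<bar> \<le> n * C0" for r
    using C0[of "n * (r - t')"] n by (auto simp: \<theta>1_def abs_mult intro!: mult_left_mono)
  have \<theta>1s: "\<bar>r\<bar> \<le> \<bar>t'\<bar> + \<bar>t + 1\<bar>" if "\<theta>1 r \<noteq> 0" for r
  proof -
    have "\<not> n * (r - t') \<le> 0" "\<not> n * (r - t') \<ge> 1" using that step'_eq_0[of "n * (r - t')"] by (auto simp: \<theta>1_def)
    then have "r > t'" "r < t + 1" using late[of r] n0 by (auto simp: mult_le_0_iff) (meson not_le)
    then show ?thesis by linarith
  qed
  have \<theta>2b: "\<bar>\<theta>2 r\<bar> \<le> 1" for r using step_bounds by (auto simp: \<theta>2_def indicator_def)
  have \<theta>2s: "\<bar>r\<bar> \<le> \<bar>s\<bar> + \<bar>t + 1\<bar>" if "\<theta>2 r \<noteq> 0" for r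
  proof -
    have "r > s" "\<not> n * (r - t') \<ge> 1" using that step_eq_0[of "n * (r - t')"] by (auto simp: \<theta>2_def indicator_def split: if_splits)
    then have "r > s" "r < t + 1" using late[of r] by (simp, meson not_le)
    then show ?thesis by linarith
  qed
  have "(\<integral>p. f (fst p) (snd p) * transport (\<lambda>q. cnj (?h q)) p \<partial>lebesgue_on ({s..} \<times> UNIV))
    = (\<integral>p. (\<theta>1 (fst p) * mollifier \<epsilon> (z - drift (t - fst p) (snd p))) *\<^sub>R F0 p \<partial>lborel)"
  proof (rule integral_lebesgue_on_eq_lborel[OF _ _ o])
    show "AE p in lborel. (if p \<in> {s..} \<times> UNIV then f (fst p) (snd p) * transport (\<lambda>q. cnj (?h q)) p else 0)
      = (\<theta>1 (fst p) * mollifier \<epsilon> (z - drift (t - fst p) (snd p))) *\<^sub>R F0 p"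
      using F0(2)
    proof eventually_elim
      case (elim p)
      note T = kinetic_test_transport[of ?\<theta> "cutoff' n t' 1 s", OF cutoff_deriv]
      consider "fst p < s" | "fst p \<in> {s..t + 1}" | "fst p > t + 1" by force
      then show ?case
      proof cases
        case 1 then show ?thesis using elim by (auto simp: mem_Times_iff)
      next
        case 2
        have c: "cutoff' n t' 1 s (fst p) = \<theta>1 (fst p)"
          using 2 step'_eq_0[of "s - fst p"] step_eq_1[of "s - fst p"] by (simp add: cutoff'_def \<theta>1_def)
        have "f (fst p) (snd p) = F0 p" using elim 2 by (auto simp: mem_Times_iff)
        then show ?thesis using 2 unfolding ch T c by (simp add: mem_Times_iff scaleR_conv_of_real)
      next
        case 3
        have "cutoff' n t' 1 s (fst p) = 0" "\<theta>1 (fst p) = 0"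
          using 3 late[of "fst p"] step'_eq_0[of "n * (fst p - t')"] step_eq_0[of "n * (fst p - t')"]
          by (auto simp: cutoff'_def \<theta>1_def)
        then show ?thesis unfolding ch T by simp
      qed
    qed
    show "(\<lambda>p. (\<theta>1 (fst p) * mollifier \<epsilon> (z - drift (t - fst p) (snd p))) *\<^sub>R F0 p) \<in> borel_measurable borel" by measurable
  qed
  also have "\<dots> = (\<integral>p. (\<theta>1 (fst p) * mollifier \<epsilon> (z - snd p)) *\<^sub>R FF p \<partial>lborel)"
    by (subst flow_integral[symmetric, where t=t]) (measurable, simp add: FF_def)
  also have "\<dots> = (\<integral>r. \<theta>1 r *\<^sub>R conv (mollifier \<epsilon>) (\<lambda>y. FF (r, y)) z \<partial>lborel)"
    by (rule time_slices_kernel(3)[OF FF \<epsilon> _ \<theta>1b \<theta>1s]) measurable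
  finally have 1: "(\<integral>p. f (fst p) (snd p) * transport (\<lambda>q. cnj (?h q)) p \<partial>lebesgue_on ({s..} \<times> UNIV))
    = (\<integral>r. \<theta>1 r *\<^sub>R conv (mollifier \<epsilon>) (\<lambda>y. FF (r, y)) z \<partial>lborel)" .
  let ?K = "\<lambda>i p. \<theta>2 (fst p) * mollifier_deriv \<epsilon> (flow_dir (t - fst p) i) (z - drift (t - fst p) (snd p))"
  have "(\<integral>p. herm (A p *v G p) (grad_v ?h p) \<partial>lebesgue_on ({s..} \<times> UNIV))
    = (\<integral>p. - (\<Sum>i\<in>UNIV. ?K i p *\<^sub>R ((B p *v G0 p) $ i)) \<partial>lborel)"
  proof (rule integral_lebesgue_on_eq_lborel[OF _ _ o])
    have ns: "AE p in (lborel :: (real \<times> (real ^ 'd) \<times> (real ^ 'd)) measure). fst p \<noteq> s"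
    proof (rule AE_lborel_prodI)
      show "Measurable.pred borel (\<lambda>p::real \<times> (real ^ 'd) \<times> (real ^ 'd). fst p \<noteq> s)" by measurable
      show "AE x in lborel. AE y in (lborel :: ((real ^ 'd) \<times> (real ^ 'd)) measure). fst (x, y) \<noteq> s"
        using AE_lborel_singleton[of s] by eventually_elim simp
    qed
    show "AE p in lborel. (if p \<in> {s..} \<times> UNIV then herm (A p *v G p) (grad_v ?h p) else 0)
      = - (\<Sum>i\<in>UNIV. ?K i p *\<^sub>R ((B p *v G0 p) $ i))"
      using ns G0(2) B(2)
    proof eventually_elim
      case (elim p)
      show ?case
      proof (cases "fst p > s")
        case True
        have g: "grad_v ?h p $ i = complex_of_real (- (?\<theta> (fst p) * mollifier_deriv \<epsilon> (flow_dir (t - fst p) i) (z - drift (t - fst p) (snd p))))" for i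
          using kinetic_test_grad[of ?\<theta> "cutoff' n t' 1 s", OF cutoff_deriv] by (simp add: grad_v_def)
        have th: "?\<theta> (fst p) = \<theta>2 (fst p)"
          using True step_eq_1[of "s - fst p"] by (simp add: cutoff_def \<theta>2_def)
        have "G p = G0 p" using elim True by (auto simp: mem_Times_iff)
        then show ?thesis using True elim
          by (simp add: mem_Times_iff herm_def g th scaleR_conv_of_real sum_negf mult_ac)
      next
        case False
        then show ?thesis using elim by (simp add: mem_Times_iff \<theta>2_def)
      qed
    qed
    show "(\<lambda>p. - (\<Sum>i\<in>UNIV. ?K i p *\<^sub>R ((B p *v G0 p) $ i))) \<in> borel_measurable borel"
      unfolding mollifier_deriv_flow_dir by measurable
  qed
  also have "\<dots> = (\<integral>p. - (\<Sum>i\<in>UNIV. (\<theta>2 (fst p) * mollifier_deriv \<epsilon> (flow_dir (t - fst p) i) (z - snd p)) *\<^sub>R (HH p $ i)) \<partial>lborel)"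
    by (subst flow_integral[symmetric, where t=t]) (unfold mollifier_deriv_flow_dir, measurable, simp add: HH_def)
  also have "\<dots> = - (\<Sum>i\<in>UNIV. \<integral>p. (\<theta>2 (fst p) * mollifier_deriv \<epsilon> (flow_dir (t - fst p) i) (z - snd p)) *\<^sub>R (HH p $ i) \<partial>lborel)"
    by (subst Bochner_Integration.integral_minus, subst Bochner_Integration.integral_sum)
      (auto intro!: time_slices_flow_kernel(1)[OF vec_nth_L2[OF HH] \<epsilon> _ \<theta>2b \<theta>2s])
  also have "\<dots> = - (\<Sum>i\<in>UNIV. \<integral>r. \<theta>2 r *\<^sub>R conv (mollifier_deriv \<epsilon> (flow_dir (t - r) i)) (\<lambda>y. HH (r, y) $ i) z \<partial>lborel)"
    by (intro arg_cong[where f=uminus] sum.cong refl time_slices_flow_kernel(3)[OF vec_nth_L2[OF HH] \<epsilon> _ \<theta>2b \<theta>2s]) measurable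
  also have "\<dots> = - (\<integral>r. \<theta>2 r *\<^sub>R source \<epsilon> r z \<partial>lborel)"
    unfolding source_def scaleR_sum_right
    by (subst Bochner_Integration.integral_sum) (auto intro!: time_slices_flow_kernel(2)[OF vec_nth_L2[OF HH] \<epsilon> _ \<theta>2b \<theta>2s])
  finally have 2: "(\<integral>p. herm (A p *v G p) (grad_v ?h p) \<partial>lebesgue_on ({s..} \<times> UNIV)) = - (\<integral>r. \<theta>2 r *\<^sub>R source \<epsilon> r z \<partial>lborel)" .
  have "n * (s - t') \<le> 0" using n t' by (intro mult_nonneg_nonpos) auto
  then have \<theta>s: "?\<theta> s = 1" by (simp add: cutoff_def step_eq_1)
  have "(\<integral>y. \<psi> y * cnj (?h (s, y)) \<partial>lebesgue) = (\<integral>y. mollifier \<epsilon> (z - drift (t - s) y) *\<^sub>R \<psi>0 y \<partial>lborel)"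
  proof (rule integral_lebesgue_eq_lborel)
    show "AE y in lborel. \<psi> y * cnj (?h (s, y)) = mollifier \<epsilon> (z - drift (t - s) y) *\<^sub>R \<psi>0 y"
      using \<psi>0(2) by eventually_elim (simp add: kinetic_test_def \<theta>s scaleR_conv_of_real)
    show "(\<lambda>y. mollifier \<epsilon> (z - drift (t - s) y) *\<^sub>R \<psi>0 y) \<in> borel_measurable borel" by measurable
  qed
  also have "\<dots> = conv (mollifier \<epsilon>) \<psi>\<psi> z"
    by (subst drift_integral[symmetric, where a="s - t"]) (measurable, simp add: conv_def \<psi>\<psi>_def)
  finally show ?thesis
    using weak_eq[OF h] unfolding 1 2 \<theta>1_def \<theta>2_def by simp
qed

lemma L2_slice: "r \<ge> s \<Longrightarrow> f r \<in> L2 lebesgue"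
  using cont by (simp add: L2_continuous_from_def)

lemma frame_slices:
  "AE r in lborel. s < r \<and> r \<le> t + 1 \<longrightarrow> (AE y in lborel. FF (r, y) = f r (drift (r - t) y))"
proof -
  have "AE p in lborel. (if flow t p \<in> {s..t + 1} \<times> UNIV then f (fst (flow t p)) (snd (flow t p)) else 0) = F0 (flow t p)"
    using flow_AE[OF F0(2)] .
  from AE_lborel_sections[OF this] show ?thesis
  proof eventually_elim
    case (elim r)
    show ?case
    proof
      assume "s < r \<and> r \<le> t + 1"
      then show "AE y in lborel. FF (r, y) = f r (drift (r - t) y)"
        using elim by (auto simp: FF_def flow_def elim!: AE_mp)
    qed
  qed
qed

text \<open>
  Continuity in time holds for the solution itself; the pairing in the moving frame involves, in addition, a mollifier that
  moves with \<open>r\<close>. Moving the transport onto the mollifier separates the two effects.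
\<close>

lemma right_continuity_pairing:
  assumes \<epsilon>: "\<epsilon> > 0" and t': "s \<le> t'" "t' \<le> t"
    and u: "u \<in> L2 lborel" "AE y in lborel. u y = f t' (drift (t' - t) y)" and \<delta>: "\<delta> > 0"
  shows "\<exists>\<eta>>0. AE r in lborel. t' < r \<and> r < t' + \<eta> \<longrightarrow>
     norm (conv (mollifier \<epsilon>) (\<lambda>y. FF (r, y)) z - conv (mollifier \<epsilon>) u z) \<le> \<delta>"
proof -
  have rep: "\<exists>h. h \<in> L2 lborel \<and> (AE y in lborel. f r y = h y)" if "r \<ge> s" for r
    using L2_lebesgue_representative[of "f r" UNIV] L2_slice[OF that] by (auto simp: lebesgue_on_UNIV_eq)
  obtain g where g: "g \<in> L2 lborel" "AE y in lborel. f t' y = g y" using rep[OF t'(1)] by auto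
  let ?k = "mollifier \<epsilon> :: (real ^ 'd) \<times> (real ^ 'd) \<Rightarrow> real"
  define N where "N = L2norm lborel ?k"
  have k2: "?k \<in> L2 lborel"
  proof (rule L2_I)
    have "continuous_on UNIV (\<lambda>z. (norm (?k z))\<^sup>2)"
      using kernel_continuous[OF mollifier_kernel[OF \<epsilon>, where 'a="(real ^ 'd) \<times> (real ^ 'd)"]] by (intro continuous_intros)
    then show "integrable lborel (\<lambda>z. (norm (?k z))\<^sup>2)"
      by (rule continuous_compact_support_integrable[where R=\<epsilon>]) (simp add: mollifier_eq_0 \<epsilon>)
  qed measurable
  have kr: "(\<lambda>y. ?k (z - drift a y)) \<in> L2 lborel" "L2norm lborel (\<lambda>y. ?k (z - drift a y)) = N" for a
  proof -
    have "(\<lambda>y. ?k (z - y)) \<in> L2 lborel"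
    proof (rule L2_I)
      show "integrable lborel (\<lambda>y. (norm (?k (z - y)))\<^sup>2)"
        using L2_integrable[OF k2] integrable_lborel_reflect_iff[of "\<lambda>y. (norm (?k y))\<^sup>2" z] by simp
    qed measurable
    then show "(\<lambda>y. ?k (z - drift a y)) \<in> L2 lborel" by (rule drift_L2)
    show "L2norm lborel (\<lambda>y. ?k (z - drift a y)) = N"
      using drift_integral[of "\<lambda>y. (norm (?k (z - y)))\<^sup>2" a] integral_lborel_reflect[of "\<lambda>y. (norm (?k y))\<^sup>2" z]
      by (simp add: N_def L2norm_def)
  qed
  define J where "J r = (\<integral>y. ?k (z - drift (t - r) y) *\<^sub>R g y \<partial>lborel)" for r
  have J: "(J \<longlongrightarrow> J t') (at t')"
  proof -
    have "continuous_on UNIV (\<lambda>r. (\<lambda>r. \<integral>y. ?k (z - drift r y) *\<^sub>R g y \<partial>lborel) (t - r))"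
      by (intro continuous_on_compose2[OF drift_pairing_continuous[OF L2_locally_integrable[OF g(1)] \<epsilon>]] continuous_intros) auto
    then show ?thesis unfolding J_def[abs_def] continuous_on_def by auto
  qed
  have conv_u: "conv ?k u z = J t'"
  proof -
    have [measurable]: "g \<in> borel_measurable borel" "u \<in> borel_measurable borel" using L2_borel g u by auto
    have "AE y in lborel. u y = g (drift (t' - t) y)"
      using u(2) drift_AE[OF g(2), of "t' - t"] by eventually_elim simp
    then have "conv ?k u z = (\<integral>y. ?k (z - y) *\<^sub>R g (drift (t' - t) y) \<partial>lborel)"
      unfolding conv_def by (intro integral_cong_AE) (auto elim!: AE_mp)
    also have "\<dots> = J t'"
      using drift_integral[of "\<lambda>y. ?k (z - drift (t - t') y) *\<^sub>R g y" "t' - t"] by (simp add: J_def)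
    finally show ?thesis .
  qed
  have close: "norm (conv ?k (\<lambda>y. FF (r, y)) z - J r) \<le> N * L2norm lebesgue (\<lambda>y. f r y - f t' y)"
    if r: "r \<ge> s" and FFr: "AE y in lborel. FF (r, y) = f r (drift (r - t) y)" for r
  proof -
    obtain h where h: "h \<in> L2 lborel" "AE y in lborel. f r y = h y" using rep[OF r] by auto
    have [measurable]: "g \<in> borel_measurable borel" "h \<in> borel_measurable borel" "FF \<in> borel_measurable borel"
      using L2_borel[OF g(1)] L2_borel[OF h(1)] L2_borel[OF FF] by auto
    have "AE y in lborel. FF (r, y) = h (drift (r - t) y)"
      using FFr drift_AE[OF h(2), of "r - t"] by eventually_elim simp
    then have "conv ?k (\<lambda>y. FF (r, y)) z = (\<integral>y. ?k (z - y) *\<^sub>R h (drift (r - t) y) \<partial>lborel)"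
      unfolding conv_def by (intro integral_cong_AE) (auto elim!: AE_mp)
    also have "\<dots> = (\<integral>y. ?k (z - drift (t - r) y) *\<^sub>R h y \<partial>lborel)"
      using drift_integral[of "\<lambda>y. ?k (z - drift (t - r) y) *\<^sub>R h y" "r - t"] by simp
    finally have c: "conv ?k (\<lambda>y. FF (r, y)) z = (\<integral>y. ?k (z - drift (t - r) y) *\<^sub>R h y \<partial>lborel)" .
    have I: "integrable lborel (\<lambda>y. ?k (z - drift (t - r) y) *\<^sub>R v y)" if v: "v \<in> L2 lborel" for v :: "_ \<Rightarrow> complex"
    proof -
      have [measurable]: "v \<in> borel_measurable borel" using L2_borel[OF v] .
      show ?thesis by (rule Bochner_Integration.integrable_bound[OF L2_norm_mult_integrable[OF kr(1) v]]) auto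
    qed
    note hg = L2_minus[OF h(1) g(1)]
    have "norm (conv ?k (\<lambda>y. FF (r, y)) z - J r) = norm (\<integral>y. ?k (z - drift (t - r) y) *\<^sub>R (h y - g y) \<partial>lborel)"
      using I[OF h(1)] I[OF g(1)] by (simp add: c J_def scaleR_diff_right)
    also have "\<dots> \<le> (\<integral>y. norm (?k (z - drift (t - r) y)) * norm (h y - g y) \<partial>lborel)"
      using integral_norm_bound[of lborel "\<lambda>y. ?k (z - drift (t - r) y) *\<^sub>R (h y - g y)"] by simp
    also have "\<dots> \<le> N * L2norm lborel (\<lambda>y. h y - g y)"
      using L2_Cauchy_Schwarz_L2norm[OF kr(1) hg] by (simp add: kr(2))
    also have "L2norm lborel (\<lambda>y. h y - g y) = L2norm lebesgue (\<lambda>y. f r y - f t' y)"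
      unfolding L2norm_def
      by (subst integral_lebesgue_eq_lborel[where u'="\<lambda>y. (norm (h y - g y))\<^sup>2"])
        (use h(2) g(2) in \<open>auto elim!: AE_mp\<close>)
    finally show ?thesis .
  qed
  have "((\<lambda>r. N * L2norm lebesgue (\<lambda>z. f r z - f t' z)) \<longlongrightarrow> N * 0) (at t' within {s..})"
    using cont t' by (intro tendsto_intros) (simp add: L2_continuous_from_def)
  then have "((\<lambda>r. N * L2norm lebesgue (\<lambda>z. f r z - f t' z) + norm (J r - J t')) \<longlongrightarrow> 0 + 0) (at t' within {s..})"
    by (intro tendsto_add tendsto_norm_zero LIM_zero tendsto_within_subset[OF J]) auto
  then have "((\<lambda>r. N * L2norm lebesgue (\<lambda>z. f r z - f t' z) + norm (J r - J t')) \<longlongrightarrow> 0) (at t' within {s..})" by simp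
  from order_tendstoD(2)[OF this \<delta>]
  obtain \<eta> where \<eta>: "\<eta> > 0" "\<And>r. r \<ge> s \<Longrightarrow> r \<noteq> t' \<Longrightarrow> dist r t' < \<eta> \<Longrightarrow> N * L2norm lebesgue (\<lambda>z. f r z - f t' z) + norm (J r - J t') < \<delta>"
    unfolding eventually_at by auto
  show ?thesis
  proof (intro exI[of _ "min \<eta> 1"] conjI)
    show "AE r in lborel. t' < r \<and> r < t' + min \<eta> 1 \<longrightarrow> norm (conv ?k (\<lambda>y. FF (r, y)) z - conv ?k u z) \<le> \<delta>"
      using frame_slices
    proof eventually_elim
      case (elim r)
      show ?case
      proof
        assume r: "t' < r \<and> r < t' + min \<eta> 1"
        then have "AE y in lborel. FF (r, y) = f r (drift (r - t) y)" using elim t' by auto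
        from close[OF _ this] r t' have "norm (conv ?k (\<lambda>y. FF (r, y)) z - J r) \<le> N * L2norm lebesgue (\<lambda>y. f r y - f t' y)" by auto
        moreover have "N * L2norm lebesgue (\<lambda>z. f r z - f t' z) + norm (J r - J t') < \<delta>"
          using r t' by (intro \<eta>(2)) (auto simp: dist_real_def)
        moreover have "norm (conv ?k (\<lambda>y. FF (r, y)) z - J t') \<le> norm (conv ?k (\<lambda>y. FF (r, y)) z - J r) + norm (J r - J t')"
          using norm_triangle_ineq[of "conv ?k (\<lambda>y. FF (r, y)) z - J r" "J r - J t'"] by simp
        ultimately show "norm (conv ?k (\<lambda>y. FF (r, y)) z - conv ?k u z) \<le> \<delta>" unfolding conv_u by linarith
      qed
    qed
  qed (use \<eta> in auto)
qed

text \<open>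
  As \<open>n \<rightarrow> \<infinity>\<close> in \<open>evolution_tested\<close>, right continuity turns the term with the derivative of the cut-off into the
  value at \<open>t'\<close>. The identity holds at every point \<open>z\<close> and for every time \<open>t'\<close>.
\<close>

lemma evolution_identity:
  assumes \<epsilon>: "\<epsilon> > 0" and t': "s \<le> t'" "t' \<le> t"
    and u: "u \<in> L2 lborel" "AE y in lborel. u y = f t' (drift (t' - t) y)"
  shows "conv (mollifier \<epsilon>) u z = conv (mollifier \<epsilon>) \<psi>\<psi> z + (\<integral>r. indicator {s<..t'} r *\<^sub>R source \<epsilon> r z \<partial>lborel)"
proof -
  define a where "a r = conv (mollifier \<epsilon>) (\<lambda>y. FF (r, y)) z" for r
  define a0 where "a0 = conv (mollifier \<epsilon>) u z"
  define C where "C = (\<integral>r. \<bar>step' r\<bar> \<partial>lborel)"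
  have C0: "C \<ge> 0" by (simp add: C_def)
  define \<theta>1 where "\<theta>1 n r = real (Suc n) * step' (real (Suc n) * (r - t'))" for n r
  define \<theta>2 where "\<theta>2 n r = indicator {s<..} r * step (real (Suc n) * (r - t'))" for n r
  have [measurable]: "\<theta>1 n \<in> borel_measurable borel" "\<theta>2 n \<in> borel_measurable borel" for n
    unfolding \<theta>1_def[abs_def] \<theta>2_def[abs_def] by measurable
  have \<theta>10: "\<theta>1 n r = 0" if "r \<le> t' \<or> r \<ge> t' + 1 / real (Suc n)" for n r
  proof -
    have "real (Suc n) * (r - t') \<le> 0 \<or> real (Suc n) * (r - t') \<ge> 1"
    proof (cases "r \<le> t'")
      case True
      then show ?thesis by (intro disjI1 mult_nonneg_nonpos) auto
    next
      case False
      then show ?thesis using that by (auto simp: field_simps)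
    qed
    then show ?thesis by (simp add: \<theta>1_def step'_eq_0)
  qed
  obtain R1 C1 where C1: "\<And>r. \<bar>step' r\<bar> \<le> C1" by (rule kernel_bounds[OF kernel_step'], rule that)
  have ia: "integrable lborel (\<lambda>r. \<theta>1 n r *\<^sub>R a r)" for n
    unfolding a_def
  proof (rule time_slices_kernel(2)[OF FF \<epsilon>])
    show "\<bar>\<theta>1 n r\<bar> \<le> real (Suc n) * C1" for r
      using C1[of "real (Suc n) * (r - t')"] by (auto simp: \<theta>1_def abs_mult intro!: mult_left_mono)
    show "\<bar>r\<bar> \<le> \<bar>t'\<bar> + 1" if "\<theta>1 n r \<noteq> 0" for r
    proof -
      have "1 / real (Suc n) \<le> 1" by simp
      then show ?thesis using \<theta>10[of r n] that by linarith
    qed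
  qed measurable
  note S = scaled_step'_integral[of "real (Suc n)" t' for n, folded \<theta>1_def]
  \<comment> \<open>The approximate identity is supported in \<open>(t', t' + 1 / (n + 1))\<close>, where the pairing is close to its value at \<open>t'\<close>.\<close>
  have lim1: "(\<lambda>n. \<integral>r. \<theta>1 n r *\<^sub>R a r \<partial>lborel) \<longlonglongrightarrow> - a0"
  proof (rule LIMSEQ_I)
    fix e :: real assume "e > 0"
    define \<delta> where "\<delta> = e / (C + 1)"
    have "\<delta> > 0" using \<open>e > 0\<close> C0 by (simp add: \<delta>_def)
    have "C * \<delta> < e" using \<open>e > 0\<close> C0 by (simp add: \<delta>_def field_simps)
    obtain \<eta> where \<eta>: "\<eta> > 0" "AE r in lborel. t' < r \<and> r < t' + \<eta> \<longrightarrow> norm (a r - a0) \<le> \<delta>"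
      using right_continuity_pairing[OF \<epsilon> t' u \<open>\<delta> > 0\<close>, of z] unfolding a_def a0_def by auto
    obtain M where M: "1 / \<eta> < real (Suc M)" using reals_Archimedean2 less_trans by (metis lessI of_nat_less_iff)
    have "norm ((\<integral>r. \<theta>1 n r *\<^sub>R a r \<partial>lborel) - (- a0)) < e" if "n \<ge> M" for n
    proof -
      have "1 / \<eta> < real (Suc n)" using M that by simp
      then have n\<eta>: "1 / real (Suc n) < \<eta>" using \<open>\<eta> > 0\<close> by (simp add: field_simps)
      have I1: "integrable lborel (\<theta>1 n)" using S(1)[of n] by simp
      have "(\<integral>r. \<theta>1 n r *\<^sub>R a0 \<partial>lborel) = - a0"
        using S(2)[of n] I1 by (subst integral_scaleR_left) auto
      then have "norm ((\<integral>r. \<theta>1 n r *\<^sub>R a r \<partial>lborel) - (- a0)) = norm (\<integral>r. \<theta>1 n r *\<^sub>R (a r - a0) \<partial>lborel)"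
        using ia[of n] I1 by (simp add: scaleR_diff_right)
      also have "\<dots> \<le> (\<integral>r. norm (\<theta>1 n r *\<^sub>R (a r - a0)) \<partial>lborel)" by (rule integral_norm_bound)
      also have "\<dots> \<le> (\<integral>r. \<bar>\<theta>1 n r\<bar> * \<delta> \<partial>lborel)"
      proof (rule integral_mono_AE)
        show "integrable lborel (\<lambda>r. norm (\<theta>1 n r *\<^sub>R (a r - a0)))"
          unfolding scaleR_diff_right using ia[of n] I1 by (intro integrable_norm Bochner_Integration.integrable_diff) auto
        show "integrable lborel (\<lambda>r. \<bar>\<theta>1 n r\<bar> * \<delta>)" using I1 by auto
        show "AE r in lborel. norm (\<theta>1 n r *\<^sub>R (a r - a0)) \<le> \<bar>\<theta>1 n r\<bar> * \<delta>"
          using \<eta>(2)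
        proof eventually_elim
          case (elim r)
          show ?case
          proof (cases "\<theta>1 n r = 0")
            case False
            then have "\<not> (r \<le> t' \<or> r \<ge> t' + 1 / real (Suc n))" using \<theta>10[of r n] by blast
            then have "t' < r \<and> r < t' + \<eta>" using n\<eta> by linarith
            then show ?thesis using elim by (auto intro: mult_left_mono)
          qed simp
        qed
      qed
      also have "\<dots> = C * \<delta>" using S(3)[of n] I1 by (simp add: C_def)
      finally show ?thesis using \<open>C * \<delta> < e\<close> by simp
    qed
    then show "\<exists>M. \<forall>n\<ge>M. norm ((\<integral>r. \<theta>1 n r *\<^sub>R a r \<partial>lborel) - (- a0)) < e" by blast
  qed
  have ab: "\<bar>r\<bar> \<le> \<bar>s\<bar> + \<bar>t + 1\<bar>" if "s \<le> r" "r \<le> t + 1" for r using that by linarith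
  have \<theta>2b: "\<bar>\<theta>2 n r\<bar> \<le> 1" for n r using step_bounds by (auto simp: \<theta>2_def indicator_def)
  have \<theta>20: "\<theta>2 n r = 0" if "r \<notin> {s<..t + 1}" for n r
  proof (cases "r \<le> s")
    case False
    then have "r - t' \<ge> 1" using that t' by auto
    then have "real (Suc n) * (r - t') \<ge> 1" using mult_mono[of 1 "real (Suc n)" 1 "r - t'"] by simp
    then show ?thesis by (simp add: \<theta>2_def step_eq_0)
  qed (simp add: \<theta>2_def)
  have \<theta>2s: "\<theta>2 n r \<noteq> 0 \<Longrightarrow> \<bar>r\<bar> \<le> \<bar>s\<bar> + \<bar>t + 1\<bar>" for n r
    using \<theta>20[of r n] by (intro ab) fastforce+
  have IT: "integrable lborel (\<lambda>r. indicator {s<..t + 1} r *\<^sub>R source \<epsilon> r z)"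
    by (rule source_integrable[OF \<epsilon>, of _ "\<bar>s\<bar> + \<bar>t + 1\<bar>"]) (auto simp: indicator_def intro!: ab split: if_splits)
  have lim2: "(\<lambda>n. \<integral>r. \<theta>2 n r *\<^sub>R source \<epsilon> r z \<partial>lborel) \<longlonglongrightarrow> (\<integral>r. indicator {s<..t'} r *\<^sub>R source \<epsilon> r z \<partial>lborel)"
  proof (rule integral_dominated_convergence[where w="\<lambda>r. norm (indicator {s<..t + 1} r *\<^sub>R source \<epsilon> r z)"])
    show "integrable lborel (\<lambda>r. norm (indicator {s<..t + 1} r *\<^sub>R source \<epsilon> r z))" by (rule integrable_norm[OF IT])
    show "AE r in lborel. norm (\<theta>2 n r *\<^sub>R source \<epsilon> r z) \<le> norm (indicator {s<..t + 1} r *\<^sub>R source \<epsilon> r z)" for n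
      using \<theta>2b[of n] \<theta>20[of _ n] by (intro AE_I2) (auto simp: indicator_def intro!: mult_left_le_one_le)
    show "(\<lambda>r. \<theta>2 n r *\<^sub>R source \<epsilon> r z) \<in> borel_measurable lborel" for n
      by (rule borel_measurable_integrable, rule source_integrable[OF \<epsilon> _ \<theta>2b \<theta>2s]) measurable
    show "(\<lambda>r. indicator {s<..t'} r *\<^sub>R source \<epsilon> r z) \<in> borel_measurable lborel"
      by (rule borel_measurable_integrable, rule source_integrable[OF \<epsilon>, of _ "\<bar>s\<bar> + \<bar>t + 1\<bar>"])
        (use t' in \<open>auto simp: indicator_def intro!: ab split: if_splits\<close>)
    show "AE r in lborel. (\<lambda>n. \<theta>2 n r *\<^sub>R source \<epsilon> r z) \<longlonglongrightarrow> indicator {s<..t'} r *\<^sub>R source \<epsilon> r z"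
    proof (intro AE_I2 tendsto_scaleR tendsto_const)
      fix r
      have "\<forall>\<^sub>F n in sequentially. \<theta>2 n r = indicator {s<..t'} r"
      proof (cases "r \<le> t'")
        case True
        then have "real (Suc n) * (r - t') \<le> 0" for n by (intro mult_nonneg_nonpos) auto
        then show ?thesis using True by (auto simp: \<theta>2_def step_eq_1 indicator_def)
      next
        case False
        obtain M where M: "1 / (r - t') < real (Suc M)" using reals_Archimedean2 less_trans by (metis lessI of_nat_less_iff)
        have "\<theta>2 n r = indicator {s<..t'} r" if "n \<ge> M" for n
        proof -
          have "1 / (r - t') < real (Suc n)" using M that by simp
          then have "real (Suc n) * (r - t') \<ge> 1" using False by (simp add: field_simps)
          then show ?thesis using False by (simp add: \<theta>2_def step_eq_0)
        qed
        then show ?thesis unfolding eventually_sequentially by blast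
      qed
      then show "(\<lambda>n. \<theta>2 n r) \<longlonglongrightarrow> indicator {s<..t'} r" by (rule tendsto_eventually)
    qed
  qed
  have id: "- (\<integral>r. \<theta>1 n r *\<^sub>R a r \<partial>lborel) - (\<integral>r. \<theta>2 n r *\<^sub>R source \<epsilon> r z \<partial>lborel) = conv (mollifier \<epsilon>) \<psi>\<psi> z" for n
    using evolution_tested[OF \<epsilon> _ t', of "real (Suc n)" z] unfolding \<theta>1_def \<theta>2_def a_def by simp
  have "(\<lambda>n. - (\<integral>r. \<theta>1 n r *\<^sub>R a r \<partial>lborel) - (\<integral>r. \<theta>2 n r *\<^sub>R source \<epsilon> r z \<partial>lborel)) \<longlonglongrightarrow> - (- a0) - (\<integral>r. indicator {s<..t'} r *\<^sub>R source \<epsilon> r z \<partial>lborel)"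
    by (intro tendsto_intros lim1 lim2)
  then have "conv (mollifier \<epsilon>) \<psi>\<psi> z = a0 - (\<integral>r. indicator {s<..t'} r *\<^sub>R source \<epsilon> r z \<partial>lborel)"
    unfolding id by (simp add: LIMSEQ_const_iff)
  then show ?thesis by (simp add: a0_def)
qed

end

section \<open>The chain rule in time and integration by parts in space\<close>

lemma borel_measurable_cnj[measurable]: "cnj \<in> borel_measurable borel"
  by (intro borel_measurable_continuous_onI continuous_intros)

lemma L2_cnj: "u \<in> L2 M \<Longrightarrow> (\<lambda>z. cnj (u z)) \<in> L2 M"
  using measurable_compose[OF L2_measurable borel_measurable_cnj, of u M]
  by (intro L2_bound[of u M "\<lambda>z. cnj (u z)" 1]) auto

lemma L2_section:
  fixes u :: "'a::euclidean_space \<times> 'b::euclidean_space \<Rightarrow> 'c::euclidean_space"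
  assumes "u \<in> L2 lborel"
  shows "AE r in lborel. (\<lambda>y. u (r, y)) \<in> L2 lborel"
  using AE_integrable_section[OF L2_integrable[OF assms]]
proof eventually_elim
  case (elim r)
  have [measurable]: "u \<in> borel_measurable borel" using L2_borel[OF assms] .
  show ?case using elim by (intro L2_I) measurable
qed

lemma L2_mult_integrable:
  fixes u v :: "'a \<Rightarrow> complex"
  assumes "u \<in> L2 M" "v \<in> L2 M" "w \<in> borel_measurable M" "\<And>x. norm (w x) \<le> C"
  shows "integrable M (\<lambda>x. w x * u x * v x)"
proof -
  have [measurable]: "u \<in> borel_measurable M" "v \<in> borel_measurable M" "w \<in> borel_measurable M" using assms by auto
  show ?thesis
  proof (rule Bochner_Integration.integrable_bound[OF integrable_mult_right[OF L2_norm_mult_integrable[OF assms(1,2)], of C]])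
    have "norm (w x * u x * v x) \<le> norm (C * (norm (u x) * norm (v x)))" for x
      using assms(4)[of x] order_trans[OF norm_ge_zero assms(4)[of x]]
      by (simp add: norm_mult mult.assoc abs_mult mult_right_mono)
    then show "AE x in M. norm (w x * u x * v x) \<le> norm (C * (norm (u x) * norm (v x)))" by simp
  qed measurable
qed

text \<open>
  The chain rule for \<open>\<bar>a\<bar>\<^sup>2\<close> when \<open>a\<close> is an indefinite integral of \<open>g\<close>. The square of \<open>\<integral> g\<close> is a double integral,
  and its two halves \<open>\<rho> \<le> r\<close> and \<open>\<rho> > r\<close> are complex conjugates of each other. This avoids differentiating
  \<open>a\<close>, which is only absolutely continuous.
\<close>

lemma norm_square_indefinite_integral:
  fixes g a :: "real \<Rightarrow> complex"
  assumes g: "integrable lborel g" and am: "a \<in> borel_measurable borel"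
    and a: "AE r in lborel. g r \<noteq> 0 \<longrightarrow> a r = c + (\<integral>\<rho>. indicator {..r} \<rho> *\<^sub>R g \<rho> \<partial>lborel)"
  shows "(norm (c + (\<integral>r. g r \<partial>lborel)))\<^sup>2 = (norm c)\<^sup>2 + 2 * Re (\<integral>r. cnj (a r) * g r \<partial>lborel)"
proof -
  have [measurable]: "g \<in> borel_measurable borel" using g by auto
  define I where "I r = (\<integral>\<rho>. indicator {..r} \<rho> *\<^sub>R g \<rho> \<partial>lborel)" for r
  define J where "J = (\<integral>r. g r \<partial>lborel)"
  let ?Q = "\<lambda>p. g (fst p) * cnj (g (snd p))"
  have Q: "integrable lborel ?Q"
  proof (rule integrable_lborel_prodI)
    show "?Q \<in> borel_measurable borel" by measurable
    show "integrable lborel (\<lambda>x. \<integral>y. norm (g (fst (x, y)) * cnj (g (snd (x, y)))) \<partial>lborel)"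
      using g by (simp add: norm_mult)
    show "AE x in lborel. integrable lborel (\<lambda>y. g (fst (x, y)) * cnj (g (snd (x, y))))"
      using g by auto
  qed
  have Q1: "integrable lborel (\<lambda>p. indicator {p. snd p \<le> fst p} p *\<^sub>R ?Q p)"
    by (rule integrable_mult_indicator[OF _ Q]) measurable
  have Q2: "integrable lborel (\<lambda>p. indicator {p. snd p > fst p} p *\<^sub>R ?Q p)"
    by (rule integrable_mult_indicator[OF _ Q]) measurable
  define X where "X = (\<integral>r. g r * cnj (I r) \<partial>lborel)"
  have i1: "(\<integral>\<rho>. indicator {p. snd p \<le> fst p} (r, \<rho>) *\<^sub>R (g r * cnj (g \<rho>)) \<partial>lborel) = g r * cnj (I r)" for r
  proof -
    have "(\<integral>\<rho>. indicator {p. snd p \<le> fst p} (r, \<rho>) *\<^sub>R (g r * cnj (g \<rho>)) \<partial>lborel) = (\<integral>\<rho>. g r * cnj (indicator {..r} \<rho> *\<^sub>R g \<rho>) \<partial>lborel)"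
      by (rule Bochner_Integration.integral_cong) (auto simp: indicator_def)
    also have "\<dots> = g r * cnj (I r)"
      unfolding I_def by (simp only: integral_mult_right_zero Bochner_Integration.integral_cnj)
    finally show ?thesis .
  qed
  have i2: "(\<integral>r. indicator {p. snd p > fst p} (r, \<rho>) *\<^sub>R (g r * cnj (g \<rho>)) \<partial>lborel) = cnj (g \<rho> * cnj (I \<rho>))" for \<rho>
  proof -
    have "(\<integral>r. indicator {p. snd p > fst p} (r, \<rho>) *\<^sub>R (g r * cnj (g \<rho>)) \<partial>lborel) = (\<integral>r. cnj (g \<rho>) * (indicator {..\<rho>} r *\<^sub>R g r) \<partial>lborel)"
    proof (rule integral_cong_AE)
      show "AE r in lborel. indicator {p. snd p > fst p} (r, \<rho>) *\<^sub>R (g r * cnj (g \<rho>)) = cnj (g \<rho>) * (indicator {..\<rho>} r *\<^sub>R g r)"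
        using AE_lborel_singleton[of \<rho>] by eventually_elim (auto simp: indicator_def)
    qed measurable
    also have "\<dots> = cnj (g \<rho>) * I \<rho>" unfolding I_def by (rule integral_mult_right_zero)
    finally show ?thesis by simp
  qed
  have X1: "X = (\<integral>p. indicator {p. snd p \<le> fst p} p *\<^sub>R ?Q p \<partial>lborel)"
    using integral_lborel_prod[OF Q1] by (simp add: i1 X_def)
  have cX: "cnj X = (\<integral>\<rho>. cnj (g \<rho>) * I \<rho> \<partial>lborel)"
    unfolding X_def by (subst Bochner_Integration.integral_cnj[symmetric]) simp
  have X2: "cnj X = (\<integral>p. indicator {p. snd p > fst p} p *\<^sub>R ?Q p \<partial>lborel)"
    using integral_lborel_prod[OF Q2] integral_lborel_swap[OF Q2] by (simp add: i2 cX)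
  have "J * cnj J = (\<integral>p. ?Q p \<partial>lborel)"
    using integral_lborel_prod[OF Q] by (simp add: J_def)
  also have "\<dots> = (\<integral>p. indicator {p. snd p \<le> fst p} p *\<^sub>R ?Q p + indicator {p. snd p > fst p} p *\<^sub>R ?Q p \<partial>lborel)"
    by (rule Bochner_Integration.integral_cong) (auto simp: indicator_def)
  also have "\<dots> = X + cnj X" using Q1 Q2 by (simp add: X1 X2 flip: X1)
  finally have JX: "J * cnj J = X + cnj X" .
  have "(norm J)\<^sup>2 = Re (J * cnj J)" by (simp add: complex_mult_cnj cmod_power2)
  then have nJ: "(norm J)\<^sup>2 = 2 * Re X" by (simp add: JX)
  have IX: "integrable lborel (\<lambda>r. g r * cnj (I r))"
    using integrable_section_integral[OF Q1] by (simp add: i1)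
  have "(\<integral>r. cnj (a r) * g r \<partial>lborel) = (\<integral>r. cnj c * g r + g r * cnj (I r) \<partial>lborel)"
  proof (rule integral_cong_AE)
    show "(\<lambda>r. cnj (a r) * g r) \<in> borel_measurable lborel" using am by measurable
    show "(\<lambda>r. cnj c * g r + g r * cnj (I r)) \<in> borel_measurable lborel"
      using borel_measurable_integrable[OF IX] by measurable
    show "AE r in lborel. cnj (a r) * g r = cnj c * g r + g r * cnj (I r)"
      using a
    proof eventually_elim
      case (elim r)
      then show ?case by (cases "g r = 0") (auto simp: I_def algebra_simps)
    qed
  qed
  also have "\<dots> = cnj c * J + X" using g IX by (simp add: J_def X_def)
  finally have e: "Re (\<integral>r. cnj (a r) * g r \<partial>lborel) = Re (cnj c * J) + Re X" by simp
  have "(norm (c + J))\<^sup>2 = (norm c)\<^sup>2 + 2 * Re (cnj c * J) + (norm J)\<^sup>2"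
    unfolding cmod_power2 by (simp add: power2_eq_square algebra_simps)
  then show ?thesis using e nJ by (simp add: J_def)
qed

lemma conv_L2:
  fixes u :: "'a::euclidean_space \<Rightarrow> 'b::euclidean_space"
  assumes "kernel k" "u \<in> L2 lborel" shows "conv k u \<in> L2 lborel"
  using moll_L2[of "\<lambda>y. y" k u] assms kernel_integrable[OF assms(1)]
  by (simp add: conv_eq_moll[abs_def])

text \<open>
  All products are integrable, so \<open>integral_line_deriv_eq_0\<close> applies without cutting off at infinity.
\<close>

lemma conv_integration_by_parts:
  fixes u h :: "'a::euclidean_space \<Rightarrow> complex"
  assumes k: "kernel k" "kernel k'" "line_deriv b k k'" and u: "u \<in> L2 lborel" and h: "h \<in> L2 lborel"
    and w: "continuous_on UNIV w" "continuous_on UNIV w'" "line_deriv b w w'" "\<And>z. \<bar>w z\<bar> \<le> C" "\<And>z. \<bar>w' z\<bar> \<le> C"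
  shows "(\<integral>z. complex_of_real (w z) * cnj (conv k u z) * conv k' h z \<partial>lborel)
    = - (\<integral>z. (complex_of_real (w z) * cnj (conv k' u z) + complex_of_real (w' z) * cnj (conv k u z)) * conv k h z \<partial>lborel)"
proof -
  note li = L2_locally_integrable[OF u] L2_locally_integrable[OF h]
  note c = conv_continuous[OF k(1) li(1)] conv_continuous[OF k(2) li(1)] conv_continuous[OF k(1) li(2)] conv_continuous[OF k(2) li(2)]
  note d = conv_line_deriv[OF k li(1)] conv_line_deriv[OF k li(2)]
  have wm: "(\<lambda>z. complex_of_real (w z)) \<in> borel_measurable lborel" "(\<lambda>z. complex_of_real (w' z)) \<in> borel_measurable lborel"
    using borel_measurable_continuous_onI[OF w(1)] borel_measurable_continuous_onI[OF w(2)] by auto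
  have dw: "line_deriv b (\<lambda>z. complex_of_real (w z)) (\<lambda>z. complex_of_real (w' z))"
    by (rule line_deriv_bounded_linear[OF bounded_linear_of_real w(3)])
  have du: "line_deriv b (\<lambda>z. cnj (conv k u z)) (\<lambda>z. cnj (conv k' u z))"
    by (rule line_deriv_bounded_linear[OF bounded_linear_cnj d(1)])
  let ?g = "\<lambda>z. complex_of_real (w z) * cnj (conv k u z) * conv k h z"
  let ?g1 = "\<lambda>z. complex_of_real (w z) * cnj (conv k u z) * conv k' h z"
  let ?g2 = "\<lambda>z. complex_of_real (w z) * cnj (conv k' u z) * conv k h z"
  let ?g3 = "\<lambda>z. complex_of_real (w' z) * cnj (conv k u z) * conv k h z"
  have I: "integrable lborel ?g" "integrable lborel ?g1" "integrable lborel ?g2" "integrable lborel ?g3"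
    using w(4,5) by (intro L2_mult_integrable[where C=C] L2_cnj conv_L2 k u h wm; simp)+
  have ld: "line_deriv b ?g (\<lambda>z. ?g1 z + (?g2 z + ?g3 z))"
    using line_deriv_mult[OF line_deriv_mult[OF dw du] d(2)] by (simp add: algebra_simps)
  have cc: "continuous_on UNIV (\<lambda>z. ?g1 z + (?g2 z + ?g3 z))"
    by (intro continuous_intros c w)
  have "(\<integral>z. ?g1 z + (?g2 z + ?g3 z) \<partial>lborel) = 0"
    using I by (intro integral_line_deriv_eq_0[OF ld cc]) auto
  moreover have "(\<integral>z. ?g1 z + (?g2 z + ?g3 z) \<partial>lborel) = (\<integral>z. ?g1 z \<partial>lborel) + (\<integral>z. ?g2 z + ?g3 z \<partial>lborel)"
    using I by simp
  ultimately show ?thesis by (simp add: add_eq_0_iff2 distrib_right)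
qed

text \<open>
  Convolution at each time with \<open>k1 + (t - r) k2\<close>. The direction \<open>flow_dir (t - r) i\<close> is affine in \<open>r\<close>, so
  differentiation along it is of this form, with two kernels independent of time.
\<close>

definition joint_conv :: "real \<Rightarrow> ((real ^ 'd::finite) \<times> (real ^ 'd) \<Rightarrow> real) \<Rightarrow> ((real ^ 'd) \<times> (real ^ 'd) \<Rightarrow> real)
    \<Rightarrow> (real \<times> (real ^ 'd) \<times> (real ^ 'd) \<Rightarrow> 'b::euclidean_space) \<Rightarrow> real \<times> (real ^ 'd) \<times> (real ^ 'd) \<Rightarrow> 'b" where
  "joint_conv t k1 k2 u p = moll (\<lambda>y. (0, y)) k1 u p + (t - fst p) *\<^sub>R moll (\<lambda>y. (0, y)) k2 u p"

lemma joint_conv_measurable[measurable]: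
  assumes [measurable]: "k1 \<in> borel_measurable borel" "k2 \<in> borel_measurable borel" "u \<in> borel_measurable borel"
  shows "joint_conv t k1 k2 u \<in> borel_measurable borel"
  unfolding joint_conv_def[abs_def] by measurable

abbreviation "flow_conv t \<epsilon> i \<equiv> joint_conv t (mollifier_deriv \<epsilon> (0, axis i 1)) (mollifier_deriv \<epsilon> (axis i 1, 0))"
abbreviation "smooth_in_space \<epsilon> \<equiv> moll (\<lambda>y. (0, y)) (mollifier \<epsilon>)"

lemma flow_conv_eq:
  fixes u :: "real \<times> (real ^ 'd::finite) \<times> (real ^ 'd) \<Rightarrow> 'b::euclidean_space"
  assumes "\<epsilon> > 0" "locally_integrable (\<lambda>y. u (r, y))"
  shows "flow_conv t \<epsilon> i u (r, z) = conv (mollifier_deriv \<epsilon> (flow_dir (t - r) i)) (\<lambda>y. u (r, y)) z"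
proof -
  note I = conv_integrable[OF mollifier_deriv_kernel[OF assms(1)] assms(2)]
  have "conv (mollifier_deriv \<epsilon> (flow_dir (t - r) i)) (\<lambda>y. u (r, y)) z
    = (\<integral>y. mollifier_deriv \<epsilon> (0, axis i 1) (z - y) *\<^sub>R u (r, y) + (t - r) *\<^sub>R (mollifier_deriv \<epsilon> (axis i 1, 0) (z - y) *\<^sub>R u (r, y)) \<partial>lborel)"
    unfolding conv_def mollifier_deriv_flow_dir by (simp add: scaleR_add_left)
  also have "\<dots> = flow_conv t \<epsilon> i u (r, z)"
    using I unfolding joint_conv_def conv_section_eq_moll[symmetric] conv_def
    by (subst Bochner_Integration.integral_add) (auto intro!: integrable_scaleR_right simp del: scaleR_scaleR)
  finally show ?thesis by simp
qed

lemma flow_conv_strip_L2: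
  fixes u :: "real \<times> (real ^ 'd::finite) \<times> (real ^ 'd) \<Rightarrow> 'b::euclidean_space"
  assumes \<epsilon>: "\<epsilon> > 0" and u: "u \<in> L2 lborel"
  shows "(\<lambda>p. indicator {s<..t} (fst p) *\<^sub>R flow_conv t \<epsilon> i u p) \<in> L2 lborel"
proof -
  have [measurable]: "u \<in> borel_measurable borel" using L2_borel[OF u] .
  have m: "moll (\<lambda>y. (0::real, y)) (mollifier_deriv \<epsilon> b) u \<in> L2 lborel" for b
    by (intro moll_L2 kernel_integrable mollifier_deriv_kernel \<epsilon> u) measurable
  have 1: "(\<lambda>p. indicator {s<..t} (fst p) *\<^sub>R moll (\<lambda>y. (0, y)) (mollifier_deriv \<epsilon> (0, axis i 1)) u p) \<in> L2 lborel"
    by (rule L2_bound[OF m[of "(0, axis i 1)"], where C=1]) (measurable, simp add: indicator_def)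
  have 2: "(\<lambda>p. indicator {s<..t} (fst p) *\<^sub>R (t - fst p) *\<^sub>R moll (\<lambda>y. (0, y)) (mollifier_deriv \<epsilon> (axis i 1, 0)) u p) \<in> L2 lborel"
    by (rule L2_bound[OF m[of "(axis i 1, 0)"], where C="\<bar>t\<bar> + \<bar>s\<bar>"]) (measurable, auto simp: indicator_def intro!: mult_right_mono)
  show ?thesis using L2_add[OF 1 2] by (simp add: joint_conv_def scaleR_add_right)
qed

section \<open>Continuously differentiable functions and the Garding inequality\<close>

lemma smooth_continuous: "smooth h \<Longrightarrow> continuous_on UNIV h"
proof -
  assume "smooth h"
  then have "h differentiable at p" for p
    unfolding smooth_def by (metis empty_set empty_subsetI foldr_Nil id_apply iter_deriv_def)
  then show ?thesis by (intro continuous_at_imp_continuous_on) (auto intro: differentiable_imp_continuous_within)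
qed

lemma smooth_line_deriv:
  assumes "smooth h" shows "line_deriv b h (dir_deriv b h)"
  unfolding line_deriv_def
proof
  fix z
  have "h differentiable at p" for p
    using assms unfolding smooth_def by (metis empty_set empty_subsetI foldr_Nil id_apply iter_deriv_def)
  then have d: "(h has_derivative frechet_derivative h (at z)) (at z)" by (simp add: frechet_derivative_works)
  have "((\<lambda>\<sigma>::real. z + \<sigma> *\<^sub>R b) has_derivative (\<lambda>\<sigma>. \<sigma> *\<^sub>R b)) (at 0)"
    by (auto intro!: derivative_eq_intros)
  from has_derivative_compose[OF this, of h "frechet_derivative h (at z)"] d
  have "((\<lambda>\<sigma>. h (z + \<sigma> *\<^sub>R b)) has_derivative (\<lambda>\<sigma>. frechet_derivative h (at z) (\<sigma> *\<^sub>R b))) (at 0)" by simp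
  then show "((\<lambda>\<sigma>. h (z + \<sigma> *\<^sub>R b)) has_vector_derivative dir_deriv b h z) (at 0)"
    using linear_cmul[OF has_derivative_linear[OF d]] by (simp add: has_vector_derivative_def dir_deriv_def)
qed

lemma smooth_dir_deriv_continuous:
  assumes "smooth h" "b \<in> Basis" shows "continuous_on UNIV (dir_deriv b h)"
proof -
  have "dir_deriv b h differentiable at p" for p
    using assms(1)[unfolded smooth_def, rule_format, of "[b]" p] assms(2) by (simp add: iter_deriv_def)
  then show ?thesis by (intro continuous_at_imp_continuous_on) (auto intro: differentiable_imp_continuous_within)
qed

lemma line_deriv_eq_0:
  fixes h :: "'a::real_normed_vector \<Rightarrow> 'b::real_normed_vector"
  assumes "line_deriv b h h'" "open U" "z \<in> U" "\<And>x. x \<in> U \<Longrightarrow> h x = 0"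
  shows "h' z = 0"
proof -
  have "((\<lambda>\<sigma>. h (z + \<sigma> *\<^sub>R b)) has_vector_derivative h' z) (at 0)" using assms(1) by (simp add: line_deriv_def)
  moreover have "((\<lambda>\<sigma>. h (z + \<sigma> *\<^sub>R b)) has_vector_derivative 0) (at 0)"
  proof (rule has_vector_derivative_transform_within_open[where f="\<lambda>_. 0"])
    have "continuous_on UNIV (\<lambda>\<sigma>::real. z + \<sigma> *\<^sub>R b)" by (intro continuous_intros)
    then show "open ((\<lambda>\<sigma>::real. z + \<sigma> *\<^sub>R b) -` U)" using assms(2) by (simp add: open_vimage)
  qed (use assms in auto)
  ultimately show ?thesis using vector_derivative_unique_at by blast
qed

text \<open>
  Garding's inequality is assumed for distributions with square integrable gradient; it is applied to
  continuously differentiable functions.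
\<close>

lemma W12_dot_grad_of_C1:
  fixes g :: "real ^ 'd::finite \<Rightarrow> complex" and Q :: "real ^ 'd \<Rightarrow> complex ^ 'd"
  assumes g: "continuous_on UNIV g" and Q: "continuous_on UNIV Q" "Q \<in> L2 lebesgue"
    and d: "\<And>i. line_deriv (axis i 1) g (\<lambda>v. Q v $ i)"
  shows "W12_dot_grad (\<lambda>\<phi>. \<integral>v. g v * \<phi> v \<partial>lebesgue) Q"
proof -
  have supp0: "\<phi> v = 0" if "v \<notin> supp \<phi>" for \<phi> :: "real ^ 'd \<Rightarrow> complex" and v
    using that closure_subset[of "{p. \<phi> p \<noteq> 0}"] by (auto simp: supp_def)
  have R: "\<exists>R. \<forall>v. norm v \<ge> R \<longrightarrow> v \<notin> supp \<phi>" if "\<phi> \<in> test_functions UNIV" for \<phi> :: "real ^ 'd \<Rightarrow> complex"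
  proof -
    have "bounded (supp \<phi>)" using that by (auto simp: test_functions_def compact_imp_bounded)
    then obtain R where "\<forall>v\<in>supp \<phi>. norm v \<le> R" by (auto simp: bounded_iff)
    then show ?thesis by (intro exI[of _ "R + 1"]) fastforce
  qed
  have cont: "continuous_on UNIV \<phi>" if "\<phi> \<in> test_functions UNIV" for \<phi> :: "real ^ 'd \<Rightarrow> complex"
    using that by (auto simp: test_functions_def intro: smooth_continuous)
  have I: "integrable lborel (\<lambda>v. u v * \<phi> v)" if u: "continuous_on UNIV u" and \<phi>: "\<phi> \<in> test_functions UNIV" for u \<phi> :: "real ^ 'd \<Rightarrow> complex"
  proof -
    obtain R where "\<And>v. norm v \<ge> R \<Longrightarrow> v \<notin> supp \<phi>" using R[OF \<phi>] by blast
    then show ?thesis using u cont[OF \<phi>]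
      by (intro continuous_compact_support_integrable[where R=R] continuous_intros) (auto simp: supp0)
  qed
  have e: "(\<integral>v. u v * \<phi> v \<partial>lebesgue) = (\<integral>v. u v * \<phi> v \<partial>lborel)" if "continuous_on UNIV u" "continuous_on UNIV \<phi>"
    for u \<phi> :: "real ^ 'd \<Rightarrow> complex"
    using that by (intro integral_completion) (simp add: borel_measurable_continuous_onI continuous_on_mult)
  have T1: "(\<integral>v. g v * (\<phi> v + \<phi>' v) \<partial>lebesgue) = (\<integral>v. g v * \<phi> v \<partial>lebesgue) + (\<integral>v. g v * \<phi>' v \<partial>lebesgue)"
    if "\<phi> \<in> test_functions UNIV" "\<phi>' \<in> test_functions UNIV" for \<phi> \<phi>'
  proof -
    have "(\<integral>v. g v * (\<phi> v + \<phi>' v) \<partial>lebesgue) = (\<integral>v. g v * \<phi> v + g v * \<phi>' v \<partial>lborel)"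
      using e[OF g continuous_on_add[OF cont[OF that(1)] cont[OF that(2)]]] by (simp add: distrib_left)
    then show ?thesis using that I[OF g] by (simp add: e g cont)
  qed
  have T2: "(\<integral>v. g v * (c * \<phi> v) \<partial>lebesgue) = c * (\<integral>v. g v * \<phi> v \<partial>lebesgue)" for c and \<phi> :: "real ^ 'd \<Rightarrow> complex"
    by (subst integral_mult_right_zero[symmetric]) (simp add: mult_ac)
  have T3: "\<exists>C N. \<forall>\<phi>\<in>test_functions UNIV. \<forall>b. supp \<phi> \<subseteq> K \<longrightarrow>
        (\<forall>bs p. set bs \<subseteq> Basis \<longrightarrow> length bs \<le> N \<longrightarrow> norm (iter_deriv bs \<phi> p) \<le> b) \<longrightarrow>
        norm (\<integral>v. g v * \<phi> v \<partial>lebesgue) \<le> C * b" if K: "compact K" for K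
  proof (intro exI ballI allI impI)
    fix \<phi> :: "real ^ 'd \<Rightarrow> complex" and b
    assume \<phi>: "\<phi> \<in> test_functions UNIV" and s: "supp \<phi> \<subseteq> K"
      and b: "\<forall>bs p. set bs \<subseteq> Basis \<longrightarrow> length bs \<le> 0 \<longrightarrow> norm (iter_deriv bs \<phi> p) \<le> b"
    have b': "norm (\<phi> p) \<le> b" for p using b[rule_format, of "[]" p] by (simp add: iter_deriv_def)
    have iK: "integrable lborel (\<lambda>v. indicator K v *\<^sub>R g v)"
      by (intro borel_integrable_compact K continuous_on_subset[OF g]) auto
    have "norm (\<integral>v. g v * \<phi> v \<partial>lebesgue) \<le> (\<integral>v. norm (g v * \<phi> v) \<partial>lborel)"
      unfolding e[OF g cont[OF \<phi>]] by (rule integral_norm_bound)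
    also have "\<dots> \<le> (\<integral>v. norm (indicator K v *\<^sub>R g v) * b \<partial>lborel)"
    proof (rule integral_mono)
      show "norm (g v * \<phi> v) \<le> norm (indicator K v *\<^sub>R g v) * b" for v
      proof (cases "v \<in> K")
        case False
        then have "\<phi> v = 0" using s supp0[of v \<phi>] by blast
        then show ?thesis using False by simp
      qed (use b'[of v] in \<open>auto simp: norm_mult intro: mult_left_mono\<close>)
      show "integrable lborel (\<lambda>v. norm (indicator K v *\<^sub>R g v) * b)" by (rule integrable_mult_left[OF integrable_norm[OF iK]])
    qed (use I[OF g \<phi>] in auto)
    also have "\<dots> = (\<integral>v. norm (indicator K v *\<^sub>R g v) \<partial>lborel) * b" by (rule integral_mult_left_zero)
    finally show "norm (\<integral>v. g v * \<phi> v \<partial>lebesgue) \<le> (\<integral>v. norm (indicator K v *\<^sub>R g v) \<partial>lborel) * b" .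
  qed
  have grad: "(\<integral>v. g v * dir_deriv (axis i 1) \<phi> v \<partial>lebesgue) = - (\<integral>v. Q v $ i * \<phi> v \<partial>lebesgue)"
    if \<phi>: "\<phi> \<in> test_functions UNIV" for \<phi> i
  proof -
    have sm: "smooth \<phi>" using \<phi> by (simp add: test_functions_def)
    have Qi: "continuous_on UNIV (\<lambda>v. Q v $ i)" by (intro continuous_intros Q)
    have dc: "continuous_on UNIV (dir_deriv (axis i 1) \<phi>)"
      by (rule smooth_dir_deriv_continuous[OF sm]) (simp add: axis_in_Basis_iff)
    obtain R where R': "\<And>v. norm v \<ge> R \<Longrightarrow> v \<notin> supp \<phi>" using R[OF \<phi>] by blast
    have "open (- supp \<phi>)" unfolding supp_def by (simp add: closed_closure open_Compl)
    then have "dir_deriv (axis i 1) \<phi> v = 0" if "v \<notin> supp \<phi>" for v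
      using that by (intro line_deriv_eq_0[OF smooth_line_deriv[OF sm]]) (auto simp: supp0)
    then have I1: "integrable lborel (\<lambda>v. g v * dir_deriv (axis i 1) \<phi> v)"
      using R' by (intro continuous_compact_support_integrable[where R=R] continuous_intros g dc) auto
    note I2 = I[OF Qi \<phi>]
    have "(\<integral>v. g v * dir_deriv (axis i 1) \<phi> v + Q v $ i * \<phi> v \<partial>lborel) = 0"
      using I1 I2 I[OF g \<phi>]
      by (intro integral_line_deriv_eq_0[OF line_deriv_mult[OF d smooth_line_deriv[OF sm]]] continuous_intros g dc Qi cont \<phi>) auto
    then show ?thesis using I1 I2 by (simp add: e g dc Qi cont \<phi> add_eq_0_iff2)
  qed
  show ?thesis
    unfolding W12_dot_grad_def distribution_def using T1 T2 T3 grad Q(2) by auto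
qed

section \<open>The flux conjugated with the weight\<close>

lemma herm_add_left: "herm (a + b) c = herm a c + herm b c"
  and herm_add_right: "herm a (b + c) = herm a b + herm a c"
  and herm_diff_left: "herm (a - b) c = herm a c - herm b c"
  by (simp_all add: herm_def sum.distrib sum_subtractf algebra_simps)

lemma herm_self: "herm a a = complex_of_real ((norm a)\<^sup>2)"
proof -
  have "herm a a = (\<Sum>i\<in>UNIV. complex_of_real ((norm (a $ i))\<^sup>2))"
    unfolding herm_def complex_norm_square ..
  also have "\<dots> = complex_of_real ((norm a)\<^sup>2)"
    by (simp add: norm_vec_def L2_set_def sum_nonneg)
  finally show ?thesis .
qed

lemma herm_scaleR: "herm (c *\<^sub>R a) b = c *\<^sub>R herm a b" "herm a (c *\<^sub>R b) = c *\<^sub>R herm a b"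
  by (simp_all add: herm_def scaleR_sum_right)

lemma norm_herm_le: "norm (herm a b) \<le> norm a * norm b"
proof -
  have "norm (herm a b) \<le> (\<Sum>i\<in>UNIV. norm (a $ i) * norm (b $ i))"
    unfolding herm_def by (rule order_trans[OF norm_sum]) (simp add: norm_mult)
  also have "\<dots> \<le> norm a * norm b"
    unfolding norm_vec_def using L2_set_mult_ineq[of "\<lambda>i. norm (a $ i)" "\<lambda>i. norm (b $ i)" UNIV]
    by simp
  finally show ?thesis .
qed

lemma norm_matrix_vector_le:
  fixes a :: "complex ^ 'd ^ 'd"
  assumes "\<And>\<xi> \<eta>. norm (herm (a *v \<xi>) \<eta>) \<le> \<Lambda> * norm \<xi> * norm \<eta>"
  shows "norm (a *v \<xi>) \<le> \<bar>\<Lambda>\<bar> * norm \<xi>"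
proof (cases "a *v \<xi> = 0")
  case False
  have "(norm (a *v \<xi>))\<^sup>2 \<le> \<Lambda> * norm \<xi> * norm (a *v \<xi>)"
    using assms[of \<xi> "a *v \<xi>"] by (simp add: herm_self norm_power)
  then have "norm (a *v \<xi>) \<le> \<Lambda> * norm \<xi>" using False by (simp add: power2_eq_square)
  also have "\<dots> \<le> \<bar>\<Lambda>\<bar> * norm \<xi>" by (intro mult_right_mono) auto
  finally show ?thesis .
qed simp

text \<open>
  With \<open>P = q + \<delta>\<close>, where \<open>\<delta>\<close> stands for \<open>f \<nabla> \<phi>\<close>, the product \<open>(a q) \<cdot> (q + 2 \<delta>)\<close> is
  \<open>(a (P - \<delta>)) \<cdot> (P + \<delta>)\<close>. The two mixed terms are at most \<open>2 \<Lambda> \<bar>P\<bar> \<bar>\<delta>\<bar> \<le> \<lambda> \<bar>P\<bar>\<^sup>2 + \<Lambda>\<^sup>2 / \<lambda> \<bar>\<delta>\<bar>\<^sup>2\<close>.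
  Integration and Garding's inequality cancel the terms in \<open>P\<close>; pointwise, \<open>a\<close> need not be coercive, so the
  inequality is kept in this form. The last term accounts for a flux \<open>h\<close> that differs from \<open>a q\<close>.
\<close>

lemma conjugated_flux_bound:
  fixes a :: "complex ^ 'd ^ 'd" and q h \<delta> :: "complex ^ 'd"
  assumes a: "\<And>\<xi> \<eta>. norm (herm (a *v \<xi>) \<eta>) \<le> \<Lambda> * norm \<xi> * norm \<eta>" and lam: "lam > 0"
  shows "- Re (herm h (q + 2 *\<^sub>R \<delta>)) \<le> - Re (herm (a *v (q + \<delta>)) (q + \<delta>)) + lam * (norm (q + \<delta>))\<^sup>2
     + (\<Lambda>\<^sup>2 / lam + \<Lambda>) * (norm \<delta>)\<^sup>2 + norm (h - a *v q) * norm (q + 2 *\<^sub>R \<delta>)"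
proof -
  define P where "P = q + \<delta>"
  have qP: "q = P - \<delta>" "q + 2 *\<^sub>R \<delta> = P + \<delta>" by (simp_all add: P_def scaleR_2)
  have h: "h = a *v P - a *v \<delta> + (h - a *v q)"
    by (simp add: qP(1) matrix_vector_mult_diff_distrib)
  have "herm h (q + 2 *\<^sub>R \<delta>) = herm (a *v P) P + herm (a *v P) \<delta> - herm (a *v \<delta>) P - herm (a *v \<delta>) \<delta> + herm (h - a *v q) (q + 2 *\<^sub>R \<delta>)"
    unfolding qP(2) by (subst h) (simp only: herm_add_left herm_add_right herm_diff_left, simp)
  moreover have "\<bar>Re (herm (a *v P) \<delta>)\<bar> \<le> \<Lambda> * norm P * norm \<delta>" "\<bar>Re (herm (a *v \<delta>) P)\<bar> \<le> \<Lambda> * norm P * norm \<delta>"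
    "\<bar>Re (herm (a *v \<delta>) \<delta>)\<bar> \<le> \<Lambda> * (norm \<delta>)\<^sup>2"
    "\<bar>Re (herm (h - a *v q) (q + 2 *\<^sub>R \<delta>))\<bar> \<le> norm (h - a *v q) * norm (q + 2 *\<^sub>R \<delta>)"
    using order_trans[OF abs_Re_le_cmod a[of P \<delta>]] order_trans[OF abs_Re_le_cmod a[of \<delta> P]] order_trans[OF abs_Re_le_cmod a[of \<delta> \<delta>]]
      order_trans[OF abs_Re_le_cmod norm_herm_le]
    by (simp_all add: mult_ac power2_eq_square)
  moreover have "2 * \<Lambda> * norm P * norm \<delta> \<le> lam * (norm P)\<^sup>2 + \<Lambda>\<^sup>2 / lam * (norm \<delta>)\<^sup>2"
  proof -
    have "0 \<le> (lam * norm P - \<Lambda> * norm \<delta>)\<^sup>2 / lam" using lam by simp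
    also have "\<dots> = lam * (norm P)\<^sup>2 + \<Lambda>\<^sup>2 / lam * (norm \<delta>)\<^sup>2 - 2 * \<Lambda> * norm P * norm \<delta>"
      using lam by (simp add: power2_eq_square field_simps)
    finally show ?thesis by simp
  qed
  moreover have "(\<Lambda>\<^sup>2 / lam + \<Lambda>) * (norm \<delta>)\<^sup>2 = \<Lambda>\<^sup>2 / lam * (norm \<delta>)\<^sup>2 + \<Lambda> * (norm \<delta>)\<^sup>2" by (simp add: distrib_right)
  ultimately show ?thesis by (simp add: P_def)
qed

lemma borel_measurable_vec_lambda[measurable (raw)]:
  fixes h :: "'a \<Rightarrow> 'd::finite \<Rightarrow> complex"
  assumes "\<And>i. (\<lambda>x. h x i) \<in> borel_measurable M"
  shows "(\<lambda>x. \<chi> i. h x i) \<in> borel_measurable M"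
  unfolding borel_measurable_euclidean_space[of "\<lambda>x. \<chi> i. h x i"]
  using assms by (auto simp: Basis_vec_def inner_axis)

lemma borel_measurable_vec_nth:
  fixes U :: "'a \<Rightarrow> 'b::euclidean_space ^ 'd::finite"
  assumes "U \<in> borel_measurable M" shows "(\<lambda>x. U x $ i) \<in> borel_measurable M"
  using measurable_compose[OF assms borel_measurable_continuous_onI[OF linear_continuous_on[OF bounded_linear_vec_nth]]] .

lemma borel_measurable_matrix_vector_mult[measurable (raw)]:
  fixes B :: "'a \<Rightarrow> complex ^ 'd ^ 'd::finite"
  assumes "B \<in> borel_measurable M" "u \<in> borel_measurable M"
  shows "(\<lambda>x. B x *v u x) \<in> borel_measurable M"
  unfolding matrix_vector_mult_def
  by (intro borel_measurable_vec_lambda borel_measurable_sum borel_measurable_times borel_measurable_vec_nth assms)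

lemma borel_measurable_herm[measurable (raw)]:
  assumes "u \<in> borel_measurable M" "v \<in> borel_measurable M"
  shows "(\<lambda>x. herm (u x) (v x)) \<in> borel_measurable M"
proof -
  have [measurable]: "(\<lambda>x. u x $ i) \<in> borel_measurable M" "(\<lambda>x. v x $ i) \<in> borel_measurable M" for i
    using assms by (auto intro: borel_measurable_vec_nth)
  show ?thesis unfolding herm_def by measurable
qed

lemma L2_vec_lambda:
  fixes h :: "'a \<Rightarrow> 'd::finite \<Rightarrow> complex"
  assumes "\<And>i. (\<lambda>x. h x i) \<in> L2 M" shows "(\<lambda>x. \<chi> i. h x i) \<in> L2 M"
proof (rule L2_I)
  show "(\<lambda>x. \<chi> i. h x i) \<in> borel_measurable M" using assms by (intro borel_measurable_vec_lambda) auto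
  have "(norm (\<chi> i. h x i))\<^sup>2 = (\<Sum>i\<in>UNIV. (norm (h x i))\<^sup>2)" for x
    by (simp add: norm_vec_def L2_set_def sum_nonneg)
  then show "integrable M (\<lambda>x. (norm (\<chi> i. h x i))\<^sup>2)" using L2_integrable[OF assms] by simp
qed

lemma L2_lborel_imp_lebesgue: "u \<in> L2 lborel \<Longrightarrow> u \<in> L2 lebesgue"
  unfolding L2_def by (auto simp: integrable_completion intro: borel_measurable_lebesgueI)

lemma line_deriv_along_drift:
  assumes "line_deriv (flow_dir a i) h h'"
  shows "line_deriv (axis i 1) (\<lambda>v. h (drift a (x, v))) (\<lambda>v. h' (drift a (x, v)))"
proof -
  have e: "drift a (x, v + \<sigma> *\<^sub>R axis i 1) = drift a (x, v) + \<sigma> *\<^sub>R flow_dir a i" for v \<sigma>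
    by (simp add: drift_def flow_dir_def algebra_simps)
  show ?thesis unfolding line_deriv_def e using assms[unfolded line_deriv_def] by blast
qed

lemma L2_herm_integrable:
  fixes u v :: "'a \<Rightarrow> complex ^ 'd::finite"
  assumes "u \<in> L2 M" "v \<in> L2 M" shows "integrable M (\<lambda>x. herm (u x) (v x))"
proof -
  have m: "u \<in> borel_measurable M" "v \<in> borel_measurable M" using assms by auto
  show ?thesis
    by (rule Bochner_Integration.integrable_bound[OF L2_norm_mult_integrable[OF assms]])
      (use m norm_herm_le in auto)
qed

section \<open>Mollified solutions and the energy identity with a weight\<close>

text \<open>
  The weight \<open>\<phi>\<close> is a function of the transported point alone, hence constant along transport.
  \<open>\<phi>d b\<close> is its derivative in the direction \<open>b\<close>, and \<open>D\<close> bounds its velocity gradient at all times in \<open>[s, t]\<close>.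
\<close>

locale weighted_kinetic_solution = weak_kinetic_solution +
  fixes lam \<Lambda> :: real and \<phi> :: "(real ^ 'a) \<times> (real ^ 'a) \<Rightarrow> real"
    and \<phi>d :: "(real ^ 'a) \<times> (real ^ 'a) \<Rightarrow> (real ^ 'a) \<times> (real ^ 'a) \<Rightarrow> real" and M D :: real
  assumes lam: "lam > 0" and bounded: "bounded_coeff \<Lambda> A" and garding: "garding_elliptic lam A"
    and \<phi>_cont: "continuous_on UNIV \<phi>" and \<phi>_bound: "\<And>z. \<bar>\<phi> z\<bar> \<le> M"
    and \<phi>_deriv: "\<And>b. line_deriv b \<phi> (\<phi>d b)" and \<phi>d_cont: "\<And>b. continuous_on UNIV (\<phi>d b)"
    and \<phi>d_linear: "\<And>a i z. \<phi>d (flow_dir a i) z = \<phi>d (0, axis i 1) z + a * \<phi>d (axis i 1, 0) z"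
    and \<phi>d_bound: "\<And>r z. s \<le> r \<Longrightarrow> r \<le> t \<Longrightarrow> norm (\<chi> i. \<phi>d (flow_dir (t - r) i) z) \<le> D"
begin

text \<open>
  The mollifications of \<open>FF\<close>, \<open>GG\<close> and \<open>HH\<close>, the velocity gradient \<open>DF\<close> of \<open>FM\<close> and the divergence \<open>SM\<close> of \<open>HM\<close>
  in the moving frame, the exponential weight, and \<open>\<delta> = FM \<nabla>\<^sub>v \<phi>\<close>. The functions \<open>DF\<close> and \<open>SM\<close> are
  defined through \<open>joint_conv\<close> and are therefore jointly measurable.
\<close>

definition "FM \<epsilon> = smooth_in_space \<epsilon> FF"
definition "GM \<epsilon> = smooth_in_space \<epsilon> GG"
definition "HM \<epsilon> = smooth_in_space \<epsilon> HH"
definition "DF \<epsilon> p = (\<chi> i. flow_conv t \<epsilon> i FF p)"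
definition "SM \<epsilon> p = (\<Sum>i\<in>UNIV. flow_conv t \<epsilon> i (\<lambda>q. HH q $ i) p)"
definition "w z = exp (2 * \<phi> z)"
definition "\<delta> \<epsilon> p = (\<chi> i. complex_of_real (\<phi>d (flow_dir (t - fst p) i) (snd p)) * FM \<epsilon> p)"
definition "BF p = B (flow t p)"

lemma field_measurable[measurable]:
  "FF \<in> borel_measurable borel" "GG \<in> borel_measurable borel" "HH \<in> borel_measurable borel"
  "(\<lambda>q. HH q $ i) \<in> borel_measurable borel" "BF \<in> borel_measurable borel" "\<psi>\<psi> \<in> borel_measurable borel"
proof -
  note [measurable] = B(1)
  show "BF \<in> borel_measurable borel" unfolding BF_def[abs_def] by measurable
qed (use L2_borel[OF FF] L2_borel[OF GG] L2_borel[OF HH] L2_borel[OF vec_nth_L2[OF HH]] L2_borel[OF \<psi>\<psi>] in auto)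

lemma weight_measurable[measurable]:
  "\<phi> \<in> borel_measurable borel" "\<phi>d b \<in> borel_measurable borel"
  using borel_measurable_continuous_onI[OF \<phi>_cont] borel_measurable_continuous_onI[OF \<phi>d_cont] by auto

lemma w_measurable[measurable]: "w \<in> borel_measurable borel"
  unfolding w_def[abs_def] by measurable

lemma smoothed_measurable[measurable]:
  "FM \<epsilon> \<in> borel_measurable borel" "HM \<epsilon> \<in> borel_measurable borel" "DF \<epsilon> \<in> borel_measurable borel"
  "SM \<epsilon> \<in> borel_measurable borel" "\<delta> \<epsilon> \<in> borel_measurable borel"
proof -
  show 1[measurable]: "FM \<epsilon> \<in> borel_measurable borel" unfolding FM_def by measurable
  show "HM \<epsilon> \<in> borel_measurable borel" unfolding HM_def by measurable
  show "DF \<epsilon> \<in> borel_measurable borel" unfolding DF_def[abs_def] by measurable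
  show "SM \<epsilon> \<in> borel_measurable borel" unfolding SM_def[abs_def] by measurable
  show "\<delta> \<epsilon> \<in> borel_measurable borel" unfolding \<delta>_def[abs_def] \<phi>d_linear by measurable
qed

lemma w_bounds: "0 < w z" "w z \<le> exp (2 * M)" "w z = (exp (\<phi> z))\<^sup>2"
  using \<phi>_bound[of z] by (auto simp: w_def exp_double[symmetric] exp_of_nat_mult[symmetric] power2_eq_square simp flip: exp_add)

lemma D_nonneg: "0 \<le> D"
  using order_trans[OF norm_ge_zero \<phi>d_bound[of t 0]] st by simp

text \<open>
  The times at which the mollifications are smooth in space; these are almost all times.
\<close>

definition regular :: "real \<Rightarrow> bool" where
  "regular r \<longleftrightarrow> (\<lambda>y. FF (r, y)) \<in> L2 lborel \<and> (\<lambda>y. HH (r, y)) \<in> L2 lborel"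

lemma regular_AE: "AE r in lborel. regular r"
  using L2_section[OF FF] L2_section[OF HH] by (auto simp: regular_def)

lemma slices:
  assumes r: "regular r" and \<epsilon>: "\<epsilon> > 0"
  shows "FM \<epsilon> (r, z) = conv (mollifier \<epsilon>) (\<lambda>y. FF (r, y)) z"
    and "HM \<epsilon> (r, z) $ i = conv (mollifier \<epsilon>) (\<lambda>y. HH (r, y) $ i) z"
    and "DF \<epsilon> (r, z) $ i = conv (mollifier_deriv \<epsilon> (flow_dir (t - r) i)) (\<lambda>y. FF (r, y)) z"
    and "flow_conv t \<epsilon> i (\<lambda>q. HH q $ i) (r, z) = conv (mollifier_deriv \<epsilon> (flow_dir (t - r) i)) (\<lambda>y. HH (r, y) $ i) z"
    and "SM \<epsilon> (r, z) = source \<epsilon> r z"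
proof -
  have l: "locally_integrable (\<lambda>y. FF (r, y))" "locally_integrable (\<lambda>y. HH (r, y))" "locally_integrable (\<lambda>y. HH (r, y) $ i)" for i
    using r vec_nth_L2[of "\<lambda>y. HH (r, y)"] by (auto simp: regular_def intro: L2_locally_integrable)
  show "FM \<epsilon> (r, z) = conv (mollifier \<epsilon>) (\<lambda>y. FF (r, y)) z"
    by (simp add: FM_def conv_section_eq_moll)
  show "HM \<epsilon> (r, z) $ i = conv (mollifier \<epsilon>) (\<lambda>y. HH (r, y) $ i) z"
    using conv_vec_nth[OF mollifier_kernel[OF \<epsilon>] l(2)] by (simp add: HM_def conv_section_eq_moll[symmetric])
  show "DF \<epsilon> (r, z) $ i = conv (mollifier_deriv \<epsilon> (flow_dir (t - r) i)) (\<lambda>y. FF (r, y)) z"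
    unfolding DF_def by (simp add: flow_conv_eq[OF \<epsilon> l(1)])
  show h: "flow_conv t \<epsilon> i (\<lambda>q. HH q $ i) (r, z) = conv (mollifier_deriv \<epsilon> (flow_dir (t - r) i)) (\<lambda>y. HH (r, y) $ i) z" for i
    by (rule flow_conv_eq[OF \<epsilon> l(3)])
  show "SM \<epsilon> (r, z) = source \<epsilon> r z" by (simp add: SM_def source_def h)
qed

lemma GM_measurable[measurable]: "GM \<epsilon> \<in> borel_measurable borel"
  unfolding GM_def by measurable

lemma DF_eq_GM:
  assumes \<epsilon>: "\<epsilon> > 0"
  shows "AE p in lborel. s < fst p \<and> fst p \<le> t \<longrightarrow> DF \<epsilon> p = GM \<epsilon> p"
proof -
  let ?P = "\<lambda>p::((real ^ 'a) \<times> (real ^ 'a)) \<times> real. s < snd p \<and> snd p \<le> t \<longrightarrow> DF \<epsilon> (snd p, fst p) = GM \<epsilon> (snd p, fst p)"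
  have "AE p in lborel. ?P p"
  proof (rule AE_lborel_prodI)
    have "Measurable.pred borel (\<lambda>p::((real ^ 'a) \<times> (real ^ 'a)) \<times> real. DF \<epsilon> (snd p, fst p) - GM \<epsilon> (snd p, fst p) = 0)"
      by measurable
    then have [measurable]: "Measurable.pred borel (\<lambda>p::((real ^ 'a) \<times> (real ^ 'a)) \<times> real. DF \<epsilon> (snd p, fst p) = GM \<epsilon> (snd p, fst p))"
      by simp
    show "Measurable.pred borel ?P" by measurable
    show "AE z in lborel. AE r in lborel. ?P (z, r)"
    proof (rule AE_I2)
      fix z
      have "AE r in lborel. \<forall>i\<in>UNIV. s < r \<and> r \<le> t \<longrightarrow> conv (mollifier_deriv \<epsilon> (flow_dir (t - r) i)) (\<lambda>y. FF (r, y)) z = conv (mollifier \<epsilon>) (\<lambda>y. GG (r, y) $ i) z"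
        by (intro AE_finite_allI gradient_identity[OF \<epsilon>]) auto
      with regular_AE L2_section[OF GG] show "AE r in lborel. ?P (z, r)"
      proof eventually_elim
        case (elim r)
        show ?case
          using elim conv_vec_nth[OF mollifier_kernel[OF \<epsilon>] L2_locally_integrable[OF elim(2)], of z]
          by (auto simp: vec_eq_iff GM_def slices[OF elim(1) \<epsilon>] conv_section_eq_moll[symmetric])
      qed
    qed
  qed
  from AE_lborel_swap[OF this] show ?thesis by simp
qed

lemma SM_strip_L2:
  assumes \<epsilon>: "\<epsilon> > 0" and "t' \<le> t"
  shows "(\<lambda>p. indicator {s<..t'} (fst p) *\<^sub>R SM \<epsilon> p) \<in> L2 lborel"
proof -
  have "(\<lambda>p. \<Sum>i\<in>I. indicator {s<..t} (fst p) *\<^sub>R flow_conv t \<epsilon> i (\<lambda>q. HH q $ i) p) \<in> L2 lborel" if "finite I" for I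
    using that
  proof (induction I rule: finite_induct)
    case empty then show ?case by (auto intro: L2_I)
  next
    case (insert i I)
    then show ?case using L2_add[OF flow_conv_strip_L2[OF \<epsilon> vec_nth_L2[OF HH], of s t i i] insert.IH]
      by (simp only: sum.insert[OF insert.hyps])
  qed
  from this[of UNIV] have "(\<lambda>p. indicator {s<..t} (fst p) *\<^sub>R SM \<epsilon> p) \<in> L2 lborel" by (simp add: SM_def scaleR_sum_right)
  then show ?thesis
    by (rule L2_bound[where C=1]) (use \<open>t' \<le> t\<close> in \<open>measurable, auto simp: indicator_def\<close>)
qed

lemma FM_L2: "\<epsilon> > 0 \<Longrightarrow> FM \<epsilon> \<in> L2 lborel"
  unfolding FM_def by (intro moll_L2 kernel_integrable mollifier_kernel FF) measurable

lemma HM_L2: "\<epsilon> > 0 \<Longrightarrow> HM \<epsilon> \<in> L2 lborel"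
  unfolding HM_def by (intro moll_L2 kernel_integrable mollifier_kernel HH) measurable

lemma mollified_energy_integrable:
  assumes \<epsilon>: "\<epsilon> > 0" and "t' \<le> t"
  shows "integrable lborel (\<lambda>p. complex_of_real (w (snd p)) * cnj (FM \<epsilon> p) * (indicator {s<..t'} (fst p) *\<^sub>R SM \<epsilon> p))"
proof (rule L2_mult_integrable[where C="exp (2 * M)"])
  show "(\<lambda>p. cnj (FM \<epsilon> p)) \<in> L2 lborel" by (rule L2_cnj[OF FM_L2[OF \<epsilon>]])
  show "(\<lambda>p. indicator {s<..t'} (fst p) *\<^sub>R SM \<epsilon> p) \<in> L2 lborel" by (rule SM_strip_L2[OF \<epsilon> assms(2)])
  show "norm (complex_of_real (w (snd p))) \<le> exp (2 * M)" for p using w_bounds(1,2)[of "snd p"] by simp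
qed measurable

text \<open>
  For each fixed \<open>z\<close> the mollified solution is an indefinite integral in time, so \<open>norm_square_indefinite_integral\<close>
  applies; then the weight is inserted and the identity is integrated over \<open>z\<close>.
\<close>

lemma mollified_energy_identity:
  assumes \<epsilon>: "\<epsilon> > 0" and t': "s \<le> t'" "t' \<le> t"
    and u: "u \<in> L2 lborel" "AE y in lborel. u y = f t' (drift (t' - t) y)"
  shows "(\<integral>z. w z * (norm (conv (mollifier \<epsilon>) u z))\<^sup>2 \<partial>lborel) = (\<integral>z. w z * (norm (conv (mollifier \<epsilon>) \<psi>\<psi> z))\<^sup>2 \<partial>lborel)
    + 2 * Re (\<integral>p. complex_of_real (w (snd p)) * cnj (FM \<epsilon> p) * (indicator {s<..t'} (fst p) *\<^sub>R SM \<epsilon> p) \<partial>lborel)"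
proof -
  define U where "U = conv (mollifier \<epsilon>) u"
  define c where "c = conv (mollifier \<epsilon>) \<psi>\<psi>"
  let ?Q = "\<lambda>p. complex_of_real (w (snd p)) * cnj (FM \<epsilon> p) * (indicator {s<..t'} (fst p) *\<^sub>R SM \<epsilon> p)"
  note Q = mollified_energy_integrable[OF \<epsilon> t'(2)]
  have L2: "U \<in> L2 lborel" "c \<in> L2 lborel"
    unfolding U_def c_def using conv_L2[OF mollifier_kernel[OF \<epsilon>]] u(1) \<psi>\<psi> by auto
  have pt: "(norm (U z))\<^sup>2 = (norm (c z))\<^sup>2 + 2 * Re (\<integral>r. cnj (FM \<epsilon> (r, z)) * (indicator {s<..t'} r *\<^sub>R SM \<epsilon> (r, z)) \<partial>lborel)" for z
  proof -
    let ?g = "\<lambda>r. indicator {s<..t'} r *\<^sub>R SM \<epsilon> (r, z)"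
    have ab: "\<bar>r\<bar> \<le> \<bar>s\<bar> + \<bar>t\<bar>" if "s < r" "r \<le> t" for r using that by linarith
    have "integrable lborel (\<lambda>r. indicator {s<..t'} r *\<^sub>R source \<epsilon> r z)"
      by (rule source_integrable[OF \<epsilon>, of _ "\<bar>s\<bar> + \<bar>t\<bar>"]) (use t' in \<open>auto simp: indicator_def intro!: ab split: if_splits\<close>)
    then have g: "integrable lborel ?g"
      by (rule integrable_cong_AE_imp) (measurable, use regular_AE in \<open>auto simp: slices[OF _ \<epsilon>] elim!: AE_mp\<close>)
    have "U z = c z + (\<integral>r. indicator {s<..t'} r *\<^sub>R source \<epsilon> r z \<partial>lborel)"
      unfolding U_def c_def by (rule evolution_identity[OF \<epsilon> t' u])
    also have src: "(\<integral>r. indicator {s<..r1} r *\<^sub>R source \<epsilon> r z \<partial>lborel) = (\<integral>r. indicator {..r1} r *\<^sub>R ?g r \<partial>lborel)" if r1: "r1 \<le> t'" for r1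
    proof (rule integral_cong_AE)
      have "integrable lborel (\<lambda>r. indicator {s<..r1} r *\<^sub>R source \<epsilon> r z)"
        by (rule source_integrable[OF \<epsilon>, of _ "\<bar>s\<bar> + \<bar>t\<bar>"]) (use r1 t' in \<open>auto simp: indicator_def intro!: ab split: if_splits\<close>)
      then show "(\<lambda>r. indicator {s<..r1} r *\<^sub>R source \<epsilon> r z) \<in> borel_measurable lborel" by auto
      show "AE r in lborel. indicator {s<..r1} r *\<^sub>R source \<epsilon> r z = indicator {..r1} r *\<^sub>R ?g r"
        using regular_AE by eventually_elim (use r1 in \<open>auto simp: slices[OF _ \<epsilon>] indicator_def\<close>)
    qed measurable
    have "(\<integral>r. indicator {s<..t'} r *\<^sub>R source \<epsilon> r z \<partial>lborel) = (\<integral>r. ?g r \<partial>lborel)"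
      by (subst src) (auto intro!: Bochner_Integration.integral_cong simp: indicator_def)
    finally have Uz: "U z = c z + (\<integral>r. ?g r \<partial>lborel)" .
    show ?thesis unfolding Uz
    proof (rule norm_square_indefinite_integral[OF g])
      show "(\<lambda>r. FM \<epsilon> (r, z)) \<in> borel_measurable borel" by measurable
      show "AE r in lborel. ?g r \<noteq> 0 \<longrightarrow> FM \<epsilon> (r, z) = c z + (\<integral>\<rho>. indicator {..r} \<rho> *\<^sub>R ?g \<rho> \<partial>lborel)"
        using regular_AE frame_slices
      proof eventually_elim
        case (elim r)
        show ?case
        proof
          assume "?g r \<noteq> 0"
          then have r: "s < r" "r \<le> t'" by (auto simp: indicator_def split: if_splits)
          have "(\<lambda>y. FF (r, y)) \<in> L2 lborel" using elim by (simp add: regular_def)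
          moreover have "AE y in lborel. FF (r, y) = f r (drift (r - t) y)" using elim r t' by auto
          ultimately have "conv (mollifier \<epsilon>) (\<lambda>y. FF (r, y)) z = c z + (\<integral>\<rho>. indicator {s<..r} \<rho> *\<^sub>R source \<epsilon> \<rho> z \<partial>lborel)"
            unfolding c_def using r t' by (intro evolution_identity[OF \<epsilon>]) auto
          then show "FM \<epsilon> (r, z) = c z + (\<integral>\<rho>. indicator {..r} \<rho> *\<^sub>R ?g \<rho> \<partial>lborel)"
            using src[OF r(2)] by (simp add: slices[OF elim(1) \<epsilon>])
        qed
      qed
    qed
  qed
  have sw: "(\<integral>z. \<integral>r. ?Q (r, z) \<partial>lborel \<partial>lborel) = (\<integral>p. ?Q p \<partial>lborel)"
    using integral_lborel_prod[OF Q] integral_lborel_swap[OF Q] by simp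
  have Qz: "integrable lborel (\<lambda>z. \<integral>r. ?Q (r, z) \<partial>lborel)"
    using integrable_section_integral[OF integrable_lborel_swap[OF Q]] by simp
  have wc: "integrable lborel (\<lambda>z. w z * (norm (c z))\<^sup>2)"
  proof (rule Bochner_Integration.integrable_bound[OF integrable_mult_right[OF L2_integrable[OF L2(2)], of "exp (2 * M)"]])
    have [measurable]: "c \<in> borel_measurable borel" using L2_borel[OF L2(2)] .
    show "(\<lambda>z. w z * (norm (c z))\<^sup>2) \<in> borel_measurable lborel" by measurable
    show "AE z in lborel. norm (w z * (norm (c z))\<^sup>2) \<le> norm (exp (2 * M) * (norm (c z))\<^sup>2)"
      using w_bounds by (intro AE_I2) (auto simp: abs_mult less_imp_le intro!: mult_right_mono)
  qed
  have "w z * (norm (U z))\<^sup>2 = w z * (norm (c z))\<^sup>2 + 2 * Re (\<integral>r. ?Q (r, z) \<partial>lborel)" for z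
  proof -
    have "(\<integral>r. ?Q (r, z) \<partial>lborel) = complex_of_real (w z) * (\<integral>r. cnj (FM \<epsilon> (r, z)) * (indicator {s<..t'} r *\<^sub>R SM \<epsilon> (r, z)) \<partial>lborel)"
      by (subst integral_mult_right_zero[symmetric]) (simp only: mult.assoc fst_conv snd_conv)
    then show ?thesis by (simp only: pt distrib_left) simp
  qed
  then have "(\<integral>z. w z * (norm (U z))\<^sup>2 \<partial>lborel) = (\<integral>z. w z * (norm (c z))\<^sup>2 \<partial>lborel) + 2 * Re (\<integral>z. \<integral>r. ?Q (r, z) \<partial>lborel \<partial>lborel)"
    using wc Qz by simp
  then show ?thesis unfolding sw by (simp add: U_def c_def)
qed

end

context weighted_kinetic_solution
begin

text \<open>The velocity gradient of \<open>exp \<phi> FM\<close>, the function to which Garding's inequality is applied.\<close>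

definition PF :: "real \<Rightarrow> real \<times> (real ^ 'a) \<times> (real ^ 'a) \<Rightarrow> complex ^ 'a" where
  "PF \<epsilon> p = exp (\<phi> (snd p)) *\<^sub>R (DF \<epsilon> p + \<delta> \<epsilon> p)"

lemma PF_measurable[measurable]: "PF \<epsilon> \<in> borel_measurable borel"
  unfolding PF_def[abs_def] by measurable

lemma coefficient_bounded_AE:
  "AE p in lborel. \<forall>\<xi> \<eta>. norm (herm (BF p *v \<xi>) \<eta>) \<le> \<Lambda> * norm \<xi> * norm \<eta>"
proof -
  have "AE p in lborel. \<forall>\<xi> \<eta>. norm (herm (B p *v \<xi>) \<eta>) \<le> \<Lambda> * norm \<xi> * norm \<eta>"
    using bounded[unfolded bounded_coeff_def AE_lebesgue_iff] B(2) by eventually_elim simp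
  from flow_AE[OF this] show ?thesis by (simp add: BF_def)
qed

lemma \<delta>_bound:
  assumes "s \<le> fst p" "fst p \<le> t" shows "norm (\<delta> \<epsilon> p) \<le> D * norm (FM \<epsilon> p)"
proof -
  have "norm (\<delta> \<epsilon> p) = norm (\<chi> i. \<phi>d (flow_dir (t - fst p) i) (snd p)) * norm (FM \<epsilon> p)"
    by (simp add: \<delta>_def norm_vec_def L2_set_def norm_mult power_mult_distrib real_sqrt_mult flip: sum_distrib_right)
  also have "\<dots> \<le> D * norm (FM \<epsilon> p)" by (intro mult_right_mono \<phi>d_bound assms) auto
  finally show ?thesis .
qed

lemma regular_slice_L2:
  assumes r: "regular r" "s \<le> r" "r \<le> t" and \<epsilon>: "\<epsilon> > 0"
  shows "(\<lambda>z. FM \<epsilon> (r, z)) \<in> L2 lborel" "(\<lambda>z. HM \<epsilon> (r, z)) \<in> L2 lborel" "(\<lambda>z. DF \<epsilon> (r, z)) \<in> L2 lborel"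
    "(\<lambda>z. \<delta> \<epsilon> (r, z)) \<in> L2 lborel" "(\<lambda>z. PF \<epsilon> (r, z)) \<in> L2 lborel"
    "\<And>z. norm (\<delta> \<epsilon> (r, z)) \<le> D * norm (FM \<epsilon> (r, z))"
proof -
  have F: "(\<lambda>y. FF (r, y)) \<in> L2 lborel" and H: "(\<lambda>y. HH (r, y)) \<in> L2 lborel" using r by (auto simp: regular_def)
  show 1: "(\<lambda>z. FM \<epsilon> (r, z)) \<in> L2 lborel"
    using conv_L2[OF mollifier_kernel[OF \<epsilon>] F] by (simp add: slices[OF r(1) \<epsilon>])
  show "(\<lambda>z. HM \<epsilon> (r, z)) \<in> L2 lborel"
    using conv_L2[OF mollifier_kernel[OF \<epsilon>] H] by (simp add: HM_def conv_section_eq_moll[symmetric])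
  have "(\<lambda>z. \<chi> i. DF \<epsilon> (r, z) $ i) \<in> L2 lborel"
    by (intro L2_vec_lambda) (simp add: slices[OF r(1) \<epsilon>] conv_L2[OF mollifier_deriv_kernel[OF \<epsilon>] F])
  then show 2: "(\<lambda>z. DF \<epsilon> (r, z)) \<in> L2 lborel" by simp
  show b: "norm (\<delta> \<epsilon> (r, z)) \<le> D * norm (FM \<epsilon> (r, z))" for z
    using \<delta>_bound[of "(r, z)" \<epsilon>] r by simp
  show 3: "(\<lambda>z. \<delta> \<epsilon> (r, z)) \<in> L2 lborel"
    by (rule L2_bound[OF 1 _ b]) measurable
  show "(\<lambda>z. PF \<epsilon> (r, z)) \<in> L2 lborel"
  proof (rule L2_bound[OF L2_add[OF 2 3], where C="exp M"])
    show "(\<lambda>z. PF \<epsilon> (r, z)) \<in> borel_measurable lborel" by measurable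
    show "norm (PF \<epsilon> (r, z)) \<le> exp M * norm (DF \<epsilon> (r, z) + \<delta> \<epsilon> (r, z))" for z
      using \<phi>_bound[of z] by (auto simp: PF_def intro!: mult_right_mono)
  qed
qed

lemma regular_slice_line_deriv:
  assumes r: "regular r" and \<epsilon>: "\<epsilon> > 0"
  shows "line_deriv (flow_dir (t - r) i) (\<lambda>z. complex_of_real (exp (\<phi> z)) * FM \<epsilon> (r, z)) (\<lambda>z. PF \<epsilon> (r, z) $ i)"
    and "continuous_on UNIV (\<lambda>z. complex_of_real (exp (\<phi> z)) * FM \<epsilon> (r, z))"
    and "continuous_on UNIV (\<lambda>z. PF \<epsilon> (r, z) $ i)"
proof -
  have F: "locally_integrable (\<lambda>y. FF (r, y))" using r by (auto simp: regular_def intro: L2_locally_integrable)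
  have e1: "(\<lambda>z. FM \<epsilon> (r, z)) = conv (mollifier \<epsilon>) (\<lambda>y. FF (r, y))" by (simp add: slices[OF r \<epsilon>])
  have e2: "(\<lambda>z. DF \<epsilon> (r, z) $ i) = conv (mollifier_deriv \<epsilon> (flow_dir (t - r) i)) (\<lambda>y. FF (r, y))" by (simp add: slices[OF r \<epsilon>])
  have d: "line_deriv (flow_dir (t - r) i) (\<lambda>z. FM \<epsilon> (r, z)) (\<lambda>z. DF \<epsilon> (r, z) $ i)"
    unfolding e1 e2 by (intro conv_line_deriv mollifier_kernel mollifier_deriv_kernel mollifier_line_deriv \<epsilon> F)
  have c: "continuous_on UNIV (\<lambda>z. FM \<epsilon> (r, z))" "continuous_on UNIV (\<lambda>z. DF \<epsilon> (r, z) $ i)"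
    unfolding e1 e2 by (intro conv_continuous mollifier_kernel mollifier_deriv_kernel \<epsilon> F)+
  have x: "line_deriv b (\<lambda>z. exp (\<phi> z)) (\<lambda>z. \<phi>d b z * exp (\<phi> z))" for b
    unfolding line_deriv_def
  proof
    fix z
    have "((\<lambda>\<sigma>. \<phi> (z + \<sigma> *\<^sub>R b)) has_real_derivative \<phi>d b z) (at 0)"
      using \<phi>_deriv[of b, unfolded line_deriv_def, rule_format, of z] by (simp add: has_real_derivative_iff_has_vector_derivative)
    from DERIV_chain2[OF DERIV_exp this]
    show "((\<lambda>\<sigma>. exp (\<phi> (z + \<sigma> *\<^sub>R b))) has_vector_derivative \<phi>d b z * exp (\<phi> z)) (at 0)"
      by (simp add: has_real_derivative_iff_has_vector_derivative mult.commute)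
  qed
  have e3: "PF \<epsilon> (r, z) $ i = complex_of_real (exp (\<phi> z)) * DF \<epsilon> (r, z) $ i + complex_of_real (\<phi>d (flow_dir (t - r) i) z * exp (\<phi> z)) * FM \<epsilon> (r, z)" for z
    by (simp add: PF_def \<delta>_def) (simp add: scaleR_conv_of_real algebra_simps)
  show "line_deriv (flow_dir (t - r) i) (\<lambda>z. complex_of_real (exp (\<phi> z)) * FM \<epsilon> (r, z)) (\<lambda>z. PF \<epsilon> (r, z) $ i)"
    unfolding e3 by (rule line_deriv_mult[OF line_deriv_bounded_linear[OF bounded_linear_of_real x] d])
  show "continuous_on UNIV (\<lambda>z. complex_of_real (exp (\<phi> z)) * FM \<epsilon> (r, z))" by (intro continuous_intros \<phi>_cont c)
  show "continuous_on UNIV (\<lambda>z. PF \<epsilon> (r, z) $ i)" unfolding e3 by (intro continuous_intros \<phi>_cont \<phi>d_cont c)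
qed

text \<open>
  At time \<open>r\<close> the moving frame is undone by a measure preserving map. On the velocity line over almost every \<open>x\<close>,
  \<open>exp \<phi> FM\<close> is continuously differentiable with gradient \<open>PF\<close> in \<open>L\<^sup>2\<close>, so Garding's inequality
  applies there; it is then integrated over \<open>x\<close>.
\<close>

lemma garding_slice:
  assumes \<epsilon>: "\<epsilon> > 0"
  shows "AE r in lborel. s < r \<and> r \<le> t \<longrightarrow>
    lam * (\<integral>z. (norm (PF \<epsilon> (r, z)))\<^sup>2 \<partial>lborel) \<le> (\<integral>z. Re (herm (BF (r, z) *v PF \<epsilon> (r, z)) (PF \<epsilon> (r, z))) \<partial>lborel)"
proof -
  note G1 = AE_lborel_sections[OF garding[unfolded garding_elliptic_def AE_lebesgue_iff]]
  note C1 = AE_lborel_sections[OF coefficient_bounded_AE]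
  note B1 = AE_lborel_sections[OF B(2)]
  show ?thesis using regular_AE G1 C1 B1
  proof eventually_elim
    case (elim r)
    show ?case
    proof
      assume r: "s < r \<and> r \<le> t"
      let ?d = "drift (t - r)"
      note sl = regular_slice_L2[OF elim(1) _ _ \<epsilon>]
      have P: "(\<lambda>z. PF \<epsilon> (r, z)) \<in> L2 lborel" using sl r by auto
      have Pd: "(\<lambda>z. PF \<epsilon> (r, ?d z)) \<in> L2 lborel" by (rule drift_L2[OF P])
      have BP: "(\<lambda>z. BF (r, z) *v PF \<epsilon> (r, z)) \<in> L2 lborel"
      proof (rule L2_I)
        show "(\<lambda>z. BF (r, z) *v PF \<epsilon> (r, z)) \<in> borel_measurable lborel" by measurable
        show "integrable lborel (\<lambda>z. (norm (BF (r, z) *v PF \<epsilon> (r, z)))\<^sup>2)"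
        proof (rule Bochner_Integration.integrable_bound[OF integrable_mult_right[OF L2_integrable[OF P], of "\<Lambda>\<^sup>2"]])
          show "AE z in lborel. norm ((norm (BF (r, z) *v PF \<epsilon> (r, z)))\<^sup>2) \<le> norm (\<Lambda>\<^sup>2 * (norm (PF \<epsilon> (r, z)))\<^sup>2)"
            using elim(3)
          proof eventually_elim
            case (elim z)
            have "norm (BF (r, z) *v PF \<epsilon> (r, z)) \<le> \<bar>\<Lambda>\<bar> * norm (PF \<epsilon> (r, z))" using elim by (intro norm_matrix_vector_le) auto
            from power_mono[OF this norm_ge_zero, of 2] show ?case by (simp add: power_mult_distrib)
          qed
        qed measurable
      qed
      have IH: "integrable lborel (\<lambda>z. herm (BF (r, z) *v PF \<epsilon> (r, z)) (PF \<epsilon> (r, z)))"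
        by (intro L2_herm_integrable BP P)
      let ?X = "\<lambda>y. (norm (PF \<epsilon> (r, ?d y)))\<^sup>2"
      let ?Y = "\<lambda>y. Re (herm (BF (r, ?d y) *v PF \<epsilon> (r, ?d y)) (PF \<epsilon> (r, ?d y)))"
      have IX: "integrable lborel ?X" by (rule L2_integrable[OF Pd])
      have IC: "integrable lborel (\<lambda>y. herm (BF (r, ?d y) *v PF \<epsilon> (r, ?d y)) (PF \<epsilon> (r, ?d y)))"
        using IH by (subst measure_preserving_integrable[OF drift_measure_preserving drift_borel, of "\<lambda>z. herm (BF (r, z) *v PF \<epsilon> (r, z)) (PF \<epsilon> (r, z))"]) auto
      then have IY: "integrable lborel ?Y" by (rule integrable_Re)
      have "(\<integral>x. lam * (\<integral>v. ?X (x, v) \<partial>lborel) \<partial>lborel) \<le> (\<integral>x. \<integral>v. ?Y (x, v) \<partial>lborel \<partial>lborel)"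
      proof (rule integral_mono_AE)
        show "integrable lborel (\<lambda>x. lam * (\<integral>v. ?X (x, v) \<partial>lborel))"
          by (intro integrable_mult_right integrable_section_integral[OF IX])
        show "integrable lborel (\<lambda>x. \<integral>v. ?Y (x, v) \<partial>lborel)" by (rule integrable_section_integral[OF IY])
        show "AE x in lborel. lam * (\<integral>v. ?X (x, v) \<partial>lborel) \<le> (\<integral>v. ?Y (x, v) \<partial>lborel)"
          using elim(2) AE_lborel_sections[OF elim(4)] L2_section[OF Pd] AE_integrable_section[OF IC]
        proof eventually_elim
          case (elim x)
          let ?g = "\<lambda>v. complex_of_real (exp (\<phi> (?d (x, v)))) * FM \<epsilon> (r, ?d (x, v))"
          let ?Q = "\<lambda>v. PF \<epsilon> (r, ?d (x, v))"
          note ld = regular_slice_line_deriv[OF \<open>regular r\<close> \<epsilon>]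
          have dc: "continuous_on UNIV (\<lambda>v. ?d (x, v))" by (intro continuous_intros)
          have Qc: "continuous_on UNIV ?Q"
          proof -
            have "continuous_on UNIV (\<lambda>v. \<chi> i. PF \<epsilon> (r, ?d (x, v)) $ i)"
              by (intro continuous_on_vec_lambda continuous_on_compose2[OF ld(3) dc]) auto
            then show ?thesis by simp
          qed
          have W: "W12_dot_grad (\<lambda>\<phi>. \<integral>v. ?g v * \<phi> v \<partial>lebesgue) ?Q"
          proof (rule W12_dot_grad_of_C1)
            show "continuous_on UNIV ?g" by (rule continuous_on_compose2[OF ld(2) dc]) auto
            show "?Q \<in> L2 lebesgue" by (rule L2_lborel_imp_lebesgue[OF elim(3)])
            show "line_deriv (axis i 1) ?g (\<lambda>v. ?Q v $ i)" for i
              by (rule line_deriv_along_drift[OF ld(1)])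
          qed (rule Qc)
          then have "lam * (L2norm lebesgue ?Q)\<^sup>2 \<le> Re (\<integral>v. herm (A (r, x, v) *v ?Q v) (?Q v) \<partial>lebesgue)"
            using elim(1) by auto
          also have "(\<integral>v. herm (A (r, x, v) *v ?Q v) (?Q v) \<partial>lebesgue) = (\<integral>v. herm (BF (r, ?d (x, v)) *v ?Q v) (?Q v) \<partial>lborel)"
          proof (rule integral_lebesgue_eq_lborel)
            show "AE v in lborel. herm (A (r, x, v) *v ?Q v) (?Q v) = herm (BF (r, ?d (x, v)) *v ?Q v) (?Q v)"
              using elim(2) by eventually_elim (simp add: BF_def flow_def)
          qed measurable
          also have "Re (\<integral>v. herm (BF (r, ?d (x, v)) *v ?Q v) (?Q v) \<partial>lborel) = (\<integral>v. ?Y (x, v) \<partial>lborel)"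
            by (rule integral_Re[symmetric, OF elim(4)])
          also have "(L2norm lebesgue ?Q)\<^sup>2 = (\<integral>v. ?X (x, v) \<partial>lborel)"
            unfolding L2norm_square
            by (rule integral_completion) (simp add: borel_measurable_continuous_onI[OF Qc])
          finally show ?case .
        qed
      qed
      then have "lam * (\<integral>y. ?X y \<partial>lborel) \<le> (\<integral>y. ?Y y \<partial>lborel)"
        by (simp only: integral_mult_right_zero integral_lborel_prod[OF IX] integral_lborel_prod[OF IY])
      then show "lam * (\<integral>z. (norm (PF \<epsilon> (r, z)))\<^sup>2 \<partial>lborel) \<le> (\<integral>z. Re (herm (BF (r, z) *v PF \<epsilon> (r, z)) (PF \<epsilon> (r, z))) \<partial>lborel)"
        using drift_integral[of "\<lambda>z. (norm (PF \<epsilon> (r, z)))\<^sup>2" "t - r"]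
          drift_integral[of "\<lambda>z. Re (herm (BF (r, z) *v PF \<epsilon> (r, z)) (PF \<epsilon> (r, z)))" "t - r"] by simp
    qed
  qed
qed

text \<open>
  The derivative of the weight \<open>w = exp (2 \<phi>)\<close> contributes the term \<open>2 \<delta>\<close> in the integration by parts.
\<close>

lemma energy_flux_slice:
  assumes r: "regular r" "s \<le> r" "r \<le> t" and \<epsilon>: "\<epsilon> > 0"
  shows "Re (\<integral>z. complex_of_real (w z) * cnj (FM \<epsilon> (r, z)) * SM \<epsilon> (r, z) \<partial>lborel)
    = - (\<integral>z. w z * Re (herm (HM \<epsilon> (r, z)) (DF \<epsilon> (r, z) + 2 *\<^sub>R \<delta> \<epsilon> (r, z))) \<partial>lborel)"
proof -
  have F: "(\<lambda>y. FF (r, y)) \<in> L2 lborel" and H: "(\<lambda>y. HH (r, y)) \<in> L2 lborel" using r by (auto simp: regular_def)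
  note Hi = vec_nth_L2[OF H]
  note sl = slices[OF r(1) \<epsilon>]
  note L = regular_slice_L2[OF r \<epsilon>]
  let ?C = "exp (2 * M) * (1 + 2 * D)"
  have C1: "exp (2 * M) * 1 \<le> ?C" using D_nonneg by (intro mult_left_mono) auto
  have wd: "line_deriv b w (\<lambda>z. 2 * \<phi>d b z * w z)" for b
    unfolding line_deriv_def
  proof
    fix z
    have "((\<lambda>\<sigma>. \<phi> (z + \<sigma> *\<^sub>R b)) has_real_derivative \<phi>d b z) (at 0)"
      using \<phi>_deriv[of b, unfolded line_deriv_def, rule_format, of z] by (simp add: has_real_derivative_iff_has_vector_derivative)
    from DERIV_chain2[OF DERIV_exp DERIV_cmult[OF this, of 2]]
    show "((\<lambda>\<sigma>. w (z + \<sigma> *\<^sub>R b)) has_vector_derivative 2 * \<phi>d b z * w z) (at 0)"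
      by (simp add: has_real_derivative_iff_has_vector_derivative w_def mult_ac)
  qed
  have wc: "continuous_on UNIV w" "continuous_on UNIV (\<lambda>z. 2 * \<phi>d b z * w z)" for b
    unfolding w_def[abs_def] by (intro continuous_intros \<phi>_cont \<phi>d_cont)+
  have wb: "\<bar>w z\<bar> \<le> ?C" for z
    using order_trans[OF w_bounds(2)[of z] C1[unfolded mult_1_right]] w_bounds(1)[of z] by (simp only: abs_of_pos)
  have wdb: "\<bar>2 * \<phi>d (flow_dir (t - r) i) z * w z\<bar> \<le> ?C" for i z
  proof -
    have "\<bar>\<phi>d (flow_dir (t - r) i) z\<bar> \<le> norm (\<chi> i. \<phi>d (flow_dir (t - r) i) z)"
      using component_le_norm_cart[of "\<chi> i. \<phi>d (flow_dir (t - r) i) z" i] by simp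
    also have "\<dots> \<le> D" by (rule \<phi>d_bound[OF r(2,3)])
    finally have "\<bar>2 * \<phi>d (flow_dir (t - r) i) z * w z\<bar> \<le> (2 * D) * exp (2 * M)"
      using w_bounds[of z] by (auto simp: abs_mult intro!: mult_mono)
    also have "\<dots> \<le> ?C" by (simp add: algebra_simps)
    finally show ?thesis .
  qed
  have cnjF: "(\<lambda>z. cnj (FM \<epsilon> (r, z))) \<in> L2 lborel" by (rule L2_cnj[OF L(1)])
  have DFi: "(\<lambda>z. DF \<epsilon> (r, z) $ i) \<in> L2 lborel" for i by (rule vec_nth_L2[OF L(3)])
  have ibp: "(\<integral>z. complex_of_real (w z) * cnj (FM \<epsilon> (r, z)) * flow_conv t \<epsilon> i (\<lambda>q. HH q $ i) (r, z) \<partial>lborel)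
     = - (\<integral>z. complex_of_real (w z) * (HM \<epsilon> (r, z) $ i * cnj ((DF \<epsilon> (r, z) + 2 *\<^sub>R \<delta> \<epsilon> (r, z)) $ i)) \<partial>lborel)" for i
  proof -
    have "(\<integral>z. complex_of_real (w z) * cnj (FM \<epsilon> (r, z)) * flow_conv t \<epsilon> i (\<lambda>q. HH q $ i) (r, z) \<partial>lborel)
      = - (\<integral>z. (complex_of_real (w z) * cnj (DF \<epsilon> (r, z) $ i) + complex_of_real (2 * \<phi>d (flow_dir (t - r) i) z * w z) * cnj (FM \<epsilon> (r, z))) * HM \<epsilon> (r, z) $ i \<partial>lborel)"
      unfolding sl
      by (rule conv_integration_by_parts[OF mollifier_kernel[OF \<epsilon>] mollifier_deriv_kernel[OF \<epsilon>] mollifier_line_deriv F Hi wc(1) wc(2) wd wb wdb])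
    also have "\<dots> = - (\<integral>z. complex_of_real (w z) * (HM \<epsilon> (r, z) $ i * cnj ((DF \<epsilon> (r, z) + 2 *\<^sub>R \<delta> \<epsilon> (r, z)) $ i)) \<partial>lborel)"
      by (intro arg_cong[where f=uminus] Bochner_Integration.integral_cong refl) (simp add: \<delta>_def scaleR_conv_of_real algebra_simps)
    finally show ?thesis .
  qed
  have flL2: "(\<lambda>z. flow_conv t \<epsilon> i (\<lambda>q. HH q $ i) (r, z)) \<in> L2 lborel" for i
    unfolding sl by (rule conv_L2[OF mollifier_deriv_kernel[OF \<epsilon>] Hi])
  have V: "(\<lambda>z. DF \<epsilon> (r, z) + 2 *\<^sub>R \<delta> \<epsilon> (r, z)) \<in> L2 lborel"
    by (intro L2_add L(3) L2_bound[OF L(4), where C=2]) auto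
  have I1: "integrable lborel (\<lambda>z. complex_of_real (w z) * cnj (FM \<epsilon> (r, z)) * flow_conv t \<epsilon> i (\<lambda>q. HH q $ i) (r, z))" for i
    using wb by (intro L2_mult_integrable[where C="?C"] cnjF flL2) auto
  have I2: "integrable lborel (\<lambda>z. complex_of_real (w z) * HM \<epsilon> (r, z) $ i * cnj ((DF \<epsilon> (r, z) + 2 *\<^sub>R \<delta> \<epsilon> (r, z)) $ i))" for i
  proof (rule L2_mult_integrable[where C="?C"])
    show "(\<lambda>z. HM \<epsilon> (r, z) $ i) \<in> L2 lborel" by (rule vec_nth_L2[OF L(2)])
    show "(\<lambda>z. cnj ((DF \<epsilon> (r, z) + 2 *\<^sub>R \<delta> \<epsilon> (r, z)) $ i)) \<in> L2 lborel"
      by (rule L2_cnj[OF vec_nth_L2[OF V]])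
  qed (use wb in auto)
  have "(\<integral>z. complex_of_real (w z) * cnj (FM \<epsilon> (r, z)) * SM \<epsilon> (r, z) \<partial>lborel)
    = (\<Sum>i\<in>UNIV. \<integral>z. complex_of_real (w z) * cnj (FM \<epsilon> (r, z)) * flow_conv t \<epsilon> i (\<lambda>q. HH q $ i) (r, z) \<partial>lborel)"
    unfolding SM_def sum_distrib_left using I1 by (subst Bochner_Integration.integral_sum) auto
  also have "\<dots> = - (\<Sum>i\<in>UNIV. \<integral>z. complex_of_real (w z) * (HM \<epsilon> (r, z) $ i * cnj ((DF \<epsilon> (r, z) + 2 *\<^sub>R \<delta> \<epsilon> (r, z)) $ i)) \<partial>lborel)"
    unfolding ibp by (simp add: sum_negf)
  also have "\<dots> = - (\<integral>z. complex_of_real (w z) * herm (HM \<epsilon> (r, z)) (DF \<epsilon> (r, z) + 2 *\<^sub>R \<delta> \<epsilon> (r, z)) \<partial>lborel)"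
    unfolding herm_def sum_distrib_left using I2 by (subst Bochner_Integration.integral_sum) (auto simp: mult.assoc)
  finally have e: "(\<integral>z. complex_of_real (w z) * cnj (FM \<epsilon> (r, z)) * SM \<epsilon> (r, z) \<partial>lborel)
    = - (\<integral>z. complex_of_real (w z) * herm (HM \<epsilon> (r, z)) (DF \<epsilon> (r, z) + 2 *\<^sub>R \<delta> \<epsilon> (r, z)) \<partial>lborel)" .
  have "integrable lborel (\<lambda>z. complex_of_real (w z) * herm (HM \<epsilon> (r, z)) (DF \<epsilon> (r, z) + 2 *\<^sub>R \<delta> \<epsilon> (r, z)))"
    unfolding herm_def sum_distrib_left using I2 by (intro Bochner_Integration.integrable_sum) (simp add: mult.assoc)
  from integral_Re[OF this] show ?thesis unfolding e by simp
qed

end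

text \<open>
  The inequality is known at almost every time only and \<open>y\<close> need not be continuous. The right-hand side
  \<open>\<phi>\<close> is continuous, and it satisfies the inequality at every time.
\<close>

lemma gronwall_integral:
  fixes y :: "real \<Rightarrow> real"
  assumes y: "set_integrable lborel {s..t} y" and m: "m \<ge> 0" and st: "s < t"
    and le: "AE r in lborel. s \<le> r \<and> r \<le> t \<longrightarrow> y r \<le> y0 + m * (LBINT x:{s..r}. y x)"
  shows "y0 + m * (LBINT x:{s..t}. y x) \<le> y0 * exp (m * (t - s))"
proof -
  have yi: "set_integrable lborel {s..r} y" if "r \<le> t" for r
    by (rule set_integrable_subset[OF y]) (use that in auto)
  have I: "(LBINT x:{s..r}. y x) = integral {s..r} y" if "r \<le> t" for r
    by (rule set_borel_integral_eq_integral(2)[OF yi[OF that]])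
  define \<phi> where "\<phi> r = y0 + m * integral {s..r} y" for r
  have \<phi>c: "continuous_on {s..t} \<phi>"
    unfolding \<phi>_def by (intro continuous_intros indefinite_integral_continuous_1 set_borel_integral_eq_integral(1)[OF y])
  define \<Phi> where "\<Phi> r = y0 + m * integral {s..r} \<phi>" for r
  have \<phi>i: "set_integrable lborel {s..r} \<phi>" if "r \<le> t" for r
    unfolding set_integrable_def
    by (intro borel_integrable_compact continuous_on_subset[OF \<phi>c]) (use that in auto)
  have \<phi>\<Phi>: "\<phi> r \<le> \<Phi> r" if r: "r \<le> t" for r
  proof -
    have "(LBINT x:{s..r}. y x) \<le> (LBINT x:{s..r}. \<phi> x)"
    proof (rule set_integral_mono_AE[OF yi[OF r] \<phi>i[OF r]])
      show "AE x \<in> {s..r} in lborel. y x \<le> \<phi> x"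
        using le by eventually_elim (use r in \<open>auto simp: \<phi>_def I\<close>)
    qed
    also have "(LBINT x:{s..r}. \<phi> x) = integral {s..r} \<phi>"
      by (rule set_borel_integral_eq_integral(2)[OF \<phi>i[OF r]])
    finally show ?thesis using m by (simp add: \<phi>_def \<Phi>_def I[OF r] mult_left_mono)
  qed
  have d\<Phi>: "(\<Phi> has_real_derivative m * \<phi> x) (at x within {s..t})" if "x \<in> {s..t}" for x
    unfolding \<Phi>_def
    by (rule derivative_eq_intros integral_has_real_derivative[OF \<phi>c that] refl | simp)+
  let ?h = "\<lambda>x. \<Phi> x * exp (- (m * (x - s)))"
  have dh: "(?h has_real_derivative (m * \<phi> x - m * \<Phi> x) * exp (- (m * (x - s)))) (at x within {s..t})" if "x \<in> {s..t}" for x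
    by (rule derivative_eq_intros d\<Phi>[OF that] refl | simp add: algebra_simps)+
  have "?h t \<le> ?h s"
  proof (rule DERIV_nonpos_imp_decreasing_open[OF less_imp_le[OF st]])
    show "\<exists>y. (?h has_real_derivative y) (at x) \<and> y \<le> 0" if "s < x" "x < t" for x
    proof (intro exI conjI)
      have "at x within {s..t} = at x" using that by (intro at_within_interior) (auto simp: interior_atLeastAtMost_real)
      then show "(?h has_real_derivative (m * \<phi> x - m * \<Phi> x) * exp (- (m * (x - s)))) (at x)" using dh[of x] that by simp
      show "(m * \<phi> x - m * \<Phi> x) * exp (- (m * (x - s))) \<le> 0"
        using \<phi>\<Phi>[of x] that m by (intro mult_nonpos_nonneg) (auto intro: mult_left_mono)
    qed
    show "continuous_on {s..t} ?h"
      by (intro DERIV_continuous_on[where D="\<lambda>x. (m * \<phi> x - m * \<Phi> x) * exp (- (m * (x - s)))"] dh)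
  qed
  then have "\<Phi> t * exp (- (m * (t - s))) \<le> y0" by (simp add: \<Phi>_def)
  then have "(\<Phi> t * exp (- (m * (t - s)))) * exp (m * (t - s)) \<le> y0 * exp (m * (t - s))"
    by (intro mult_right_mono) auto
  then have "\<Phi> t \<le> y0 * exp (m * (t - s))"
    unfolding mult.assoc exp_add[symmetric] by simp
  then show ?thesis using \<phi>\<Phi>[of t] by (simp add: \<phi>_def I)
qed

lemma matrix_vector_scaleR:
  fixes a :: "complex ^ 'd ^ 'd::finite" shows "a *v (c *\<^sub>R x) = c *\<^sub>R (a *v x)"
  by (simp add: matrix_vector_mult_def vec_eq_iff scaleR_sum_right)

lemma integrable_weighted_square:
  assumes "u \<in> L2 M" "v \<in> borel_measurable M" "\<And>x. \<bar>v x\<bar> \<le> (C::real)"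
  shows "integrable M (\<lambda>x. v x * (norm (u x))\<^sup>2)"
proof -
  have C0: "0 \<le> C" using assms(3) order_trans abs_ge_zero by blast
  have [measurable]: "u \<in> borel_measurable M" using assms by auto
  show ?thesis using assms C0
    by (intro Bochner_Integration.integrable_bound[OF integrable_mult_right[OF L2_integrable[OF assms(1)], of C]])
      (auto simp: abs_mult intro!: mult_right_mono)
qed

context weighted_kinetic_solution
begin

text \<open>The mollified flux minus the flux of the mollified gradient: mollification does not commute with \<open>A\<close>.\<close>

definition "EF \<epsilon> p = HM \<epsilon> p - BF p *v DF \<epsilon> p"

lemma EF_measurable[measurable]: "EF \<epsilon> \<in> borel_measurable borel"
  unfolding EF_def[abs_def] by measurable

text \<open>
  Garding's inequality for \<open>PF\<close> cancels the first two terms on the right-hand side of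
  \<open>conjugated_flux_bound\<close>; what remains is the energy and the commutator with the coefficients.
\<close>

lemma energy_slice_estimate:
  assumes \<epsilon>: "\<epsilon> > 0" and \<Lambda>: "\<Lambda> \<ge> 0"
  shows "AE r in lborel. s < r \<and> r \<le> t \<longrightarrow>
    integrable lborel (\<lambda>z. norm (EF \<epsilon> (r, z)) * norm (DF \<epsilon> (r, z) + 2 *\<^sub>R \<delta> \<epsilon> (r, z))) \<and>
    Re (\<integral>z. complex_of_real (w z) * cnj (FM \<epsilon> (r, z)) * SM \<epsilon> (r, z) \<partial>lborel)
    \<le> (\<Lambda>\<^sup>2 / lam + \<Lambda>) * D\<^sup>2 * (\<integral>z. w z * (norm (FM \<epsilon> (r, z)))\<^sup>2 \<partial>lborel)
      + exp (2 * M) * (\<integral>z. norm (EF \<epsilon> (r, z)) * norm (DF \<epsilon> (r, z) + 2 *\<^sub>R \<delta> \<epsilon> (r, z)) \<partial>lborel)"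
  using regular_AE garding_slice[OF \<epsilon>] AE_lborel_sections[OF coefficient_bounded_AE]
proof eventually_elim
  case (elim r)
  show ?case
  proof
    assume r: "s < r \<and> r \<le> t"
    then have r': "s \<le> r" "r \<le> t" by auto
    note L = regular_slice_L2[OF elim(1) r' \<epsilon>]
    let ?V = "\<lambda>z. DF \<epsilon> (r, z) + 2 *\<^sub>R \<delta> \<epsilon> (r, z)"
    let ?K = "\<Lambda>\<^sup>2 / lam + \<Lambda>"
    have K0: "?K \<ge> 0" using \<Lambda> lam by simp
    have BL2: "(\<lambda>z. BF (r, z) *v u z) \<in> L2 lborel" if "u \<in> L2 lborel" for u
    proof (rule L2_bound_AE[OF that])
      have [measurable]: "u \<in> borel_measurable borel" using L2_borel[OF that] .
      show "(\<lambda>z. BF (r, z) *v u z) \<in> borel_measurable lborel" by measurable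
      show "AE z in lborel. norm (BF (r, z) *v u z) \<le> \<bar>\<Lambda>\<bar> * norm (u z)"
        using elim(3) by eventually_elim (intro norm_matrix_vector_le, auto)
    qed
    have V: "?V \<in> L2 lborel" by (intro L2_add L(3) L2_bound[OF L(4), where C=2]) auto
    have E: "(\<lambda>z. EF \<epsilon> (r, z)) \<in> L2 lborel" unfolding EF_def by (intro L2_minus L(2) BL2 L(3))
    have EV: "integrable lborel (\<lambda>z. norm (EF \<epsilon> (r, z)) * norm (?V z))" by (rule L2_norm_mult_integrable[OF E V])
    have iP: "integrable lborel (\<lambda>z. Re (herm (BF (r, z) *v PF \<epsilon> (r, z)) (PF \<epsilon> (r, z))))"
      by (intro integrable_Re L2_herm_integrable BL2 L(5))
    have iP2: "integrable lborel (\<lambda>z. lam * (norm (PF \<epsilon> (r, z)))\<^sup>2)" by (intro integrable_mult_right L2_integrable L(5))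
    have iF: "integrable lborel (\<lambda>z. w z * (norm (FM \<epsilon> (r, z)))\<^sup>2)"
      using w_bounds by (intro integrable_weighted_square[OF L(1), where C="exp (2 * M)"]) (auto simp: less_imp_le)
    have iH: "integrable lborel (\<lambda>z. w z * Re (herm (HM \<epsilon> (r, z)) (?V z)))"
    proof (rule Bochner_Integration.integrable_bound[OF integrable_mult_right[OF L2_norm_mult_integrable[OF L(2) V], of "exp (2 * M)"]])
      show "(\<lambda>z. w z * Re (herm (HM \<epsilon> (r, z)) (?V z))) \<in> borel_measurable lborel" by measurable
      show "AE z in lborel. norm (w z * Re (herm (HM \<epsilon> (r, z)) (?V z))) \<le> norm (exp (2 * M) * (norm (HM \<epsilon> (r, z)) * norm (?V z)))"
        using w_bounds(1,2) order_trans[OF abs_Re_le_cmod norm_herm_le]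
        by (intro AE_I2) (auto simp: abs_mult less_imp_le intro!: mult_mono)
    qed
    have "- (\<integral>z. w z * Re (herm (HM \<epsilon> (r, z)) (?V z)) \<partial>lborel) = (\<integral>z. - (w z * Re (herm (HM \<epsilon> (r, z)) (?V z))) \<partial>lborel)" by simp
    also have "\<dots> \<le> (\<integral>z. (- Re (herm (BF (r, z) *v PF \<epsilon> (r, z)) (PF \<epsilon> (r, z))) + lam * (norm (PF \<epsilon> (r, z)))\<^sup>2)
        + (?K * D\<^sup>2 * (w z * (norm (FM \<epsilon> (r, z)))\<^sup>2) + exp (2 * M) * (norm (EF \<epsilon> (r, z)) * norm (?V z))) \<partial>lborel)"
    proof (rule integral_mono_AE)
      show "AE z in lborel. - (w z * Re (herm (HM \<epsilon> (r, z)) (?V z))) \<le> (- Re (herm (BF (r, z) *v PF \<epsilon> (r, z)) (PF \<epsilon> (r, z))) + lam * (norm (PF \<epsilon> (r, z)))\<^sup>2)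
        + (?K * D\<^sup>2 * (w z * (norm (FM \<epsilon> (r, z)))\<^sup>2) + exp (2 * M) * (norm (EF \<epsilon> (r, z)) * norm (?V z)))"
        using elim(3)
      proof eventually_elim
        case (elim z)
        let ?q = "DF \<epsilon> (r, z)" and ?d = "\<delta> \<epsilon> (r, z)" and ?a = "BF (r, z)"
        have "- Re (herm (HM \<epsilon> (r, z)) (?V z)) \<le> - Re (herm (?a *v (?q + ?d)) (?q + ?d)) + lam * (norm (?q + ?d))\<^sup>2
           + ?K * (norm ?d)\<^sup>2 + norm (EF \<epsilon> (r, z)) * norm (?V z)"
          unfolding EF_def using elim by (intro conjugated_flux_bound lam) auto
        then have 1: "w z * - Re (herm (HM \<epsilon> (r, z)) (?V z)) \<le> w z * (- Re (herm (?a *v (?q + ?d)) (?q + ?d)) + lam * (norm (?q + ?d))\<^sup>2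
           + ?K * (norm ?d)\<^sup>2 + norm (EF \<epsilon> (r, z)) * norm (?V z))"
          using w_bounds(1)[of z] by (intro mult_left_mono) auto
        have 2: "w z * Re (herm (?a *v (?q + ?d)) (?q + ?d)) = Re (herm (?a *v PF \<epsilon> (r, z)) (PF \<epsilon> (r, z)))"
          by (simp add: PF_def matrix_vector_scaleR herm_scaleR w_bounds(3) power2_eq_square)
        have 3: "w z * (norm (?q + ?d))\<^sup>2 = (norm (PF \<epsilon> (r, z)))\<^sup>2"
          by (simp add: PF_def w_bounds(3) power_mult_distrib)
        have "(norm ?d)\<^sup>2 \<le> D\<^sup>2 * (norm (FM \<epsilon> (r, z)))\<^sup>2"
          using power_mono[OF L(6)[of z] norm_ge_zero, of 2] by (simp add: power_mult_distrib)
        then have 4: "w z * (?K * (norm ?d)\<^sup>2) \<le> w z * (?K * (D\<^sup>2 * (norm (FM \<epsilon> (r, z)))\<^sup>2))"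
          using w_bounds(1)[of z] K0 by (intro mult_left_mono) auto
        have 5: "w z * (norm (EF \<epsilon> (r, z)) * norm (?V z)) \<le> exp (2 * M) * (norm (EF \<epsilon> (r, z)) * norm (?V z))"
          using w_bounds(2)[of z] by (intro mult_right_mono) auto
        have e: "w z * (- Re (herm (?a *v (?q + ?d)) (?q + ?d)) + lam * (norm (?q + ?d))\<^sup>2
           + ?K * (norm ?d)\<^sup>2 + norm (EF \<epsilon> (r, z)) * norm (?V z)) =
          - (w z * Re (herm (?a *v (?q + ?d)) (?q + ?d))) + lam * (w z * (norm (?q + ?d))\<^sup>2)
           + w z * (?K * (norm ?d)\<^sup>2) + w z * (norm (EF \<epsilon> (r, z)) * norm (?V z))"
          by (simp only: distrib_left mult_minus_right mult.left_commute)
        have f: "?K * D\<^sup>2 * (w z * (norm (FM \<epsilon> (r, z)))\<^sup>2) = w z * (?K * (D\<^sup>2 * (norm (FM \<epsilon> (r, z)))\<^sup>2))"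
          by (simp only: mult_ac)
        show ?case using 1 4 5 unfolding e 2 3 f by linarith
      qed
    qed (use iH iP iP2 iF EV in \<open>auto intro!: Bochner_Integration.integrable_add Bochner_Integration.integrable_minus\<close>)
    also have "\<dots> = (- (\<integral>z. Re (herm (BF (r, z) *v PF \<epsilon> (r, z)) (PF \<epsilon> (r, z))) \<partial>lborel) + lam * (\<integral>z. (norm (PF \<epsilon> (r, z)))\<^sup>2 \<partial>lborel))
        + (?K * D\<^sup>2 * (\<integral>z. w z * (norm (FM \<epsilon> (r, z)))\<^sup>2 \<partial>lborel) + exp (2 * M) * (\<integral>z. norm (EF \<epsilon> (r, z)) * norm (?V z) \<partial>lborel))"
      using iP iP2 iF EV by (simp add: L2_integrable[OF L(5)])
    finally show "integrable lborel (\<lambda>z. norm (EF \<epsilon> (r, z)) * norm (?V z)) \<and>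
      Re (\<integral>z. complex_of_real (w z) * cnj (FM \<epsilon> (r, z)) * SM \<epsilon> (r, z) \<partial>lborel)
      \<le> ?K * D\<^sup>2 * (\<integral>z. w z * (norm (FM \<epsilon> (r, z)))\<^sup>2 \<partial>lborel) + exp (2 * M) * (\<integral>z. norm (EF \<epsilon> (r, z)) * norm (?V z) \<partial>lborel)"
      using energy_flux_slice[OF elim(1) r' \<epsilon>] elim(2) r EV by simp
  qed
qed

end

section \<open>Passage to the limit and the weighted contraction\<close>

lemma mollifier_tendsto_L2:
  fixes u :: "'a::euclidean_space \<Rightarrow> 'b::euclidean_space" and \<iota> :: "'z::euclidean_space \<Rightarrow> 'a"
  assumes "bounded_linear \<iota>" "u \<in> L2 lborel"
  shows "(\<lambda>n. \<integral>x. (norm (moll \<iota> (mollifier (1 / real (Suc n))) u x - u x))\<^sup>2 \<partial>lborel) \<longlonglongrightarrow> 0"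
proof (rule moll_tendsto_L2[OF assms, where \<epsilon>="\<lambda>n. 1 / real (Suc n)"])
  show "(\<lambda>n. 1 / real (Suc n)) \<longlonglongrightarrow> 0" by (rule LIMSEQ_Suc[OF lim_1_over_n])
  show "integrable lborel (mollifier (1 / real (Suc n)))" for n
    by (rule kernel_integrable[OF mollifier_kernel]) simp
qed (auto intro: mollifier_nonneg mollifier_integral mollifier_eq_0)

context weighted_kinetic_solution
begin

lemma GM_L2: "\<epsilon> > 0 \<Longrightarrow> GM \<epsilon> \<in> L2 lborel"
  unfolding GM_def by (intro moll_L2 kernel_integrable mollifier_kernel GG) measurable

lemma coefficient_mult_L2:
  assumes "u \<in> L2 lborel" shows "(\<lambda>p. BF p *v u p) \<in> L2 lborel"
proof (rule L2_bound_AE[OF assms])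
  have [measurable]: "u \<in> borel_measurable borel" using L2_borel[OF assms] .
  show "(\<lambda>p. BF p *v u p) \<in> borel_measurable lborel" by measurable
  show "AE p in lborel. norm (BF p *v u p) \<le> \<bar>\<Lambda>\<bar> * norm (u p)"
    using coefficient_bounded_AE by eventually_elim (intro norm_matrix_vector_le, auto)
qed

text \<open>
  The estimate on slices, integrated in time. In the error term the gradient \<open>DF\<close> of the mollification is
  replaced by the mollification \<open>GM\<close> of the gradient, which stays bounded in \<open>L\<^sup>2\<close> as \<open>\<epsilon> \<rightarrow> 0\<close>.
\<close>

lemma mollified_energy_inequality:
  assumes \<epsilon>: "\<epsilon> > 0" and \<Lambda>: "\<Lambda> \<ge> 0" and t': "s \<le> t'" "t' \<le> t"
    and u: "u \<in> L2 lborel" "AE y in lborel. u y = f t' (drift (t' - t) y)"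
  shows "(\<integral>z. w z * (norm (conv (mollifier \<epsilon>) u z))\<^sup>2 \<partial>lborel) \<le> (\<integral>z. w z * (norm (conv (mollifier \<epsilon>) \<psi>\<psi> z))\<^sup>2 \<partial>lborel)
    + 2 * ((\<Lambda>\<^sup>2 / lam + \<Lambda>) * D\<^sup>2 * (\<integral>p. (indicator {s<..t'} (fst p) * w (snd p)) * (norm (FM \<epsilon> p))\<^sup>2 \<partial>lborel)
      + exp (2 * M) * ((\<integral>p. norm (HM \<epsilon> p - BF p *v GM \<epsilon> p) * norm (GM \<epsilon> p) \<partial>lborel)
         + 2 * D * (\<integral>p. norm (HM \<epsilon> p - BF p *v GM \<epsilon> p) * norm (FM \<epsilon> p) \<partial>lborel)))"
proof -
  let ?K = "\<Lambda>\<^sup>2 / lam + \<Lambda>"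
  let ?Q = "\<lambda>p. complex_of_real (w (snd p)) * cnj (FM \<epsilon> p) * (indicator {s<..t'} (fst p) *\<^sub>R SM \<epsilon> p)"
  note Q = mollified_energy_integrable[OF \<epsilon> t'(2)]
  let ?\<eta> = "\<lambda>p. HM \<epsilon> p - BF p *v GM \<epsilon> p"
  let ?X = "\<lambda>p. (indicator {s<..t'} (fst p) * w (snd p)) * (norm (FM \<epsilon> p))\<^sup>2"
  let ?Y = "\<lambda>p. indicator {s<..t'} (fst p) * (norm (EF \<epsilon> p) * norm (DF \<epsilon> p + 2 *\<^sub>R \<delta> \<epsilon> p))"
  have eta: "?\<eta> \<in> L2 lborel" by (intro L2_minus HM_L2 coefficient_mult_L2 GM_L2 \<epsilon>)
  have X: "integrable lborel ?X"
    using w_bounds(1,2) by (intro integrable_weighted_square[OF FM_L2[OF \<epsilon>], where C="exp (2 * M)"]) (auto simp: indicator_def less_imp_le)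
  have YB: "AE p in lborel. ?Y p \<le> norm (?\<eta> p) * norm (GM \<epsilon> p) + 2 * D * (norm (?\<eta> p) * norm (FM \<epsilon> p))"
    using DF_eq_GM[OF \<epsilon>]
  proof eventually_elim
    case (elim p)
    show ?case
    proof (cases "fst p \<in> {s<..t'}")
      case True
      then have e: "DF \<epsilon> p = GM \<epsilon> p" using elim t' by auto
      have "norm (DF \<epsilon> p + 2 *\<^sub>R \<delta> \<epsilon> p) \<le> norm (GM \<epsilon> p) + 2 * (D * norm (FM \<epsilon> p))"
        unfolding e using \<delta>_bound[of p \<epsilon>] True t' by (intro order_trans[OF norm_triangle_ineq]) auto
      then have "norm (?\<eta> p) * norm (DF \<epsilon> p + 2 *\<^sub>R \<delta> \<epsilon> p) \<le> norm (?\<eta> p) * (norm (GM \<epsilon> p) + 2 * (D * norm (FM \<epsilon> p)))"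
        by (intro mult_left_mono) auto
      then show ?thesis using True by (simp add: EF_def e algebra_simps)
    qed (use D_nonneg in auto)
  qed
  have E1: "integrable lborel (\<lambda>p. norm (?\<eta> p) * norm (GM \<epsilon> p))" by (rule L2_norm_mult_integrable[OF eta GM_L2[OF \<epsilon>]])
  have E2: "integrable lborel (\<lambda>p. norm (?\<eta> p) * norm (FM \<epsilon> p))" by (rule L2_norm_mult_integrable[OF eta FM_L2[OF \<epsilon>]])
  have EE: "integrable lborel (\<lambda>p. norm (?\<eta> p) * norm (GM \<epsilon> p) + 2 * D * (norm (?\<eta> p) * norm (FM \<epsilon> p)))"
    using E1 E2 by auto
  have Y: "integrable lborel ?Y"
  proof (rule Bochner_Integration.integrable_bound[OF EE])
    show "AE p in lborel. norm (?Y p) \<le> norm (norm (?\<eta> p) * norm (GM \<epsilon> p) + 2 * D * (norm (?\<eta> p) * norm (FM \<epsilon> p)))"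
      using YB by eventually_elim (auto simp: abs_mult)
  qed measurable
  have "Re (\<integral>p. ?Q p \<partial>lborel) = (\<integral>r. Re (\<integral>z. ?Q (r, z) \<partial>lborel) \<partial>lborel)"
    using integral_Re[OF integrable_section_integral[OF Q]] integral_lborel_prod[OF Q] by simp
  also have "\<dots> \<le> (\<integral>r. ?K * D\<^sup>2 * (\<integral>z. ?X (r, z) \<partial>lborel) + exp (2 * M) * (\<integral>z. ?Y (r, z) \<partial>lborel) \<partial>lborel)"
  proof (rule integral_mono_AE)
    show "integrable lborel (\<lambda>r. Re (\<integral>z. ?Q (r, z) \<partial>lborel))" by (rule integrable_Re[OF integrable_section_integral[OF Q]])
    show "integrable lborel (\<lambda>r. ?K * D\<^sup>2 * (\<integral>z. ?X (r, z) \<partial>lborel) + exp (2 * M) * (\<integral>z. ?Y (r, z) \<partial>lborel))"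
      by (intro Bochner_Integration.integrable_add integrable_mult_right integrable_section_integral X Y)
    show "AE r in lborel. Re (\<integral>z. ?Q (r, z) \<partial>lborel) \<le> ?K * D\<^sup>2 * (\<integral>z. ?X (r, z) \<partial>lborel) + exp (2 * M) * (\<integral>z. ?Y (r, z) \<partial>lborel)"
      using energy_slice_estimate[OF \<epsilon> \<Lambda>]
    proof eventually_elim
      case (elim r)
      show ?case
      proof (cases "r \<in> {s<..t'}")
        case True
        then have "s < r \<and> r \<le> t" using t' by auto
        with elim True show ?thesis by (simp add: mult.assoc)
      qed simp
    qed
  qed
  also have "\<dots> = ?K * D\<^sup>2 * (\<integral>p. ?X p \<partial>lborel) + exp (2 * M) * (\<integral>p. ?Y p \<partial>lborel)"
    by (subst Bochner_Integration.integral_add[OF integrable_mult_right[OF integrable_section_integral[OF X]] integrable_mult_right[OF integrable_section_integral[OF Y]]])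
      (simp only: integral_mult_right_zero integral_lborel_prod[OF X] integral_lborel_prod[OF Y])
  also have "(\<integral>p. ?Y p \<partial>lborel) \<le> (\<integral>p. norm (?\<eta> p) * norm (GM \<epsilon> p) + 2 * D * (norm (?\<eta> p) * norm (FM \<epsilon> p)) \<partial>lborel)"
    by (rule integral_mono_AE[OF Y EE YB])
  also have "\<dots> = (\<integral>p. norm (?\<eta> p) * norm (GM \<epsilon> p) \<partial>lborel) + 2 * D * (\<integral>p. norm (?\<eta> p) * norm (FM \<epsilon> p) \<partial>lborel)"
    using E1 E2 by simp
  finally have "Re (\<integral>p. ?Q p \<partial>lborel) \<le> ?K * D\<^sup>2 * (\<integral>p. ?X p \<partial>lborel) + exp (2 * M) * ((\<integral>p. norm (?\<eta> p) * norm (GM \<epsilon> p) \<partial>lborel) + 2 * D * (\<integral>p. norm (?\<eta> p) * norm (FM \<epsilon> p) \<partial>lborel))"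
    by simp
  then show ?thesis
    unfolding mollified_energy_identity[OF \<epsilon> t' u] by (intro add_left_mono mult_left_mono) simp_all
qed

text \<open>
  As \<open>\<epsilon> \<rightarrow> 0\<close>, both \<open>HM\<close> and \<open>A GM\<close> converge to \<open>A \<nabla>\<^sub>v f\<close> in \<open>L\<^sup>2\<close>, so the commutator disappears. All other terms
  converge because the weight is bounded.
\<close>

lemma energy_inequality:
  assumes \<Lambda>: "\<Lambda> \<ge> 0" and t': "s \<le> t'" "t' \<le> t"
    and u: "u \<in> L2 lborel" "AE y in lborel. u y = f t' (drift (t' - t) y)"
  shows "(\<integral>z. w z * (norm (u z))\<^sup>2 \<partial>lborel) \<le> (\<integral>z. w z * (norm (\<psi>\<psi> z))\<^sup>2 \<partial>lborel)
    + 2 * ((\<Lambda>\<^sup>2 / lam + \<Lambda>) * D\<^sup>2 * (\<integral>p. (indicator {s<..t'} (fst p) * w (snd p)) * (norm (FF p))\<^sup>2 \<partial>lborel))"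
proof -
  let ?K = "\<Lambda>\<^sup>2 / lam + \<Lambda>"
  define \<epsilon> where "\<epsilon> n = 1 / real (Suc n)" for n
  have \<epsilon>: "\<epsilon> n > 0" for n by (simp add: \<epsilon>_def)
  have \<iota>: "bounded_linear (\<lambda>y::(real ^ 'a) \<times> (real ^ 'a). (0::real, y))"
    by (intro bounded_linear_Pair bounded_linear_zero bounded_linear_ident)
  have cF: "(\<lambda>n. \<integral>p. (norm (FM (\<epsilon> n) p - FF p))\<^sup>2 \<partial>lborel) \<longlonglongrightarrow> 0"
    unfolding FM_def \<epsilon>_def by (rule mollifier_tendsto_L2[OF \<iota> FF])
  have cG: "(\<lambda>n. \<integral>p. (norm (GM (\<epsilon> n) p - GG p))\<^sup>2 \<partial>lborel) \<longlonglongrightarrow> 0"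
    unfolding GM_def \<epsilon>_def by (rule mollifier_tendsto_L2[OF \<iota> GG])
  have cH: "(\<lambda>n. \<integral>p. (norm (HM (\<epsilon> n) p - HH p))\<^sup>2 \<partial>lborel) \<longlonglongrightarrow> 0"
    unfolding HM_def \<epsilon>_def by (rule mollifier_tendsto_L2[OF \<iota> HH])
  have id: "bounded_linear (\<lambda>y::(real ^ 'a) \<times> (real ^ 'a). y)" by (rule bounded_linear_ident)
  have cu: "(\<lambda>n. \<integral>z. (norm (conv (mollifier (\<epsilon> n)) u z - u z))\<^sup>2 \<partial>lborel) \<longlonglongrightarrow> 0"
    unfolding conv_eq_moll \<epsilon>_def by (rule mollifier_tendsto_L2[OF id u(1)])
  have c\<psi>: "(\<lambda>n. \<integral>z. (norm (conv (mollifier (\<epsilon> n)) \<psi>\<psi> z - \<psi>\<psi> z))\<^sup>2 \<partial>lborel) \<longlonglongrightarrow> 0"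
    unfolding conv_eq_moll \<epsilon>_def by (rule mollifier_tendsto_L2[OF id \<psi>\<psi>])
  have wb: "\<bar>w z\<bar> \<le> exp (2 * M)" for z using w_bounds(1,2)[of z] by simp
  let ?\<eta> = "\<lambda>n p. HM (\<epsilon> n) p - BF p *v GM (\<epsilon> n) p"
  have eta: "?\<eta> n \<in> L2 lborel" for n by (intro L2_minus HM_L2 coefficient_mult_L2 GM_L2 \<epsilon>)
  have c\<eta>: "(\<lambda>n. \<integral>p. (norm (?\<eta> n p))\<^sup>2 \<partial>lborel) \<longlonglongrightarrow> 0"
  proof (rule tendsto_sandwich[OF _ _ tendsto_const])
    have "(\<lambda>n. 2 * (\<integral>p. (norm (HM (\<epsilon> n) p - HH p))\<^sup>2 \<partial>lborel) + 2 * (\<Lambda>\<^sup>2 * (\<integral>p. (norm (GM (\<epsilon> n) p - GG p))\<^sup>2 \<partial>lborel))) \<longlonglongrightarrow> 2 * 0 + 2 * (\<Lambda>\<^sup>2 * 0)"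
      by (intro tendsto_intros cH cG)
    then show "(\<lambda>n. 2 * (\<integral>p. (norm (HM (\<epsilon> n) p - HH p))\<^sup>2 \<partial>lborel) + 2 * (\<Lambda>\<^sup>2 * (\<integral>p. (norm (GM (\<epsilon> n) p - GG p))\<^sup>2 \<partial>lborel))) \<longlonglongrightarrow> 0" by simp
    show "\<forall>\<^sub>F n in sequentially. (\<integral>p. (norm (?\<eta> n p))\<^sup>2 \<partial>lborel) \<le> 2 * (\<integral>p. (norm (HM (\<epsilon> n) p - HH p))\<^sup>2 \<partial>lborel) + 2 * (\<Lambda>\<^sup>2 * (\<integral>p. (norm (GM (\<epsilon> n) p - GG p))\<^sup>2 \<partial>lborel))"
    proof (intro always_eventually allI)
      fix n
      note dH = L2_integrable[OF L2_minus[OF HM_L2[OF \<epsilon>] HH]] and dG = L2_integrable[OF L2_minus[OF GM_L2[OF \<epsilon>] GG]]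
      have "(\<integral>p. (norm (?\<eta> n p))\<^sup>2 \<partial>lborel) \<le> (\<integral>p. 2 * (norm (HM (\<epsilon> n) p - HH p))\<^sup>2 + 2 * (\<Lambda>\<^sup>2 * (norm (GM (\<epsilon> n) p - GG p))\<^sup>2) \<partial>lborel)"
      proof (rule integral_mono_AE[OF L2_integrable[OF eta]])
        show "integrable lborel (\<lambda>p. 2 * (norm (HM (\<epsilon> n) p - HH p))\<^sup>2 + 2 * (\<Lambda>\<^sup>2 * (norm (GM (\<epsilon> n) p - GG p))\<^sup>2))"
          by (intro Bochner_Integration.integrable_add integrable_mult_right dH dG)
        show "AE p in lborel. (norm (?\<eta> n p))\<^sup>2 \<le> 2 * (norm (HM (\<epsilon> n) p - HH p))\<^sup>2 + 2 * (\<Lambda>\<^sup>2 * (norm (GM (\<epsilon> n) p - GG p))\<^sup>2)"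
          using coefficient_bounded_AE
        proof eventually_elim
          case (elim p)
          have e: "?\<eta> n p = (HM (\<epsilon> n) p - HH p) - BF p *v (GM (\<epsilon> n) p - GG p)"
            by (simp add: HH_def BF_def GG_def matrix_vector_mult_diff_distrib)
          have "norm (BF p *v (GM (\<epsilon> n) p - GG p)) \<le> \<bar>\<Lambda>\<bar> * norm (GM (\<epsilon> n) p - GG p)"
            using elim by (intro norm_matrix_vector_le) auto
          then have "norm (?\<eta> n p) \<le> norm (HM (\<epsilon> n) p - HH p) + \<bar>\<Lambda>\<bar> * norm (GM (\<epsilon> n) p - GG p)"
            unfolding e using norm_triangle_ineq4[of "HM (\<epsilon> n) p - HH p" "BF p *v (GM (\<epsilon> n) p - GG p)"] by linarith
          from order_trans[OF power_mono[OF this norm_ge_zero, of 2] square_add_le] show ?case by (simp add: power_mult_distrib)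
        qed
      qed
      then show "(\<integral>p. (norm (?\<eta> n p))\<^sup>2 \<partial>lborel) \<le> 2 * (\<integral>p. (norm (HM (\<epsilon> n) p - HH p))\<^sup>2 \<partial>lborel) + 2 * (\<Lambda>\<^sup>2 * (\<integral>p. (norm (GM (\<epsilon> n) p - GG p))\<^sup>2 \<partial>lborel))"
        using dH[of n] dG[of n] by simp
    qed
  qed auto
  have l1: "(\<lambda>n. \<integral>z. w z * (norm (conv (mollifier (\<epsilon> n)) u z))\<^sup>2 \<partial>lborel) \<longlonglongrightarrow> (\<integral>z. w z * (norm (u z))\<^sup>2 \<partial>lborel)"
    by (rule L2_limit_weighted_square[OF conv_L2[OF mollifier_kernel[OF \<epsilon>] u(1)] u(1) cu _ wb]) measurable
  have l2: "(\<lambda>n. \<integral>z. w z * (norm (conv (mollifier (\<epsilon> n)) \<psi>\<psi> z))\<^sup>2 \<partial>lborel) \<longlonglongrightarrow> (\<integral>z. w z * (norm (\<psi>\<psi> z))\<^sup>2 \<partial>lborel)"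
    by (rule L2_limit_weighted_square[OF conv_L2[OF mollifier_kernel[OF \<epsilon>] \<psi>\<psi>] \<psi>\<psi> c\<psi> _ wb]) measurable
  have l3: "(\<lambda>n. \<integral>p. (indicator {s<..t'} (fst p) * w (snd p)) * (norm (FM (\<epsilon> n) p))\<^sup>2 \<partial>lborel) \<longlonglongrightarrow> (\<integral>p. (indicator {s<..t'} (fst p) * w (snd p)) * (norm (FF p))\<^sup>2 \<partial>lborel)"
    by (rule L2_limit_weighted_square[OF FM_L2[OF \<epsilon>] FF cF, where C="exp (2 * M)"]) (measurable, use wb in \<open>auto simp: indicator_def\<close>)
  have l4: "(\<lambda>n. \<integral>p. norm (?\<eta> n p) * norm (GM (\<epsilon> n) p) \<partial>lborel) \<longlonglongrightarrow> 0"
    by (rule L2_limit_product_zero[OF eta c\<eta> GM_L2[OF \<epsilon>] GG cG])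
  have l5: "(\<lambda>n. \<integral>p. norm (?\<eta> n p) * norm (FM (\<epsilon> n) p) \<partial>lborel) \<longlonglongrightarrow> 0"
    by (rule L2_limit_product_zero[OF eta c\<eta> FM_L2[OF \<epsilon>] FF cF])
  have "(\<integral>z. w z * (norm (u z))\<^sup>2 \<partial>lborel) \<le> (\<integral>z. w z * (norm (\<psi>\<psi> z))\<^sup>2 \<partial>lborel)
    + 2 * (?K * D\<^sup>2 * (\<integral>p. (indicator {s<..t'} (fst p) * w (snd p)) * (norm (FF p))\<^sup>2 \<partial>lborel) + exp (2 * M) * (0 + 2 * D * 0))"
  proof (rule LIMSEQ_le[OF l1])
    show "(\<lambda>n. (\<integral>z. w z * (norm (conv (mollifier (\<epsilon> n)) \<psi>\<psi> z))\<^sup>2 \<partial>lborel)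
      + 2 * (?K * D\<^sup>2 * (\<integral>p. (indicator {s<..t'} (fst p) * w (snd p)) * (norm (FM (\<epsilon> n) p))\<^sup>2 \<partial>lborel)
      + exp (2 * M) * ((\<integral>p. norm (?\<eta> n p) * norm (GM (\<epsilon> n) p) \<partial>lborel) + 2 * D * (\<integral>p. norm (?\<eta> n p) * norm (FM (\<epsilon> n) p) \<partial>lborel))))
      \<longlonglongrightarrow> (\<integral>z. w z * (norm (\<psi>\<psi> z))\<^sup>2 \<partial>lborel)
    + 2 * (?K * D\<^sup>2 * (\<integral>p. (indicator {s<..t'} (fst p) * w (snd p)) * (norm (FF p))\<^sup>2 \<partial>lborel) + exp (2 * M) * (0 + 2 * D * 0))"
      by (intro tendsto_add tendsto_mult tendsto_const l2 l3 l4 l5)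
  qed (use mollified_energy_inequality[OF \<epsilon> \<Lambda> t' u] in auto)
  then show ?thesis by simp
qed

text \<open>
  The energy inequality at almost every time, with \<open>u\<close> the slice of \<open>FF\<close>, is the hypothesis of Gronwall's
  inequality; one more use of it at time \<open>t\<close> itself gives the bound for \<open>f t\<close>.
\<close>

theorem weighted_contraction:
  assumes \<Lambda>: "\<Lambda> \<ge> 0" and u: "u \<in> L2 lborel" "AE y in lborel. u y = f t y"
  shows "(\<integral>z. w z * (norm (u z))\<^sup>2 \<partial>lborel) \<le> exp (2 * (\<Lambda>\<^sup>2 / lam + \<Lambda>) * D\<^sup>2 * (t - s)) * (\<integral>z. w z * (norm (\<psi>\<psi> z))\<^sup>2 \<partial>lborel)"
proof -
  let ?m = "2 * (\<Lambda>\<^sup>2 / lam + \<Lambda>) * D\<^sup>2"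
  define y where "y r = indicator {s<..t} r * (\<integral>z. w z * (norm (FF (r, z)))\<^sup>2 \<partial>lborel)" for r
  define y0 where "y0 = (\<integral>z. w z * (norm (\<psi>\<psi> z))\<^sup>2 \<partial>lborel)"
  have m0: "?m \<ge> 0" using \<Lambda> lam by simp
  have X: "integrable lborel (\<lambda>p. (indicator {s<..t'} (fst p) * w (snd p)) * (norm (FF p))\<^sup>2)" for t'
    using w_bounds(1,2) by (intro integrable_weighted_square[OF FF, where C="exp (2 * M)"]) (auto simp: indicator_def less_imp_le)
  have yi: "integrable lborel y"
    using integrable_section_integral[OF X[of t]] by (simp add: y_def[abs_def] mult.assoc)
  have e: "(\<integral>p. (indicator {s<..t'} (fst p) * w (snd p)) * (norm (FF p))\<^sup>2 \<partial>lborel) = (LBINT r:{s..t'}. y r)" if "t' \<le> t" for t'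
  proof -
    have "(\<integral>p. (indicator {s<..t'} (fst p) * w (snd p)) * (norm (FF p))\<^sup>2 \<partial>lborel) = (\<integral>r. indicator {s<..t'} r * (\<integral>z. w z * (norm (FF (r, z)))\<^sup>2 \<partial>lborel) \<partial>lborel)"
      using integral_lborel_prod[OF X[of t']] by (simp add: mult.assoc)
    also have "\<dots> = (LBINT r:{s..t'}. y r)"
      unfolding set_lebesgue_integral_def y_def
      by (rule Bochner_Integration.integral_cong) (use that in \<open>auto simp: indicator_def\<close>)
    finally show ?thesis .
  qed
  have "AE r in lborel. s \<le> r \<and> r \<le> t \<longrightarrow> y r \<le> y0 + ?m * (LBINT x:{s..r}. y x)"
    using regular_AE frame_slices AE_lborel_singleton[of s]
  proof eventually_elim
    case (elim r)
    show ?case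
    proof
      assume "s \<le> r \<and> r \<le> t"
      then have r: "s < r" "r \<le> t" using elim by auto
      have F: "(\<lambda>z. FF (r, z)) \<in> L2 lborel" "AE z in lborel. FF (r, z) = f r (drift (r - t) z)"
        using elim r by (auto simp: regular_def)
      have yr: "y r = (\<integral>z. w z * (norm (FF (r, z)))\<^sup>2 \<partial>lborel)" using r by (simp add: y_def)
      show "y r \<le> y0 + ?m * (LBINT x:{s..r}. y x)"
        using energy_inequality[OF \<Lambda> less_imp_le[OF r(1)] r(2) F]
        unfolding e[OF r(2)] y0_def[symmetric] yr[symmetric] by (simp only: mult.assoc)
    qed
  qed
  moreover have "set_integrable lborel {s..t} y"
    unfolding set_integrable_def by (rule integrable_mult_indicator[OF _ yi]) simp
  ultimately have "y0 + ?m * (LBINT x:{s..t}. y x) \<le> y0 * exp (?m * (t - s))"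
    using gronwall_integral[OF _ m0 st] by blast
  moreover have "(\<integral>z. w z * (norm (u z))\<^sup>2 \<partial>lborel) \<le> y0 + ?m * (LBINT x:{s..t}. y x)"
  proof -
    have "AE y in lborel. u y = f t (drift (t - t) y)" using u(2) by simp
    from energy_inequality[OF \<Lambda> less_imp_le[OF st] order_refl u(1) this] show ?thesis
      unfolding e[OF order_refl] y0_def[symmetric] by (simp only: mult.assoc)
  qed
  ultimately show ?thesis unfolding y0_def by (simp only: mult.commute[of "exp _"] order_trans)
qed

end

section \<open>The ellipticity constant does not exceed the bound\<close>

lemma AE_lborel_imp_ex:
  assumes "AE x in (lborel :: 'a::euclidean_space measure). P x" shows "\<exists>x. P x"
proof (rule ccontr)
  assume "\<not> (\<exists>x. P x)"
  then have "AE x in (lborel :: 'a measure). False" using assms by auto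
  then have "emeasure (lborel :: 'a measure) UNIV = 0"
    by (subst (asm) AE_iff_measurable[OF _ refl]) auto
  then show False by (simp add: emeasure_lborel_UNIV)
qed

lemma continuous_AE_zero:
  fixes Q :: "'a::euclidean_space \<Rightarrow> 'b::real_normed_vector"
  assumes c: "continuous_on UNIV Q" and z: "AE v in lborel. Q v = 0" shows "Q v = 0"
proof (rule ccontr)
  assume "Q v \<noteq> 0"
  have "open (Q -` (- {0}))" using c by (intro open_vimage) auto
  then obtain e where e: "e > 0" "ball v e \<subseteq> Q -` (- {0})" using \<open>Q v \<noteq> 0\<close> by (meson ComplI open_contains_ball singletonD vimageI2)
  have "AE x in lborel. x \<notin> ball v e" using z by eventually_elim (use e in auto)
  then have "emeasure lborel (ball v e) = 0"
    by (intro AE_iff_measurable[THEN iffD1, rotated 2]) auto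
  then have "measure lborel (ball v e) = 0" by (simp add: measure_def)
  then show False using content_ball_pos[OF e(1), of v] by simp
qed

text \<open>
  Both inequalities are tested on the gradient of a mollifier, at one point \<open>(t, x)\<close> at which they hold. This
  gradient is not zero almost everywhere, since otherwise the mollifier would be constant.
\<close>

lemma garding_constant_le_bound:
  fixes A :: "real \<times> (real ^ 'd::finite) \<times> (real ^ 'd) \<Rightarrow> complex ^ 'd ^ 'd"
  assumes A: "A \<in> borel_measurable lebesgue" and b: "bounded_coeff \<Lambda> A" and g: "garding_elliptic lam A"
  shows "lam \<le> \<Lambda>"
proof -
  obtain B where B: "B \<in> borel_measurable borel" "AE p in lborel. A p = B p"
    using borel_representative[OF A] by blast
  define g0 where "g0 v = complex_of_real (mollifier 1 (v :: real ^ 'd))" for v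
  define Q :: "real ^ 'd \<Rightarrow> complex ^ 'd" where "Q v = (\<chi> i. complex_of_real (mollifier_deriv 1 (axis i 1) v))" for v
  have kc: "continuous_on UNIV (mollifier 1 :: real ^ 'd \<Rightarrow> real)" "continuous_on UNIV (mollifier_deriv 1 (axis i 1) :: real ^ 'd \<Rightarrow> real)" for i
    by (intro kernel_continuous mollifier_kernel mollifier_deriv_kernel; simp)+
  have Qc: "continuous_on UNIV Q" unfolding Q_def[abs_def] by (intro continuous_on_vec_lambda continuous_intros kc)
  have k0: "mollifier_deriv 1 (axis i 1) v = 0" if "norm v \<ge> 1" for v :: "real ^ 'd" and i
    using that by (simp add: mollifier_deriv_def flat_eq_0)
  have Q0: "Q v = 0" if "norm v \<ge> 1" for v using k0[OF that] by (simp add: Q_def vec_eq_iff)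
  have QL2: "Q \<in> L2 lborel"
    by (intro L2_I continuous_compact_support_integrable[where R=1] borel_measurable_continuous_onI[OF Qc, unfolded measurable_lborel1[symmetric]] continuous_intros Qc) (auto simp: Q0 borel_measurable_continuous_onI[OF Qc])
  have ld: "line_deriv (axis i 1) g0 (\<lambda>v. Q v $ i)" for i
    using line_deriv_bounded_linear[OF bounded_linear_of_real mollifier_line_deriv[of "axis i 1" 1]] by (simp add: g0_def[abs_def] Q_def)
  have W: "W12_dot_grad (\<lambda>\<phi>. \<integral>v. g0 v * \<phi> v \<partial>lebesgue) Q"
    by (intro W12_dot_grad_of_C1 Qc L2_lborel_imp_lebesgue QL2 ld) (auto simp: g0_def[abs_def] intro!: continuous_intros kc)
  define N where "N = (\<integral>v. (norm (Q v))\<^sup>2 \<partial>lborel)"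
  have N0: "N > 0"
  proof (rule ccontr)
    assume "\<not> N > 0"
    then have "N = 0" unfolding N_def by (simp add: antisym_conv2 Bochner_Integration.integral_nonneg less_le)
    then have "AE v in lborel. (norm (Q v))\<^sup>2 = 0"
      unfolding N_def by (subst (asm) integral_nonneg_eq_0_iff_AE[OF L2_integrable[OF QL2]]) auto
    then have "AE v in lborel. Q v = 0" by simp
    note Q0' = continuous_AE_zero[OF Qc this]
    have z: "mollifier_deriv 1 (axis i 1) v = 0" for i and v :: "real ^ 'd"
      using Q0'[of v] by (simp add: Q_def vec_eq_iff)
    obtain i :: 'd where True by simp
    have "\<bar>mollifier 1 (0 + 1 *\<^sub>R axis i (1::real)) - mollifier 1 (0 :: real ^ 'd)\<bar> \<le> 0 * \<bar>1\<bar>"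
      by (rule line_deriv_difference_bound[OF mollifier_line_deriv]) (simp add: z)
    then have "mollifier 1 (0 :: real ^ 'd) = 0" by (simp add: mollifier_eq_0)
    moreover have "mollifier 1 (0 :: real ^ 'd) > 0"
      using bump_integral_pos[of 1, where 'a="real ^ 'd"] by (simp add: mollifier_def bump_def flat_pos)
    ultimately show False by simp
  qed
  have "AE p in lborel. \<forall>\<xi> \<eta>. norm (herm (A p *v \<xi>) \<eta>) \<le> \<Lambda> * norm \<xi> * norm \<eta>"
    using b by (simp add: bounded_coeff_def AE_lebesgue_iff)
  from AE_lborel_sections[OF this] AE_lborel_sections[OF g[unfolded garding_elliptic_def AE_lebesgue_iff]] AE_lborel_sections[OF B(2)]
  have "AE r in lborel. (AE z in lborel. \<forall>\<xi> \<eta>. norm (herm (A (r, z) *v \<xi>) \<eta>) \<le> \<Lambda> * norm \<xi> * norm \<eta>)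
     \<and> (AE x in lborel. \<forall>T G. W12_dot_grad T G \<longrightarrow> lam * (L2norm lebesgue G)\<^sup>2 \<le> Re (\<integral>v. herm (A (r, x, v) *v G v) (G v) \<partial>lebesgue))
     \<and> (AE z in lborel. A (r, z) = B (r, z))" by eventually_elim simp
  then obtain r where r: "AE z in lborel. \<forall>\<xi> \<eta>. norm (herm (A (r, z) *v \<xi>) \<eta>) \<le> \<Lambda> * norm \<xi> * norm \<eta>"
      "AE x in lborel. \<forall>T G. W12_dot_grad T G \<longrightarrow> lam * (L2norm lebesgue G)\<^sup>2 \<le> Re (\<integral>v. herm (A (r, x, v) *v G v) (G v) \<partial>lebesgue)"
      "AE z in lborel. A (r, z) = B (r, z)"
    using AE_lborel_imp_ex by blast
  from AE_lborel_sections[OF r(1)] r(2) AE_lborel_sections[OF r(3)]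
  have "AE x in lborel. (AE v in lborel. \<forall>\<xi> \<eta>. norm (herm (A (r, x, v) *v \<xi>) \<eta>) \<le> \<Lambda> * norm \<xi> * norm \<eta>)
     \<and> lam * (L2norm lebesgue Q)\<^sup>2 \<le> Re (\<integral>v. herm (A (r, x, v) *v Q v) (Q v) \<partial>lebesgue)
     \<and> (AE v in lborel. A (r, x, v) = B (r, x, v))" by eventually_elim (use W in auto)
  then obtain x where x: "AE v in lborel. \<forall>\<xi> \<eta>. norm (herm (A (r, x, v) *v \<xi>) \<eta>) \<le> \<Lambda> * norm \<xi> * norm \<eta>"
    "lam * (L2norm lebesgue Q)\<^sup>2 \<le> Re (\<integral>v. herm (A (r, x, v) *v Q v) (Q v) \<partial>lebesgue)"
    "AE v in lborel. A (r, x, v) = B (r, x, v)"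
    using AE_lborel_imp_ex by blast
  have [measurable]: "Q \<in> borel_measurable borel" "B \<in> borel_measurable borel" using L2_borel[OF QL2] B by auto
  have m: "(\<lambda>v. herm (B (r, x, v) *v Q v) (Q v)) \<in> borel_measurable borel" by measurable
  have bd: "AE v in lborel. norm (herm (B (r, x, v) *v Q v) (Q v)) \<le> \<Lambda> * (norm (Q v))\<^sup>2"
    using x(1,3)
  proof eventually_elim
    case (elim v) then show ?case using spec[OF spec[OF elim(1), of "Q v"], of "Q v"] by (simp add: power2_eq_square mult.assoc)
  qed
  have i: "integrable lborel (\<lambda>v. herm (B (r, x, v) *v Q v) (Q v))"
  proof (rule Bochner_Integration.integrable_bound[OF integrable_mult_right[OF L2_integrable[OF QL2], of \<Lambda>]])
    show "(\<lambda>v. herm (B (r, x, v) *v Q v) (Q v)) \<in> borel_measurable lborel" using m by simp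
    show "AE v in lborel. norm (herm (B (r, x, v) *v Q v) (Q v)) \<le> norm (\<Lambda> * (norm (Q v))\<^sup>2)"
      using bd by eventually_elim (auto intro: order_trans[OF _ abs_ge_self])
  qed
  have "L2norm lebesgue Q = L2norm lborel Q"
    unfolding L2norm_def by (subst integral_completion) (auto simp: measurable_lborel1)
  then have "lam * N \<le> Re (\<integral>v. herm (A (r, x, v) *v Q v) (Q v) \<partial>lebesgue)"
    using x(2) by (simp add: N_def L2norm_square)
  also have "(\<integral>v. herm (A (r, x, v) *v Q v) (Q v) \<partial>lebesgue) = (\<integral>v. herm (B (r, x, v) *v Q v) (Q v) \<partial>lborel)"
    by (rule integral_lebesgue_eq_lborel[OF _ m]) (use x(3) in \<open>auto elim!: AE_mp\<close>)
  also have "Re \<dots> \<le> norm \<dots>" by (rule complex_Re_le_cmod)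
  also have "\<dots> \<le> (\<integral>v. norm (herm (B (r, x, v) *v Q v) (Q v)) \<partial>lborel)" by (rule integral_norm_bound)
  also have "\<dots> \<le> (\<integral>v. \<Lambda> * (norm (Q v))\<^sup>2 \<partial>lborel)"
    by (rule integral_mono_AE[OF integrable_norm[OF i] integrable_mult_right[OF L2_integrable[OF QL2]] bd])
  also have "\<dots> = \<Lambda> * N" by (simp add: N_def)
  finally show ?thesis using N0 by simp
qed

section \<open>The weighted contraction for weak solutions\<close>

text \<open>
  The solution, its gradient and the coefficients are replaced by Borel representatives, to which
  \<open>weighted_contraction\<close> applies. The initial value enters transported to time \<open>t\<close>, where it is compared with \<open>\<phi>\<close>.
\<close>

theorem weighted_energy_bound:
  fixes A :: "real \<times> (real ^ 'd::finite) \<times> (real ^ 'd) \<Rightarrow> complex ^ 'd ^ 'd"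
  assumes A: "A \<in> borel_measurable lebesgue" "bounded_coeff \<Lambda> A" "lam > 0" "garding_elliptic lam A"
    and f: "weak_solution A s \<psi> f" "L2_continuous_from s f" and st: "s < t"
    and \<psi>0: "\<psi>0 \<in> L2 lborel" "AE z in lborel. \<psi> z = \<psi>0 z"
    and u: "u \<in> L2 lborel" "AE z in lborel. u z = f t z"
    and \<phi>_cont: "continuous_on UNIV \<phi>" and \<phi>_bound: "\<And>z. \<bar>\<phi> z\<bar> \<le> M"
    and \<phi>_deriv: "\<And>b. line_deriv b \<phi> (\<phi>d b)" and \<phi>d_cont: "\<And>b. continuous_on UNIV (\<phi>d b)"
    and \<phi>d_linear: "\<And>a i z. \<phi>d (flow_dir a i) z = \<phi>d (0, axis i 1) z + a * \<phi>d (axis i 1, 0) z"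
    and \<phi>d_bound: "\<And>r z. s \<le> r \<Longrightarrow> r \<le> t \<Longrightarrow> norm (\<chi> i. \<phi>d (flow_dir (t - r) i) z) \<le> D"
  shows "(\<integral>z. exp (2 * \<phi> z) * (norm (u z))\<^sup>2 \<partial>lborel)
    \<le> exp (2 * (\<Lambda>\<^sup>2 / lam + \<Lambda>) * D\<^sup>2 * (t - s)) * (\<integral>z. exp (2 * \<phi> z) * (norm (\<psi>0 (drift (s - t) z)))\<^sup>2 \<partial>lborel)"
proof -
  obtain G where G: "weak_grad_v s f G"
    and weq: "\<And>h. h \<in> test_functions UNIV \<Longrightarrow>
           - (\<integral>p. f (fst p) (snd p) * transport (\<lambda>q. cnj (h q)) p \<partial>lebesgue_on ({s..} \<times> UNIV))
           + (\<integral>p. herm (A p *v G p) (grad_v h p) \<partial>lebesgue_on ({s..} \<times> UNIV))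
           = (\<integral>z. \<psi> z * cnj (h (s, z)) \<partial>lebesgue)"
    using f(1) unfolding weak_solution_def by blast
  have "(\<lambda>p. f (fst p) (snd p)) \<in> L2 (lebesgue_on ({s..t + 1} \<times> UNIV))"
    using f(1) st unfolding weak_solution_def by auto
  then obtain F0 where F0: "F0 \<in> L2 lborel" "AE p in lborel. (if p \<in> {s..t + 1} \<times> UNIV then f (fst p) (snd p) else 0) = F0 p"
    by (rule L2_lebesgue_representative) (auto intro!: borel_Times)
  have "G \<in> L2 (lebesgue_on ({s<..} \<times> UNIV))" using G by (simp add: weak_grad_v_def)
  then obtain G0 where G0: "G0 \<in> L2 lborel" "AE p in lborel. (if p \<in> {s<..} \<times> UNIV then G p else 0) = G0 p"
    by (rule L2_lebesgue_representative) (auto intro!: borel_Times)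
  obtain B where B: "B \<in> borel_measurable borel" "AE p in lborel. A p = B p"
    using borel_representative[OF A(1)] by blast
  have H0: "(\<lambda>p. B p *v G0 p) \<in> L2 lborel"
  proof (rule L2_bound_AE[OF G0(1)])
    have [measurable]: "G0 \<in> borel_measurable borel" "B \<in> borel_measurable borel" using L2_borel[OF G0(1)] B by auto
    show "(\<lambda>p. B p *v G0 p) \<in> borel_measurable lborel" by measurable
    show "AE p in lborel. norm (B p *v G0 p) \<le> \<bar>\<Lambda>\<bar> * norm (G0 p)"
      using A(2)[unfolded bounded_coeff_def AE_lebesgue_iff] B(2)
      by eventually_elim (intro norm_matrix_vector_le, auto)
  qed
  interpret weighted_kinetic_solution A B s t \<psi> \<psi>0 f F0 G G0 lam \<Lambda> \<phi> \<phi>d M D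
    by unfold_locales (fact st G weq f F0 G0 B H0 \<psi>0 A \<phi>_cont \<phi>_bound \<phi>_deriv \<phi>d_cont \<phi>d_linear \<phi>d_bound)+
  have "lam \<le> \<Lambda>" by (rule garding_constant_le_bound[OF A(1,2,4)])
  then have "\<Lambda> \<ge> 0" using A(3) by simp
  from weighted_contraction[OF this u] show ?thesis by (simp add: w_def \<psi>\<psi>_def)
qed

section \<open>A smooth weight from the kinetic distance\<close>

text \<open>
  In these coordinates the kinetic distance from \<open>z\<close> to \<open>p\<close> is the Euclidean distance from \<open>z\<close> to
  \<open>drift \<tau> p\<close>.
\<close>

definition rescale :: "real \<Rightarrow> (real ^ 'd::finite) \<times> (real ^ 'd) \<Rightarrow> (real ^ 'd) \<times> (real ^ 'd)" where
  "rescale \<tau> z = (fst z /\<^sub>R \<tau>, snd z)"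

lemma rescale_diff: "rescale \<tau> (x - y) = rescale \<tau> x - rescale \<tau> y"
  and rescale_scaleR: "rescale \<tau> (c *\<^sub>R x) = c *\<^sub>R rescale \<tau> x"
  by (simp_all add: rescale_def scaleR_diff_right)

lemma norm_rescale_le:
  assumes "\<tau> > 0" shows "norm (rescale \<tau> z) \<le> (1 + 1 / \<tau>) * norm z"
proof -
  have "norm (rescale \<tau> z) \<le> norm (fst z) / \<tau> + norm (snd z)"
    using norm_Pair_le[of "fst z /\<^sub>R \<tau>" "snd z"] assms by (simp add: rescale_def divide_inverse mult.commute)
  also have "\<dots> \<le> norm z / \<tau> + norm z"
    using norm_fst_le[of "fst z" "snd z"] norm_snd_le[of "snd z" "fst z"] assms
    by (intro add_mono divide_right_mono) auto
  finally show ?thesis by (simp add: algebra_simps)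
qed

text \<open>
  The position component of the displacement is \<open>(a / \<tau>) v\<close>, and \<open>a \<le> \<tau>\<close>.
\<close>

lemma norm_rescale_flow:
  assumes "\<tau> > 0" "0 \<le> a" "a \<le> \<tau>"
  shows "norm (rescale \<tau> (drift a (0, v))) \<le> sqrt 2 * norm v"
proof -
  have "(norm (rescale \<tau> (drift a (0, v))))\<^sup>2 = (a / \<tau>)\<^sup>2 * (norm v)\<^sup>2 + (norm v)\<^sup>2"
    using assms by (simp add: rescale_def drift_def norm_Pair power_mult_distrib power_divide field_simps)
  also have "\<dots> \<le> 1 * (norm v)\<^sup>2 + (norm v)\<^sup>2"
    using assms by (intro add_right_mono mult_right_mono) (auto simp: power_le_one)
  also have "\<dots> = (sqrt 2 * norm v)\<^sup>2" by (simp add: power_mult_distrib)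
  finally show ?thesis by (rule power2_le_imp_le) simp
qed

lemma line_deriv_Lipschitz:
  fixes h :: "'a::real_vector \<Rightarrow> real"
  assumes "line_deriv b h h'" "\<And>z \<sigma>. \<bar>h (z + \<sigma> *\<^sub>R b) - h z\<bar> \<le> \<bar>\<sigma>\<bar> * C"
  shows "\<bar>h' z\<bar> \<le> C"
proof -
  have "((\<lambda>\<sigma>. h (z + \<sigma> *\<^sub>R b)) has_real_derivative h' z) (at 0)"
    using assms(1) by (simp add: line_deriv_def has_real_derivative_iff_has_vector_derivative)
  then have "((\<lambda>\<sigma>. \<bar>(h (z + \<sigma> *\<^sub>R b) - h z) / \<sigma>\<bar>) \<longlongrightarrow> \<bar>h' z\<bar>) (at 0)"
    by (intro tendsto_rabs) (simp add: DERIV_def)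
  moreover have "\<forall>\<^sub>F \<sigma> in at 0. \<bar>(h (z + \<sigma> *\<^sub>R b) - h z) / \<sigma>\<bar> \<le> C"
    unfolding eventually_at_filter
    by (rule always_eventually) (use assms(2)[of z] in \<open>auto simp: abs_divide divide_le_eq mult.commute\<close>)
  ultimately show ?thesis by (intro tendsto_upperbound[where F="at (0::real)"]) auto
qed

lemma conv_mollifier_scaled_deriv_sum:
  fixes d :: "'a::euclidean_space \<Rightarrow> real"
  assumes \<epsilon>: "\<epsilon> > 0" and d: "locally_integrable d" and I: "finite I"
  shows "(\<Sum>i\<in>I. a i * conv (mollifier_deriv \<epsilon> (b i)) d z) = conv (mollifier_deriv \<epsilon> (\<Sum>i\<in>I. a i *\<^sub>R b i)) d z"
  using I
proof (induction I rule: finite_induct)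
  case empty then show ?case by (simp add: conv_def mollifier_deriv_linear)
next
  case (insert i I)
  note J = conv_integrable[OF mollifier_deriv_kernel[OF \<epsilon>] d]
  have "conv (mollifier_deriv \<epsilon> (\<Sum>i\<in>insert i I. a i *\<^sub>R b i)) d z =
    (\<integral>y. a i *\<^sub>R (mollifier_deriv \<epsilon> (b i) (z - y) *\<^sub>R d y) + mollifier_deriv \<epsilon> (\<Sum>i\<in>I. a i *\<^sub>R b i) (z - y) *\<^sub>R d y \<partial>lborel)"
    unfolding conv_def using insert.hyps by (simp add: mollifier_deriv_linear algebra_simps)
  also have "\<dots> = a i * conv (mollifier_deriv \<epsilon> (b i)) d z + conv (mollifier_deriv \<epsilon> (\<Sum>i\<in>I. a i *\<^sub>R b i)) d z"
    unfolding conv_def real_scaleR_def[symmetric]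
    by (simp only: Bochner_Integration.integral_add[OF integrable_scaleR_right[OF J] J] integral_scaleR_right)
  finally show ?case using insert by simp
qed

text \<open>
  \<open>\<phi>\<close> is \<open>\<kappa>\<close> times the mollified distance to the transported set, truncated at \<open>\<rho>\<close>. Mollification keeps the
  Lipschitz constant with respect to \<open>rescale \<tau>\<close> and changes the function by at most \<open>\<eta>\<close> if the radius is small.
  Linearity of the derivative in the direction, which an arbitrary family of directional derivatives lacks,
  is inherited from the mollifier.
\<close>

lemma kinetic_weight_exists:
  fixes E F :: "((real ^ 'd::finite) \<times> (real ^ 'd)) set"
  assumes \<tau>: "\<tau> > 0" and \<kappa>: "\<kappa> \<ge> 0" and \<eta>: "\<eta> > 0" and F: "F \<noteq> {}" and \<rho>: "\<rho> \<ge> 0"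
    and dist: "\<And>x v y w. (x, v) \<in> E \<Longrightarrow> (y, w) \<in> F \<Longrightarrow> \<rho>\<^sup>2 \<le> (norm (x - y - \<tau> *\<^sub>R w))\<^sup>2 / \<tau>\<^sup>2 + (norm (v - w))\<^sup>2"
  obtains \<phi> \<phi>d where "continuous_on UNIV \<phi>" "\<And>z. \<bar>\<phi> z\<bar> \<le> \<kappa> * \<rho>" "\<And>b. line_deriv b \<phi> (\<phi>d b)" "\<And>b. continuous_on UNIV (\<phi>d b)"
    "\<And>a i z. \<phi>d (flow_dir a i) z = \<phi>d (0, axis i 1) z + a * \<phi>d (axis i 1, 0) z"
    "\<And>a z. 0 \<le> a \<Longrightarrow> a \<le> \<tau> \<Longrightarrow> norm (\<chi> i. \<phi>d (flow_dir a i) z) \<le> \<kappa> * sqrt 2"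
    "\<And>z. z \<in> E \<Longrightarrow> \<phi> z \<ge> \<kappa> * (\<rho> - \<eta>)" "\<And>z. drift (- \<tau>) z \<in> F \<Longrightarrow> \<phi> z \<le> \<kappa> * \<eta>"
proof -
  \<comment> \<open>The radius for which \<open>norm_rescale_le\<close> makes the smoothing error at most \<open>\<eta>\<close>.\<close>
  define \<mu> where "\<mu> = \<eta> / (1 + 1 / \<tau>)"
  have t1: "1 + 1 / \<tau> > 0" using \<tau> by (simp add: add_pos_pos)
  have \<mu>: "\<mu> > 0" using \<eta> t1 by (simp add: \<mu>_def)
  have \<mu>\<eta>: "(1 + 1 / \<tau>) * \<mu> = \<eta>" using t1 by (simp add: \<mu>_def)
  define F' where "F' = (\<lambda>p. rescale \<tau> (drift \<tau> p)) ` F"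
  have F': "F' \<noteq> {}" using F by (simp add: F'_def)
  define d where "d z = min (infdist (rescale \<tau> z) F') \<rho>" for z :: "(real ^ 'd) \<times> (real ^ 'd)"
  have d0: "0 \<le> d z" "d z \<le> \<rho>" for z using \<rho> infdist_nonneg[of "rescale \<tau> z" F'] by (auto simp: d_def)
  have Lip: "\<bar>d z - d z'\<bar> \<le> norm (rescale \<tau> (z - z'))" for z z'
    using infdist_triangle_abs[of "rescale \<tau> z" F' "rescale \<tau> z'"] by (auto simp: d_def dist_norm rescale_diff)
  have dc: "continuous_on UNIV d"
    unfolding d_def rescale_def by (intro continuous_intros)
  have li: "locally_integrable d" by (rule continuous_locally_integrable[OF dc])
  let ?k = "mollifier \<mu> :: (real ^ 'd) \<times> (real ^ 'd) \<Rightarrow> real"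
  note kk = mollifier_kernel[OF \<mu>]
  define \<Phi> where "\<Phi> = conv ?k d"
  have ki: "integrable lborel (\<lambda>y. ?k y * c)" "(\<integral>y. ?k y * c \<partial>lborel) = c" for c :: real
    using kernel_integrable[OF kk] mollifier_integral[OF \<mu>] by auto
  have kd: "integrable lborel (\<lambda>y. ?k y * d (z - y))" for z
    using conv_integrable[OF kk li, of z] integrable_lborel_reflect_iff[of "\<lambda>y. ?k y * d (z - y)" z] by simp
  have \<Phi>e: "\<Phi> z = (\<integral>y. ?k y * d (z - y) \<partial>lborel)" for z
    by (simp add: \<Phi>_def conv_eq_moll moll_def)
  have \<Phi>0: "0 \<le> \<Phi> z" for z unfolding \<Phi>e by (intro Bochner_Integration.integral_nonneg mult_nonneg_nonneg mollifier_nonneg d0)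
  have \<Phi>\<rho>: "\<Phi> z \<le> \<rho>" for z
  proof -
    have "\<Phi> z \<le> (\<integral>y. ?k y * \<rho> \<partial>lborel)" unfolding \<Phi>e
      by (intro integral_mono kd ki mult_left_mono d0 mollifier_nonneg)
    also have "\<dots> = \<rho>" by (rule ki)
    finally show ?thesis .
  qed
  have \<Phi>close: "\<bar>\<Phi> z - d z\<bar> \<le> \<eta>" for z
  proof -
    have "\<Phi> z - d z = (\<integral>y. ?k y * (d (z - y) - d z) \<partial>lborel)"
      using kd[of z] ki[of "d z"] by (simp add: \<Phi>e right_diff_distrib)
    also have "\<bar>\<dots>\<bar> \<le> (\<integral>y. norm (?k y * (d (z - y) - d z)) \<partial>lborel)"
      using integral_norm_bound[of lborel "\<lambda>y. ?k y * (d (z - y) - d z)"] by simp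
    also have "\<dots> \<le> (\<integral>y. ?k y * \<eta> \<partial>lborel)"
    proof (rule integral_mono)
      show "integrable lborel (\<lambda>y. norm (?k y * (d (z - y) - d z)))"
        unfolding right_diff_distrib by (intro integrable_norm Bochner_Integration.integrable_diff kd ki)
      show "integrable lborel (\<lambda>y. ?k y * \<eta>)" by (rule ki)
      show "norm (?k y * (d (z - y) - d z)) \<le> ?k y * \<eta>" for y
      proof (cases "norm y < \<mu>")
        case True
        have "\<bar>d (z - y) - d z\<bar> \<le> (1 + 1 / \<tau>) * norm (z - y - z)"
          by (rule order_trans[OF Lip norm_rescale_le[OF \<tau>]])
        also have "\<dots> \<le> (1 + 1 / \<tau>) * \<mu>" using True t1 by (intro mult_left_mono) auto
        finally show ?thesis unfolding \<mu>\<eta> using mollifier_nonneg[of \<mu> y] by (simp add: abs_mult mult_left_mono)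
      qed (use mollifier_eq_0[of \<mu> y] \<mu> in auto)
    qed
    also have "\<dots> = \<eta>" by (rule ki)
    finally show ?thesis .
  qed
  have \<Phi>Lip: "\<bar>\<Phi> z - \<Phi> z'\<bar> \<le> norm (rescale \<tau> (z - z'))" for z z'
  proof -
    have "\<Phi> z - \<Phi> z' = (\<integral>y. ?k y * (d (z - y) - d (z' - y)) \<partial>lborel)"
      using kd[of z] kd[of z'] by (simp add: \<Phi>e right_diff_distrib)
    also have "\<bar>\<dots>\<bar> \<le> (\<integral>y. norm (?k y * (d (z - y) - d (z' - y))) \<partial>lborel)"
      using integral_norm_bound[of lborel "\<lambda>y. ?k y * (d (z - y) - d (z' - y))"] by simp
    also have "\<dots> \<le> (\<integral>y. ?k y * norm (rescale \<tau> (z - z')) \<partial>lborel)"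
    proof (rule integral_mono)
      show "integrable lborel (\<lambda>y. norm (?k y * (d (z - y) - d (z' - y))))"
        unfolding right_diff_distrib by (intro integrable_norm Bochner_Integration.integrable_diff kd)
      show "norm (?k y * (d (z - y) - d (z' - y))) \<le> ?k y * norm (rescale \<tau> (z - z'))" for y
        using Lip[of "z - y" "z' - y"] mollifier_nonneg[of \<mu> y] by (simp add: abs_mult mult_left_mono)
    qed (rule ki)
    also have "\<dots> = norm (rescale \<tau> (z - z'))" by (rule ki)
    finally show ?thesis .
  qed
  define \<Phi>d where "\<Phi>d b = conv (mollifier_deriv \<mu> b) d" for b
  have ld: "line_deriv b \<Phi> (\<Phi>d b)" for b
    unfolding \<Phi>_def \<Phi>d_def by (intro conv_line_deriv kk mollifier_deriv_kernel mollifier_line_deriv \<mu> li)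
  have \<Phi>db: "\<bar>\<Phi>d b z\<bar> \<le> norm (rescale \<tau> b)" for b z
  proof (rule line_deriv_Lipschitz[OF ld])
    show "\<bar>\<Phi> (z + \<sigma> *\<^sub>R b) - \<Phi> z\<bar> \<le> \<bar>\<sigma>\<bar> * norm (rescale \<tau> b)" for z \<sigma>
      using \<Phi>Lip[of "z + \<sigma> *\<^sub>R b" z] by (simp add: rescale_scaleR)
  qed
  have lin: "\<Phi>d (flow_dir a i) z = \<Phi>d (0, axis i 1) z + a * \<Phi>d (axis i 1, 0) z" for a i z
    using conv_mollifier_scaled_deriv_sum[OF \<mu> li, of "{True, False}" "\<lambda>c. if c then 1 else a" "\<lambda>c. if c then (0, axis i 1) else (axis i 1, 0)" z]
    unfolding flow_dir_decompose by (simp add: \<Phi>d_def)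
  have grad: "norm (\<chi> i. \<Phi>d (flow_dir a i) z) \<le> sqrt 2" if a: "0 \<le> a" "a \<le> \<tau>" for a z
  proof -
    \<comment> \<open>The derivative in the direction \<open>drift a (0, g)\<close>, with \<open>g\<close> the gradient itself, is \<open>\<bar>g\<bar>\<^sup>2\<close>.\<close>
    define g :: "real ^ 'd" where "g = (\<chi> i. \<Phi>d (flow_dir a i) z)"
    have e: "(\<Sum>i\<in>UNIV. g $ i *\<^sub>R flow_dir a i) = drift a (0, g)"
    proof -
      have "(\<Sum>i\<in>UNIV. g $ i *\<^sub>R axis i 1) = g" using basis_expansion[of g] by (simp add: scalar_mult_eq_scaleR)
      moreover from this have "(\<Sum>i\<in>UNIV. (g $ i * a) *\<^sub>R axis i 1) = a *\<^sub>R g"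
        by (simp add: mult.commute[of _ a] flip: scaleR_scaleR scaleR_sum_right)
      ultimately show ?thesis
        by (simp add: flow_dir_def drift_def prod_eq_iff fst_sum snd_sum)
    qed
    have "(norm g)\<^sup>2 = (\<Sum>i\<in>UNIV. g $ i * \<Phi>d (flow_dir a i) z)"
      by (simp add: g_def norm_vec_def L2_set_def sum_nonneg power2_eq_square)
    also have "\<dots> = \<Phi>d (drift a (0, g)) z"
      unfolding \<Phi>d_def by (subst conv_mollifier_scaled_deriv_sum[OF \<mu> li]) (simp_all add: e)
    also have "\<dots> \<le> norm (rescale \<tau> (drift a (0, g)))" using \<Phi>db[of "drift a (0, g)" z] by simp
    also have "\<dots> \<le> sqrt 2 * norm g" by (rule norm_rescale_flow[OF \<tau> a])
    finally have "norm g * norm g \<le> sqrt 2 * norm g" by (simp add: power2_eq_square)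
    then show ?thesis unfolding g_def[symmetric] by (cases "norm g = 0") auto
  qed
  have dE: "d z = \<rho>" if "z \<in> E" for z
  proof -
    have "\<rho> \<le> infdist (rescale \<tau> z) F'"
      unfolding infdist_notempty[OF F']
    proof (rule cINF_greatest[OF F'])
      fix q assume "q \<in> F'"
      then obtain p where p: "p \<in> F" "q = rescale \<tau> (drift \<tau> p)" by (auto simp: F'_def)
      have "\<rho>\<^sup>2 \<le> (norm (fst z - fst p - \<tau> *\<^sub>R snd p))\<^sup>2 / \<tau>\<^sup>2 + (norm (snd z - snd p))\<^sup>2"
        using dist[of "fst z" "snd z" "fst p" "snd p"] p that by simp
      also have "\<dots> = (norm (rescale \<tau> z - q))\<^sup>2"
      proof -
        have n: "(norm (X /\<^sub>R \<tau>, Y))\<^sup>2 = (norm X)\<^sup>2 / \<tau>\<^sup>2 + (norm Y)\<^sup>2" for X Y :: "real ^ 'd"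
          using \<tau> by (simp add: norm_Pair power_mult_distrib power_inverse divide_inverse mult.commute)
        have "rescale \<tau> z - q = ((fst z - fst p - \<tau> *\<^sub>R snd p) /\<^sub>R \<tau>, snd z - snd p)"
          by (simp add: p(2) rescale_def drift_def algebra_simps)
        then show ?thesis by (simp only: n)
      qed
      finally show "\<rho> \<le> dist (rescale \<tau> z) q" unfolding dist_norm by (rule power2_le_imp_le) simp
    qed
    then show ?thesis by (simp add: d_def)
  qed
  have dF: "d z = 0" if "drift (- \<tau>) z \<in> F" for z
  proof -
    have "rescale \<tau> z \<in> F'" unfolding F'_def by (rule image_eqI[OF _ that]) simp
    then show ?thesis using \<rho> by (simp add: d_def)
  qed
  show ?thesis
  proof (rule that[of "\<lambda>z. \<kappa> * \<Phi> z" "\<lambda>b z. \<kappa> * \<Phi>d b z"])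
    show "continuous_on UNIV (\<lambda>z. \<kappa> * \<Phi> z)" unfolding \<Phi>_def by (intro continuous_intros conv_continuous kk li)
    show "\<bar>\<kappa> * \<Phi> z\<bar> \<le> \<kappa> * \<rho>" for z using \<Phi>0[of z] \<Phi>\<rho>[of z] \<kappa> by (simp add: abs_mult mult_left_mono)
    show "line_deriv b (\<lambda>z. \<kappa> * \<Phi> z) (\<lambda>z. \<kappa> * \<Phi>d b z)" for b
      by (rule line_deriv_bounded_linear[OF bounded_linear_mult_right ld])
    show "continuous_on UNIV (\<lambda>z. \<kappa> * \<Phi>d b z)" for b
      unfolding \<Phi>d_def by (intro continuous_intros conv_continuous mollifier_deriv_kernel \<mu> li)
    show "\<kappa> * \<Phi>d (flow_dir a i) z = \<kappa> * \<Phi>d (0, axis i 1) z + a * (\<kappa> * \<Phi>d (axis i 1, 0) z)" for a i z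
      by (simp add: lin algebra_simps)
    show "norm (\<chi> i. \<kappa> * \<Phi>d (flow_dir a i) z) \<le> \<kappa> * sqrt 2" if "0 \<le> a" "a \<le> \<tau>" for a z
    proof -
      have "(\<chi> i. \<kappa> * \<Phi>d (flow_dir a i) z) = \<kappa> *\<^sub>R (\<chi> i. \<Phi>d (flow_dir a i) z)" by (simp add: vec_eq_iff)
      then show ?thesis using grad[OF that, of z] \<kappa> by (simp add: mult_left_mono)
    qed
    show "\<kappa> * (\<rho> - \<eta>) \<le> \<kappa> * \<Phi> z" if "z \<in> E" for z
      using \<Phi>close[of z] dE[OF that] \<kappa> by (intro mult_left_mono) auto
    show "\<kappa> * \<Phi> z \<le> \<kappa> * \<eta>" if "drift (- \<tau>) z \<in> F" for z
      using \<Phi>close[of z] dF[OF that] \<kappa> by (intro mult_left_mono) auto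
  qed
qed

section \<open>The off-diagonal bound\<close>

lemma kin_dist_nonneg: "E \<noteq> {} \<Longrightarrow> F \<noteq> {} \<Longrightarrow> 0 \<le> kin_dist \<tau> E F"
  unfolding kin_dist_def by (intro real_sqrt_ge_zero cINF_greatest) auto

text \<open>
  The infimum is over a set bounded below by \<open>0\<close>, so squaring undoes the square root.
\<close>

lemma kin_dist_square_le:
  fixes E F :: "((real ^ 'd::finite) \<times> (real ^ 'd)) set"
  assumes "(x, v) \<in> E" "(y, w) \<in> F"
  shows "(kin_dist \<tau> E F)\<^sup>2 \<le> (norm (x - y - \<tau> *\<^sub>R w))\<^sup>2 / \<tau>\<^sup>2 + (norm (v - w))\<^sup>2"
proof -
  define c :: "((real ^ 'd) \<times> (real ^ 'd)) \<times> (real ^ 'd) \<times> (real ^ 'd) \<Rightarrow> real" where "c = (\<lambda>((x, v), (y, w)). (norm (x - y - \<tau> *\<^sub>R w))\<^sup>2 / \<tau>\<^sup>2 + (norm (v - w))\<^sup>2)"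
  have c0: "0 \<le> c p" for p by (auto simp: c_def split: prod.split)
  have "(INF p\<in>E \<times> F. c p) \<ge> 0" by (rule cINF_greatest) (use assms c0 in auto)
  then have "(kin_dist \<tau> E F)\<^sup>2 = (INF p\<in>E \<times> F. c p)" by (simp add: kin_dist_def c_def)
  also have "\<dots> \<le> c ((x, v), (y, w))"
    by (rule cINF_lower) (use assms c0 in \<open>auto intro!: bdd_belowI2[where m=0]\<close>)
  finally show ?thesis by (simp add: c_def)
qed

text \<open>
  Write \<open>q = \<Lambda>\<^sup>2 / \<lambda>\<close> and \<open>\<tau> = t - s\<close>.  For the weight of slope \<open>\<kappa>\<close> and smoothing error \<open>\<rho> / 8\<close>, the
  weighted contraction loses \<open>8 q \<kappa>\<^sup>2 \<tau>\<close> in the exponent (by \<open>\<Lambda> \<le> q\<close>) and the gap of the weight between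
  the two sets gains \<open>3 \<kappa> \<rho> / 2\<close>.  At \<open>\<kappa> = \<rho> / (10 q \<tau>)\<close> the net gain is \<open>7 \<rho>\<^sup>2 / (100 q \<tau>)\<close>, which
  exceeds \<open>6 \<rho>\<^sup>2 / (104 q \<tau>)\<close>.
\<close>

lemma Davies_exponent:
  fixes q \<tau> \<rho> \<Lambda> :: real
  assumes "q > 0" "\<tau> > 0" "\<Lambda> \<le> q" and \<kappa>: "\<kappa> = \<rho> / (10 * q * \<tau>)" and \<eta>: "\<kappa> * \<eta> = \<kappa> * \<rho> / 8"
  shows "2 * (q + \<Lambda>) * (\<kappa> * sqrt 2)\<^sup>2 * \<tau> + 2 * (\<kappa> * \<eta>) - 2 * (\<kappa> * (\<rho> - \<eta>)) \<le> - (2 * (3 / (104 * q) * \<rho>\<^sup>2 / \<tau>))"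
proof -
  have sum: "a + 2 * e - 2 * d \<le> - (2 * g)"
    if "a \<le> 8 * b" "b = R / 100" "c = R / 10" "d = c - c / 8" "g = 3 / 104 * R" "0 \<le> R" "e = c / 8" for a b c d e g R :: real
    using that by linarith
  have le: "(q + \<Lambda>) * (\<kappa>\<^sup>2 * \<tau>) \<le> (2 * q) * (\<kappa>\<^sup>2 * \<tau>)"
    using assms by (intro mult_right_mono) auto
  show ?thesis
  proof (rule sum)
    show "2 * (q + \<Lambda>) * (\<kappa> * sqrt 2)\<^sup>2 * \<tau> \<le> 8 * (q * (\<kappa>\<^sup>2 * \<tau>))"
      using le by (simp add: power_mult_distrib algebra_simps)
    show "q * (\<kappa>\<^sup>2 * \<tau>) = \<rho>\<^sup>2 / (q * \<tau>) / 100" "\<kappa> * \<rho> = \<rho>\<^sup>2 / (q * \<tau>) / 10"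
      using assms(1,2) by (simp_all add: \<kappa> power2_eq_square field_simps)
    show "\<kappa> * (\<rho> - \<eta>) = \<kappa> * \<rho> - \<kappa> * \<rho> / 8" by (simp only: right_diff_distrib \<eta>)
    show "3 / (104 * q) * \<rho>\<^sup>2 / \<tau> = 3 / 104 * (\<rho>\<^sup>2 / (q * \<tau>))" by simp
    show "0 \<le> \<rho>\<^sup>2 / (q * \<tau>)" using assms(1,2) by simp
    show "\<kappa> * \<eta> = \<kappa> * \<rho> / 8" by (rule \<eta>)
  qed
qed

text \<open>
  The number \<open>\<rho>\<close> need not be the distance itself: \<open>\<rho> = 0\<close> with \<open>F\<close> the whole space is the plain contraction
  property.
\<close>

lemma off_diagonal_energy_bound:
  fixes A :: "real \<times> (real ^ 'd::finite) \<times> (real ^ 'd) \<Rightarrow> complex ^ 'd ^ 'd"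
  assumes A: "A \<in> borel_measurable lebesgue" "bounded_coeff \<Lambda> A" "lam > 0" "garding_elliptic lam A"
    and f: "weak_solution A s \<psi> f" "L2_continuous_from s f" and st: "s < t"
    and \<psi>0: "\<psi>0 \<in> L2 lborel" "AE z in lborel. \<psi> z = \<psi>0 z"
    and u: "u \<in> L2 lborel" "AE z in lborel. u z = f t z"
    and E: "E \<in> sets borel" and F: "F \<noteq> {}" "AE z in lborel. z \<notin> F \<longrightarrow> \<psi>0 z = 0" and \<rho>: "\<rho> \<ge> 0"
    and dist: "\<And>x v y w. (x, v) \<in> E \<Longrightarrow> (y, w) \<in> F \<Longrightarrow>
      \<rho>\<^sup>2 \<le> (norm (x - y - (t - s) *\<^sub>R w))\<^sup>2 / (t - s)\<^sup>2 + (norm (v - w))\<^sup>2"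
  shows "(\<integral>z. indicator E z * (norm (u z))\<^sup>2 \<partial>lborel)
    \<le> exp (- (2 * (3 * lam / (104 * \<Lambda>\<^sup>2) * \<rho>\<^sup>2 / (t - s)))) * (\<integral>z. (norm (\<psi>0 z))\<^sup>2 \<partial>lborel)"
proof -
  define \<tau> where "\<tau> = t - s"
  have \<tau>: "\<tau> > 0" using st by (simp add: \<tau>_def)
  have l\<Lambda>: "lam \<le> \<Lambda>" by (rule garding_constant_le_bound[OF A(1,2,4)])
  define q where "q = \<Lambda>\<^sup>2 / lam"
  have q: "q > 0" using l\<Lambda> A(3) by (simp add: q_def)
  have "\<Lambda> * lam \<le> \<Lambda> * \<Lambda>" using l\<Lambda> A(3) by (intro mult_left_mono) auto
  then have \<Lambda>q: "\<Lambda> \<le> q" using A(3) by (simp add: q_def field_simps power2_eq_square)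
  define \<kappa> where "\<kappa> = \<rho> / (10 * q * \<tau>)"
  have \<kappa>: "\<kappa> \<ge> 0" using \<rho> q \<tau> by (simp add: \<kappa>_def)
  \<comment> \<open>The smoothing error has to be positive also for \<open>\<rho> = 0\<close>, where \<open>\<kappa> = 0\<close> and the weight is zero.\<close>
  define \<eta> where "\<eta> = (if \<rho> = 0 then 1 else \<rho> / 8)"
  have \<eta>: "\<eta> > 0" "\<kappa> * \<eta> = \<kappa> * \<rho> / 8" using \<rho> by (auto simp: \<eta>_def \<kappa>_def)
  obtain \<phi> \<phi>d where \<phi>: "continuous_on UNIV \<phi>" "\<And>z. \<bar>\<phi> z\<bar> \<le> \<kappa> * \<rho>"
      "\<And>b. line_deriv b \<phi> (\<phi>d b)" "\<And>b. continuous_on UNIV (\<phi>d b)"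
      "\<And>a i z. \<phi>d (flow_dir a i) z = \<phi>d (0, axis i 1) z + a * \<phi>d (axis i 1, 0) z"
      "\<And>a z. 0 \<le> a \<Longrightarrow> a \<le> \<tau> \<Longrightarrow> norm (\<chi> i. \<phi>d (flow_dir a i) z) \<le> \<kappa> * sqrt 2"
    and \<phi>E: "\<And>z. z \<in> E \<Longrightarrow> \<phi> z \<ge> \<kappa> * (\<rho> - \<eta>)" and \<phi>F: "\<And>z. drift (- \<tau>) z \<in> F \<Longrightarrow> \<phi> z \<le> \<kappa> * \<eta>"
    by (rule kinetic_weight_exists[OF \<tau> \<kappa> \<eta>(1) F(1) \<rho> dist[folded \<tau>_def]]) auto
  have [measurable]: "\<phi> \<in> borel_measurable borel" "u \<in> borel_measurable borel" "\<psi>0 \<in> borel_measurable borel" "E \<in> sets borel"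
    using borel_measurable_continuous_onI[OF \<phi>(1)] L2_borel[OF u(1)] L2_borel[OF \<psi>0(1)] E by auto
  have dL2: "(\<lambda>z. \<psi>0 (drift (- \<tau>) z)) \<in> L2 lborel" by (rule drift_L2[OF \<psi>0(1)])
  have wi: "integrable lborel (\<lambda>z. exp (2 * \<phi> z) * (norm (g z))\<^sup>2)" if g: "g \<in> L2 lborel" for g :: "(real ^ 'd) \<times> (real ^ 'd) \<Rightarrow> complex"
  proof (rule Bochner_Integration.integrable_bound[OF integrable_mult_right[OF L2_integrable[OF g], of "exp (2 * (\<kappa> * \<rho>))"]])
    have [measurable]: "g \<in> borel_measurable borel" by (rule L2_borel[OF g])
    show "(\<lambda>z. exp (2 * \<phi> z) * (norm (g z))\<^sup>2) \<in> borel_measurable lborel" by measurable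
    have "\<phi> z \<le> \<kappa> * \<rho>" for z using \<phi>(2)[of z] by linarith
    then show "AE z in lborel. norm (exp (2 * \<phi> z) * (norm (g z))\<^sup>2) \<le> norm (exp (2 * (\<kappa> * \<rho>)) * (norm (g z))\<^sup>2)"
      by (auto simp: abs_mult intro!: mult_right_mono AE_I2)
  qed
  define I where "I = (\<integral>z. (norm (\<psi>0 z))\<^sup>2 \<partial>lborel)"
  have I0: "I \<ge> 0" unfolding I_def by (intro Bochner_Integration.integral_nonneg) simp
  have Ei: "integrable lborel (\<lambda>z. indicator E z * (norm (u z))\<^sup>2)"
    using integrable_real_mult_indicator[OF _ L2_integrable[OF u(1)], of E] E by (simp add: mult.commute)
  let ?J = "\<integral>z. indicator E z * (norm (u z))\<^sup>2 \<partial>lborel"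
  have "exp (2 * (\<kappa> * (\<rho> - \<eta>))) * ?J = (\<integral>z. exp (2 * (\<kappa> * (\<rho> - \<eta>))) * (indicator E z * (norm (u z))\<^sup>2) \<partial>lborel)" by simp
  also have "\<dots> \<le> (\<integral>z. exp (2 * \<phi> z) * (norm (u z))\<^sup>2 \<partial>lborel)"
    by (rule integral_mono[OF integrable_mult_right[OF Ei] wi[OF u(1)]])
      (auto simp: indicator_def intro!: mult_right_mono dest: \<phi>E)
  also have "\<dots> \<le> exp (2 * (\<Lambda>\<^sup>2 / lam + \<Lambda>) * (\<kappa> * sqrt 2)\<^sup>2 * (t - s)) * (\<integral>z. exp (2 * \<phi> z) * (norm (\<psi>0 (drift (s - t) z)))\<^sup>2 \<partial>lborel)"
    by (rule weighted_energy_bound[OF A f st \<psi>0 u \<phi>(1-5) \<phi>(6)]) (auto simp: \<tau>_def)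
  also have "\<dots> = exp (2 * (q + \<Lambda>) * (\<kappa> * sqrt 2)\<^sup>2 * \<tau>) * (\<integral>z. exp (2 * \<phi> z) * (norm (\<psi>0 (drift (- \<tau>) z)))\<^sup>2 \<partial>lborel)"
    by (simp add: \<tau>_def q_def)
  also have "(\<integral>z. exp (2 * \<phi> z) * (norm (\<psi>0 (drift (- \<tau>) z)))\<^sup>2 \<partial>lborel) \<le> (\<integral>z. exp (2 * (\<kappa> * \<eta>)) * (norm (\<psi>0 (drift (- \<tau>) z)))\<^sup>2 \<partial>lborel)"
  proof (rule integral_mono_AE[OF wi[OF dL2] integrable_mult_right[OF L2_integrable[OF dL2]]])
    show "AE z in lborel. exp (2 * \<phi> z) * (norm (\<psi>0 (drift (- \<tau>) z)))\<^sup>2 \<le> exp (2 * (\<kappa> * \<eta>)) * (norm (\<psi>0 (drift (- \<tau>) z)))\<^sup>2"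
      using drift_AE[OF F(2), of "- \<tau>"]
    proof eventually_elim
      case (elim z)
      then show ?case using \<phi>F[of z] by (cases "drift (- \<tau>) z \<in> F") (auto intro!: mult_right_mono)
    qed
  qed
  also have "\<dots> = exp (2 * (\<kappa> * \<eta>)) * I"
    using drift_integral[of "\<lambda>z. (norm (\<psi>0 z))\<^sup>2" "- \<tau>"] by (simp add: I_def)
  finally have "exp (2 * (\<kappa> * (\<rho> - \<eta>))) * ?J \<le> exp (2 * (q + \<Lambda>) * (\<kappa> * sqrt 2)\<^sup>2 * \<tau>) * (exp (2 * (\<kappa> * \<eta>)) * I)"
    by simp
  moreover have "J \<le> exp (b + c - a) * I" if "exp a * J \<le> exp b * (exp c * I)" for a b c J :: real
    using that by (simp add: exp_add exp_diff field_simps)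
  ultimately have "?J \<le> exp (2 * (q + \<Lambda>) * (\<kappa> * sqrt 2)\<^sup>2 * \<tau> + 2 * (\<kappa> * \<eta>) - 2 * (\<kappa> * (\<rho> - \<eta>))) * I"
    by blast
  also have "\<dots> \<le> exp (- (2 * (3 / (104 * q) * \<rho>\<^sup>2 / \<tau>))) * I"
    using Davies_exponent[OF q \<tau> \<Lambda>q \<kappa>_def \<eta>(2)] I0 by (intro mult_right_mono) simp_all
  also have "3 / (104 * q) = 3 * lam / (104 * \<Lambda>\<^sup>2)" by (simp add: q_def)
  finally show ?thesis by (simp add: I_def \<tau>_def)
qed

theorem theorem4p1:
  fixes A :: "real \<times> (real ^ 'd) \<times> (real ^ 'd) \<Rightarrow> complex ^ 'd ^ 'd"
    and \<Gamma> :: "real \<Rightarrow> real \<Rightarrow> ((real ^ 'd) \<times> (real ^ 'd) \<Rightarrow> complex)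
                \<Rightarrow> (real ^ 'd) \<times> (real ^ 'd) \<Rightarrow> complex"
    and lam \<Lambda> \<alpha> s t :: real
    and E F :: "((real ^ 'd) \<times> (real ^ 'd)) set"
    and \<psi> :: "(real ^ 'd) \<times> (real ^ 'd) \<Rightarrow> complex"
  assumes "A \<in> borel_measurable lebesgue"
    and "bounded_coeff \<Lambda> A"
    and "lam > 0" and "garding_elliptic lam A"
    and "fundamental_solution_operators A \<Gamma>"
    and "closed E" and "closed F"
    and "s < t"
    and "\<psi> \<in> L2 lebesgue" and "AE z in lebesgue. z \<notin> F \<longrightarrow> \<psi> z = 0"
    and "\<alpha> = 3 * lam / (104 * \<Lambda>\<^sup>2)"
  shows "L2norm (lebesgue_on E) (\<Gamma> t s \<psi>)
           \<le> exp (- (\<alpha> * (kin_dist (t - s) E F)\<^sup>2 / (t - s))) * L2norm (lebesgue_on F) \<psi>"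
proof -
  obtain f where f: "weak_solution A s \<psi> f" "L2_continuous_from s f" "AE z in lborel. \<Gamma> t s \<psi> z = f t z"
    using assms(5,8,9) unfolding fundamental_solution_operators_def AE_lebesgue_iff by (meson less_imp_le)
  have borel: "E \<in> sets borel" "F \<in> sets borel" using assms(6,7) by auto
  have "\<psi> \<in> L2 (lebesgue_on UNIV)" using assms(9) by (simp add: lebesgue_on_UNIV_eq)
  then obtain \<psi>0 where \<psi>0: "\<psi>0 \<in> L2 lborel" "AE z in lborel. \<psi> z = \<psi>0 z"
    by (rule L2_lebesgue_representative) auto
  have "f t \<in> L2 (lebesgue_on UNIV)"
    using f(2) assms(8) by (simp add: lebesgue_on_UNIV_eq L2_continuous_from_def)
  then obtain u where u': "u \<in> L2 lborel" "AE z in lborel. f t z = u z"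
    by (rule L2_lebesgue_representative) auto
  then have u: "u \<in> L2 lborel" "AE z in lborel. u z = f t z" by auto
  have [measurable]: "u \<in> borel_measurable borel" "\<psi>0 \<in> borel_measurable borel" "E \<in> sets borel"
    using L2_borel[OF u(1)] L2_borel[OF \<psi>0(1)] borel by auto
  have F0: "AE z in lborel. z \<notin> F \<longrightarrow> \<psi>0 z = 0"
    using assms(10)[unfolded AE_lebesgue_iff] \<psi>0(2) by eventually_elim simp
  define J where "J = (\<integral>z. indicator E z * (norm (u z))\<^sup>2 \<partial>lborel)"
  define I where "I = (\<integral>z. (norm (\<psi>0 z))\<^sup>2 \<partial>lborel)"
  have "(\<integral>z. (norm (\<Gamma> t s \<psi> z))\<^sup>2 \<partial>lebesgue_on E) = J" unfolding J_def
  proof (rule integral_lebesgue_on_eq_lborel[OF _ _ borel(1)])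
    show "AE z in lborel. (if z \<in> E then (norm (\<Gamma> t s \<psi> z))\<^sup>2 else 0) = indicator E z * (norm (u z))\<^sup>2"
      using f(3) u(2) by eventually_elim simp
  qed measurable
  then have J: "L2norm (lebesgue_on E) (\<Gamma> t s \<psi>) = sqrt J" by (simp add: L2norm_def)
  have "(\<integral>z. (norm (\<psi> z))\<^sup>2 \<partial>lebesgue_on F) = I" unfolding I_def
  proof (rule integral_lebesgue_on_eq_lborel[OF _ _ borel(2)])
    show "AE z in lborel. (if z \<in> F then (norm (\<psi> z))\<^sup>2 else 0) = (norm (\<psi>0 z))\<^sup>2"
      using F0 \<psi>0(2) by eventually_elim simp
  qed measurable
  then have I: "L2norm (lebesgue_on F) \<psi> = sqrt I" by (simp add: L2norm_def)
  note bound = off_diagonal_energy_bound[OF assms(1-4) f(1,2) assms(8) \<psi>0 u borel(1), folded J_def I_def, folded assms(11)]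
  show ?thesis
  proof (cases "E = {} \<or> F = {}")
    case True
    \<comment> \<open>Here the distance is an unspecified number, but one of the two norms vanishes.\<close>
    have "J \<le> exp (- (2 * (\<alpha> * 0\<^sup>2 / (t - s)))) * I" by (rule bound[of UNIV]) auto
    moreover have "E = {} \<Longrightarrow> J = 0" by (simp add: J_def)
    moreover have "I = 0" if "F = {}"
    proof -
      have "AE z in lborel. (norm (\<psi>0 z))\<^sup>2 = 0" using F0 that by simp
      then have "I = (\<integral>z. 0 \<partial>(lborel :: ((real ^ 'd) \<times> (real ^ 'd)) measure))"
        unfolding I_def by (intro integral_cong_AE) auto
      then show ?thesis by simp
    qed
    moreover have "J \<ge> 0" "I \<ge> 0" unfolding J_def I_def by (intro Bochner_Integration.integral_nonneg; simp)+
    ultimately show ?thesis using True unfolding I J by auto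
  next
    case False
    define \<rho> where "\<rho> = kin_dist (t - s) E F"
    have "J \<le> exp (- (2 * (\<alpha> * \<rho>\<^sup>2 / (t - s)))) * I"
      unfolding \<rho>_def by (rule bound[OF _ F0]) (use False in \<open>auto intro: kin_dist_nonneg kin_dist_square_le\<close>)
    then have "sqrt J \<le> sqrt ((exp (- (\<alpha> * \<rho>\<^sup>2 / (t - s))))\<^sup>2 * I)" by (simp add: exp_double[symmetric])
    also have "\<dots> = exp (- (\<alpha> * \<rho>\<^sup>2 / (t - s))) * sqrt I" by (simp add: real_sqrt_mult)
    finally show ?thesis unfolding I J \<rho>_def .
  qed
qed

end
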